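(* Let $n\ge 1$ be an integer, let $\alpha>-1$, and let $w_\alpha(x)=(1+|x|^2)^{(\alpha+n+1)/2}$ for $x\in\mathbb{R}^n$. Let $f\in w_\alpha\mathcal{D}'_{L^1}$. Then $u=\mathcal{K}_\alpha[f]$ is a solution to the Dirichlet problem $$D_\alpha u=0\ \text{ in }\ \mathbb{R}^{n+1}_+,\qquad u=f\ \text{ in }\ \mathbb{R}^n,$$ where the boundary condition means that $\lim_{y\to0}u_y=f$ in $\mathcal{S}'(\mathbb{R}^n)$, with $u_y(x)=u(x,y)$.
   Context: $\mathbb{R}^{n+1}_+=\{(x,y)\in\mathbb{R}^n\times\mathbb{R}:y>0\}$ and $D_\alpha u=y^{-\alpha}\big(\sum_{i=1}^n\partial_{x_i}^2u+\partial_y^2u-\frac{\alpha}{y}\partial_yu\big)$. Convergence in $\mathcal{S}'$ means $\langle u_y,\varphi\rangle\to\langle f,\varphi\rangle$ for all $\varphi\in\mathcal{S}$. All function and distribution spaces are on $\mathbb{R}^n$. The kernel is $\mathcal{K}_\alpha(x,y)=\frac{\Gamma((\alpha+n+1)/2)}{\Gamma((\alpha+1)/2)\pi^{n/2}}\cdot\frac{y^{\alpha+1}}{(|x|^2+y^2)^{(\alpha+n+1)/2}}$ for $x\in\mathbb{R}^n$, $y>0$, and $\mathcal{K}_{\alpha,y}(x)=\mathcal{K}_\alpha(x,y)$. Translation is $\tau_\eta\varphi(x)=\varphi(x-\eta)$. $\mathcal{B}$ is the space of smooth $\varphi:\mathbb{R}^n\to\mathbb{C}$ such that $\varphi$ and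 all its derivatives are bounded; $\dot{\mathcal{B}}$ is the closed subspace of those $\varphi\in\mathcal{B}$ with $\partial^\beta\varphi(x)\to0$ as $|x|\to\infty$ for all multi-indices $\beta$ (topology: uniform convergence of all derivatives). $\mathcal{D}'_{L^1}$ is the dual of $\dot{\mathcal{B}}$; it is a space of tempered distributions, consisting exactly of the finite sums $u=\sum_\beta\partial^\beta u_\beta$ with $u_\beta\in L^1$. $\mathcal{B}_c$ is $\mathcal{B}$ endowed with the finest locally convex topology that on bounded subsets of $\mathcal{B}$ induces the topology inherited from $C^\infty$; every $u\in\mathcal{D}'_{L^1}$ extends uniquely to a continuous linear form on $\mathcal{B}_c$, with pairing $\langle u,\varphi\rangle_{\mathcal{D}'_{L^1},\mathcal{B}_c}=\sum_\beta(-1)^{|\beta|}\int u_\beta\,\partial^\beta\varphi\,dx$ for $\varphi\in\mathcal{B}$. The weighted space is $w_\alpha\mathcal{D}'_{L^1}=\{u\in\mathcal{S}': w_\alpha^{-1}u\in\mathcal{D}'_{L^1}\}$. $\mathcal{S}'$-convolution: two tempered distributions $u,v$ are $\mathcal{S}'$-convolvable if $u(\check v\ast\varphi)\in\mathcal{D}'_{L^1}$ for every $\varphi\in\mathcal{S}$, where $\check\varphi(x)=\varphi(-x)$ (extended to $\mathcal{S}'$ by duality) and $\check v\ast\varphi$ is the function $\eta\mapsto\langle v,\tau_{-\eta}\varphi\rangle_{\mathcal{S}',\mathcal{S}}$. Then $u\ast v\in\mathcal{S}'$ is defined by $\langle u\ast v,\varphi\rangle=\langle u(\check v\ast\varphi),1\rangle_{\mathcal{D}'_{L^1},\mathcal{B}_c}$.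 For $f\in w_\alpha\mathcal{D}'_{L^1}$ the $\mathcal{S}'$-convolution $\mathcal{K}_{\alpha,y}\ast f$ exists for every $y>0$ and is the function $x\mapsto\langle w_\alpha^{-1}f,w_\alpha\tau_x\mathcal{K}_{\alpha,y}\rangle_{\mathcal{D}'_{L^1},\mathcal{B}_c}$. The Poisson integral of $f$ is the function $\mathcal{K}_\alpha[f](x,y)=\mathcal{K}_{\alpha,y}\ast f(x)$, $(x,y)\in\mathbb{R}^{n+1}_+$. *)

theory Defs
  imports "HOL-Analysis.Analysis"
begin

section \<open>Partial derivatives and differentiability classes\<close>

definition pd :: "'a \<Rightarrow> ('a \<Rightarrow> complex) \<Rightarrow> 'a::euclidean_space \<Rightarrow> complex" where
  "pd v f x = vector_derivative (\<lambda>t. f (x + t *\<^sub>R v)) (at 0)"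

text \<open>
  A multi-index is represented by a list of basis vectors: the list in which the
  i-th basis vector occurs \<open>\<beta>\<^sub>i\<close> times stands for \<open>\<beta>\<close>, and
  its length is the order of \<open>\<beta>\<close>. For functions of class \<open>C\<^sup>k\<close> the order
  of the list is irrelevant up to length \<open>k\<close>.
\<close>

primrec iter_pd :: "'a list \<Rightarrow> ('a \<Rightarrow> complex) \<Rightarrow> 'a::euclidean_space \<Rightarrow> complex" where
  "iter_pd [] f = f"
| "iter_pd (v # vs) f = pd v (iter_pd vs f)"

definition Ck_on :: "nat \<Rightarrow> 'a set \<Rightarrow> ('a::euclidean_space \<Rightarrow> complex) \<Rightarrow> bool" where
  "Ck_on k S f \<longleftrightarrow>
     (\<forall>vs\<in>lists Basis. length vs < k \<longrightarrow> iter_pd vs f differentiable_on S) \<and>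
     (\<forall>vs\<in>lists Basis. length vs \<le> k \<longrightarrow> continuous_on S (iter_pd vs f))"

definition smooth :: "('a::euclidean_space \<Rightarrow> complex) \<Rightarrow> bool" where
  "smooth f \<longleftrightarrow> (\<forall>k. Ck_on k UNIV f)"


section \<open>Locally convex function spaces and their duals\<close>

definition seminorm_on ::
    "('a \<Rightarrow> complex) set \<Rightarrow> (('a \<Rightarrow> complex) \<Rightarrow> real) \<Rightarrow> bool" where
  "seminorm_on V p \<longleftrightarrow>
     (\<forall>\<phi>\<in>V. 0 \<le> p \<phi>) \<and>
     (\<forall>\<phi>\<in>V. \<forall>\<psi>\<in>V. p (\<lambda>x. \<phi> x + \<psi> x) \<le> p \<phi> + p \<psi>) \<and>
     (\<forall>\<phi>\<in>V. \<forall>c. p (\<lambda>x. c * \<phi> x) = norm c * p \<phi>)"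

text \<open>The locally convex topology on the linear space \<open>V\<close> generated by a nonempty family
  \<open>P\<close> of seminorms on \<open>V\<close>.\<close>

definition seminorm_topology ::
    "('a \<Rightarrow> complex) set \<Rightarrow> (('a \<Rightarrow> complex) \<Rightarrow> real) set \<Rightarrow> ('a \<Rightarrow> complex) topology" where
  "seminorm_topology V P =
     topology_generated_by
       {{\<psi> \<in> V. p (\<lambda>x. \<psi> x - \<phi> x) < r} | p \<phi> r. p \<in> P \<and> \<phi> \<in> V \<and> 0 < r}"

text \<open>Functionals are total functions in HOL. Only their values on \<open>V\<close> are meaningful.\<close>

definition dual ::
    "('a \<Rightarrow> complex) set \<Rightarrow> (('a \<Rightarrow> complex) \<Rightarrow> real) set \<Rightarrow> (('a \<Rightarrow> complex) \<Rightarrow> complex) set" where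
  "dual V P =
     {u. (\<forall>\<phi>\<in>V. \<forall>\<psi>\<in>V. u (\<lambda>x. \<phi> x + \<psi> x) = u \<phi> + u \<psi>) \<and>
         (\<forall>\<phi>\<in>V. \<forall>c. u (\<lambda>x. c * \<phi> x) = c * u \<phi>) \<and>
         continuous_map (seminorm_topology V P) euclidean u}"


section \<open>The Schwartz space and tempered distributions\<close>

definition schwartz :: "(real^'n \<Rightarrow> complex) set" where
  "schwartz =
     {\<phi>. smooth \<phi> \<and>
         (\<forall>k. \<forall>vs\<in>lists Basis. bounded (range (\<lambda>x. (1 + norm x) ^ k *\<^sub>R iter_pd vs \<phi> x)))}"

definition schwartz_seminorms :: "((real^'n \<Rightarrow> complex) \<Rightarrow> real) set" where
  "schwartz_seminorms =
     {\<lambda>\<phi>. SUP x. (1 + norm x) ^ k * norm (iter_pd vs \<phi> x) | k vs. vs \<in> lists Basis}"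

definition tempered :: "((real^'n \<Rightarrow> complex) \<Rightarrow> complex) set" where
  "tempered = dual schwartz schwartz_seminorms"

definition tendsto_tempered ::
    "('b \<Rightarrow> (real^'n \<Rightarrow> complex) \<Rightarrow> complex) \<Rightarrow> ((real^'n \<Rightarrow> complex) \<Rightarrow> complex) \<Rightarrow> 'b filter \<Rightarrow> bool"
  where
  "tendsto_tempered u f F \<longleftrightarrow>
     (\<forall>\<^sub>F y in F. u y \<in> tempered) \<and> f \<in> tempered \<and>
     (\<forall>\<phi>\<in>schwartz. ((\<lambda>y. u y \<phi>) \<longlongrightarrow> f \<phi>) F)"

definition dist_of :: "(real^'n \<Rightarrow> complex) \<Rightarrow> (real^'n \<Rightarrow> complex) \<Rightarrow> complex" where
  "dist_of g \<phi> = (LINT x|lborel. g x * \<phi> x)"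

definition dist_mult ::
    "(real^'n \<Rightarrow> complex) \<Rightarrow> ((real^'n \<Rightarrow> complex) \<Rightarrow> complex) \<Rightarrow> (real^'n \<Rightarrow> complex) \<Rightarrow> complex" where
  "dist_mult g u \<phi> = u (\<lambda>x. g x * \<phi> x)"

definition translate :: "real^'n \<Rightarrow> (real^'n \<Rightarrow> complex) \<Rightarrow> real^'n \<Rightarrow> complex" where
  "translate \<eta> \<phi> x = \<phi> (x - \<eta>)"


section \<open>Integrable distributions\<close>

definition space_B :: "(real^'n \<Rightarrow> complex) set" where
  "space_B = {\<phi>. smooth \<phi> \<and> (\<forall>vs\<in>lists Basis. bounded (range (iter_pd vs \<phi>)))}"

definition space_Bdot :: "(real^'n \<Rightarrow> complex) set" where
  "space_Bdot = {\<phi> \<in> space_B. \<forall>vs\<in>lists Basis. (iter_pd vs \<phi> \<longlongrightarrow> 0) at_infinity}"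

definition B_seminorms :: "((real^'n \<Rightarrow> complex) \<Rightarrow> real) set" where
  "B_seminorms = {\<lambda>\<phi>. SUP x. norm (iter_pd vs \<phi> x) | vs. vs \<in> lists Basis}"

text \<open>Integrable distributions are regarded as tempered distributions, namely those that are
  restrictions to \<^const>\<open>schwartz\<close> of elements of the dual of \<^const>\<open>space_Bdot\<close>.\<close>

definition DL1 :: "((real^'n \<Rightarrow> complex) \<Rightarrow> complex) set" where
  "DL1 = {u \<in> tempered. \<exists>v \<in> dual space_Bdot B_seminorms. \<forall>\<phi>\<in>schwartz. v \<phi> = u \<phi>}"

definition bounded_in_B :: "(real^'n \<Rightarrow> complex) set \<Rightarrow> bool" where
  "bounded_in_B A \<longleftrightarrow>
     A \<subseteq> space_B \<and> (\<forall>vs\<in>lists Basis. \<exists>C. \<forall>\<phi>\<in>A. \<forall>x. norm (iter_pd vs \<phi> x) \<le> C)"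

definition Cinf_seminorms :: "((real^'n \<Rightarrow> complex) \<Rightarrow> real) set" where
  "Cinf_seminorms =
     {\<lambda>\<phi>. SUP x\<in>K. norm (iter_pd vs \<phi> x) | K vs. compact K \<and> K \<noteq> {} \<and> vs \<in> lists Basis}"

text \<open>
  The topology of \<open>\<B>\<^sub>c\<close> is the finest locally convex topology on \<^const>\<open>space_B\<close> that
  induces on every bounded set the topology inherited from \<open>C\<^sup>\<infinity>\<close>. It is generated by the
  union of all families of seminorms whose topology has this property: the topology induced on a
  set by a supremum of topologies is the supremum of the induced topologies, so the union has
  the property again.
\<close>

definition Bc_seminorms :: "((real^'n \<Rightarrow> complex) \<Rightarrow> real) set" where
  "Bc_seminorms =
     \<Union>{P. (\<forall>p\<in>P. seminorm_on space_B p) \<and>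
          (\<forall>A. bounded_in_B A \<longrightarrow>
             subtopology (seminorm_topology space_B P) A =
             subtopology (seminorm_topology space_B Cinf_seminorms) A)}"

text \<open>The pairing of an integrable distribution \<open>u\<close> with \<open>\<phi> \<in> \<B>\<close>: the value at \<open>\<phi>\<close> of
  the unique extension of \<open>u\<close> to a continuous linear form on \<open>\<B>\<^sub>c\<close>.\<close>

definition Bc_pairing ::
    "((real^'n \<Rightarrow> complex) \<Rightarrow> complex) \<Rightarrow> (real^'n \<Rightarrow> complex) \<Rightarrow> complex" where
  "Bc_pairing u \<phi> =
     (THE c. \<exists>v \<in> dual space_B Bc_seminorms. (\<forall>\<psi>\<in>schwartz. v \<psi> = u \<psi>) \<and> c = v \<phi>)"

definition weight :: "real \<Rightarrow> real^'n \<Rightarrow> real" where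
  "weight \<alpha> x = (1 + (norm x)\<^sup>2) powr ((\<alpha> + real CARD('n) + 1) / 2)"

definition weighted_DL1 :: "real \<Rightarrow> ((real^'n \<Rightarrow> complex) \<Rightarrow> complex) set" where
  "weighted_DL1 \<alpha> =
     {u \<in> tempered. dist_mult (\<lambda>x. complex_of_real (inverse (weight \<alpha> x))) u \<in> DL1}"


section \<open>Convolution of tempered distributions\<close>

text \<open>The function obtained by convolving the reflection of \<open>v\<close> with the test function
  \<open>\<phi>\<close>.\<close>

definition refl_conv ::
    "((real^'n \<Rightarrow> complex) \<Rightarrow> complex) \<Rightarrow> (real^'n \<Rightarrow> complex) \<Rightarrow> real^'n \<Rightarrow> complex" where
  "refl_conv v \<phi> \<eta> = v (translate (- \<eta>) \<phi>)"

definition convolvable ::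
    "((real^'n \<Rightarrow> complex) \<Rightarrow> complex) \<Rightarrow> ((real^'n \<Rightarrow> complex) \<Rightarrow> complex) \<Rightarrow> bool" where
  "convolvable u v \<longleftrightarrow>
     u \<in> tempered \<and> v \<in> tempered \<and> (\<forall>\<phi>\<in>schwartz. dist_mult (refl_conv v \<phi>) u \<in> DL1)"

definition dist_conv ::
    "((real^'n \<Rightarrow> complex) \<Rightarrow> complex) \<Rightarrow> ((real^'n \<Rightarrow> complex) \<Rightarrow> complex) \<Rightarrow>
     (real^'n \<Rightarrow> complex) \<Rightarrow> complex" where
  "dist_conv u v \<phi> = Bc_pairing (dist_mult (refl_conv v \<phi>) u) (\<lambda>x. 1)"


section \<open>The Poisson integral and the differential operator\<close>

definition poisson_kernel :: "real \<Rightarrow> real \<Rightarrow> real^'n \<Rightarrow> real" where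
  "poisson_kernel \<alpha> y x =
     Gamma ((\<alpha> + real CARD('n) + 1) / 2) / (Gamma ((\<alpha> + 1) / 2) * pi powr (real CARD('n) / 2)) *
     (y powr (\<alpha> + 1) / ((norm x)\<^sup>2 + y\<^sup>2) powr ((\<alpha> + real CARD('n) + 1) / 2))"

text \<open>The convolution of the kernel with \<open>f\<close> is a distribution given by a continuous function,
  and pointwise values refer to this function, which is unique.\<close>

definition poisson_integral ::
    "real \<Rightarrow> ((real^'n \<Rightarrow> complex) \<Rightarrow> complex) \<Rightarrow> (real^'n) \<times> real \<Rightarrow> complex" where
  "poisson_integral \<alpha> f = (\<lambda>(x, y).
     (THE g. let K = dist_of (\<lambda>z. complex_of_real (poisson_kernel \<alpha> y z)) in
        convolvable K f \<and> continuous_on UNIV g \<and>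
        (\<forall>\<phi>\<in>schwartz. integrable lborel (\<lambda>z. g z * \<phi> z) \<and> dist_conv K f \<phi> = dist_of g \<phi>)) x)"

definition upper_half_space :: "((real^'n) \<times> real) set" where
  "upper_half_space = {(x, y). 0 < y}"

definition D_op :: "real \<Rightarrow> ((real^'n) \<times> real \<Rightarrow> complex) \<Rightarrow> (real^'n) \<times> real \<Rightarrow> complex" where
  "D_op \<alpha> u = (\<lambda>(x, y).
     (y powr (- \<alpha>)) *\<^sub>R
       ((\<Sum>i\<in>UNIV. pd (axis i 1, 0) (pd (axis i 1, 0) u) (x, y))
        + pd (0, 1) (pd (0, 1) u) (x, y)
        - (\<alpha> / y) *\<^sub>R pd (0, 1) u (x, y)))"

end

theory Submission
  imports Defs "HOL-Probability.Distributions"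
begin

text \<open>
  Let \<open>s = (\<alpha> + n + 1) / 2\<close> and let \<open>w\<close> be the weight \<open>(1 + |x|\<^sup>2)\<^sup>s\<close>, so that
  \<open>f = w F\<close> with an integrable distribution \<open>F\<close>. A single property of \<open>F\<close> carries the proof: it
  extends to a linear form on \<open>\<B>\<close> that tends to 0 along every sequence which is bounded in
  \<open>\<B>\<close> and tends to 0 in \<open>C\<^sup>\<infinity>\<close> (\<open>Bc_form\<close>, \<open>dual_Bdot_extension\<close>). The extension is the limit of
  \<open>F\<close> along Gaussian cutoffs. Its continuity takes the place of a representation of \<open>F\<close> by
  derivatives of integrable functions and comes from a gliding hump: if \<open>|F \<phi>\<^sub>j| \<ge> e\<close> for
  infinitely many members of such a sequence, then some of them are so far apart that, multiplied by
  suitable phases, they add up to a bounded function on which \<open>F\<close> is as large as desired. The forms with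
  this property are exactly the continuous linear forms on \<open>\<B>\<^sub>c\<close> (\<open>Bc_form_imp_dual\<close>,
  \<open>dual_imp_Bc_form\<close>), so they are what the pairing evaluates. They also respect orders of magnitude:
  if all derivatives of \<open>\<Phi>\<^sub>i\<close> are \<open>O(W\<^sub>i)\<close>, uniformly in the space variable and in \<open>i\<close>, then
  \<open>F \<Phi>\<^sub>i = O(W\<^sub>i)\<close> (\<open>Bc_form_bound\<close>).

  The Poisson integral is \<open>u(x, y) = F (w P\<^sub>y(x - \<cdot>))\<close> with the Poisson kernel \<open>P\<^sub>y\<close>. The kernel decays
  like \<open>1 / w\<close>, its derivatives at least as fast; hence \<open>w P\<^sub>y(x - \<cdot>)\<close> belongs to \<open>\<B>\<close>, and the
  Taylor remainders of the kernel in \<open>(x, y)\<close>, multiplied by \<open>w\<close>, are \<open>O(|h|\<^sup>2)\<close> with all their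
  derivatives. Therefore \<open>F\<close> commutes with partial derivatives, \<open>u\<close> is smooth, and the differential
  equation is inherited from the kernel (\<open>slice_transform_has_partials\<close>, \<open>poisson_equation\<close>).

  To see that \<open>u(\<cdot>, y)\<close> is the convolution of \<open>P\<^sub>y\<close> with \<open>f\<close>, fix a Schwartz function \<open>\<phi>\<close> and consider
  \<open>V \<psi> = F (w (P\<^sub>y\<psi> \<star> \<phi>))\<close> for \<open>\<psi>\<close> in \<open>\<B>\<close>, where \<open>(k \<star> \<phi>)(z) = \<integral> k(\<eta>) \<phi>(z + \<eta>) d\<eta>\<close>.
  The form \<open>V\<close> is again continuous on \<open>\<B>\<^sub>c\<close>. Since \<open>F\<close> commutes with integrals
  (\<open>Bc_form_integral\<close>), \<open>V\<close> extends the distribution occurring in the definition of convolvability,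
  and \<open>V 1 = \<integral> u(x, y) \<phi>(x) dx\<close>. A continuous function is determined by its integrals against
  Gaussians, so \<open>u(\<cdot>, y)\<close> is the function described in the definition of the Poisson integral
  (\<open>poisson_integral_eq\<close>).

  Finally \<open>V 1 - f \<phi> = F (w (P\<^sub>y \<star> \<phi> - \<phi>))\<close>. For \<open>y \<rightarrow> 0\<close> the argument of \<open>F\<close> stays bounded in
  \<open>\<B>\<close>, and it tends to 0 in \<open>C\<^sup>\<infinity>\<close> because \<open>P\<^sub>y\<close> is nonnegative, has integral 1 and concentrates
  at the origin (\<open>boundary_values\<close>).
\<close>

section \<open>Partial derivatives\<close>

text \<open>
  The derivative is recorded by its coordinates \<open>G b\<close>, so that statements about iterated
  partial derivatives reduce to exhibiting a class of functions that contains the coordinates of the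
  derivatives of its members.
\<close>

definition has_partials :: "('a::euclidean_space \<Rightarrow> complex) \<Rightarrow> ('a \<Rightarrow> 'a \<Rightarrow> complex) \<Rightarrow> 'a \<Rightarrow> bool" where
  "has_partials f G x \<longleftrightarrow> (f has_derivative (\<lambda>h. \<Sum>b\<in>Basis. (h \<bullet> b) *\<^sub>R G b x)) (at x)"

lemma pd_has_derivative:
  assumes "(f has_derivative D) (at x)"
  shows "pd v f x = D v"
proof -
  have "((\<lambda>t. f (x + t *\<^sub>R v)) has_derivative (\<lambda>t. D (t *\<^sub>R v))) (at 0)"
    by (rule has_derivative_compose[where f = "\<lambda>t. x + t *\<^sub>R v" and g = f])
      (use assms in \<open>auto intro!: derivative_eq_intros\<close>)
  then have "((\<lambda>t. f (x + t *\<^sub>R v)) has_vector_derivative D v) (at 0)"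
    by (simp add: has_vector_derivative_def linear_cmul[OF has_derivative_linear[OF assms]])
  then show ?thesis
    unfolding pd_def by (rule vector_derivative_at)
qed

lemma pd_has_partials:
  assumes "has_partials f G x" "b \<in> Basis"
  shows "pd b f x = G b x"
proof -
  have "(\<Sum>c\<in>Basis. (b \<bullet> c) *\<^sub>R G c x) = (\<Sum>c\<in>Basis. if c = b then G b x else 0)"
    using assms(2) by (intro sum.cong) (auto simp: inner_Basis)
  then show ?thesis
    using pd_has_derivative[OF assms(1)[unfolded has_partials_def], of b] assms(2) by simp
qed

lemma differentiable_imp_has_partials:
  assumes "f differentiable (at x)"
  shows "has_partials f (\<lambda>b. pd b f) x"
proof -
  obtain D where D: "(f has_derivative D) (at x)"
    using assms by (auto simp: differentiable_def)
  have "D h = (\<Sum>b\<in>Basis. (h \<bullet> b) *\<^sub>R pd b f x)" for h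
  proof -
    have "D h = D (\<Sum>b\<in>Basis. (h \<bullet> b) *\<^sub>R b)" by (simp add: euclidean_representation)
    also have "\<dots> = (\<Sum>b\<in>Basis. (h \<bullet> b) *\<^sub>R D b)"
      using has_derivative_linear[OF D] by (simp add: linear_sum linear_cmul)
    finally show ?thesis by (simp add: pd_has_derivative[OF D])
  qed
  then have "D = (\<lambda>h. \<Sum>b\<in>Basis. (h \<bullet> b) *\<^sub>R pd b f x)" by auto
  with D show ?thesis unfolding has_partials_def by simp
qed

lemma has_partials_differentiable: "has_partials f G x \<Longrightarrow> f differentiable (at x)"
  unfolding has_partials_def differentiable_def by blast

lemma has_partials_add:
  assumes "has_partials f F x" "has_partials g G x"
  shows "has_partials (\<lambda>x. f x + g x) (\<lambda>b x. F b x + G b x) x"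
  using has_derivative_add[OF assms[unfolded has_partials_def]]
  by (simp add: has_partials_def sum.distrib scaleR_add_right)

lemma has_partials_cmult:
  assumes "has_partials f F x"
  shows "has_partials (\<lambda>x. c * f x) (\<lambda>b x. c * F b x) x"
  using has_derivative_mult_right[OF assms[unfolded has_partials_def], of c]
  by (simp add: has_partials_def sum_distrib_left)

lemma has_partials_mult:
  assumes "has_partials f F x" "has_partials g G x"
  shows "has_partials (\<lambda>x. f x * g x) (\<lambda>b x. f x * G b x + F b x * g x) x"
  using has_derivative_mult[OF assms[unfolded has_partials_def]]
  by (simp add: has_partials_def sum.distrib sum_distrib_left sum_distrib_right scaleR_add_right)

lemma has_partials_const: "has_partials (\<lambda>x. c) (\<lambda>b x. 0) x"
  by (simp add: has_partials_def)

lemma has_partials_cong_open: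
  assumes "has_partials f F x" "open S" "x \<in> S" "\<And>y. y \<in> S \<Longrightarrow> g y = f y"
  shows "has_partials g F x"
  unfolding has_partials_def
  by (rule has_derivative_transform_within_open[OF assms(1)[unfolded has_partials_def] assms(2,3)])
    (simp add: assms(4))

lemma has_partials_affine:
  assumes "has_partials f F (c *\<^sub>R x + a)"
  shows "has_partials (\<lambda>x. f (c *\<^sub>R x + a)) (\<lambda>b x. c *\<^sub>R F b (c *\<^sub>R x + a)) x"
proof -
  have "((\<lambda>x. f (c *\<^sub>R x + a)) has_derivative (\<lambda>h. \<Sum>b\<in>Basis. ((c *\<^sub>R h) \<bullet> b) *\<^sub>R F b (c *\<^sub>R x + a))) (at x)"
    by (rule has_derivative_compose[where f = "\<lambda>x. c *\<^sub>R x + a" and g = f])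
      (use assms in \<open>auto intro!: derivative_eq_intros simp: has_partials_def\<close>)
  then show ?thesis by (simp add: has_partials_def mult.commute)
qed

lemma has_partials_mvt:
  fixes f :: "'a::euclidean_space \<Rightarrow> complex" and M :: real
  assumes "\<And>t. t \<in> {0..1} \<Longrightarrow> has_partials f G (p + t *\<^sub>R h)"
    and "\<And>t b. t \<in> {0..1} \<Longrightarrow> b \<in> Basis \<Longrightarrow> norm (G b (p + t *\<^sub>R h)) \<le> M"
  shows "norm (f (p + h) - f p) \<le> DIM('a) * M * norm h"
proof -
  let ?S = "(\<lambda>t. p + t *\<^sub>R h) ` {0..1::real}"
  have "norm (f (p + h) - f p) \<le> norm h * (DIM('a) * M)"
  proof (rule differentiable_bound_segment[where f' = "\<lambda>x k. \<Sum>b\<in>Basis. (k \<bullet> b) *\<^sub>R G b x" and G = ?S])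
    show "p + t *\<^sub>R h \<in> ?S" if "t \<in> {0..1}" for t using that by auto
    show "(f has_derivative (\<lambda>k. \<Sum>b\<in>Basis. (k \<bullet> b) *\<^sub>R G b x)) (at x within ?S)" if "x \<in> ?S" for x
      using that assms(1) by (auto simp: has_partials_def intro: has_derivative_at_withinI)
    show "onorm (\<lambda>k. \<Sum>b\<in>Basis. (k \<bullet> b) *\<^sub>R G b (p + t *\<^sub>R h)) \<le> DIM('a) * M" if "t \<in> {0..1}" for t
    proof (rule onorm_le)
      fix k
      have "norm (\<Sum>b\<in>Basis. (k \<bullet> b) *\<^sub>R G b (p + t *\<^sub>R h)) \<le> (\<Sum>b\<in>(Basis::'a set). norm k * M)"
        using that assms(2) by (intro sum_norm_le) (auto intro!: mult_mono Basis_le_norm)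
      then show "norm (\<Sum>b\<in>Basis. (k \<bullet> b) *\<^sub>R G b (p + t *\<^sub>R h)) \<le> DIM('a) * M * norm k"
        by (simp add: mult_ac)
    qed
  qed
  then show ?thesis by (simp add: mult_ac)
qed

lemma has_partials_taylor:
  fixes f :: "'a::euclidean_space \<Rightarrow> complex" and M :: real
  assumes "\<And>t. t \<in> {0..1} \<Longrightarrow> has_partials f G (p + t *\<^sub>R h)"
    and "\<And>t b. t \<in> {0..1} \<Longrightarrow> b \<in> Basis \<Longrightarrow> norm (G b (p + t *\<^sub>R h) - G b p) \<le> M"
  shows "norm (f (p + h) - f p - (\<Sum>b\<in>Basis. (h \<bullet> b) *\<^sub>R G b p)) \<le> DIM('a) * M * norm h"
proof -
  \<comment> \<open>subtracting the linear part reduces the claim to the mean value inequality\<close>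
  define g where "g = (\<lambda>q. f q - (\<Sum>b\<in>Basis. (q \<bullet> b) *\<^sub>R G b p))"
  have "norm (g (p + h) - g p) \<le> DIM('a) * M * norm h"
  proof (rule has_partials_mvt[where G = "\<lambda>b q. G b q - G b p"])
    show "has_partials g (\<lambda>b q. G b q - G b p) (p + t *\<^sub>R h)" if "t \<in> {0..1}" for t
      using assms(1)[OF that] unfolding has_partials_def g_def
      by (auto intro!: derivative_eq_intros simp: sum_subtractf scaleR_diff_right)
  qed (use assms(2) in auto)
  moreover have "g (p + h) - g p = f (p + h) - f p - (\<Sum>b\<in>Basis. (h \<bullet> b) *\<^sub>R G b p)"
    by (simp add: g_def inner_add_left scaleR_add_left sum.distrib)
  ultimately show ?thesis by simp
qed

section \<open>Smooth functions\<close>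

lemma iter_pd_snoc: "iter_pd (vs @ [v]) f = iter_pd vs (pd v f)"
  by (induction vs) auto

text \<open>
  Iterated derivatives are controlled coinductively: if the functions of a class are differentiable on an
  open set with partial derivatives in the class, then all iterated derivatives remain in the class. The
  function \<open>f\<close> has to agree with a member only on the open set, because derivatives there do
  not see values elsewhere.
\<close>

lemma partials_closed_class:
  assumes "open S"
    and closed: "\<And>g. g \<in> X \<Longrightarrow> \<exists>G. (\<forall>x\<in>S. has_partials g G x) \<and> (\<forall>b\<in>Basis. G b \<in> X)"
    and f: "g \<in> X" "\<And>x. x \<in> S \<Longrightarrow> f x = g x" and vs: "vs \<in> lists Basis"
  shows "\<exists>g\<in>X. \<forall>x\<in>S. iter_pd vs f x = g x"
  using vs
proof (induction vs)
  case Nil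
  then show ?case using f by auto
next
  case (Cons v vs)
  then obtain g where g: "g \<in> X" "\<And>x. x \<in> S \<Longrightarrow> iter_pd vs f x = g x" by auto
  obtain G where G: "\<And>x. x \<in> S \<Longrightarrow> has_partials g G x" "\<And>b. b \<in> Basis \<Longrightarrow> G b \<in> X"
    using closed[OF g(1)] by auto
  have "has_partials (iter_pd vs f) G x" if "x \<in> S" for x
    using has_partials_cong_open[OF G(1)[OF that] \<open>open S\<close> that g(2)] .
  then have "\<forall>x\<in>S. iter_pd (v # vs) f x = G v x"
    using Cons by (auto simp: pd_has_partials)
  then show ?case using G(2) Cons by blast
qed

lemma partials_closed_class_Ck_on:
  assumes "open S"
    and closed: "\<And>g. g \<in> X \<Longrightarrow> \<exists>G. (\<forall>x\<in>S. has_partials g G x) \<and> (\<forall>b\<in>Basis. G b \<in> X)"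
    and f: "g \<in> X" "\<And>x. x \<in> S \<Longrightarrow> f x = g x"
  shows "Ck_on k S f"
proof -
  have "iter_pd vs f differentiable_on S" if vs: "vs \<in> lists Basis" for vs
  proof -
    obtain g where g: "g \<in> X" "\<And>x. x \<in> S \<Longrightarrow> iter_pd vs f x = g x"
      using partials_closed_class[of S X g f vs, OF assms(1) closed f vs] by blast
    obtain G where G: "\<forall>x\<in>S. has_partials g G x"
      using closed[OF g(1)] by blast
    have "has_partials (iter_pd vs f) G x" if "x \<in> S" for x
      using has_partials_cong_open[OF G[rule_format, OF that] \<open>open S\<close> that g(2)] .
    then have "iter_pd vs f differentiable (at x within S)" if "x \<in> S" for x
      using has_partials_differentiable[THEN differentiable_at_withinI] that by blast
    then show ?thesis
      unfolding differentiable_on_def by blast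
  qed
  then show ?thesis
    unfolding Ck_on_def using differentiable_imp_continuous_on by blast
qed

lemma smooth_iff: "smooth f \<longleftrightarrow> (\<forall>vs\<in>lists Basis. \<forall>x. iter_pd vs f differentiable (at x))"
proof
  assume "smooth f"
  then show "\<forall>vs\<in>lists Basis. \<forall>x. iter_pd vs f differentiable (at x)"
    unfolding smooth_def Ck_on_def differentiable_on_def
    by (metis UNIV_I lessI)
next
  assume *: "\<forall>vs\<in>lists Basis. \<forall>x. iter_pd vs f differentiable (at x)"
  then have "iter_pd vs f differentiable_on UNIV" if "vs \<in> lists Basis" for vs
    using that by (auto simp: differentiable_on_def)
  then show "smooth f"
    unfolding smooth_def Ck_on_def using differentiable_imp_continuous_on by blast
qed

lemma smooth_coinduct:
  assumes "f \<in> X"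
    and "\<And>g. g \<in> X \<Longrightarrow> \<exists>G. (\<forall>x. has_partials g G x) \<and> (\<forall>b\<in>Basis. G b \<in> X)"
  shows "smooth f"
  unfolding smooth_def
  using partials_closed_class_Ck_on[of UNIV X f f] assms by auto

lemma smooth_has_partials:
  assumes "smooth f" "vs \<in> lists Basis"
  shows "has_partials (iter_pd vs f) (\<lambda>b. iter_pd (b # vs) f) x"
  using assms by (auto simp: smooth_iff intro: differentiable_imp_has_partials)

lemma smooth_has_partials0: "smooth f \<Longrightarrow> has_partials f (\<lambda>b. pd b f) x"
  using smooth_has_partials[of f "[]"] by simp

lemma smooth_pd: "smooth f \<Longrightarrow> b \<in> Basis \<Longrightarrow> smooth (pd b f)"
  by (auto simp: smooth_iff simp flip: iter_pd_snoc)

lemma smooth_continuous: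
  assumes "smooth f" "vs \<in> lists Basis"
  shows "continuous_on UNIV (iter_pd vs f)"
  using assms unfolding smooth_def Ck_on_def by auto

lemma smooth_continuous0: "smooth f \<Longrightarrow> continuous_on UNIV f"
  using smooth_continuous[of f "[]"] by simp

lemma smooth_const: "smooth (\<lambda>x. c)"
  by (rule smooth_coinduct[where X = "range (\<lambda>c x. c)"]) (auto intro!: exI[of _ "\<lambda>b x. 0"] has_partials_const)

lemma smooth_add:
  assumes "smooth f" "smooth g"
  shows "smooth (\<lambda>x. f x + g x)"
proof (rule smooth_coinduct[where X = "{\<lambda>x. f x + g x | f g. smooth f \<and> smooth g}"])
  fix h assume "h \<in> {\<lambda>x. f x + g x | f g. smooth f \<and> smooth g}"
  then obtain f g where fg: "h = (\<lambda>x. f x + g x)" "smooth f" "smooth g" by auto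
  show "\<exists>G. (\<forall>x. has_partials h G x) \<and> (\<forall>b\<in>Basis. G b \<in> {\<lambda>x. f x + g x | f g. smooth f \<and> smooth g})"
    using fg(2,3) by (intro exI[of _ "\<lambda>b x. pd b f x + pd b g x"])
     (auto simp: fg(1) intro!: has_partials_add smooth_has_partials0 smooth_pd)
qed (use assms in auto)

lemma smooth_cmult:
  assumes "smooth f"
  shows "smooth (\<lambda>x. c * f x)"
proof (rule smooth_coinduct[where X = "{\<lambda>x. c * f x | f. smooth f}"])
  fix h assume "h \<in> {\<lambda>x. c * f x | f. smooth f}"
  then obtain f where f: "h = (\<lambda>x. c * f x)" "smooth f" by auto
  show "\<exists>G. (\<forall>x. has_partials h G x) \<and> (\<forall>b\<in>Basis. G b \<in> {\<lambda>x. c * f x | f. smooth f})"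
    using f(2) by (intro exI[of _ "\<lambda>b x. c * pd b f x"])
     (auto simp: f(1) intro!: has_partials_cmult smooth_has_partials0 smooth_pd)
qed (use assms in auto)

text \<open>
  A class closed under partial derivatives that contains all products of smooth functions: the derivative
  of a product is a sum of two products.
\<close>

inductive_set product_sums :: "('a::euclidean_space \<Rightarrow> complex) set" where
  "smooth f \<Longrightarrow> smooth g \<Longrightarrow> (\<lambda>x. f x * g x) \<in> product_sums"
| "f \<in> product_sums \<Longrightarrow> g \<in> product_sums \<Longrightarrow> (\<lambda>x. f x + g x) \<in> product_sums"

lemma smooth_mult:
  assumes "smooth f" "smooth g"
  shows "smooth (\<lambda>x. f x * g x)"
proof (rule smooth_coinduct[where X = product_sums])
  fix h :: "'a \<Rightarrow> complex" assume "h \<in> product_sums"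
  then show "\<exists>G. (\<forall>x. has_partials h G x) \<and> (\<forall>b\<in>Basis. G b \<in> product_sums)"
  proof induction
    case (1 f g)
    then show ?case
      by (intro exI[of _ "\<lambda>b x. f x * pd b g x + pd b f x * g x"])
       (auto intro!: has_partials_mult smooth_has_partials0 smooth_pd product_sums.intros)
  next
    case (2 f g)
    then obtain F G where "\<forall>x. has_partials f F x" "\<forall>b\<in>Basis. F b \<in> product_sums"
      "\<forall>x. has_partials g G x" "\<forall>b\<in>Basis. G b \<in> product_sums" by auto
    then show ?case
      by (intro exI[of _ "\<lambda>b x. F b x + G b x"])
       (auto intro!: has_partials_add product_sums.intros)
  qed
qed (use assms in \<open>auto intro: product_sums.intros\<close>)

lemma iter_pd_add:
  assumes "smooth f" "smooth g" "vs \<in> lists Basis"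
  shows "iter_pd vs (\<lambda>x. f x + g x) = (\<lambda>x. iter_pd vs f x + iter_pd vs g x)"
  using assms(3)
proof (induction vs)
  case (Cons v vs)
  then have "has_partials (iter_pd vs (\<lambda>x. f x + g x)) (\<lambda>b x. iter_pd (b # vs) f x + iter_pd (b # vs) g x) x" for x
    by (auto intro!: has_partials_add smooth_has_partials assms simp del: iter_pd.simps)
  then show ?case using pd_has_partials Cons by fastforce
qed auto

lemma iter_pd_cmult:
  assumes "smooth f" "vs \<in> lists Basis"
  shows "iter_pd vs (\<lambda>x. c * f x) = (\<lambda>x. c * iter_pd vs f x)"
  using assms(2)
proof (induction vs)
  case (Cons v vs)
  then have "has_partials (iter_pd vs (\<lambda>x. c * f x)) (\<lambda>b x. c * iter_pd (b # vs) f x) x" for x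
    by (auto intro!: has_partials_cmult smooth_has_partials assms simp del: iter_pd.simps)
  then show ?case using pd_has_partials Cons by fastforce
qed auto

lemma smooth_uminus: "smooth f \<Longrightarrow> smooth (\<lambda>x. - f x)"
  using smooth_cmult[of f "-1"] by simp

lemma smooth_diff: "smooth f \<Longrightarrow> smooth g \<Longrightarrow> smooth (\<lambda>x. f x - g x)"
  using smooth_add[of f "\<lambda>x. - g x"] smooth_uminus[of g] by simp

lemma iter_pd_diff:
  assumes "smooth f" "smooth g" "vs \<in> lists Basis"
  shows "iter_pd vs (\<lambda>x. f x - g x) = (\<lambda>x. iter_pd vs f x - iter_pd vs g x)"
  using iter_pd_add[OF assms(1) smooth_uminus[OF assms(2)] assms(3)]
    iter_pd_cmult[OF assms(2,3), of "-1"] by simp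

lemma iter_pd_const: "vs \<noteq> [] \<Longrightarrow> vs \<in> lists Basis \<Longrightarrow> iter_pd vs (\<lambda>x. c) = (\<lambda>x. 0)"
proof (induction vs)
  case (Cons v vs)
  have "has_partials (iter_pd vs (\<lambda>x. c)) (\<lambda>b x. 0) x" for x
    by (cases "vs = []") (use Cons in \<open>auto intro: has_partials_const\<close>)
  then show ?case using pd_has_partials Cons by fastforce
qed auto

lemma smooth_sum:
  assumes "finite J" "\<And>j. j \<in> J \<Longrightarrow> smooth (f j)"
  shows "smooth (\<lambda>x. \<Sum>j\<in>J. f j x)"
  using assms by (induction J) (auto intro: smooth_const smooth_add)

lemma iter_pd_sum:
  assumes "finite J" "\<And>j. j \<in> J \<Longrightarrow> smooth (f j)" "vs \<in> lists Basis"
  shows "iter_pd vs (\<lambda>x. \<Sum>j\<in>J. f j x) = (\<lambda>x. \<Sum>j\<in>J. iter_pd vs (f j) x)"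
  using assms
proof (induction J)
  case empty
  then show ?case by (cases "vs = []") (auto simp: iter_pd_const)
next
  case (insert j J)
  then show ?case by (simp add: iter_pd_add smooth_sum)
qed

text \<open>
  The formula and its differentiability are proved together, since each step of the induction
  differentiates the formula of the preceding step.
\<close>

lemma iter_pd_affine_has_partials:
  assumes "smooth f" "vs \<in> lists Basis"
  shows "iter_pd vs (\<lambda>x. f (c *\<^sub>R x + a)) = (\<lambda>x. c ^ length vs *\<^sub>R iter_pd vs f (c *\<^sub>R x + a)) \<and>
    has_partials (\<lambda>x. c ^ length vs *\<^sub>R iter_pd vs f (c *\<^sub>R x + a))
      (\<lambda>b x. c ^ length (b # vs) *\<^sub>R iter_pd (b # vs) f (c *\<^sub>R x + a)) x"
  using assms(2)
proof (induction vs arbitrary: x)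
  case Nil
  then show ?case
    using has_partials_affine[OF smooth_has_partials0[OF assms(1)]] by simp
next
  case (Cons v vs)
  have "has_partials (\<lambda>x. iter_pd (v # vs) f (c *\<^sub>R x + a))
      (\<lambda>b x. c *\<^sub>R iter_pd (b # v # vs) f (c *\<^sub>R x + a)) x" for x
    by (rule has_partials_affine[OF smooth_has_partials[OF assms(1)]])
       (use Cons in auto)
  from has_partials_cmult[OF this, of "complex_of_real (c ^ length (v # vs))"]
  have 1: "has_partials (\<lambda>x. c ^ length (v # vs) *\<^sub>R iter_pd (v # vs) f (c *\<^sub>R x + a))
      (\<lambda>b x. c ^ length (b # v # vs) *\<^sub>R iter_pd (b # v # vs) f (c *\<^sub>R x + a)) x" for x
    by (simp add: scaleR_conv_of_real mult_ac)
  have "iter_pd (v # vs) (\<lambda>x. f (c *\<^sub>R x + a)) = (\<lambda>x. c ^ length (v # vs) *\<^sub>R iter_pd (v # vs) f (c *\<^sub>R x + a))"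
    using Cons pd_has_partials[of "iter_pd vs (\<lambda>x. f (c *\<^sub>R x + a))"] by fastforce
  with 1 show ?case by blast
qed

lemmas iter_pd_affine = iter_pd_affine_has_partials[THEN conjunct1]

lemma smooth_affine: "smooth f \<Longrightarrow> smooth (\<lambda>x. f (c *\<^sub>R x + a))"
  unfolding smooth_iff[of "\<lambda>x. f (c *\<^sub>R x + a)"]
  using has_partials_differentiable[OF iter_pd_affine_has_partials[of f _ c a, THEN conjunct2]]
  by (simp add: iter_pd_affine)

section \<open>Dominated families\<close>

text \<open>
  For each order of differentiation there is one constant for the whole family. Boundedness in a function
  space, decay, dependence on parameters and rates of convergence are all expressed in this way, with
  different choices of \<open>W\<close>.
\<close>

definition dominated ::
    "'i set \<Rightarrow> ('i \<Rightarrow> 'a \<Rightarrow> real) \<Rightarrow> ('i \<Rightarrow> 'a::euclidean_space \<Rightarrow> complex) \<Rightarrow> bool" where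
  "dominated I W \<Phi> \<longleftrightarrow>
     (\<forall>i\<in>I. smooth (\<Phi> i) \<and> (\<forall>x. 0 \<le> W i x)) \<and>
     (\<forall>vs\<in>lists Basis. \<exists>C. \<forall>i\<in>I. \<forall>x. norm (iter_pd vs (\<Phi> i) x) \<le> C * W i x)"

abbreviation dominated1 :: "('a \<Rightarrow> real) \<Rightarrow> ('a::euclidean_space \<Rightarrow> complex) \<Rightarrow> bool" where
  "dominated1 W \<phi> \<equiv> dominated {()} (\<lambda>_. W) (\<lambda>_. \<phi>)"

lemma dominatedI:
  assumes "\<And>i. i \<in> I \<Longrightarrow> smooth (\<Phi> i)" "\<And>i x. i \<in> I \<Longrightarrow> 0 \<le> W i x"
    "\<And>vs. vs \<in> lists Basis \<Longrightarrow> \<exists>C. \<forall>i\<in>I. \<forall>x. norm (iter_pd vs (\<Phi> i) x) \<le> C * W i x"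
  shows "dominated I W \<Phi>"
  using assms unfolding dominated_def by blast

lemma dominated_smooth: "dominated I W \<Phi> \<Longrightarrow> i \<in> I \<Longrightarrow> smooth (\<Phi> i)"
  and dominated_nonneg: "dominated I W \<Phi> \<Longrightarrow> i \<in> I \<Longrightarrow> 0 \<le> W i x"
  unfolding dominated_def by blast+

lemma dominatedD:
  assumes "dominated I W \<Phi>" "vs \<in> lists Basis"
  shows "\<exists>C\<ge>0. \<forall>i\<in>I. \<forall>x. norm (iter_pd vs (\<Phi> i) x) \<le> C * W i x"
proof -
  obtain C where C: "\<forall>i\<in>I. \<forall>x. norm (iter_pd vs (\<Phi> i) x) \<le> C * W i x"
    using assms unfolding dominated_def by blast
  have "norm (iter_pd vs (\<Phi> i) x) \<le> max C 0 * W i x" if "i \<in> I" for i x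
    using C[rule_format, OF that, of x] mult_right_mono[OF max.cobounded1[of C 0] dominated_nonneg[OF assms(1) that, of x]]
    by linarith
  then show ?thesis by (intro exI[of _ "max C 0"]) auto
qed

lemma dominatedD0:
  assumes "dominated I W \<Phi>"
  shows "\<exists>C\<ge>0. \<forall>i\<in>I. \<forall>x. norm (\<Phi> i x) \<le> C * W i x"
  using dominatedD[OF assms, of "[]"] by auto

lemma dominated_mono:
  assumes "dominated I W \<Phi>" "\<And>i x. i \<in> I \<Longrightarrow> W i x \<le> K * V i x" "\<And>i x. i \<in> I \<Longrightarrow> 0 \<le> V i x"
  shows "dominated I V \<Phi>"
proof (rule dominatedI)
  fix vs :: "'b list" assume "vs \<in> lists Basis"
  then obtain C where C0: "C \<ge> 0" "\<forall>i\<in>I. \<forall>x. norm (iter_pd vs (\<Phi> i) x) \<le> C * W i x"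
    using dominatedD[OF assms(1), of vs] by blast
  note C = C0(1) C0(2)[rule_format]
  have "norm (iter_pd vs (\<Phi> i) x) \<le> (C * K) * V i x" if "i \<in> I" for i x
    using C(2)[OF that, of x] mult_left_mono[OF assms(2)[OF that, of x] C(1)] by (simp add: mult.assoc)
  then show "\<exists>C. \<forall>i\<in>I. \<forall>x. norm (iter_pd vs (\<Phi> i) x) \<le> C * V i x" by blast
qed (auto intro: dominated_smooth[OF assms(1)] assms(3))

lemma dominated_reindex:
  assumes "dominated I W \<Phi>" "\<And>j. j \<in> J \<Longrightarrow> h j \<in> I"
  shows "dominated J (\<lambda>j. W (h j)) (\<lambda>j. \<Phi> (h j))"
proof (rule dominatedI)
  fix vs :: "'b list" assume "vs \<in> lists Basis"
  then show "\<exists>C. \<forall>j\<in>J. \<forall>x. norm (iter_pd vs (\<Phi> (h j)) x) \<le> C * W (h j) x"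
    using assms(2) by (meson dominatedD[OF assms(1), of vs])
qed (auto intro: dominated_smooth[OF assms(1)] dominated_nonneg[OF assms(1)] assms(2))

lemma dominated_const: "dominated1 W \<phi> \<Longrightarrow> dominated I (\<lambda>_. W) (\<lambda>_. \<phi>)"
  using dominated_reindex[of "{()}" "\<lambda>_. W" "\<lambda>_. \<phi>" I "\<lambda>_. ()"] by simp

lemma dominated_add:
  assumes "dominated I W \<Phi>" "dominated I W \<Psi>"
  shows "dominated I W (\<lambda>i x. \<Phi> i x + \<Psi> i x)"
proof (rule dominatedI)
  fix vs :: "'b list" assume vs: "vs \<in> lists Basis"
  obtain C where C0: "C \<ge> 0" "\<forall>i\<in>I. \<forall>x. norm (iter_pd vs (\<Phi> i) x) \<le> C * W i x"
    using dominatedD[OF assms(1) vs] by blast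
  note C = C0(1) C0(2)[rule_format]
  obtain D where D0: "D \<ge> 0" "\<forall>i\<in>I. \<forall>x. norm (iter_pd vs (\<Psi> i) x) \<le> D * W i x"
    using dominatedD[OF assms(2) vs] by blast
  note D = D0(1) D0(2)[rule_format]
  have "norm (iter_pd vs (\<lambda>x. \<Phi> i x + \<Psi> i x) x) \<le> (C + D) * W i x" if "i \<in> I" for i x
    using C(2)[OF that, of x] D(2)[OF that, of x] norm_triangle_ineq[of "iter_pd vs (\<Phi> i) x" "iter_pd vs (\<Psi> i) x"]
      dominated_smooth[OF assms(1) that] dominated_smooth[OF assms(2) that] vs
    by (simp add: iter_pd_add distrib_right)
  then show "\<exists>C. \<forall>i\<in>I. \<forall>x. norm (iter_pd vs (\<lambda>x. \<Phi> i x + \<Psi> i x) x) \<le> C * W i x" by blast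
qed (auto intro: smooth_add dominated_smooth[OF assms(1)] dominated_smooth[OF assms(2)] dominated_nonneg[OF assms(1)])

lemma dominated_scale:
  assumes "dominated I W \<Phi>"
  shows "dominated I (\<lambda>i x. norm (c i) * W i x) (\<lambda>i x. c i * \<Phi> i x)"
proof (rule dominatedI)
  fix vs :: "'b list" assume vs: "vs \<in> lists Basis"
  obtain C where C0: "C \<ge> 0" "\<forall>i\<in>I. \<forall>x. norm (iter_pd vs (\<Phi> i) x) \<le> C * W i x"
    using dominatedD[OF assms(1) vs] by blast
  note C = C0(1) C0(2)[rule_format]
  have "norm (iter_pd vs (\<lambda>x. c i * \<Phi> i x) x) \<le> C * (norm (c i) * W i x)" if "i \<in> I" for i x
    using mult_left_mono[OF C(2)[OF that, of x] norm_ge_zero[of "c i"]] dominated_smooth[OF assms(1) that] vs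
    by (simp add: iter_pd_cmult norm_mult mult_ac)
  then show "\<exists>C. \<forall>i\<in>I. \<forall>x. norm (iter_pd vs (\<lambda>x. c i * \<Phi> i x) x) \<le> C * (norm (c i) * W i x)" by blast
qed (auto intro: smooth_cmult dominated_smooth[OF assms] dominated_nonneg[OF assms] mult_nonneg_nonneg)

lemma dominated_cmult:
  assumes "dominated I W \<Phi>"
  shows "dominated I W (\<lambda>i x. c * \<Phi> i x)"
  using dominated_mono[OF dominated_scale[OF assms, of "\<lambda>_. c"], of "norm c" W] dominated_nonneg[OF assms]
  by auto

lemma dominated_diff:
  assumes "dominated I W \<Phi>" "dominated I W \<Psi>"
  shows "dominated I W (\<lambda>i x. \<Phi> i x - \<Psi> i x)"
  using dominated_add[OF assms(1) dominated_cmult[OF assms(2), of "-1"]] by simp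

lemma dominated_pd:
  assumes "dominated I W \<Phi>" "b \<in> Basis"
  shows "dominated I W (\<lambda>i. pd b (\<Phi> i))"
proof (rule dominatedI)
  fix vs :: "'b list" assume "vs \<in> lists Basis"
  then have "vs @ [b] \<in> lists Basis" using assms(2) by auto
  from this show "\<exists>C. \<forall>i\<in>I. \<forall>x. norm (iter_pd vs (pd b (\<Phi> i)) x) \<le> C * W i x"
    using dominatedD[OF assms(1), of "vs @ [b]"] by (auto simp: iter_pd_snoc)
qed (auto intro: smooth_pd assms(2) dominated_smooth[OF assms(1)] dominated_nonneg[OF assms(1)])

text \<open>
  Leibniz' rule without binomial coefficients: taking out the innermost derivative turns a product into a
  sum of two products of families with the same weights.
\<close>

lemma dominated_mult:
  assumes "dominated I W \<Phi>" "dominated I V \<Psi>"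
  shows "dominated I (\<lambda>i x. W i x * V i x) (\<lambda>i x. \<Phi> i x * \<Psi> i x)"
proof (rule dominatedI)
  fix vs :: "'b list" assume "vs \<in> lists Basis"
  then show "\<exists>C. \<forall>i\<in>I. \<forall>x. norm (iter_pd vs (\<lambda>x. \<Phi> i x * \<Psi> i x) x) \<le> C * (W i x * V i x)"
    using assms
  proof (induction vs arbitrary: \<Phi> \<Psi> rule: rev_induct)
    case Nil
    obtain C where C0: "C \<ge> 0" "\<forall>i\<in>I. \<forall>x. norm (\<Phi> i x) \<le> C * W i x"
      using dominatedD0[OF Nil(2)] by blast
    note C = C0(1) C0(2)[rule_format]
    obtain D where D0: "D \<ge> 0" "\<forall>i\<in>I. \<forall>x. norm (\<Psi> i x) \<le> D * V i x"
      using dominatedD0[OF Nil(3)] by blast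
    note D = D0(1) D0(2)[rule_format]
    have "norm (\<Phi> i x * \<Psi> i x) \<le> (C * D) * (W i x * V i x)" if "i \<in> I" for i x
      using mult_mono[OF C(2)[OF that, of x] D(2)[OF that, of x]] C(1) D(1) dominated_nonneg[OF Nil(2) that, of x]
      by (simp add: norm_mult mult_ac)
    then show ?case by auto
  next
    case (snoc v vs)
    then have v: "v \<in> Basis" and vs: "vs \<in> lists Basis" by auto
    obtain C where C: "\<And>i x. i \<in> I \<Longrightarrow> norm (iter_pd vs (\<lambda>x. \<Phi> i x * pd v (\<Psi> i) x) x) \<le> C * (W i x * V i x)"
      using snoc.IH[OF vs snoc.prems(2) dominated_pd[OF snoc.prems(3) v]] by blast
    obtain D where D: "\<And>i x. i \<in> I \<Longrightarrow> norm (iter_pd vs (\<lambda>x. pd v (\<Phi> i) x * \<Psi> i x) x) \<le> D * (W i x * V i x)"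
      using snoc.IH[OF vs dominated_pd[OF snoc.prems(2) v] snoc.prems(3)] by blast
    have "norm (iter_pd (vs @ [v]) (\<lambda>x. \<Phi> i x * \<Psi> i x) x) \<le> (C + D) * (W i x * V i x)" if "i \<in> I" for i x
    proof -
      note s = dominated_smooth[OF snoc.prems(2) that] dominated_smooth[OF snoc.prems(3) that]
      have "pd v (\<lambda>x. \<Phi> i x * \<Psi> i x) = (\<lambda>x. \<Phi> i x * pd v (\<Psi> i) x + pd v (\<Phi> i) x * \<Psi> i x)"
        using pd_has_partials[OF has_partials_mult[OF smooth_has_partials0[OF s(1)] smooth_has_partials0[OF s(2)]] v]
        by auto
      then have "iter_pd (vs @ [v]) (\<lambda>x. \<Phi> i x * \<Psi> i x) x =
          iter_pd vs (\<lambda>x. \<Phi> i x * pd v (\<Psi> i) x) x + iter_pd vs (\<lambda>x. pd v (\<Phi> i) x * \<Psi> i x) x"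
        by (simp add: iter_pd_snoc iter_pd_add smooth_mult smooth_pd s v vs)
      then show ?thesis
        using C[OF that, of x] D[OF that, of x] norm_triangle_ineq[of "iter_pd vs (\<lambda>x. \<Phi> i x * pd v (\<Psi> i) x) x" "iter_pd vs (\<lambda>x. pd v (\<Phi> i) x * \<Psi> i x) x"]
        by (simp add: distrib_right)
    qed
    then show ?case by blast
  qed
qed (simp_all add: smooth_mult dominated_smooth[OF assms(1)] dominated_nonneg[OF assms(1)] dominated_smooth[OF assms(2)] dominated_nonneg[OF assms(2)])

lemma dominated_affine:
  assumes "dominated I W \<Phi>" "\<And>i. i \<in> I \<Longrightarrow> \<bar>c i\<bar> \<le> K"
  shows "dominated I (\<lambda>i x. W i (c i *\<^sub>R x + a i)) (\<lambda>i x. \<Phi> i (c i *\<^sub>R x + a i))"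
proof (rule dominatedI)
  fix vs :: "'b list" assume vs: "vs \<in> lists Basis"
  obtain C where C0: "C \<ge> 0" "\<forall>i\<in>I. \<forall>x. norm (iter_pd vs (\<Phi> i) x) \<le> C * W i x"
    using dominatedD[OF assms(1) vs] by blast
  note C = C0(1) C0(2)[rule_format]
  have "norm (iter_pd vs (\<lambda>x. \<Phi> i (c i *\<^sub>R x + a i)) x) \<le> (K ^ length vs * C) * W i (c i *\<^sub>R x + a i)"
    if "i \<in> I" for i x
  proof -
    have "\<bar>c i\<bar> ^ length vs * norm (iter_pd vs (\<Phi> i) (c i *\<^sub>R x + a i)) \<le> K ^ length vs * (C * W i (c i *\<^sub>R x + a i))"
      using assms(2)[OF that] C(1) dominated_nonneg[OF assms(1) that]
      by (intro mult_mono power_mono C(2)[OF that]) auto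
    then show ?thesis
      by (simp add: iter_pd_affine[OF dominated_smooth[OF assms(1) that] vs] power_abs mult_ac)
  qed
  then show "\<exists>D. \<forall>i\<in>I. \<forall>x. norm (iter_pd vs (\<lambda>x. \<Phi> i (c i *\<^sub>R x + a i)) x) \<le> D * W i (c i *\<^sub>R x + a i)"
    by blast
qed (auto intro: smooth_affine dominated_smooth[OF assms(1)] dominated_nonneg[OF assms(1)])

section \<open>Weights\<close>

text \<open>
  The weight of the problem is \<open>wt s\<close> with \<open>s = (\<alpha> + n + 1) / 2\<close>; other
  exponents measure the decay of Schwartz functions and of kernels.
\<close>

definition wt :: "real \<Rightarrow> 'a::real_normed_vector \<Rightarrow> real" where
  "wt t x = (1 + (norm x)\<^sup>2) powr t"

lemma one_plus_norm2_pos: "0 < 1 + (norm x)\<^sup>2"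
  by (simp add: add_pos_nonneg)

lemma wt_pos: "0 < wt t x"
  using one_plus_norm2_pos[of x] by (simp add: wt_def)

lemma wt_nonneg: "0 \<le> wt t x"
  by (simp add: wt_def)

lemma wt_0: "wt 0 x = 1"
  using one_plus_norm2_pos[of x] by (simp add: wt_def)

lemma wt_mult: "wt s x * wt t x = wt (s + t) x"
  by (simp add: wt_def powr_add)

lemma wt_minus: "wt (- t) x = inverse (wt t x)"
  by (simp add: wt_def powr_minus)

lemma wt_uminus: "wt t (- x) = wt t x"
  by (simp add: wt_def)

lemma wt_mono: "s \<le> t \<Longrightarrow> wt s x \<le> wt t x"
  by (simp add: wt_def powr_mono)

lemma continuous_on_wt: "continuous_on S (wt t)"
  unfolding wt_def using one_plus_norm2_pos
  by (intro continuous_intros ballI) (rule less_imp_neq[symmetric])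

lemma borel_measurable_wt[measurable]: "wt t \<in> borel_measurable borel"
  by (rule borel_measurable_continuous_onI[OF continuous_on_wt])

text \<open>
  Peetre's inequality. Because of it, a translation costs no more than a power of the distance.
\<close>

lemma wt_peetre:
  assumes "0 \<le> t"
  shows "wt t (x + y) \<le> 2 powr t * wt t x * wt t y"
proof -
  have "(norm (x + y))\<^sup>2 \<le> (norm x + norm y)\<^sup>2"
    by (intro power_mono norm_triangle_ineq) auto
  also have "\<dots> \<le> 2 * (norm x)\<^sup>2 + 2 * (norm y)\<^sup>2"
    using sum_squares_bound[of "norm x" "norm y"] by (simp add: power2_sum)
  finally have "(norm (x + y))\<^sup>2 \<le> 2 * (norm x)\<^sup>2 + 2 * (norm y)\<^sup>2" .
  moreover have "2 * (1 + (norm x)\<^sup>2) * (1 + (norm y)\<^sup>2) =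
      2 + 2 * (norm x)\<^sup>2 + 2 * (norm y)\<^sup>2 + 2 * (norm x * norm y)\<^sup>2"
    by (simp add: algebra_simps power_mult_distrib)
  ultimately have "1 + (norm (x + y))\<^sup>2 \<le> 2 * (1 + (norm x)\<^sup>2) * (1 + (norm y)\<^sup>2)"
    using zero_le_power2[of "norm x * norm y"] by linarith
  then have "(1 + (norm (x + y))\<^sup>2) powr t \<le> (2 * (1 + (norm x)\<^sup>2) * (1 + (norm y)\<^sup>2)) powr t"
    using assms by (intro powr_mono2) auto
  then show ?thesis
    by (simp only: wt_def powr_mult)
qed

lemma wt_peetre_minus:
  assumes "0 \<le> t"
  shows "wt (- t) x \<le> 2 powr t * wt (- t) (x + y) * wt t y"
proof -
  have "wt (- t) x * wt t (x + y) * wt (- t) (x + y) \<le> wt (- t) x * (2 powr t * wt t x * wt t y) * wt (- t) (x + y)"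
    by (intro mult_right_mono mult_left_mono wt_peetre assms wt_nonneg)
  moreover have "wt t (x + y) * wt (- t) (x + y) = 1" "wt (- t) x * wt t x = 1"
    by (auto simp: wt_mult wt_0)
  moreover have "wt (- t) x * (2 powr t * wt t x * wt t y) * wt (- t) (x + y) =
      (wt (- t) x * wt t x) * (2 powr t * wt (- t) (x + y) * wt t y)" by (simp only: mult_ac)
  ultimately show ?thesis by (simp only: mult.assoc mult_1_left mult_1_right)
qed

text \<open>
  Unlike Peetre's inequality this keeps the weights of \<open>x\<close> and \<open>y\<close> apart;
  inside an integral each of them can then be absorbed by the factor that decays in its variable.
\<close>

lemma wt_add_le:
  assumes "0 \<le> t"
  shows "wt t (x + y) \<le> 4 powr t * (wt t x + wt t y)"
proof -
  have *: "wt t (x + y) \<le> 4 powr t * wt t z" if "norm x \<le> norm z" "norm y \<le> norm z" for z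
  proof -
    have "norm (x + y) \<le> 2 * norm z" using norm_triangle_ineq[of x y] that by linarith
    then have "(norm (x + y))\<^sup>2 \<le> (2 * norm z)\<^sup>2" by (intro power_mono) auto
    then have "(1 + (norm (x + y))\<^sup>2) powr t \<le> (4 * (1 + (norm z)\<^sup>2)) powr t"
      using assms by (intro powr_mono2) auto
    then show ?thesis by (simp only: wt_def powr_mult)
  qed
  have "wt t x \<ge> 0" "wt t y \<ge> 0" by (auto simp: wt_nonneg)
  then have "4 powr t * wt t x \<le> 4 powr t * (wt t x + wt t y)" "4 powr t * wt t y \<le> 4 powr t * (wt t x + wt t y)"
    by (auto intro!: mult_left_mono)
  with *[of x] *[of y] show ?thesis by (cases "norm x \<le> norm y") linarith+
qed

lemma wt_le_power:
  assumes "2 * \<bar>t\<bar> \<le> real k"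
  shows "wt t x \<le> (1 + norm x) ^ k"
proof -
  have "1 + (norm x)\<^sup>2 \<le> (1 + norm x)\<^sup>2" by (simp add: power2_sum)
  then have "wt \<bar>t\<bar> x \<le> ((1 + norm x)\<^sup>2) powr \<bar>t\<bar>"
    unfolding wt_def by (intro powr_mono2) auto
  also have "\<dots> = (1 + norm x) powr (2 * \<bar>t\<bar>)"
    using powr_powr[of "1 + norm x" 2 "\<bar>t\<bar>"] by (simp add: add_nonneg_eq_0_iff)
  also have "\<dots> \<le> (1 + norm x) powr real k"
    using assms by (intro powr_mono) auto
  also have "\<dots> = (1 + norm x) ^ k"
    by (rule powr_realpow) (simp add: add_pos_nonneg)
  finally show ?thesis using wt_mono[of t "\<bar>t\<bar>" x] by linarith
qed

lemma power_le_wt: "(1 + norm x) ^ k \<le> 2 ^ k * wt (real k / 2) x"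
proof -
  have "(1 + norm x)\<^sup>2 \<le> 4 * (1 + (norm x)\<^sup>2)"
  proof -
    have "4 * (1 + (norm x)\<^sup>2) - (1 + norm x)\<^sup>2 = (1 - norm x)\<^sup>2 + 2 + 2 * (norm x)\<^sup>2"
      by (simp add: power2_eq_square algebra_simps)
    moreover have "0 \<le> (1 - norm x)\<^sup>2 + 2 + 2 * (norm x)\<^sup>2" by (simp add: add_nonneg_nonneg)
    ultimately show ?thesis by linarith
  qed
  then have "((1 + norm x)\<^sup>2) powr (real k / 2) \<le> (4 * (1 + (norm x)\<^sup>2)) powr (real k / 2)"
    by (intro powr_mono2) auto
  moreover have "((1 + norm x)\<^sup>2) powr (real k / 2) = (1 + norm x) ^ k"
    using powr_powr[of "1 + norm x" 2 "real k / 2"] powr_realpow[of "1 + norm x" k]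
    by (simp add: add_nonneg_eq_0_iff add_pos_nonneg)
  moreover have "4 powr (real k / 2) = 2 ^ k"
    using powr_powr[of "2::real" 2 "real k / 2"] by (simp add: powr_realpow)
  ultimately show ?thesis by (simp only: wt_def powr_mult)
qed

section \<open>Function spaces\<close>

text \<open>
  Replacing the polynomial factors of the definition by the weights \<open>wt t\<close> makes the
  calculus of dominated families available for Schwartz functions.
\<close>

lemma schwartz_iff: "\<phi> \<in> schwartz \<longleftrightarrow> (\<forall>t. dominated1 (wt t) \<phi>)"
proof
  assume \<phi>: "\<phi> \<in> schwartz"
  show "\<forall>t. dominated1 (wt t) \<phi>"
  proof (intro allI dominatedI)
    fix t :: real and vs :: "(real^'a) list" assume vs: "vs \<in> lists Basis"
    obtain k :: nat where k: "2 * \<bar>t\<bar> \<le> real k" using real_arch_simple by blast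
    have "bounded (range (\<lambda>x. (1 + norm x) ^ k *\<^sub>R iter_pd vs \<phi> x))"
      using \<phi> vs by (auto simp: schwartz_def)
    then obtain C where C: "\<And>x. norm ((1 + norm x) ^ k *\<^sub>R iter_pd vs \<phi> x) \<le> C"
      by (auto simp: bounded_iff)
    have "norm (iter_pd vs \<phi> x) \<le> C * wt t x" for x
    proof -
      have "wt t x * wt (- t) x * norm (iter_pd vs \<phi> x) \<le> wt t x * (1 + norm x) ^ k * norm (iter_pd vs \<phi> x)"
        using k by (intro mult_right_mono mult_left_mono wt_le_power wt_nonneg) auto
      also have "\<dots> \<le> wt t x * C"
        using C[of x] by (simp add: mult.assoc mult_left_mono wt_nonneg)
      finally show ?thesis by (simp add: wt_mult wt_0 mult.commute)
    qed
    then show "\<exists>C. \<forall>i\<in>{()}. \<forall>x. norm (iter_pd vs \<phi> x) \<le> C * wt t x" by blast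
  qed (use \<phi> in \<open>auto simp: wt_nonneg schwartz_def\<close>)
next
  assume *: "\<forall>t. dominated1 (wt t) \<phi>"
  have "bounded (range (\<lambda>x. (1 + norm x) ^ k *\<^sub>R iter_pd vs \<phi> x))" if vs: "vs \<in> lists Basis" for k vs
  proof -
    obtain C where C: "C \<ge> 0" "\<And>x. norm (iter_pd vs \<phi> x) \<le> C * wt (- real k / 2) x"
      using dominatedD[OF *[rule_format] vs] by auto
    have "norm ((1 + norm x) ^ k *\<^sub>R iter_pd vs \<phi> x) \<le> 2 ^ k * C" for x
    proof -
      have "(1 + norm x) ^ k * norm (iter_pd vs \<phi> x) \<le> (2 ^ k * wt (real k / 2) x) * (C * wt (- real k / 2) x)"
        by (intro mult_mono C power_le_wt) (auto simp: wt_nonneg)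
      also have "\<dots> = 2 ^ k * C * (wt (real k / 2) x * wt (- real k / 2) x)" by simp
      finally show ?thesis by (simp add: wt_mult wt_0)
    qed
    then show ?thesis by (auto simp: bounded_iff)
  qed
  then show "\<phi> \<in> schwartz"
    using *[rule_format, THEN dominated_smooth] by (auto simp: schwartz_def)
qed

lemma schwartz_dominated: "\<phi> \<in> schwartz \<Longrightarrow> dominated1 (wt t) \<phi>"
  by (simp add: schwartz_iff)

lemma space_B_iff: "\<phi> \<in> space_B \<longleftrightarrow> dominated1 (\<lambda>_. 1) \<phi>"
  unfolding space_B_def dominated_def bounded_iff by auto

lemma dominated_in_B:
  assumes "dominated I (\<lambda>i x. W i) \<Phi>" "i \<in> I"
  shows "\<Phi> i \<in> space_B"
  unfolding space_B_iff
  by (rule dominated_mono[OF dominated_reindex[OF assms(1), of "{()}" "\<lambda>_. i"], of "W i"]) (use assms in auto)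

lemma space_B_add: "\<phi> \<in> space_B \<Longrightarrow> \<psi> \<in> space_B \<Longrightarrow> (\<lambda>x. \<phi> x + \<psi> x) \<in> space_B"
  unfolding space_B_iff by (rule dominated_add)

lemma space_B_diff: "\<phi> \<in> space_B \<Longrightarrow> \<psi> \<in> space_B \<Longrightarrow> (\<lambda>x. \<phi> x - \<psi> x) \<in> space_B"
  unfolding space_B_iff by (rule dominated_diff)

lemma space_B_cmult: "\<phi> \<in> space_B \<Longrightarrow> (\<lambda>x. c * \<phi> x) \<in> space_B"
  unfolding space_B_iff by (rule dominated_cmult)

lemma space_B_const: "(\<lambda>x. c) \<in> space_B"
  unfolding space_B_iff
proof (rule dominatedI)
  fix vs :: "(real^'a) list" assume vs: "vs \<in> lists Basis"
  then show "\<exists>C. \<forall>i\<in>{()}. \<forall>x. norm (iter_pd vs (\<lambda>x::real^'a. c) x) \<le> C * 1"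
    by (cases "vs = []") (auto simp: iter_pd_const intro!: exI[of _ "norm c"])
qed (auto simp: smooth_const)

lemma space_B_sum:
  assumes "finite J" "\<And>j. j \<in> J \<Longrightarrow> \<phi> j \<in> space_B"
  shows "(\<lambda>x. \<Sum>j\<in>J. \<phi> j x) \<in> space_B"
  using assms by (induction J) (auto intro: space_B_const space_B_add)

lemma space_B_smooth: "\<phi> \<in> space_B \<Longrightarrow> smooth \<phi>"
  by (simp add: space_B_def)

lemma schwartz_subset_Bdot: "schwartz \<subseteq> space_Bdot"
proof
  fix \<phi> :: "real^'n \<Rightarrow> complex" assume \<phi>: "\<phi> \<in> schwartz"
  have "(iter_pd vs \<phi> \<longlongrightarrow> 0) at_infinity" if vs: "vs \<in> lists Basis" for vs
  proof -
    obtain C where C: "C \<ge> 0" "\<And>x. norm (iter_pd vs \<phi> x) \<le> C * wt (- 1) x"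
      using dominatedD[OF schwartz_dominated[OF \<phi>] vs] by auto
    have "((\<lambda>x::real^'n. C * inverse (1 + (norm x)\<^sup>2)) \<longlongrightarrow> C * 0) at_infinity"
      by (intro tendsto_intros tendsto_inverse_0_at_top filterlim_tendsto_add_at_top[OF tendsto_const]
          filterlim_pow_at_top filterlim_norm_at_top) auto
    then have "((\<lambda>x::real^'n. C * wt (- 1) x) \<longlongrightarrow> 0) at_infinity"
      using one_plus_norm2_pos by (simp add: wt_def powr_minus less_imp_le)
    then show ?thesis
      by (rule Lim_null_comparison[rotated]) (use C in auto)
  qed
  moreover have "\<phi> \<in> space_B"
    using schwartz_dominated[OF \<phi>, of 0] by (simp add: space_B_iff wt_0[abs_def])
  ultimately show "\<phi> \<in> space_Bdot" by (simp add: space_Bdot_def)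
qed

lemma schwartz_subset_B: "schwartz \<subseteq> space_B"
  using schwartz_subset_Bdot by (auto simp: space_Bdot_def)

lemma schwartz_mult:
  assumes "\<phi> \<in> schwartz" "dominated1 (wt t) g"
  shows "(\<lambda>x. g x * \<phi> x) \<in> schwartz"
  unfolding schwartz_iff
proof
  fix r show "dominated1 (wt r) (\<lambda>x. g x * \<phi> x)"
    using dominated_mult[OF assms(2) schwartz_dominated[OF assms(1), of "r - t"]] by (simp add: wt_mult)
qed

lemma schwartz_add: "\<phi> \<in> schwartz \<Longrightarrow> \<psi> \<in> schwartz \<Longrightarrow> (\<lambda>x. \<phi> x + \<psi> x) \<in> schwartz"
  unfolding schwartz_iff by (auto intro: dominated_add)

lemma schwartz_cmult: "\<phi> \<in> schwartz \<Longrightarrow> (\<lambda>x. c * \<phi> x) \<in> schwartz"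
  unfolding schwartz_iff by (auto intro: dominated_cmult)

lemma schwartz_affine:
  fixes \<phi> :: "real^'n \<Rightarrow> complex"
  assumes "\<phi> \<in> schwartz" "c \<noteq> 0"
  shows "(\<lambda>x. \<phi> (c *\<^sub>R x + a)) \<in> schwartz"
  unfolding schwartz_iff
proof
  fix t :: real
  \<comment> \<open>a decay of order at least \<open>t\<close> whose exponent has a definite sign, as Peetre's inequality requires\<close>
  define s where "s = \<bar>t\<bar>"
  have "dominated1 (\<lambda>x. wt (- s) (c *\<^sub>R x + a)) (\<lambda>x. \<phi> (c *\<^sub>R x + a))"
    by (rule dominated_affine[OF schwartz_dominated[OF assms(1)], of "\<lambda>_. c" "\<bar>c\<bar>"]) auto
  then show "dominated1 (wt t) (\<lambda>x. \<phi> (c *\<^sub>R x + a))"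
  proof (rule dominated_mono)
    fix x :: "real^'n"
    define m where "m = min 1 (c\<^sup>2)"
    have m: "m > 0" using assms(2) by (auto simp: m_def)
    have "m * (1 + (norm x)\<^sup>2) \<le> 1 + (norm (c *\<^sub>R x))\<^sup>2"
      by (auto simp: m_def distrib_left power_mult_distrib intro!: add_mono mult_right_mono)
    then have "wt (- s) (c *\<^sub>R x) \<le> (m * (1 + (norm x)\<^sup>2)) powr (- s)"
      unfolding wt_def using m one_plus_norm2_pos[of x] by (intro powr_mono2') (auto simp: s_def)
    also have "\<dots> = m powr (- s) * wt (- s) x"
      using m by (simp add: wt_def powr_mult)
    finally have 1: "wt (- s) (c *\<^sub>R x) \<le> m powr (- s) * wt t x"
      using mult_left_mono[OF wt_mono[of "- s" t x], of "m powr (- s)"] by (auto simp: s_def abs_if split: if_splits)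
    have "wt (- s) (c *\<^sub>R x + a) \<le> 2 powr s * wt (- s) (c *\<^sub>R x) * wt s a"
      using wt_peetre_minus[of s "c *\<^sub>R x + a" "- a"] by (simp add: s_def wt_uminus)
    also have "\<dots> \<le> 2 powr s * (m powr (- s) * wt t x) * wt s a"
      by (intro mult_right_mono mult_left_mono 1) (auto simp: wt_nonneg)
    finally show "wt (- s) (c *\<^sub>R x + a) \<le> (2 powr s * m powr (- s) * wt s a) * wt t x"
      by (simp add: mult_ac)
  qed (auto simp: wt_nonneg)
qed

section \<open>Linear forms that are sequentially continuous on bounded sets\<close>

text \<open>
  Sequences that are bounded in \<open>\<B>\<close> and tend to 0 in \<open>C\<^sup>\<infinity>\<close>.
\<close>

definition B_null :: "(nat \<Rightarrow> real^'n \<Rightarrow> complex) \<Rightarrow> bool" where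
  "B_null \<Phi> \<longleftrightarrow> dominated UNIV (\<lambda>_ _. 1) \<Phi> \<and>
     (\<forall>vs\<in>lists Basis. \<forall>R. \<forall>\<epsilon>>0. \<forall>\<^sub>F j in sequentially. \<forall>x\<in>cball 0 R. norm (iter_pd vs (\<Phi> j) x) < \<epsilon>)"

text \<open>
  The rate \<open>\<epsilon>\<close> may be accompanied by any locally bounded factor, because
  convergence in \<open>C\<^sup>\<infinity>\<close> is tested on balls.
\<close>

lemma B_nullI:
  fixes \<Phi> :: "nat \<Rightarrow> real^'a \<Rightarrow> complex"
  assumes "dominated UNIV (\<lambda>_ _. 1) \<Phi>" "dominated UNIV (\<lambda>j x. \<epsilon> j * W x) \<Phi>"
    "\<epsilon> \<longlonglongrightarrow> 0" "\<And>R. \<exists>K. \<forall>x\<in>cball 0 R. \<bar>W x\<bar> \<le> K"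
  shows "B_null \<Phi>"
  unfolding B_null_def
proof (intro conjI ballI allI impI assms(1))
  fix vs :: "(real^'a) list" and R e :: real
  assume vs: "vs \<in> lists Basis" and "e > 0"
  obtain C where C: "C \<ge> 0" "\<And>j x. norm (iter_pd vs (\<Phi> j) x) \<le> C * (\<epsilon> j * W x)"
    using dominatedD[OF assms(2) vs] by auto
  obtain K where K: "\<And>x. x \<in> cball 0 R \<Longrightarrow> \<bar>W x\<bar> \<le> K" using assms(4) by blast
  have "(\<lambda>j. C * (\<bar>\<epsilon> j\<bar> * \<bar>K\<bar>)) \<longlonglongrightarrow> C * (\<bar>0\<bar> * \<bar>K\<bar>)"
    by (intro tendsto_intros assms(3))
  then have "\<forall>\<^sub>F j in sequentially. C * (\<bar>\<epsilon> j\<bar> * \<bar>K\<bar>) < e"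
    using \<open>e > 0\<close> by (auto intro: order_tendstoD)
  then show "\<forall>\<^sub>F j in sequentially. \<forall>x\<in>cball 0 R. norm (iter_pd vs (\<Phi> j) x) < e"
  proof (rule eventually_mono, intro ballI)
    fix j and x :: "real^'a" assume j: "C * (\<bar>\<epsilon> j\<bar> * \<bar>K\<bar>) < e" and x: "x \<in> cball 0 R"
    have "\<epsilon> j * W x \<le> \<bar>\<epsilon> j\<bar> * \<bar>W x\<bar>" by (simp flip: abs_mult)
    also have "\<dots> \<le> \<bar>\<epsilon> j\<bar> * \<bar>K\<bar>" using K[OF x] by (intro mult_left_mono) auto
    finally show "norm (iter_pd vs (\<Phi> j) x) < e"
      using C(2)[of j x] mult_left_mono[OF _ C(1), of "\<epsilon> j * W x" "\<bar>\<epsilon> j\<bar> * \<bar>K\<bar>"] j by linarith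
  qed
qed

text \<open>
  These are the continuous linear forms on \<open>\<B>\<^sub>c\<close>, as
  \<open>Bc_form_imp_dual\<close> and \<open>dual_imp_Bc_form\<close> show; sequences are the form in
  which continuity can be verified and applied.
\<close>

definition Bc_form :: "((real^'n \<Rightarrow> complex) \<Rightarrow> complex) \<Rightarrow> bool" where
  "Bc_form F \<longleftrightarrow>
     (\<forall>\<phi>\<in>space_B. \<forall>\<psi>\<in>space_B. F (\<lambda>x. \<phi> x + \<psi> x) = F \<phi> + F \<psi>) \<and>
     (\<forall>\<phi>\<in>space_B. \<forall>c. F (\<lambda>x. c * \<phi> x) = c * F \<phi>) \<and>
     (\<forall>\<Phi>. B_null \<Phi> \<longrightarrow> (\<lambda>j. F (\<Phi> j)) \<longlonglongrightarrow> 0)"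

lemma Bc_form_add: "Bc_form F \<Longrightarrow> \<phi> \<in> space_B \<Longrightarrow> \<psi> \<in> space_B \<Longrightarrow> F (\<lambda>x. \<phi> x + \<psi> x) = F \<phi> + F \<psi>"
  and Bc_form_cmult: "Bc_form F \<Longrightarrow> \<phi> \<in> space_B \<Longrightarrow> F (\<lambda>x. c * \<phi> x) = c * F \<phi>"
  and Bc_form_null: "Bc_form F \<Longrightarrow> B_null \<Phi> \<Longrightarrow> (\<lambda>j. F (\<Phi> j)) \<longlonglongrightarrow> 0"
  unfolding Bc_form_def by blast+

lemma Bc_form_diff:
  assumes "Bc_form F" "\<phi> \<in> space_B" "\<psi> \<in> space_B"
  shows "F (\<lambda>x. \<phi> x - \<psi> x) = F \<phi> - F \<psi>"
  using Bc_form_add[OF assms(1,2) space_B_cmult[OF assms(3), of "-1"]] Bc_form_cmult[OF assms(1,3), of "-1"]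
  by simp

lemma Bc_form_zero: "Bc_form F \<Longrightarrow> F (\<lambda>x. 0) = 0"
  using Bc_form_cmult[of F "\<lambda>x. 0" 0] space_B_const[of 0] by simp

lemma Bc_form_sum:
  assumes "Bc_form F" "finite J" "\<And>j. j \<in> J \<Longrightarrow> \<phi> j \<in> space_B"
  shows "F (\<lambda>x. \<Sum>j\<in>J. c j * \<phi> j x) = (\<Sum>j\<in>J. c j * F (\<phi> j))"
  using assms(2,3)
proof (induction J)
  case (insert j J)
  then show ?case
    by (simp add: Bc_form_add[OF assms(1)] space_B_cmult space_B_sum Bc_form_cmult[OF assms(1)])
qed (simp add: Bc_form_zero assms(1))

text \<open>
  If no constant worked, there would be functions in the family which, after division by their values
  under \<open>F\<close>, are dominated by \<open>1 / (k + 1)\<close> for \<open>k = 0, 1,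
  \<dots>\<close>. They would form a null sequence on which \<open>F\<close> is constantly 1.
\<close>

lemma Bc_form_bound:
  assumes F: "Bc_form F" and dom: "dominated I (\<lambda>i x. W i) \<Phi>"
  shows "\<exists>C\<ge>0. \<forall>i\<in>I. norm (F (\<Phi> i)) \<le> C * W i"
proof -
  have "\<exists>k::nat. \<forall>i\<in>I. norm (F (\<Phi> i)) \<le> real (Suc k) * W i"
  proof (rule ccontr)
    assume "\<not> ?thesis"
    then obtain i where i: "\<And>k. i k \<in> I" "\<And>k. norm (F (\<Phi> (i k))) > real (Suc k) * W (i k)"
      by (metis not_le)
    have W: "W (i k) \<ge> 0" for k using dominated_nonneg[OF dom i(1)[of k]] by auto
    have nz: "norm (F (\<Phi> (i k))) > 0" for k
      using i(2)[of k] W[of k] by (smt (verit) mult_nonneg_nonneg of_nat_0_le_iff)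
    define \<Psi> where "\<Psi> k x = inverse (F (\<Phi> (i k))) * \<Phi> (i k) x" for k x
    have d: "dominated UNIV (\<lambda>k x. norm (inverse (F (\<Phi> (i k)))) * W (i k)) \<Psi>"
      unfolding \<Psi>_def by (intro dominated_scale dominated_reindex[OF dom] i)
    have le: "norm (inverse (F (\<Phi> (i k)))) * W (i k) \<le> inverse (real (Suc k))" for k
    proof -
      have "W (i k) * real (Suc k) \<le> norm (F (\<Phi> (i k)))" using i(2)[of k] by (simp add: mult.commute)
      then have "W (i k) / norm (F (\<Phi> (i k))) \<le> 1 / real (Suc k)"
        using nz[of k] by (subst frac_le_eq) (auto simp: divide_simps mult.commute)
      then show ?thesis by (simp add: norm_inverse divide_inverse mult.commute)
    qed
    have "dominated UNIV (\<lambda>k x. inverse (real (Suc k)) * 1) \<Psi>"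
      by (rule dominated_mono[OF d, of 1]) (use le in auto)
    moreover have "dominated UNIV (\<lambda>k x. 1) \<Psi>"
    proof (rule dominated_mono[OF d, of 1])
      show "norm (inverse (F (\<Phi> (i k)))) * W (i k) \<le> 1 * 1" for k
        using le[of k] by (rule order_trans) (simp add: field_simps)
    qed auto
    ultimately have "B_null \<Psi>"
      by (intro B_nullI[OF _ _ LIMSEQ_inverse_real_of_nat, where W = "\<lambda>_. 1"]) (auto intro: exI[of _ 1])
    from Bc_form_null[OF F this] have "(\<lambda>k. F (\<Psi> k)) \<longlonglongrightarrow> 0" .
    moreover have "F (\<Psi> k) = 1" for k
      using Bc_form_cmult[OF F dominated_in_B[OF dom i(1)], of "inverse (F (\<Phi> (i k)))" k] nz[of k]
      by (simp add: \<Psi>_def[abs_def])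
    ultimately show False by (simp add: LIMSEQ_const_iff)
  qed
  then show ?thesis by (metis of_nat_0_le_iff)
qed

section \<open>Topologies generated by seminorms\<close>

definition seminorm_ball ::
    "(('a \<Rightarrow> complex) \<Rightarrow> real) set \<Rightarrow> ('a \<Rightarrow> complex) \<Rightarrow> real \<Rightarrow> ('a \<Rightarrow> complex) set" where
  "seminorm_ball Q \<phi> r = {\<psi>. \<forall>p\<in>Q. p (\<lambda>x. \<psi> x - \<phi> x) < r}"

lemma in_seminorm_ball: "\<psi> \<in> seminorm_ball Q \<phi> r \<longleftrightarrow> (\<forall>p\<in>Q. p (\<lambda>x. \<psi> x - \<phi> x) < r)"
  by (simp add: seminorm_ball_def)

locale seminormed =
  fixes V :: "('a \<Rightarrow> complex) set" and P :: "(('a \<Rightarrow> complex) \<Rightarrow> real) set"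
  assumes add: "\<phi> \<in> V \<Longrightarrow> \<psi> \<in> V \<Longrightarrow> (\<lambda>x. \<phi> x + \<psi> x) \<in> V"
    and cmult: "\<phi> \<in> V \<Longrightarrow> (\<lambda>x. c * \<phi> x) \<in> V"
    and nonempty: "V \<noteq> {}" "P \<noteq> {}"
    and seminorms: "p \<in> P \<Longrightarrow> seminorm_on V p"
begin

lemma diff: "\<phi> \<in> V \<Longrightarrow> \<psi> \<in> V \<Longrightarrow> (\<lambda>x. \<phi> x - \<psi> x) \<in> V"
  using add[of \<phi> "\<lambda>x. -1 * \<psi> x"] cmult[of \<psi> "-1"] by simp

lemma zero: "(\<lambda>x. 0) \<in> V"
  using cmult[of _ 0] nonempty by auto

lemma seminorm_nonneg: "p \<in> P \<Longrightarrow> \<phi> \<in> V \<Longrightarrow> 0 \<le> p \<phi>"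
  and seminorm_add: "p \<in> P \<Longrightarrow> \<phi> \<in> V \<Longrightarrow> \<psi> \<in> V \<Longrightarrow> p (\<lambda>x. \<phi> x + \<psi> x) \<le> p \<phi> + p \<psi>"
  and seminorm_cmult: "p \<in> P \<Longrightarrow> \<phi> \<in> V \<Longrightarrow> p (\<lambda>x. c * \<phi> x) = norm c * p \<phi>"
  using seminorms unfolding seminorm_on_def by blast+

lemma seminorm_zero: "p \<in> P \<Longrightarrow> p (\<lambda>x. 0) = 0"
  using seminorm_cmult[of p "\<lambda>x. 0" 0] zero by simp

lemma seminorm_ball_center:
  assumes "Q \<subseteq> P" "0 < r"
  shows "\<phi> \<in> seminorm_ball Q \<phi> r"
  unfolding in_seminorm_ball
proof
  fix p assume "p \<in> Q"
  then have "p \<in> P" using assms(1) by blast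
  then have "p (\<lambda>x. 0) = 0" by (rule seminorm_zero)
  then show "p (\<lambda>x. \<phi> x - \<phi> x) < r" using assms(2) by simp
qed

lemma seminorm_diff_triangle:
  assumes "p \<in> P" "\<phi> \<in> V" "\<psi> \<in> V" "\<theta> \<in> V"
  shows "p (\<lambda>x. \<phi> x - \<theta> x) \<le> p (\<lambda>x. \<phi> x - \<psi> x) + p (\<lambda>x. \<psi> x - \<theta> x)"
  using seminorm_add[OF assms(1) diff[OF assms(2,3)] diff[OF assms(3,4)]] by simp

abbreviation T :: "('a \<Rightarrow> complex) topology" where "T \<equiv> seminorm_topology V P"

text \<open>
  Neighbourhoods relative to a subset \<open>A\<close>. The definition of \<open>\<B>\<^sub>c\<close>
  compares topologies on bounded sets, and this notion allows the comparison to be made seminorm by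
  seminorm.
\<close>

definition nbhd_in :: "('a \<Rightarrow> complex) set \<Rightarrow> ('a \<Rightarrow> complex) \<Rightarrow> ('a \<Rightarrow> complex) set \<Rightarrow> bool" where
  "nbhd_in A \<phi> S \<longleftrightarrow> (\<exists>Q \<delta>. finite Q \<and> Q \<subseteq> P \<and> 0 < \<delta> \<and> A \<inter> seminorm_ball Q \<phi> \<delta> \<subseteq> S)"

lemma nbhd_inI:
  "finite Q \<Longrightarrow> Q \<subseteq> P \<Longrightarrow> 0 < \<delta> \<Longrightarrow> A \<inter> seminorm_ball Q \<phi> \<delta> \<subseteq> S \<Longrightarrow> nbhd_in A \<phi> S"
  unfolding nbhd_in_def by blast

lemma nbhd_in_mono: "nbhd_in A \<phi> S \<Longrightarrow> S \<inter> A' \<subseteq> S' \<Longrightarrow> A' \<subseteq> A \<Longrightarrow> nbhd_in A' \<phi> S'"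
  unfolding nbhd_in_def by blast

lemma nbhd_in_Int:
  assumes "nbhd_in A \<phi> S" "nbhd_in A \<phi> S'"
  shows "nbhd_in A \<phi> (S \<inter> S')"
proof -
  obtain Q \<delta> Q' \<delta>' where *: "finite Q" "Q \<subseteq> P" "0 < \<delta>" "finite Q'" "Q' \<subseteq> P" "0 < \<delta>'"
    "A \<inter> seminorm_ball Q \<phi> \<delta> \<subseteq> S" "A \<inter> seminorm_ball Q' \<phi> \<delta>' \<subseteq> S'"
    using assms unfolding nbhd_in_def by blast
  have "seminorm_ball (Q \<union> Q') \<phi> (min \<delta> \<delta>') \<subseteq> seminorm_ball Q \<phi> \<delta> \<inter> seminorm_ball Q' \<phi> \<delta>'"
    by (auto simp: in_seminorm_ball)
  then show ?thesis
    by (intro nbhd_inI[of "Q \<union> Q'" "min \<delta> \<delta>'"]) (use * in auto)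
qed

text \<open>
  The sets that generate the topology are balls around arbitrary centres; the triangle inequality moves
  the centre to the given point.
\<close>

lemma openin_imp_nbhd_in:
  assumes "openin T U" "\<phi> \<in> U"
  shows "U \<subseteq> V \<and> nbhd_in V \<phi> U"
proof -
  have "generate_topology_on {{\<psi> \<in> V. p (\<lambda>x. \<psi> x - \<phi> x) < r} | p \<phi> r. p \<in> P \<and> \<phi> \<in> V \<and> 0 < r} U"
    using assms(1) unfolding seminorm_topology_def by (rule openin_topology_generated_by)
  then show ?thesis using assms(2)
  proof (induction arbitrary: \<phi>)
    case (Int a b)
    then have "a \<subseteq> V \<and> nbhd_in V \<phi> a" "b \<subseteq> V \<and> nbhd_in V \<phi> b" by auto
    then show ?case using nbhd_in_Int by blast
  next
    case (UN K)
    then obtain k where k: "k \<in> K" "\<phi> \<in> k" by blast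
    have "nbhd_in V \<phi> k" using UN.IH[OF k] by simp
    from nbhd_in_mono[OF this, of V "\<Union>K"] have "nbhd_in V \<phi> (\<Union>K)" using k by auto
    moreover have "\<Union>K \<subseteq> V" using UN.IH by blast
    ultimately show ?case by blast
  next
    case (Basis s)
    then obtain p \<theta> r where s: "s = {\<psi> \<in> V. p (\<lambda>x. \<psi> x - \<theta> x) < r}" and p: "p \<in> P" "\<theta> \<in> V" "0 < r" by blast
    have \<phi>: "\<phi> \<in> V" "p (\<lambda>x. \<phi> x - \<theta> x) < r" using Basis s by auto
    have "nbhd_in V \<phi> s"
    proof (rule nbhd_inI[of "{p}" "r - p (\<lambda>x. \<phi> x - \<theta> x)"])
      show "V \<inter> seminorm_ball {p} \<phi> (r - p (\<lambda>x. \<phi> x - \<theta> x)) \<subseteq> s"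
      proof
      fix \<psi> assume "\<psi> \<in> V \<inter> seminorm_ball {p} \<phi> (r - p (\<lambda>x. \<phi> x - \<theta> x))"
      then have \<psi>: "\<psi> \<in> V" and "p (\<lambda>x. \<psi> x - \<phi> x) < r - p (\<lambda>x. \<phi> x - \<theta> x)"
        by (auto simp: in_seminorm_ball)
      then show "\<psi> \<in> s"
        using seminorm_diff_triangle[OF p(1) \<psi> \<phi>(1) p(2)] \<psi> by (simp add: s)
      qed
    qed (use p \<phi> in auto)
    then show ?case using s by blast
  qed auto
qed

lemma openin_seminorm_ball:
  assumes "finite Q" "Q \<subseteq> P" "Q \<noteq> {}" "0 < r" "\<phi> \<in> V"
  shows "openin T (V \<inter> seminorm_ball Q \<phi> r)"
proof -
  have "openin T (\<Inter>p\<in>Q. {\<psi> \<in> V. p (\<lambda>x. \<psi> x - \<phi> x) < r})"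
    unfolding seminorm_topology_def
  proof (rule openin_Inter)
    fix X assume "X \<in> (\<lambda>p. {\<psi> \<in> V. p (\<lambda>x. \<psi> x - \<phi> x) < r}) ` Q"
    then obtain p where "p \<in> Q" "X = {\<psi> \<in> V. p (\<lambda>x. \<psi> x - \<phi> x) < r}" by blast
    then show "openin (topology_generated_by
        {{\<psi> \<in> V. p (\<lambda>x. \<psi> x - \<phi> x) < r} | p \<phi> r. p \<in> P \<and> \<phi> \<in> V \<and> 0 < r}) X"
      using assms by (intro topology_generated_by_Basis) blast
  qed (use assms in auto)
  also have "(\<Inter>p\<in>Q. {\<psi> \<in> V. p (\<lambda>x. \<psi> x - \<phi> x) < r}) = V \<inter> seminorm_ball Q \<phi> r"
    using assms(3) by (auto simp: in_seminorm_ball)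
  finally show ?thesis .
qed

lemma openin_subtopology_iff:
  assumes "A \<subseteq> V"
  shows "openin (subtopology T A) S \<longleftrightarrow> S \<subseteq> A \<and> (\<forall>\<phi>\<in>S. nbhd_in A \<phi> S)"
proof
  assume "openin (subtopology T A) S"
  then obtain U where U: "openin T U" "S = U \<inter> A" by (auto simp: openin_subtopology)
  have "nbhd_in A \<phi> S" if "\<phi> \<in> S" for \<phi>
  proof -
    have "nbhd_in V \<phi> U" using openin_imp_nbhd_in[OF U(1)] that U(2) by blast
    from nbhd_in_mono[OF this, of A S] show ?thesis using assms U(2) by simp
  qed
  then show "S \<subseteq> A \<and> (\<forall>\<phi>\<in>S. nbhd_in A \<phi> S)" using U(2) by blast
next
  assume S: "S \<subseteq> A \<and> (\<forall>\<phi>\<in>S. nbhd_in A \<phi> S)"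
  obtain p0 where p0: "p0 \<in> P" using nonempty by blast
  have "\<exists>U. openin T U \<and> \<phi> \<in> U \<and> U \<inter> A \<subseteq> S" if \<phi>: "\<phi> \<in> S" for \<phi>
  proof -
    obtain Q \<delta> where Q: "finite Q" "Q \<subseteq> P" "0 < \<delta>"
      "A \<inter> seminorm_ball Q \<phi> \<delta> \<subseteq> S"
      using S \<phi> unfolding nbhd_in_def by blast
    let ?U = "V \<inter> seminorm_ball (insert p0 Q) \<phi> \<delta>"
    have "openin T ?U" by (rule openin_seminorm_ball) (use Q p0 \<phi> S assms in auto)
    moreover have "\<phi> \<in> ?U" using \<phi> S assms Q p0 seminorm_ball_center[of "insert p0 Q" \<delta> \<phi>] by auto
    moreover have "?U \<inter> A \<subseteq> S" using Q(4) by (auto simp: in_seminorm_ball)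
    ultimately show ?thesis by blast
  qed
  then have *: "\<forall>\<phi>\<in>S. \<exists>U. openin T U \<and> \<phi> \<in> U \<and> U \<inter> A \<subseteq> S" by (rule ballI)
  define W where "W = \<Union>{U. openin T U \<and> U \<inter> A \<subseteq> S}"
  have "S \<subseteq> W"
  proof
    fix \<phi> assume "\<phi> \<in> S"
    from bspec[OF * this] show "\<phi> \<in> W" unfolding W_def by (elim exE) (rule UnionI, auto)
  qed
  moreover have "W \<inter> A \<subseteq> S" unfolding W_def by auto
  moreover have "openin T W" unfolding W_def by (rule openin_Union) simp
  ultimately show "openin (subtopology T A) S" unfolding openin_subtopology using S by (intro exI[of _ W]) auto
qed

lemma topspace_T: "topspace T = V"
proof
  show "topspace T \<subseteq> V"
    using openin_imp_nbhd_in[OF openin_topspace] by blast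
  obtain p0 where p0: "p0 \<in> P" using nonempty by blast
  show "V \<subseteq> topspace T"
  proof
    fix \<phi> assume \<phi>: "\<phi> \<in> V"
    have "openin T (V \<inter> seminorm_ball {p0} \<phi> 1)"
      by (rule openin_seminorm_ball) (use p0 \<phi> in auto)
    moreover have "\<phi> \<in> V \<inter> seminorm_ball {p0} \<phi> 1"
      using \<phi> p0 seminorm_ball_center[of "{p0}" 1 \<phi>] by auto
    ultimately show "\<phi> \<in> topspace T"
      using openin_subset by blast
  qed
qed

lemma openin_iff: "openin T S \<longleftrightarrow> S \<subseteq> V \<and> (\<forall>\<phi>\<in>S. nbhd_in V \<phi> S)"
  using openin_subtopology_iff[of V S] by (simp add: subtopology_superset topspace_T)

text \<open>
  A continuous form is bounded by 1 on a ball of finitely many seminorms, and by homogeneity the bound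
  extends to the whole space.
\<close>

lemma dual_bound:
  assumes "u \<in> dual V P"
  shows "\<exists>Q C. finite Q \<and> Q \<subseteq> P \<and> 0 \<le> C \<and> (\<forall>\<phi>\<in>V. norm (u \<phi>) \<le> C * (\<Sum>p\<in>Q. p \<phi>))"
proof -
  have u: "u (\<lambda>x. c * \<phi> x) = c * u \<phi>" if "\<phi> \<in> V" for c \<phi>
    using assms that unfolding dual_def by blast
  have "continuous_map T euclidean u" using assms by (simp add: dual_def)
  then have "openin T {\<phi> \<in> topspace T. u \<phi> \<in> ball 0 1}"
    by (rule openin_continuous_map_preimage) auto
  then have "openin T {\<phi> \<in> V. u \<phi> \<in> ball 0 1}" by (simp add: topspace_T)
  moreover have "(\<lambda>x. 0) \<in> {\<phi> \<in> V. u \<phi> \<in> ball 0 1}"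
    using zero u[OF zero, of 0] by simp
  ultimately have "nbhd_in V (\<lambda>x. 0) {\<phi> \<in> V. u \<phi> \<in> ball 0 1}"
    using openin_iff by blast
  then obtain Q \<delta> where Q: "finite Q" "Q \<subseteq> P" "0 < \<delta>"
    and sub: "V \<inter> seminorm_ball Q (\<lambda>x. 0) \<delta> \<subseteq> {\<phi> \<in> V. u \<phi> \<in> ball 0 1}"
    unfolding nbhd_in_def by blast
  have Q4: "norm (u \<psi>) < 1" if "\<psi> \<in> V" "\<And>p. p \<in> Q \<Longrightarrow> p \<psi> < \<delta>" for \<psi>
    using subsetD[OF sub, of \<psi>] that by (auto simp: in_seminorm_ball)
  have "norm (u \<phi>) \<le> (1 / \<delta>) * (\<Sum>p\<in>Q. p \<phi>)" if \<phi>: "\<phi> \<in> V" for \<phi>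
  proof (rule dense_ge)
    fix r assume r: "(1 / \<delta>) * (\<Sum>p\<in>Q. p \<phi>) < r"
    have nn: "0 \<le> (\<Sum>p\<in>Q. p \<phi>)" using Q(2) \<phi> by (intro sum_nonneg seminorm_nonneg) auto
    then have "0 \<le> (1 / \<delta>) * (\<Sum>p\<in>Q. p \<phi>)" using Q(3) by simp
    with r have r0: "r > 0" by linarith
    have "p (\<lambda>x. complex_of_real (1 / r) * \<phi> x) < \<delta>" if p: "p \<in> Q" for p
    proof -
      have "p \<phi> \<le> (\<Sum>p\<in>Q. p \<phi>)"
        using p Q \<phi> by (intro member_le_sum) (auto intro: seminorm_nonneg)
      also have "\<dots> < r * \<delta>" using r Q(3) by (simp add: field_simps)
      finally show ?thesis
        using seminorm_cmult[OF subsetD[OF Q(2) p] \<phi>, of "complex_of_real (1 / r)"] r0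
        by (simp only: norm_of_real) (simp add: divide_less_eq mult.commute)
    qed
    then have "norm (u (\<lambda>x. complex_of_real (1 / r) * \<phi> x)) < 1"
      by (intro Q4 cmult[OF \<phi>])
    then show "norm (u \<phi>) \<le> r"
      unfolding u[OF \<phi>] norm_mult norm_of_real using r0 by (simp add: field_simps)
  qed
  then show ?thesis using Q by (intro exI[of _ Q] exI[of _ "1 / \<delta>"]) auto
qed

lemma dualI:
  assumes lin: "\<And>\<phi> \<psi>. \<phi> \<in> V \<Longrightarrow> \<psi> \<in> V \<Longrightarrow> u (\<lambda>x. \<phi> x + \<psi> x) = u \<phi> + u \<psi>"
    "\<And>\<phi> c. \<phi> \<in> V \<Longrightarrow> u (\<lambda>x. c * \<phi> x) = c * u \<phi>"
    and bound: "p0 \<in> P" "\<And>\<phi>. \<phi> \<in> V \<Longrightarrow> norm (u \<phi>) \<le> C * p0 \<phi>"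
  shows "u \<in> dual V P"
proof -
  have "openin T {\<phi> \<in> V. u \<phi> \<in> W}" if W: "open W" for W
    unfolding openin_iff
  proof (intro conjI ballI)
    fix \<phi> assume "\<phi> \<in> {\<phi> \<in> V. u \<phi> \<in> W}"
    then have \<phi>: "\<phi> \<in> V" "u \<phi> \<in> W" by auto
    then obtain e where e: "e > 0" "ball (u \<phi>) e \<subseteq> W" using W open_contains_ball by blast
    show "nbhd_in V \<phi> {\<phi> \<in> V. u \<phi> \<in> W}"
    proof (rule nbhd_inI[of "{p0}" "e / (\<bar>C\<bar> + 1)"])
      show "V \<inter> seminorm_ball {p0} \<phi> (e / (\<bar>C\<bar> + 1)) \<subseteq> {\<phi> \<in> V. u \<phi> \<in> W}"
      proof
      fix \<psi> assume "\<psi> \<in> V \<inter> seminorm_ball {p0} \<phi> (e / (\<bar>C\<bar> + 1))"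
      then have \<psi>: "\<psi> \<in> V" and *: "p0 (\<lambda>x. \<psi> x - \<phi> x) < e / (\<bar>C\<bar> + 1)"
        by (auto simp: in_seminorm_ball)
      have "u (\<lambda>x. \<psi> x - \<phi> x) = u \<psi> - u \<phi>"
        using lin(1)[OF \<psi> cmult[OF \<phi>(1), of "-1"]] lin(2)[OF \<phi>(1), of "-1"] by simp
      then have "norm (u \<psi> - u \<phi>) \<le> C * p0 (\<lambda>x. \<psi> x - \<phi> x)"
        using bound(2)[OF diff[OF \<psi> \<phi>(1)]] by simp
      also have "\<dots> \<le> (\<bar>C\<bar> + 1) * p0 (\<lambda>x. \<psi> x - \<phi> x)"
        using seminorm_nonneg[OF bound(1) diff[OF \<psi> \<phi>(1)]] by (intro mult_right_mono) auto
      also have "\<dots> < e" using * by (simp add: field_simps add_nonneg_pos)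
      finally show "\<psi> \<in> {\<phi> \<in> V. u \<phi> \<in> W}" using e(2) \<psi> by (auto simp: dist_norm norm_minus_commute)
      qed
    qed (use bound(1) e in auto)
  qed auto
  then have "continuous_map T euclidean u"
    by (auto simp: continuous_map_def topspace_T)
  then show ?thesis using lin by (simp add: dual_def)
qed

end

lemma seminorm_on_SUP:
  assumes "\<And>\<phi>. \<phi> \<in> V \<Longrightarrow> smooth \<phi>" "vs \<in> lists Basis" "K \<noteq> {}" "\<And>x. 0 \<le> g x"
    and bdd: "\<And>\<phi>. \<phi> \<in> V \<Longrightarrow> bdd_above ((\<lambda>x. g x * norm (iter_pd vs \<phi> x)) ` K)"
  shows "seminorm_on V (\<lambda>\<phi>. SUP x\<in>K. g x * norm (iter_pd vs \<phi> x))"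
  unfolding seminorm_on_def
proof (intro conjI ballI allI)
  note up = cSUP_upper[OF _ bdd]
  obtain x0 where x0: "x0 \<in> K" using assms(3) by blast
  fix \<phi> assume \<phi>: "\<phi> \<in> V"
  show nn: "0 \<le> (SUP x\<in>K. g x * norm (iter_pd vs \<phi> x))"
    using up[OF x0 \<phi>] assms(4)[of x0] by (smt (verit) mult_nonneg_nonneg norm_ge_zero)
  show "(SUP x\<in>K. g x * norm (iter_pd vs (\<lambda>x. \<phi> x + \<psi> x) x)) \<le>
      (SUP x\<in>K. g x * norm (iter_pd vs \<phi> x)) + (SUP x\<in>K. g x * norm (iter_pd vs \<psi> x))" if \<psi>: "\<psi> \<in> V" for \<psi>
  proof (rule cSUP_least[OF assms(3)])
    fix x assume x: "x \<in> K"
    have "g x * norm (iter_pd vs (\<lambda>x. \<phi> x + \<psi> x) x) \<le> g x * norm (iter_pd vs \<phi> x) + g x * norm (iter_pd vs \<psi> x)"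
      using mult_left_mono[OF norm_triangle_ineq assms(4)]
      by (simp add: iter_pd_add assms \<phi> \<psi> distrib_left)
    then show "g x * norm (iter_pd vs (\<lambda>x. \<phi> x + \<psi> x) x) \<le>
      (SUP x\<in>K. g x * norm (iter_pd vs \<phi> x)) + (SUP x\<in>K. g x * norm (iter_pd vs \<psi> x))"
      using up[OF x \<phi>] up[OF x \<psi>] by linarith
  qed
  show "(SUP x\<in>K. g x * norm (iter_pd vs (\<lambda>x. c * \<phi> x) x)) = norm c * (SUP x\<in>K. g x * norm (iter_pd vs \<phi> x))" for c
  proof -
    have e: "g x * norm (iter_pd vs (\<lambda>x. c * \<phi> x) x) = norm c * (g x * norm (iter_pd vs \<phi> x))" for x
      by (simp add: iter_pd_cmult assms \<phi> norm_mult)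
    show ?thesis
      unfolding e
    proof (rule antisym)
      show le: "(SUP x\<in>K. norm c * (g x * norm (iter_pd vs \<phi> x))) \<le> norm c * (SUP x\<in>K. g x * norm (iter_pd vs \<phi> x))"
        by (rule cSUP_least[OF assms(3)]) (auto intro!: mult_left_mono up \<phi>)
      show "norm c * (SUP x\<in>K. g x * norm (iter_pd vs \<phi> x)) \<le> (SUP x\<in>K. norm c * (g x * norm (iter_pd vs \<phi> x)))"
      proof (cases "c = 0")
        case True
        then show ?thesis using assms(3) by simp
      next
        case False
        have "bdd_above ((\<lambda>x. norm c * (g x * norm (iter_pd vs \<phi> x))) ` K)"
          by (rule bdd_aboveI2[where M = "norm c * (SUP x\<in>K. g x * norm (iter_pd vs \<phi> x))"])
             (auto intro!: mult_left_mono up \<phi>)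
        then have "(SUP x\<in>K. g x * norm (iter_pd vs \<phi> x)) \<le> (SUP x\<in>K. norm c * (g x * norm (iter_pd vs \<phi> x))) / norm c"
          using False by (intro cSUP_least[OF assms(3)]) (auto simp: field_simps intro!: cSUP_upper2)
        then show ?thesis using False by (simp add: field_simps)
      qed
    qed
  qed
qed

lemma bdd_above_iter_pd_B:
  assumes "\<phi> \<in> space_B" "vs \<in> lists Basis"
  shows "bdd_above ((\<lambda>x. norm (iter_pd vs \<phi> x)) ` K)"
proof -
  have "bounded (range (iter_pd vs \<phi>))" using assms by (auto simp: space_B_def)
  then obtain C where "\<And>x. norm (iter_pd vs \<phi> x) \<le> C" by (auto simp: bounded_iff)
  then show ?thesis by (intro bdd_aboveI2[where M = C]) auto
qed

lemma seminorm_B: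
  assumes "vs \<in> lists Basis" "K \<noteq> {}" "V \<subseteq> space_B"
  shows "seminorm_on V (\<lambda>\<phi>. SUP x\<in>K. norm (iter_pd vs \<phi> x))"
proof -
  have "smooth \<phi>" "bdd_above ((\<lambda>x. 1 * norm (iter_pd vs \<phi> x)) ` K)" if "\<phi> \<in> V" for \<phi>
    using that assms(3) bdd_above_iter_pd_B[OF _ assms(1), of \<phi> K] space_B_smooth[of \<phi>] by auto
  then have "seminorm_on V (\<lambda>\<phi>. SUP x\<in>K. 1 * norm (iter_pd vs \<phi> x))"
    by (intro seminorm_on_SUP assms) auto
  then show ?thesis by simp
qed

lemma in_space_Bdot_iff: "\<phi> \<in> space_Bdot \<longleftrightarrow> \<phi> \<in> space_B \<and> (\<forall>vs\<in>lists Basis. (iter_pd vs \<phi> \<longlongrightarrow> 0) at_infinity)"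
  by (simp add: space_Bdot_def)

lemma Bdot_add: "\<phi> \<in> space_Bdot \<Longrightarrow> \<psi> \<in> space_Bdot \<Longrightarrow> (\<lambda>x. \<phi> x + \<psi> x) \<in> space_Bdot"
  unfolding in_space_Bdot_iff
  by (auto simp: space_B_add iter_pd_add space_B_smooth intro!: tendsto_add_zero)

lemma Bdot_cmult: "\<phi> \<in> space_Bdot \<Longrightarrow> (\<lambda>x. c * \<phi> x) \<in> space_Bdot"
  unfolding in_space_Bdot_iff
  by (auto simp: space_B_cmult iter_pd_cmult space_B_smooth intro!: tendsto_mult_right_zero)

lemma Bdot_zero: "(\<lambda>x. 0) \<in> space_Bdot"
  unfolding in_space_Bdot_iff
proof (intro conjI ballI)
  fix vs :: "(real^'a) list" assume "vs \<in> lists Basis"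
  then show "(iter_pd vs (\<lambda>x::real^'a. 0::complex) \<longlongrightarrow> 0) at_infinity"
    by (cases "vs = []") (auto simp: iter_pd_const)
qed (rule space_B_const)

lemma Bdot_sum:
  assumes "finite J" "\<And>j. j \<in> J \<Longrightarrow> \<phi> j \<in> space_Bdot"
  shows "(\<lambda>x. \<Sum>j\<in>J. \<phi> j x) \<in> space_Bdot"
  using assms by (induction J) (auto intro: Bdot_zero Bdot_add)

interpretation Bdot: seminormed "space_Bdot :: (real^'n \<Rightarrow> complex) set" B_seminorms
proof
  show "seminorm_on space_Bdot p" if "p \<in> B_seminorms" for p :: "(real^'n \<Rightarrow> complex) \<Rightarrow> real"
    using that seminorm_B[of _ UNIV space_Bdot] by (auto simp: B_seminorms_def space_Bdot_def)
qed (use Bdot_zero in \<open>auto simp: Bdot_add Bdot_cmult B_seminorms_def\<close>)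

lemma schwartz_zero: "(\<lambda>x. 0) \<in> schwartz"
  unfolding schwartz_iff
proof (intro allI dominatedI)
  fix t :: real and vs :: "(real^'a) list" assume "vs \<in> lists Basis"
  then show "\<exists>C. \<forall>i\<in>{()}. \<forall>x. norm (iter_pd vs (\<lambda>x::real^'a. 0::complex) x) \<le> C * wt t x"
    by (cases "vs = []") (auto simp: iter_pd_const intro: exI[of _ 0])
qed (auto simp: smooth_const wt_nonneg)

interpretation schwartz: seminormed "schwartz :: (real^'n \<Rightarrow> complex) set" schwartz_seminorms
proof
  fix p :: "(real^'n \<Rightarrow> complex) \<Rightarrow> real" assume "p \<in> schwartz_seminorms"
  then obtain k vs where p: "p = (\<lambda>\<phi>. SUP x. (1 + norm x) ^ k * norm (iter_pd vs \<phi> x))" and vs: "vs \<in> lists Basis"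
    by (auto simp: schwartz_seminorms_def)
  show "seminorm_on schwartz p"
    unfolding p
  proof (rule seminorm_on_SUP[OF _ vs])
    fix \<phi> :: "real^'n \<Rightarrow> complex" assume "\<phi> \<in> schwartz"
    then have "bounded (range (\<lambda>x. (1 + norm x) ^ k *\<^sub>R iter_pd vs \<phi> x))"
      using vs by (auto simp: schwartz_def)
    then obtain C where "\<And>x. norm ((1 + norm x) ^ k *\<^sub>R iter_pd vs \<phi> x) \<le> C" by (auto simp: bounded_iff)
    then show "bdd_above (range (\<lambda>x. (1 + norm x) ^ k * norm (iter_pd vs \<phi> x)))"
      by (intro bdd_aboveI2[where M = C]) simp
  qed (auto simp: schwartz_def)
qed (use schwartz_zero in \<open>auto simp: schwartz_add schwartz_cmult schwartz_seminorms_def\<close>)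

lemma Cinf_seminorm:
  assumes "p \<in> Cinf_seminorms"
  shows "seminorm_on space_B p"
  using assms seminorm_B[of _ _ space_B] by (auto simp: Cinf_seminorms_def)

lemma Cinf_seminorms_nonempty: "Cinf_seminorms \<noteq> {}"
proof -
  have "(\<lambda>\<phi>. SUP x\<in>{undefined}. norm (iter_pd [] \<phi> x)) \<in> Cinf_seminorms"
    unfolding Cinf_seminorms_def by (intro CollectI exI[of _ "{undefined}"] exI[of _ "[]"]) auto
  then show ?thesis by blast
qed

interpretation Cinf: seminormed "space_B :: (real^'n \<Rightarrow> complex) set" Cinf_seminorms
  by unfold_locales
    (use space_B_const[of 0] in \<open>auto simp: space_B_add space_B_cmult Cinf_seminorm Cinf_seminorms_nonempty\<close>)

lemma Cinf_subset_Bc: "Cinf_seminorms \<subseteq> Bc_seminorms"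
  unfolding Bc_seminorms_def using Cinf_seminorm by blast

interpretation Bc: seminormed "space_B :: (real^'n \<Rightarrow> complex) set" Bc_seminorms
  by unfold_locales
    (use space_B_const[of 0] Cinf_subset_Bc Cinf_seminorms_nonempty in
      \<open>auto simp: space_B_add space_B_cmult Bc_seminorms_def\<close>)

section \<open>Duals\<close>

text \<open>
  A criterion without derivatives, sufficient for distributions that are functions of polynomial growth.
\<close>

lemma temperedI:
  fixes u :: "(real^'n \<Rightarrow> complex) \<Rightarrow> complex"
  assumes "\<And>\<phi> \<psi>. \<phi> \<in> schwartz \<Longrightarrow> \<psi> \<in> schwartz \<Longrightarrow> u (\<lambda>x. \<phi> x + \<psi> x) = u \<phi> + u \<psi>"
    "\<And>\<phi> c. \<phi> \<in> schwartz \<Longrightarrow> u (\<lambda>x. c * \<phi> x) = c * u \<phi>"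
    and bound: "\<And>\<phi> K. \<phi> \<in> schwartz \<Longrightarrow> (\<And>x. (1 + norm x) ^ k * norm (\<phi> x) \<le> K) \<Longrightarrow> norm (u \<phi>) \<le> C * K"
  shows "u \<in> tempered"
  unfolding tempered_def
proof (rule schwartz.dualI[OF assms(1,2)])
  let ?p = "\<lambda>\<phi>::real^'n \<Rightarrow> complex. SUP x. (1 + norm x) ^ k * norm (iter_pd [] \<phi> x)"
  show "?p \<in> schwartz_seminorms" unfolding schwartz_seminorms_def by blast
  fix \<phi> :: "real^'n \<Rightarrow> complex" assume \<phi>: "\<phi> \<in> schwartz"
  have "bounded (range (\<lambda>x. (1 + norm x) ^ k *\<^sub>R iter_pd [] \<phi> x))"
    using \<phi> unfolding schwartz_def by blast
  then obtain D where D: "\<And>x. norm ((1 + norm x) ^ k *\<^sub>R \<phi> x) \<le> D" by (auto simp: bounded_iff)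
  then have "bdd_above (range (\<lambda>x. (1 + norm x) ^ k * norm (\<phi> x)))"
    by (intro bdd_aboveI2[where M = D]) simp
  then show "norm (u \<phi>) \<le> C * ?p \<phi>"
    by (intro bound[OF \<phi>]) (auto intro: cSUP_upper)
qed

lemma dual_BdotI:
  fixes u :: "(real^'n \<Rightarrow> complex) \<Rightarrow> complex"
  assumes "\<And>\<phi> \<psi>. \<phi> \<in> space_Bdot \<Longrightarrow> \<psi> \<in> space_Bdot \<Longrightarrow> u (\<lambda>x. \<phi> x + \<psi> x) = u \<phi> + u \<psi>"
    "\<And>\<phi> c. \<phi> \<in> space_Bdot \<Longrightarrow> u (\<lambda>x. c * \<phi> x) = c * u \<phi>"
    and bound: "\<And>\<phi> K. \<phi> \<in> space_Bdot \<Longrightarrow> (\<And>x. norm (\<phi> x) \<le> K) \<Longrightarrow> norm (u \<phi>) \<le> C * K"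
  shows "u \<in> dual space_Bdot B_seminorms"
proof (rule Bdot.dualI[OF assms(1,2)])
  let ?p = "\<lambda>\<phi>::real^'n \<Rightarrow> complex. SUP x. norm (iter_pd [] \<phi> x)"
  show "?p \<in> B_seminorms" unfolding B_seminorms_def by blast
  fix \<phi> :: "real^'n \<Rightarrow> complex" assume \<phi>: "\<phi> \<in> space_Bdot"
  then have "bdd_above (range (\<lambda>x. norm (\<phi> x)))"
    using bdd_above_iter_pd_B[of \<phi> "[]" UNIV] by (simp add: space_Bdot_def)
  then show "norm (u \<phi>) \<le> C * ?p \<phi>"
    by (intro bound[OF \<phi>]) (auto intro: cSUP_upper)
qed

text \<open>
  The finitely many seminorms are combined into a sum of derivatives at one point, as it is this sum that
  stays bounded when humps with different locations are added.
\<close>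

lemma dual_Bdot_bound:
  fixes u :: "(real^'n \<Rightarrow> complex) \<Rightarrow> complex"
  assumes "u \<in> dual space_Bdot B_seminorms"
  obtains L C where "finite L" "L \<subseteq> lists Basis" "0 \<le> C"
    "\<And>\<phi> K. \<phi> \<in> space_Bdot \<Longrightarrow> (\<And>x. (\<Sum>vs\<in>L. norm (iter_pd vs \<phi> x)) \<le> K) \<Longrightarrow> norm (u \<phi>) \<le> C * K"
proof -
  obtain Q C where Q: "finite Q" "Q \<subseteq> B_seminorms" "0 \<le> C"
    "\<And>\<phi>. \<phi> \<in> space_Bdot \<Longrightarrow> norm (u \<phi>) \<le> C * (\<Sum>p\<in>Q. p \<phi>)"
    using Bdot.dual_bound[OF assms] by blast
  define sup_norm where "sup_norm = (\<lambda>vs (\<phi> :: real^'n \<Rightarrow> complex). SUP x. norm (iter_pd vs \<phi> x))"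
  have "Q \<subseteq> sup_norm ` lists Basis"
    using Q(2) unfolding B_seminorms_def sup_norm_def by blast
  then obtain L where L: "finite L" "L \<subseteq> lists Basis" "Q = sup_norm ` L"
    using finite_subset_image[OF Q(1), of sup_norm "lists Basis"] by metis
  have "norm (u \<phi>) \<le> (C * card Q) * K"
    if \<phi>: "\<phi> \<in> space_Bdot" and K: "\<And>x. (\<Sum>vs\<in>L. norm (iter_pd vs \<phi> x)) \<le> K" for \<phi> K
  proof -
    have "p \<phi> \<le> K" if "p \<in> Q" for p
    proof -
      obtain vs where vs: "vs \<in> L" "p = sup_norm vs" using \<open>p \<in> Q\<close> L(3) by blast
      have "norm (iter_pd vs \<phi> x) \<le> K" for x
        using member_le_sum[OF vs(1) _ L(1), of "\<lambda>vs. norm (iter_pd vs \<phi> x)"] K[of x] by force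
      then show ?thesis unfolding vs(2) sup_norm_def by (intro cSUP_least) auto
    qed
    then have "(\<Sum>p\<in>Q. p \<phi>) \<le> card Q * K" by (rule sum_bounded_above)
    then show ?thesis
      using Q(4)[OF \<phi>] mult_left_mono[OF _ Q(3)] by (fastforce simp: mult.assoc)
  qed
  then show ?thesis using that[of L "C * card Q"] L Q(3) by auto
qed

text \<open>
  Sequential continuity is enough because \<open>C\<^sup>\<infinity>\<close> has a countable base of
  neighbourhoods of 0: the \<open>k\<close>-th one controls the derivatives up to order \<open>k\<close>
  on the ball of radius \<open>k\<close>.
\<close>

lemma Bc_form_Cinf_nbhd:
  fixes F :: "(real^'n \<Rightarrow> complex) \<Rightarrow> complex"
  assumes F: "Bc_form F" and A: "bounded_in_B A" and \<phi>: "\<phi> \<in> A" and "\<delta> > 0"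
  shows "Cinf.nbhd_in A \<phi> {\<psi>. norm (F (\<lambda>x. \<psi> x - \<phi> x)) < \<delta>}"
proof (rule ccontr)
  assume no: "\<not> ?thesis"
  define Q where "Q k = (\<lambda>vs \<phi>. SUP x\<in>cball (0::real^'n) (real k). norm (iter_pd vs \<phi> x)) `
     {vs. set vs \<subseteq> Basis \<and> length vs \<le> k}" for k
  have fin: "finite (Q k)" for k
    unfolding Q_def by (intro finite_imageI finite_lists_length_le) auto
  have sub: "Q k \<subseteq> Cinf_seminorms" for k
  proof
    fix p assume "p \<in> Q k"
    then obtain vs where "p = (\<lambda>\<phi>. SUP x\<in>cball (0::real^'n) (real k). norm (iter_pd vs \<phi> x))" "set vs \<subseteq> Basis"
      unfolding Q_def by blast
    then show "p \<in> Cinf_seminorms"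
      unfolding Cinf_seminorms_def by (intro CollectI exI[of _ "cball 0 (real k)"] exI[of _ vs]) auto
  qed
  have "\<exists>\<psi>. \<psi> \<in> A \<and> \<psi> \<in> seminorm_ball (Q k) \<phi> (inverse (real (Suc k))) \<and> \<not> norm (F (\<lambda>x. \<psi> x - \<phi> x)) < \<delta>" for k
  proof -
    have "\<not> A \<inter> seminorm_ball (Q k) \<phi> (inverse (real (Suc k))) \<subseteq> {\<psi>. norm (F (\<lambda>x. \<psi> x - \<phi> x)) < \<delta>}"
      using no fin[of k] sub[of k] unfolding Cinf.nbhd_in_def by auto
    then show ?thesis by auto
  qed
  then obtain \<psi> where "\<forall>k. \<psi> k \<in> A \<and> \<psi> k \<in> seminorm_ball (Q k) \<phi> (inverse (real (Suc k))) \<and> \<not> norm (F (\<lambda>x. \<psi> k x - \<phi> x)) < \<delta>"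
    by metis
  then have \<psi>: "\<And>k. \<psi> k \<in> A" "\<And>k p. p \<in> Q k \<Longrightarrow> p (\<lambda>x. \<psi> k x - \<phi> x) < inverse (real (Suc k))"
    "\<And>k. \<not> norm (F (\<lambda>x. \<psi> k x - \<phi> x)) < \<delta>" by (auto simp: in_seminorm_ball)
  have AB: "A \<subseteq> space_B" using A by (simp add: bounded_in_B_def)
  have domA: "dominated A (\<lambda>_ _. 1) (\<lambda>\<psi>. \<psi>)"
  proof (rule dominatedI)
    fix vs :: "(real^'n) list" assume "vs \<in> lists Basis"
    then show "\<exists>C. \<forall>i\<in>A. \<forall>x. norm (iter_pd vs i x) \<le> C * 1" using A by (auto simp: bounded_in_B_def)
  qed (use AB space_B_smooth in auto)
  have "B_null (\<lambda>k x. \<psi> k x - \<phi> x)"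
    unfolding B_null_def
  proof (intro conjI ballI allI impI)
    show "dominated UNIV (\<lambda>_ _. 1) (\<lambda>k x. \<psi> k x - \<phi> x)"
      by (intro dominated_diff dominated_reindex[OF domA, of UNIV \<psi>] dominated_reindex[OF domA, of UNIV "\<lambda>_. \<phi>"])
         (use \<psi> \<phi> in auto)
    fix vs :: "(real^'n) list" and R e :: real assume vs: "vs \<in> lists Basis" and e: "e > 0"
    obtain N1 :: nat where N1: "R \<le> real N1" using real_arch_simple by blast
    obtain N2 where N2: "inverse (real (Suc N2)) < e" using reals_Archimedean[OF e] by auto
    show "\<forall>\<^sub>F k in sequentially. \<forall>x\<in>cball 0 R. norm (iter_pd vs (\<lambda>x. \<psi> k x - \<phi> x) x) < e"
    proof (rule eventually_sequentiallyI[of "max (length vs) (max N1 N2)"], intro ballI)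
      fix k and x :: "real^'n" assume k: "max (length vs) (max N1 N2) \<le> k" and x: "x \<in> cball 0 R"
      have B: "(\<lambda>x. \<psi> k x - \<phi> x) \<in> space_B" using \<psi>(1) \<phi> AB by (auto intro!: space_B_diff)
      have "norm (iter_pd vs (\<lambda>x. \<psi> k x - \<phi> x) x) \<le> (SUP x\<in>cball 0 (real k). norm (iter_pd vs (\<lambda>x. \<psi> k x - \<phi> x) x))"
        using x k N1 by (intro cSUP_upper bdd_above_iter_pd_B B vs) auto
      also have "\<dots> < inverse (real (Suc k))"
        using \<psi>(2)[of "\<lambda>\<phi>. SUP x\<in>cball 0 (real k). norm (iter_pd vs \<phi> x)" k] k vs by (auto simp: Q_def)
      also have "\<dots> \<le> inverse (real (Suc N2))" using k by (intro le_imp_inverse_le) auto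
      finally show "norm (iter_pd vs (\<lambda>x. \<psi> k x - \<phi> x) x) < e" using N2 by linarith
    qed
  qed
  from Bc_form_null[OF F this] have "\<forall>\<^sub>F k in sequentially. norm (F (\<lambda>x. \<psi> k x - \<phi> x)) < \<delta>"
    using \<open>\<delta> > 0\<close> by (auto simp: tendsto_iff)
  then show False using \<psi>(3) by (auto simp: eventually_sequentially)
qed

text \<open>
  Adjoining the seminorm \<open>|F|\<close> to those of \<open>C\<^sup>\<infinity>\<close> leaves the
  induced topology on bounded sets unchanged, so this seminorm is among those that generate the topology
  of \<open>\<B>\<^sub>c\<close>.
\<close>

lemma Bc_form_imp_dual:
  fixes F :: "(real^'n \<Rightarrow> complex) \<Rightarrow> complex"
  assumes F: "Bc_form F"
  shows "F \<in> dual space_B Bc_seminorms"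
proof -
  define pF where "pF = (\<lambda>\<phi>. norm (F \<phi>))"
  define P where "P = insert pF Cinf_seminorms"
  have pF: "seminorm_on space_B pF"
    unfolding seminorm_on_def pF_def
    by (auto simp: Bc_form_add[OF F] Bc_form_cmult[OF F] norm_mult norm_triangle_ineq)
  interpret P: seminormed "space_B :: (real^'n \<Rightarrow> complex) set" P
    by unfold_locales
      (use space_B_const[of 0] pF in \<open>auto simp: space_B_add space_B_cmult Cinf_seminorm P_def\<close>)
  have "subtopology (seminorm_topology space_B P) A = subtopology (seminorm_topology space_B Cinf_seminorms) A"
    if A: "bounded_in_B A" for A
    unfolding topology_eq
  proof
    fix S
    have AB: "A \<subseteq> space_B" using A by (simp add: bounded_in_B_def)
    have "Cinf.nbhd_in A \<phi> S" if S: "S \<subseteq> A" "\<phi> \<in> S" and nb: "P.nbhd_in A \<phi> S" for \<phi>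
    proof -
      obtain Q \<delta> where Q: "finite Q" "Q \<subseteq> P" "0 < \<delta>" "A \<inter> seminorm_ball Q \<phi> \<delta> \<subseteq> S"
        using nb unfolding P.nbhd_in_def by blast
      have "Cinf.nbhd_in A \<phi> (A \<inter> seminorm_ball (Q \<inter> Cinf_seminorms) \<phi> \<delta>)"
        by (rule Cinf.nbhd_inI[of "Q \<inter> Cinf_seminorms" \<delta>]) (use Q in auto)
      moreover have "Cinf.nbhd_in A \<phi> {\<psi>. norm (F (\<lambda>x. \<psi> x - \<phi> x)) < \<delta>}"
        by (rule Bc_form_Cinf_nbhd[OF F A]) (use S Q in auto)
      ultimately have "Cinf.nbhd_in A \<phi> (A \<inter> seminorm_ball (Q \<inter> Cinf_seminorms) \<phi> \<delta> \<inter>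
          {\<psi>. norm (F (\<lambda>x. \<psi> x - \<phi> x)) < \<delta>})" (is "Cinf.nbhd_in A \<phi> ?U")
        by (rule Cinf.nbhd_in_Int)
      moreover have "?U \<subseteq> A \<inter> seminorm_ball Q \<phi> \<delta>"
      proof
        fix \<psi> assume \<psi>: "\<psi> \<in> ?U"
        have "p (\<lambda>x. \<psi> x - \<phi> x) < \<delta>" if "p \<in> Q" for p
        proof (cases "p = pF")
          case True
          then show ?thesis using \<psi> by (simp add: pF_def)
        next
          case False
          then have "p \<in> Q \<inter> Cinf_seminorms" using that Q(2) by (auto simp: P_def)
          then show ?thesis using \<psi> unfolding in_seminorm_ball Int_iff by blast
        qed
        then show "\<psi> \<in> A \<inter> seminorm_ball Q \<phi> \<delta>" using \<psi> by (auto simp: in_seminorm_ball)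
      qed
      ultimately show ?thesis using Q(4) by (intro Cinf.nbhd_in_mono[where S = ?U and A = A and A' = A and S' = S]) auto
    qed
    moreover have "P.nbhd_in A \<phi> S" if "Cinf.nbhd_in A \<phi> S" for \<phi>
      using that unfolding Cinf.nbhd_in_def P.nbhd_in_def using subset_insertI[of Cinf_seminorms pF] P_def by (metis subset_trans)
    ultimately show "openin (subtopology (seminorm_topology space_B P) A) S =
        openin (subtopology (seminorm_topology space_B Cinf_seminorms) A) S"
      unfolding P.openin_subtopology_iff[OF AB] Cinf.openin_subtopology_iff[OF AB] by blast
  qed
  then have "P \<subseteq> Bc_seminorms"
    unfolding Bc_seminorms_def using P.seminorms by blast
  then have "pF \<in> Bc_seminorms" by (auto simp: P_def)
  then show ?thesis
    by (intro Bc.dualI[where ?p0.0 = pF and C = 1])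
      (auto simp: Bc_form_add[OF F] Bc_form_cmult[OF F] pF_def)
qed

text \<open>
  A null sequence together with its limit is a bounded set; on it the seminorms of
  \<open>\<B>\<^sub>c\<close> are continuous with respect to \<open>C\<^sup>\<infinity>\<close>.
\<close>

lemma dual_imp_Bc_form:
  fixes v :: "(real^'n \<Rightarrow> complex) \<Rightarrow> complex"
  assumes v: "v \<in> dual space_B Bc_seminorms"
  shows "Bc_form v"
  unfolding Bc_form_def
proof (intro conjI allI impI)
  show "\<forall>\<phi>\<in>space_B. \<forall>\<psi>\<in>space_B. v (\<lambda>x. \<phi> x + \<psi> x) = v \<phi> + v \<psi>"
    and "\<forall>\<phi>\<in>space_B. \<forall>c. v (\<lambda>x. c * \<phi> x) = c * v \<phi>"
    using v by (simp_all add: dual_def)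
  fix \<Phi> :: "nat \<Rightarrow> real^'n \<Rightarrow> complex" assume null: "B_null \<Phi>"
  have dom: "dominated UNIV (\<lambda>_ _. 1) \<Phi>" using null by (simp add: B_null_def)
  then have \<Phi>B: "\<Phi> j \<in> space_B" for j by (rule dominated_in_B[of UNIV "\<lambda>_. 1"]) simp
  define A where "A = insert (\<lambda>x. 0) (range \<Phi>)"
  have AB: "A \<subseteq> space_B" using \<Phi>B space_B_const by (auto simp: A_def)
  have A: "bounded_in_B A"
    unfolding bounded_in_B_def
  proof (intro conjI AB ballI)
    fix vs :: "(real^'n) list" assume vs: "vs \<in> lists Basis"
    obtain C where C: "C \<ge> 0" "\<forall>j\<in>UNIV. \<forall>x. norm (iter_pd vs (\<Phi> j) x) \<le> C * 1"
      using dominatedD[OF dom vs] by blast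
    have "norm (iter_pd vs (\<lambda>x::real^'n. 0::complex) x) = 0" for x
      using vs by (cases "vs = []") (auto simp: iter_pd_const)
    then show "\<exists>C. \<forall>\<phi>\<in>A. \<forall>x. norm (iter_pd vs \<phi> x) \<le> C" using C by (auto simp: A_def)
  qed
  have Cinf0: "(\<lambda>j. q (\<Phi> j)) \<longlonglongrightarrow> 0" if q: "q \<in> Cinf_seminorms" for q
  proof (rule tendstoI)
    fix e :: real assume e: "e > 0"
    obtain K vs where K: "q = (\<lambda>\<phi>. SUP x\<in>K. norm (iter_pd vs \<phi> x))" "compact K" "K \<noteq> {}" "vs \<in> lists Basis"
      using q by (auto simp: Cinf_seminorms_def)
    obtain R where "\<forall>x\<in>K. norm x \<le> R" using compact_imp_bounded[OF K(2)] unfolding bounded_iff by blast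
    then have R: "K \<subseteq> cball 0 R" by auto
    have "\<forall>\<^sub>F j in sequentially. \<forall>x\<in>cball 0 R. norm (iter_pd vs (\<Phi> j) x) < e / 2"
      using null K(4) half_gt_zero[OF e] unfolding B_null_def by blast
    then show "\<forall>\<^sub>F j in sequentially. dist (q (\<Phi> j)) 0 < e"
    proof (rule eventually_mono)
      fix j assume *: "\<forall>x\<in>cball 0 R. norm (iter_pd vs (\<Phi> j) x) < e / 2"
      have "q (\<Phi> j) \<le> e / 2"
        unfolding K(1) using * R by (intro cSUP_least[OF K(3)]) (auto simp: less_imp_le)
      then show "dist (q (\<Phi> j)) 0 < e"
        using Cinf.seminorm_nonneg[OF q \<Phi>B[of j]] e by (simp add: dist_real_def)
    qed
  qed
  have Bc0: "(\<lambda>j. p (\<Phi> j)) \<longlonglongrightarrow> 0" if p: "p \<in> Bc_seminorms" for p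
  proof (rule tendstoI)
    fix e :: real assume e: "e > 0"
    obtain P where P: "p \<in> P" "\<And>p. p \<in> P \<Longrightarrow> seminorm_on space_B p"
      "subtopology (seminorm_topology space_B P) A = subtopology (seminorm_topology space_B Cinf_seminorms) A"
      using p A unfolding Bc_seminorms_def by blast
    interpret P: seminormed "space_B :: (real^'n \<Rightarrow> complex) set" P
      by unfold_locales (use space_B_const[of 0] P in \<open>auto simp: space_B_add space_B_cmult\<close>)
    let ?U = "space_B \<inter> seminorm_ball {p} (\<lambda>x. 0) e"
    have "openin (seminorm_topology space_B P) ?U"
      by (rule P.openin_seminorm_ball) (use P e space_B_const in auto)
    then have "openin (subtopology (seminorm_topology space_B Cinf_seminorms) A) (?U \<inter> A)"
      unfolding P(3)[symmetric] by (auto simp: openin_subtopology)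
    moreover have "(\<lambda>x. 0) \<in> ?U \<inter> A"
      using P.seminorm_zero[OF P(1)] e by (auto simp: A_def space_B_const in_seminorm_ball)
    ultimately have "Cinf.nbhd_in A (\<lambda>x. 0) (?U \<inter> A)"
      using Cinf.openin_subtopology_iff[OF AB] by blast
    then obtain Q \<delta> where Q: "finite Q" "Q \<subseteq> Cinf_seminorms" "0 < \<delta>"
      "A \<inter> seminorm_ball Q (\<lambda>x. 0) \<delta> \<subseteq> ?U \<inter> A"
      unfolding Cinf.nbhd_in_def by blast
    have "\<forall>\<^sub>F j in sequentially. \<forall>q\<in>Q. q (\<Phi> j) < \<delta>"
      using Q(1)
    proof (rule eventually_ball_finite, intro ballI)
      fix q assume "q \<in> Q"
      then have "q \<in> Cinf_seminorms" using Q(2) by blast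
      from order_tendstoD(2)[OF Cinf0[OF this] Q(3)] show "\<forall>\<^sub>F j in sequentially. q (\<Phi> j) < \<delta>" .
    qed
    then show "\<forall>\<^sub>F j in sequentially. dist (p (\<Phi> j)) 0 < e"
    proof (rule eventually_mono)
      fix j assume "\<forall>q\<in>Q. q (\<Phi> j) < \<delta>"
      then have "\<Phi> j \<in> A \<inter> seminorm_ball Q (\<lambda>x. 0) \<delta>" by (auto simp: A_def in_seminorm_ball)
      then have "p (\<Phi> j) < e" using Q(4) by (auto simp: in_seminorm_ball)
      then show "dist (p (\<Phi> j)) 0 < e"
        using P.seminorm_nonneg[OF P(1) \<Phi>B[of j]] by (simp add: dist_real_def)
    qed
  qed
  obtain Q C where Q: "finite Q" "Q \<subseteq> Bc_seminorms" "0 \<le> C"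
    "\<And>\<phi>. \<phi> \<in> space_B \<Longrightarrow> norm (v \<phi>) \<le> C * (\<Sum>p\<in>Q. p \<phi>)"
    using Bc.dual_bound[OF v] by blast
  have "(\<lambda>j. C * (\<Sum>p\<in>Q. p (\<Phi> j))) \<longlonglongrightarrow> C * (\<Sum>p\<in>Q. 0)"
    using Q(2) by (intro tendsto_intros Bc0) auto
  then have "(\<lambda>j. C * (\<Sum>p\<in>Q. p (\<Phi> j))) \<longlonglongrightarrow> 0" by simp
  then show "(\<lambda>j. v (\<Phi> j)) \<longlonglongrightarrow> 0"
    by (rule Lim_null_comparison[rotated]) (use Q(4)[OF \<Phi>B] in auto)
qed

section \<open>The Gaussian and cutoffs\<close>

inductive_set polynomials :: "('a::euclidean_space \<Rightarrow> real) set" where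
  "(\<lambda>x. c) \<in> polynomials"
| "(\<lambda>x. x \<bullet> b) \<in> polynomials"
| "p \<in> polynomials \<Longrightarrow> q \<in> polynomials \<Longrightarrow> (\<lambda>x. p x + q x) \<in> polynomials"
| "p \<in> polynomials \<Longrightarrow> q \<in> polynomials \<Longrightarrow> (\<lambda>x. p x * q x) \<in> polynomials"

lemma polynomials_derivative:
  assumes "p \<in> polynomials"
  shows "\<exists>D. (\<forall>b. D b \<in> polynomials) \<and> (\<forall>x. (p has_derivative (\<lambda>h. \<Sum>b\<in>Basis. (h \<bullet> b) * D b x)) (at x))"
  using assms
proof induction
  case (1 c)
  show ?case by (intro exI[of _ "\<lambda>b x. 0"]) (auto intro: polynomials.intros)
next
  case (2 c)
  have "((\<lambda>x. x \<bullet> c) has_derivative (\<lambda>h. \<Sum>b\<in>Basis. (h \<bullet> b) * (b \<bullet> c))) (at x)" for x :: 'a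
  proof -
    have "(\<lambda>h::'a. \<Sum>b\<in>Basis. (h \<bullet> b) * (b \<bullet> c)) = (\<lambda>h. h \<bullet> c)"
      by (subst euclidean_inner) (simp add: inner_commute)
    then show ?thesis by (auto intro!: derivative_eq_intros)
  qed
  then show ?case by (intro exI[of _ "\<lambda>b x. b \<bullet> c"]) (auto intro: polynomials.intros)
next
  case (3 p q)
  then obtain D E where "\<forall>b. D b \<in> polynomials" "\<forall>x. (p has_derivative (\<lambda>h. \<Sum>b\<in>Basis. (h \<bullet> b) * D b x)) (at x)"
    "\<forall>b. E b \<in> polynomials" "\<forall>x. (q has_derivative (\<lambda>h. \<Sum>b\<in>Basis. (h \<bullet> b) * E b x)) (at x)" by auto
  then show ?case
    by (intro exI[of _ "\<lambda>b x. D b x + E b x"])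
      (auto intro!: polynomials.intros derivative_eq_intros simp: distrib_left sum.distrib)
next
  case (4 p q)
  then obtain D E where "\<forall>b. D b \<in> polynomials" "\<forall>x. (p has_derivative (\<lambda>h. \<Sum>b\<in>Basis. (h \<bullet> b) * D b x)) (at x)"
    "\<forall>b. E b \<in> polynomials" "\<forall>x. (q has_derivative (\<lambda>h. \<Sum>b\<in>Basis. (h \<bullet> b) * E b x)) (at x)" by auto
  with 4 show ?case
    by (intro exI[of _ "\<lambda>b x. p x * E b x + D b x * q x"])
      (auto intro!: polynomials.intros derivative_eq_intros
        simp: distrib_left sum.distrib sum_distrib_left sum_distrib_right mult_ac)
qed

lemma polynomials_bound:
  assumes "p \<in> polynomials"
  shows "\<exists>C t. 0 \<le> C \<and> 0 \<le> t \<and> (\<forall>x. \<bar>p x\<bar> \<le> C * wt t x)"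
  using assms
proof induction
  case (1 c)
  show ?case by (intro exI[of _ "\<bar>c\<bar>"] exI[of _ 0]) (auto simp: wt_0)
next
  case (2 b)
  have "\<bar>x \<bullet> b\<bar> \<le> (2 * norm b) * wt (1/2) x" for x
  proof -
    have "norm x \<le> (1 + norm x) ^ 1" by simp
    also have "\<dots> \<le> 2 ^ 1 * wt (real 1 / 2) x" by (rule power_le_wt)
    finally have "norm x * norm b \<le> (2 * wt (1/2) x) * norm b" by (intro mult_right_mono) auto
    then show ?thesis using Cauchy_Schwarz_ineq2[of x b] by (simp add: mult_ac)
  qed
  then show ?case by (intro exI[of _ "2 * norm b"] exI[of _ "1/2"]) auto
next
  case (3 p q)
  then obtain C s D t where *: "0 \<le> C" "0 \<le> s" "\<forall>x. \<bar>p x\<bar> \<le> C * wt s x" "0 \<le> D" "0 \<le> t" "\<forall>x. \<bar>q x\<bar> \<le> D * wt t x" by auto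
  have "\<bar>p x + q x\<bar> \<le> (C + D) * wt (s + t) x" for x
  proof -
    have "C * wt s x \<le> C * wt (s + t) x" "D * wt t x \<le> D * wt (s + t) x"
      using * by (auto intro!: mult_left_mono wt_mono)
    then show ?thesis using *(3)[rule_format, of x] *(6)[rule_format, of x] by (simp add: distrib_right)
  qed
  then show ?case using * by (intro exI[of _ "C + D"] exI[of _ "s + t"]) auto
next
  case (4 p q)
  then obtain C s D t where *: "0 \<le> C" "0 \<le> s" "\<forall>x. \<bar>p x\<bar> \<le> C * wt s x" "0 \<le> D" "0 \<le> t" "\<forall>x. \<bar>q x\<bar> \<le> D * wt t x" by auto
  have "\<bar>p x * q x\<bar> \<le> (C * D) * wt (s + t) x" for x
    using mult_mono[OF *(3)[rule_format, of x] *(6)[rule_format, of x]] *(1)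
    by (simp add: abs_mult wt_nonneg mult_ac flip: wt_mult)
  then show ?case using * by (intro exI[of _ "C * D"] exI[of _ "s + t"]) auto
qed

definition gauss :: "'a::euclidean_space \<Rightarrow> complex" where
  "gauss x = complex_of_real (exp (- (norm x)\<^sup>2))"

text \<open>
  The bound is the \<open>N\<close>-th power of the inequality \<open>u / N \<le> exp (u / N)\<close> for
  \<open>u = 1 + |x|\<^sup>2\<close>.
\<close>

lemma exp_minus_norm_le_wt:
  obtains C where "0 \<le> C" "\<And>x. exp (- (norm x)\<^sup>2) \<le> C * wt (- t) x"
proof -
  obtain N :: nat where N: "t \<le> real N" "N > 0"
    using reals_Archimedean2[of "max t 0"] by (metis less_eq_real_def max_less_iff_conj of_nat_0_less_iff)
  have "exp (- (norm x)\<^sup>2) \<le> (real N ^ N * exp 1) * wt (- t) x" for x :: 'a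
  proof -
    define u where "u = 1 + (norm x)\<^sup>2"
    have u: "u \<ge> 1" by (simp add: u_def)
    have "u / real N \<le> exp (u / real N)" using exp_ge_add_one_self[of "u / real N"] by linarith
    then have "(u / real N) ^ N \<le> exp (u / real N) ^ N" using u by (intro power_mono) auto
    also have "\<dots> = exp u" using N by (simp flip: exp_of_nat_mult)
    finally have "u ^ N \<le> real N ^ N * exp u" using N by (simp add: power_divide field_simps)
    then have 1: "u ^ N * exp (- u) \<le> real N ^ N" by (simp add: exp_minus field_simps)
    have "wt t x \<le> u ^ N"
      using powr_mono[OF N(1) u] powr_realpow[OF less_le_trans[OF zero_less_one u], of N] by (simp add: wt_def u_def)
    then have "wt t x * exp (- u) \<le> u ^ N * exp (- u)" by (intro mult_right_mono) auto
    with 1 have "wt t x * exp (- u) \<le> real N ^ N" by linarith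
    then have "exp (- u) \<le> real N ^ N * wt (- t) x"
      using wt_pos[of t x] by (simp add: wt_minus field_simps)
    moreover have "exp (- (norm x)\<^sup>2) = exp 1 * exp (- u)" by (simp add: u_def flip: exp_add)
    ultimately show ?thesis by (simp add: mult_ac)
  qed
  then show ?thesis using that[of "real N ^ N * exp 1"] by auto
qed

text \<open>
  The products of polynomials with the Gaussian form a class that is closed under partial derivatives.
\<close>

lemma gauss_schwartz: "(gauss :: real^'n \<Rightarrow> complex) \<in> schwartz"
proof -
  define X where "X = {\<lambda>x. complex_of_real (p x * exp (- (norm x)\<^sup>2)) | p. p \<in> (polynomials :: (real^'n \<Rightarrow> real) set)}"
  have g: "gauss \<in> X"
    unfolding X_def gauss_def by (intro CollectI exI[of _ "\<lambda>x. 1"]) (auto intro: polynomials.intros)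
  have closed: "\<exists>G. (\<forall>x\<in>UNIV. has_partials g G x) \<and> (\<forall>b\<in>Basis. G b \<in> X)" if "g \<in> X" for g
  proof -
    obtain p where p: "p \<in> polynomials" "g = (\<lambda>x. complex_of_real (p x * exp (- (norm x)\<^sup>2)))"
      using \<open>g \<in> X\<close> by (auto simp: X_def)
    obtain D where D: "\<And>b. D b \<in> polynomials" "\<And>x. (p has_derivative (\<lambda>h. \<Sum>b\<in>Basis. (h \<bullet> b) * D b x)) (at x)"
      using polynomials_derivative[OF p(1)] by auto
    define G where "G b x = complex_of_real ((D b x + (- 2) * ((x \<bullet> b) * p x)) * exp (- (norm x)\<^sup>2))" for b x
    have "has_partials g G x" for x
    proof -
      have eq: "(\<lambda>h. \<Sum>b\<in>Basis. (h \<bullet> b) *\<^sub>R G b x) = (\<lambda>h. complex_of_real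
          (p x * (- (2 * (x \<bullet> h)) * exp (- (x \<bullet> x))) + (\<Sum>b\<in>Basis. (h \<bullet> b) * D b x) * exp (- (x \<bullet> x))))"
      proof (rule ext)
        fix h
        have "p x * (- (2 * (x \<bullet> h)) * exp (- (x \<bullet> x))) =
            (\<Sum>b\<in>Basis. (h \<bullet> b) * (- 2 * ((x \<bullet> b) * p x)) * exp (- (x \<bullet> x)))"
          by (subst euclidean_inner) (simp add: sum_distrib_left sum_distrib_right sum_negf mult_ac)
        moreover have "(\<Sum>b\<in>Basis. (h \<bullet> b) *\<^sub>R G b x) = complex_of_real
           (\<Sum>b\<in>Basis. (h \<bullet> b) * ((D b x + (- 2) * ((x \<bullet> b) * p x)) * exp (- (x \<bullet> x))))"
          by (simp add: G_def power2_norm_eq_inner scaleR_conv_of_real)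
        moreover have "(\<Sum>b\<in>Basis. (h \<bullet> b) * ((D b x + (- 2) * ((x \<bullet> b) * p x)) * exp (- (x \<bullet> x)))) =
           (\<Sum>b\<in>Basis. (h \<bullet> b) * (- 2 * ((x \<bullet> b) * p x)) * exp (- (x \<bullet> x))) + (\<Sum>b\<in>Basis. (h \<bullet> b) * D b x) * exp (- (x \<bullet> x))"
          unfolding sum_distrib_right sum.distrib[symmetric] by (intro sum.cong refl) (simp add: algebra_simps)
        ultimately show "(\<Sum>b\<in>Basis. (h \<bullet> b) *\<^sub>R G b x) = complex_of_real
          (p x * (- (2 * (x \<bullet> h)) * exp (- (x \<bullet> x))) + (\<Sum>b\<in>Basis. (h \<bullet> b) * D b x) * exp (- (x \<bullet> x)))" by (simp only:)
      qed
      show ?thesis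
        unfolding has_partials_def eq p(2) power2_norm_eq_inner
        by (intro has_derivative_of_real)
          (auto intro!: derivative_eq_intros D(2) simp: inner_commute algebra_simps)
    qed
    moreover have "G b \<in> X" for b
      unfolding X_def G_def
      by (intro CollectI exI[of _ "\<lambda>x. D b x + (- 2) * ((x \<bullet> b) * p x)"] conjI refl polynomials.intros D p)
    ultimately show ?thesis by blast
  qed
  have sm: "smooth (gauss :: real^'n \<Rightarrow> complex)"
    by (rule smooth_coinduct[of _ X]) (use g closed in auto)
  show ?thesis
    unfolding schwartz_iff
  proof (intro allI dominatedI)
    fix t :: real and vs :: "(real^'n) list" assume vs: "vs \<in> lists Basis"
    obtain h where "h \<in> X" "\<forall>x\<in>UNIV. iter_pd vs gauss x = h x"
      using partials_closed_class[of UNIV X gauss gauss vs, OF open_UNIV closed g refl vs] by blast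
    then obtain p where p: "p \<in> polynomials" "\<And>x. iter_pd vs gauss x = complex_of_real (p x * exp (- (norm x)\<^sup>2))"
      by (auto simp: X_def)
    obtain C s where C: "0 \<le> C" "\<forall>x. \<bar>p x\<bar> \<le> C * wt s x" using polynomials_bound[OF p(1)] by auto
    obtain D where D: "0 \<le> D" "\<And>x::real^'n. exp (- (norm x)\<^sup>2) \<le> D * wt (- (s - t)) x"
      using exp_minus_norm_le_wt by blast
    have "norm (iter_pd vs gauss x) \<le> (C * D) * wt t x" for x
    proof -
      have "\<bar>p x\<bar> * exp (- (norm x)\<^sup>2) \<le> (C * wt s x) * (D * wt (- (s - t)) x)"
        using C D(1) by (intro mult_mono D(2)) (auto simp: wt_nonneg)
      also have "\<dots> = (C * D) * (wt s x * wt (- (s - t)) x)" by (simp only: mult_ac)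
      finally show ?thesis by (simp add: p(2) norm_mult wt_mult)
    qed
    then show "\<exists>C. \<forall>i\<in>{()}. \<forall>x. norm (iter_pd vs gauss x) \<le> C * wt t x" by blast
  qed (use sm in \<open>auto simp: wt_nonneg\<close>)
qed

text \<open>
  Gaussians of increasing width are bounded in \<open>\<B>\<close> and tend to 1 in
  \<open>C\<^sup>\<infinity>\<close>, and multiplication by them maps \<open>\<B>\<close> into the
  Schwartz space. The summand 0 gives the argument the form of an affine substitution.
\<close>

definition cutoff :: "nat \<Rightarrow> real^'n \<Rightarrow> complex" where
  "cutoff k x = gauss (inverse (real (Suc k)) *\<^sub>R x + 0)"

lemma cutoff_schwartz: "cutoff k \<in> schwartz"
  using schwartz_affine[OF gauss_schwartz, of "inverse (real (Suc k))" 0] by (simp add: cutoff_def[abs_def])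

lemma inverse_Suc_le: "\<bar>inverse (real (Suc k))\<bar> \<le> 1"
  by (simp add: field_simps)

lemma cutoff_dominated: "dominated UNIV (\<lambda>_ _. 1) cutoff"
proof -
  have "dominated1 (\<lambda>_. 1) (gauss :: real^'n \<Rightarrow> complex)"
    using gauss_schwartz schwartz_subset_B space_B_iff by blast
  from dominated_affine[OF dominated_const[OF this, of UNIV], of "\<lambda>k. inverse (real (Suc k))" 1 "\<lambda>_. 0"]
  show ?thesis using inverse_Suc_le by (simp add: cutoff_def[abs_def])
qed

text \<open>
  The factor \<open>1 / (k + 1)\<close> is supplied by the mean value theorem for the function itself and
  by the chain rule for its derivatives.
\<close>

lemma cutoff_minus_one_dominated:
  "dominated UNIV (\<lambda>k x. inverse (real (Suc k)) * (1 + norm x)) (\<lambda>k x. cutoff k x - (1::complex))"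
proof (rule dominatedI)
  fix vs :: "(real^'n) list" assume vs: "vs \<in> lists Basis"
  let ?g = "gauss :: real^'n \<Rightarrow> complex"
  have sm: "smooth ?g" using gauss_schwartz schwartz_subset_B space_B_smooth by blast
  have d: "dominated1 (\<lambda>_. 1) ?g"
    using gauss_schwartz schwartz_subset_B space_B_iff by blast
  show "\<exists>C. \<forall>k\<in>UNIV. \<forall>x. norm (iter_pd vs (\<lambda>x. cutoff k x - (1::complex)) x) \<le> C * (inverse (real (Suc k)) * (1 + norm x))"
  proof (cases "vs = []")
    case True
    have "\<exists>C\<ge>0. \<forall>b\<in>Basis. \<forall>x. norm (pd b ?g x) \<le> C"
    proof -
      have "\<exists>C. \<forall>x. norm (pd b ?g x) \<le> C" if "b \<in> Basis" for b
        using dominatedD[OF d, of "[b]"] that by auto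
      then obtain C where C: "\<And>b x. b \<in> Basis \<Longrightarrow> norm (pd b ?g x) \<le> C b" by metis
      have "norm (pd b ?g x) \<le> (\<Sum>b\<in>Basis. \<bar>C b\<bar>)" if "b \<in> Basis" for b x
        using C[OF that, of x] member_le_sum[OF that, of "\<lambda>b. \<bar>C b\<bar>"] by force
      then show ?thesis by (intro exI[of _ "\<Sum>b\<in>Basis. \<bar>C b\<bar>"]) (auto intro: sum_nonneg)
    qed
    then obtain C where C: "C \<ge> 0" "\<And>b x. b \<in> Basis \<Longrightarrow> norm (pd b ?g x) \<le> C" by blast
    have "norm (cutoff k x - (1::complex)) \<le> (DIM(real^'n) * C) * (inverse (real (Suc k)) * (1 + norm x))" for k and x :: "real^'n"
    proof -
      let ?h = "inverse (real (Suc k)) *\<^sub>R x"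
      have "norm (?g (0 + ?h) - ?g 0) \<le> DIM(real^'n) * C * norm ?h"
        using has_partials_mvt[of ?g "\<lambda>b. pd b ?g" 0 ?h C, OF smooth_has_partials0[OF sm] C(2)] by simp
      also have "\<dots> = (DIM(real^'n) * C) * (inverse (real (Suc k)) * norm x)" by simp
      also have "\<dots> \<le> (DIM(real^'n) * C) * (inverse (real (Suc k)) * (1 + norm x))"
        using C(1) by (intro mult_left_mono) auto
      finally show ?thesis by (simp add: cutoff_def gauss_def)
    qed
    then show ?thesis using True by auto
  next
    case False
    obtain C where C: "C \<ge> 0" "\<forall>i\<in>{()}. \<forall>x. norm (iter_pd vs ?g x) \<le> C * 1" using dominatedD[OF d vs] by blast
    have "norm (iter_pd vs (\<lambda>x. cutoff k x - (1::complex)) x) \<le> C * (inverse (real (Suc k)) * (1 + norm x))" for k and x :: "real^'n"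
    proof -
      let ?c = "inverse (real (Suc k))"
      have "iter_pd vs (\<lambda>x. cutoff k x - (1::complex)) =
          (\<lambda>x. iter_pd vs (\<lambda>x. ?g (?c *\<^sub>R x + 0)) x - iter_pd vs (\<lambda>x. 1) x)"
        unfolding cutoff_def by (rule iter_pd_diff[OF smooth_affine[OF sm] smooth_const vs])
      then have "iter_pd vs (\<lambda>x. cutoff k x - (1::complex)) x = ?c ^ length vs *\<^sub>R iter_pd vs ?g (?c *\<^sub>R x + 0)"
        by (simp only: iter_pd_affine[OF sm vs] iter_pd_const[OF False vs] diff_zero)
      then have "norm (iter_pd vs (\<lambda>x. cutoff k x - (1::complex)) x) = ?c ^ length vs * norm (iter_pd vs ?g (?c *\<^sub>R x + 0))"
        by simp
      also have "\<dots> \<le> (?c ^ 1 * (1 + norm x)) * C"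
      proof (rule mult_mono)
        have "?c ^ length vs \<le> ?c ^ 1"
          using False inverse_Suc_le[of k] by (intro power_decreasing) (cases vs, auto)
        moreover have "?c ^ 1 * 1 \<le> ?c ^ 1 * (1 + norm x)" by (intro mult_left_mono) auto
        ultimately show "?c ^ length vs \<le> ?c ^ 1 * (1 + norm x)" by linarith
      qed (use C in auto)
      finally show ?thesis by (simp add: mult_ac)
    qed
    then show ?thesis by blast
  qed
qed (use cutoff_schwartz in \<open>auto intro!: smooth_diff smooth_const simp: schwartz_def\<close>)

lemma B_null_add:
  assumes "B_null \<Phi>" "B_null \<Psi>"
  shows "B_null (\<lambda>j x. \<Phi> j x + \<Psi> j x)"
  unfolding B_null_def
proof (intro conjI ballI allI impI)
  have d: "dominated UNIV (\<lambda>_ _. 1) \<Phi>" "dominated UNIV (\<lambda>_ _. 1) \<Psi>"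
    using assms by (auto simp: B_null_def)
  then show "dominated UNIV (\<lambda>_ _. 1) (\<lambda>j x. \<Phi> j x + \<Psi> j x)" by (rule dominated_add)
  fix vs :: "(real^'a) list" and R e :: real assume vs: "vs \<in> lists Basis" and "e > 0"
  then have e: "e / 2 > 0" by simp
  have "\<forall>\<^sub>F j in sequentially. \<forall>x\<in>cball 0 R. norm (iter_pd vs (\<Phi> j) x) < e / 2"
    "\<forall>\<^sub>F j in sequentially. \<forall>x\<in>cball 0 R. norm (iter_pd vs (\<Psi> j) x) < e / 2"
    using assms vs e unfolding B_null_def by blast+
  then show "\<forall>\<^sub>F j in sequentially. \<forall>x\<in>cball 0 R. norm (iter_pd vs (\<lambda>x. \<Phi> j x + \<Psi> j x) x) < e"
  proof eventually_elim
    case (elim j)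
    show ?case
    proof
      fix x :: "real^'a" assume "x \<in> cball 0 R"
      then have "norm (iter_pd vs (\<Phi> j) x) < e / 2" "norm (iter_pd vs (\<Psi> j) x) < e / 2" using elim by auto
      then show "norm (iter_pd vs (\<lambda>x. \<Phi> j x + \<Psi> j x) x) < e"
        using norm_triangle_ineq[of "iter_pd vs (\<Phi> j) x" "iter_pd vs (\<Psi> j) x"] dominated_smooth[OF d(1)] dominated_smooth[OF d(2)] vs
        by (simp add: iter_pd_add)
    qed
  qed
qed

text \<open>
  The index \<open>\<kappa> j\<close> may run ahead of \<open>j\<close>, as diagonal sequences require.
\<close>

lemma cutoff_mult_null:
  assumes "dominated UNIV (\<lambda>_ _. 1) \<Phi>" "\<And>j. j \<le> \<kappa> j"
  shows "B_null (\<lambda>j x. cutoff (\<kappa> j) x * \<Phi> j x - \<Phi> j x)"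
proof (rule B_nullI)
  show "dominated UNIV (\<lambda>_ _. 1) (\<lambda>j x. cutoff (\<kappa> j) x * \<Phi> j x - \<Phi> j x)"
    using dominated_diff[OF dominated_mult[OF dominated_reindex[OF cutoff_dominated, of UNIV \<kappa>] assms(1), simplified] assms(1)] by simp
  have "dominated UNIV (\<lambda>j x. inverse (real (Suc (\<kappa> j))) * (1 + norm x)) (\<lambda>j x. (cutoff (\<kappa> j) x - 1) * \<Phi> j x)"
    using dominated_mult[OF dominated_reindex[OF cutoff_minus_one_dominated, of UNIV \<kappa>] assms(1)] by simp
  then show "dominated UNIV (\<lambda>j x. inverse (real (Suc (\<kappa> j))) * (1 + norm x)) (\<lambda>j x. cutoff (\<kappa> j) x * \<Phi> j x - \<Phi> j x)"
    by (simp add: left_diff_distrib)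
  show "(\<lambda>j. inverse (real (Suc (\<kappa> j)))) \<longlonglongrightarrow> 0"
  proof (rule Lim_null_comparison[OF _ LIMSEQ_inverse_real_of_nat])
    show "\<forall>\<^sub>F j in sequentially. norm (inverse (real (Suc (\<kappa> j)))) \<le> inverse (real (Suc j))"
      using assms(2) by (intro always_eventually allI) (auto simp: field_simps)
  qed
  show "\<exists>K. \<forall>x\<in>cball 0 R. \<bar>1 + norm (x :: real^'b)\<bar> \<le> K" for R
    by (intro exI[of _ "1 + R"]) auto
qed

lemma cutoff_mult_schwartz: "\<phi> \<in> space_B \<Longrightarrow> (\<lambda>x. cutoff k x * \<phi> x) \<in> schwartz"
  using schwartz_mult[OF cutoff_schwartz[of k], of 0 \<phi>] by (simp add: space_B_iff wt_0[abs_def] mult.commute)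

lemma Bc_form_cutoff_tendsto:
  assumes F: "Bc_form F" and \<phi>: "\<phi> \<in> space_B"
  shows "(\<lambda>k. F (\<lambda>x. cutoff k x * \<phi> x)) \<longlonglongrightarrow> F \<phi>"
proof -
  have "(\<lambda>k. F (\<lambda>x. cutoff k x * \<phi> x - \<phi> x)) \<longlonglongrightarrow> 0"
    by (rule Bc_form_null[OF F cutoff_mult_null[where \<kappa> = "\<lambda>k. k"]])
      (use \<phi> in \<open>auto simp: space_B_iff intro: dominated_const\<close>)
  moreover have "F (\<lambda>x. cutoff k x * \<phi> x - \<phi> x) = F (\<lambda>x. cutoff k x * \<phi> x) - F \<phi>" for k
    using cutoff_mult_schwartz[OF \<phi>] schwartz_subset_B by (intro Bc_form_diff F \<phi>) blast
  ultimately show ?thesis by (simp add: LIM_zero_iff)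
qed

text \<open>
  Cutoffs approximate every function of \<open>\<B>\<close> by Schwartz functions, so a continuous form
  on \<open>\<B>\<^sub>c\<close> is determined by its restriction to the Schwartz space.
\<close>

lemma Bc_pairing_eq:
  assumes F: "Bc_form F" and u: "\<And>\<psi>. \<psi> \<in> schwartz \<Longrightarrow> F \<psi> = u \<psi>" and \<phi>: "\<phi> \<in> space_B"
  shows "Bc_pairing u \<phi> = F \<phi>"
  unfolding Bc_pairing_def
proof (rule the_equality)
  show "\<exists>v\<in>dual space_B Bc_seminorms. (\<forall>\<psi>\<in>schwartz. v \<psi> = u \<psi>) \<and> F \<phi> = v \<phi>"
    using Bc_form_imp_dual[OF F] u by blast
next
  fix c assume "\<exists>v\<in>dual space_B Bc_seminorms. (\<forall>\<psi>\<in>schwartz. v \<psi> = u \<psi>) \<and> c = v \<phi>"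
  then obtain v where v: "Bc_form v" "\<And>\<psi>. \<psi> \<in> schwartz \<Longrightarrow> v \<psi> = u \<psi>" "c = v \<phi>"
    using dual_imp_Bc_form by blast
  have "(\<lambda>k. v (\<lambda>x. cutoff k x * \<phi> x)) \<longlonglongrightarrow> v \<phi>" "(\<lambda>k. F (\<lambda>x. cutoff k x * \<phi> x)) \<longlonglongrightarrow> F \<phi>"
    using v(1) F \<phi> by (auto intro: Bc_form_cutoff_tendsto)
  moreover have "v (\<lambda>x. cutoff k x * \<phi> x) = F (\<lambda>x. cutoff k x * \<phi> x)" for k
    using v(2) u cutoff_mult_schwartz[OF \<phi>] by simp
  ultimately show "c = F \<phi>" using LIMSEQ_unique v(3) by simp
qed

section \<open>Extension of integrable distributions to bounded functions\<close>

text \<open>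
  The humps are chosen one after the other. Outside a large ball the sum of the chosen humps is small,
  and inside this ball all sufficiently late humps are small; hence adding a late hump hardly raises the
  bound.
\<close>

lemma gliding_hump:
  fixes n :: "nat \<Rightarrow> 'a::real_normed_vector \<Rightarrow> real"
  assumes "infinite J" "\<And>j x. 0 \<le> n j x" "\<And>j x. n j x \<le> B"
    and inf: "\<And>j. (n j \<longlongrightarrow> 0) at_infinity"
    and loc: "\<And>R \<epsilon>. \<epsilon> > 0 \<Longrightarrow> \<forall>\<^sub>F j in sequentially. \<forall>x\<in>cball 0 R. n j x < \<epsilon>"
  shows "\<delta> > 0 \<Longrightarrow> \<exists>S\<subseteq>J. finite S \<and> card S = m \<and> (\<forall>x. (\<Sum>j\<in>S. n j x) \<le> B + \<delta>)"
proof (induction m arbitrary: \<delta>)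
  case 0
  have "0 \<le> B" using assms(2,3) order_trans by blast
  then show ?case using 0 by (intro exI[of _ "{}"]) auto
next
  case (Suc m)
  obtain S where S: "S \<subseteq> J" "finite S" "card S = m" "\<And>x. (\<Sum>j\<in>S. n j x) \<le> B + \<delta> / 2"
    using Suc.IH[of "\<delta> / 2"] Suc.prems by auto
  have "((\<lambda>x. \<Sum>j\<in>S. n j x) \<longlongrightarrow> (\<Sum>j\<in>S. 0)) at_infinity" by (intro tendsto_sum inf)
  then have "\<forall>\<^sub>F x in at_infinity. (\<Sum>j\<in>S. n j x) < \<delta>" using Suc.prems by (auto intro: order_tendstoD)
  then obtain R where R: "\<And>x. R \<le> norm x \<Longrightarrow> (\<Sum>j\<in>S. n j x) < \<delta>"
    by (auto simp: eventually_at_infinity)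
  have "\<forall>\<^sub>F j in sequentially. \<forall>x\<in>cball 0 R. n j x < \<delta> / 2"
    using loc[of "\<delta> / 2" R] Suc.prems by simp
  then obtain N where "\<forall>j\<ge>N. \<forall>x\<in>cball 0 R. n j x < \<delta> / 2"
    unfolding eventually_sequentially by blast
  then have N: "n j x < \<delta> / 2" if "N \<le> j" "norm x \<le> R" for j x
    using that by (simp add: mem_cball_0)
  have "infinite (J - S - {..<N})" using assms(1) S(2) by (simp add: Diff_infinite_finite)
  then obtain j where j: "j \<in> J" "j \<notin> S" "N \<le> j"
    by (metis Diff_iff finite.emptyI lessThan_iff not_less subsetI subset_empty equals0I)
  have "(\<Sum>j\<in>insert j S. n j x) \<le> B + \<delta>" for x
    using R[of x] N[OF j(3), of x] S(4)[of x] assms(3)[of j x] S(2) j(2)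
    by (cases "norm x \<le> R") auto
  then show ?case
    using S j by (intro exI[of _ "insert j S"]) auto
qed

text \<open>
  If \<open>|u \<Phi>\<^sub>j| \<ge> e\<close> for infinitely many \<open>j\<close>, choose
  \<open>m\<close> of these functions by \<open>gliding_hump\<close> and multiply them by phases that
  make \<open>u \<Phi>\<^sub>j\<close> positive. The seminorms of the sum are bounded independently of
  \<open>m\<close>, but its value under \<open>u\<close> is at least \<open>m e\<close>.
\<close>

lemma dual_Bdot_null:
  fixes u :: "(real^'n \<Rightarrow> complex) \<Rightarrow> complex"
  assumes u: "u \<in> dual space_Bdot B_seminorms" and null: "B_null \<Phi>" and \<Phi>: "\<And>j. \<Phi> j \<in> space_Bdot"
  shows "(\<lambda>j. u (\<Phi> j)) \<longlonglongrightarrow> 0"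
proof (rule ccontr)
  assume "\<not> ?thesis"
  then obtain e where e: "e > 0" "\<not> (\<forall>\<^sub>F j in sequentially. norm (u (\<Phi> j)) < e)"
    by (auto simp: tendsto_iff)
  define J where "J = {j. e \<le> norm (u (\<Phi> j))}"
  have J: "infinite J"
    using e(2) unfolding J_def infinite_nat_iff_unbounded_le eventually_sequentially by (auto simp: not_less)
  obtain L C where L: "finite L" "L \<subseteq> lists Basis" "0 \<le> C"
    "\<And>\<phi> K. \<phi> \<in> space_Bdot \<Longrightarrow> (\<And>x. (\<Sum>vs\<in>L. norm (iter_pd vs \<phi> x)) \<le> K) \<Longrightarrow> norm (u \<phi>) \<le> C * K"
    using dual_Bdot_bound[OF u] by metis
  have add: "u (\<lambda>x. \<phi> x + \<psi> x) = u \<phi> + u \<psi>" if "\<phi> \<in> space_Bdot" "\<psi> \<in> space_Bdot" for \<phi> \<psi>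
    using u that unfolding dual_def by blast
  have cmult: "u (\<lambda>x. c * \<phi> x) = c * u \<phi>" if "\<phi> \<in> space_Bdot" for c \<phi>
    using u that unfolding dual_def by blast
  define n where "n j x = (\<Sum>vs\<in>L. norm (iter_pd vs (\<Phi> j) x))" for j x
  have dom: "dominated UNIV (\<lambda>_ _. 1) \<Phi>" using null by (simp add: B_null_def)
  have "\<exists>D. \<forall>j x. norm (iter_pd vs (\<Phi> j) x) \<le> D" if "vs \<in> L" for vs
    using dominatedD[OF dom, of vs] that L(2) by auto
  then obtain D where D: "\<And>vs j x. vs \<in> L \<Longrightarrow> norm (iter_pd vs (\<Phi> j) x) \<le> D vs" by metis
  have 1: "0 \<le> n j x" for j x by (simp add: n_def sum_nonneg)
  have 2: "n j x \<le> (\<Sum>vs\<in>L. D vs)" for j x unfolding n_def by (intro sum_mono D)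
  have 3: "(n j \<longlongrightarrow> 0) at_infinity" for j
  proof -
    have "((\<lambda>x. \<Sum>vs\<in>L. norm (iter_pd vs (\<Phi> j) x)) \<longlongrightarrow> (\<Sum>vs\<in>L. 0)) at_infinity"
      using \<Phi>[of j] L(2) by (intro tendsto_sum tendsto_norm_zero) (auto simp: in_space_Bdot_iff)
    then show ?thesis by (simp add: n_def[abs_def])
  qed
  have 4: "\<forall>\<^sub>F j in sequentially. \<forall>x\<in>cball 0 R. n j x < d" if d: "d > 0" for R d
  proof -
    define d' where "d' = d / (real (card L) + 1)"
    have d': "d' > 0" using d by (simp add: d'_def)
    have "\<forall>\<^sub>F j in sequentially. \<forall>x\<in>cball 0 R. norm (iter_pd vs (\<Phi> j) x) < d'" if "vs \<in> L" for vs
      using null d' that L(2) unfolding B_null_def by blast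
    then have "\<forall>\<^sub>F j in sequentially. \<forall>vs\<in>L. \<forall>x\<in>cball 0 R. norm (iter_pd vs (\<Phi> j) x) < d'"
      using L(1) by (simp add: eventually_ball_finite)
    then show ?thesis
    proof (rule eventually_mono, intro ballI)
      fix j and x :: "real^'n"
      assume *: "\<forall>vs\<in>L. \<forall>x\<in>cball 0 R. norm (iter_pd vs (\<Phi> j) x) < d'" and x: "x \<in> cball 0 R"
      have "n j x \<le> (\<Sum>vs\<in>L. d')" unfolding n_def using * x by (intro sum_mono) (auto simp: less_imp_le)
      also have "\<dots> = card L * d'" by simp
      also have "\<dots> < (card L + 1) * d'" using d' by simp
      also have "\<dots> = d" using of_nat_0_le_iff[of "card L"] by (simp add: d'_def add.commute add_nonneg_eq_0_iff)
      finally show "n j x < d" .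
    qed
  qed
  \<comment> \<open>the bound that \<open>gliding_hump\<close> gives for the sum, with tolerance 1, for every number \<open>m\<close> of humps\<close>
  define K where "K = (\<Sum>vs\<in>L. D vs) + 1"
  obtain m :: nat where m: "C * K < real m * e"
    using reals_Archimedean3[OF e(1)] by blast
  obtain S where S: "S \<subseteq> J" "finite S" "card S = m" "\<forall>x. (\<Sum>j\<in>S. n j x) \<le> K"
    using gliding_hump[of J n, OF J 1 2 3 4, of 1 m] unfolding K_def by auto
  define c where "c j = cnj (u (\<Phi> j)) / norm (u (\<Phi> j))" for j
  have cn: "norm (c j) = 1" and cu: "c j * u (\<Phi> j) = norm (u (\<Phi> j))" if "j \<in> S" for j
  proof -
    have "u (\<Phi> j) \<noteq> 0" using that S(1) e(1) by (auto simp: J_def)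
    then show "norm (c j) = 1" "c j * u (\<Phi> j) = norm (u (\<Phi> j))"
      by (auto simp: c_def norm_divide complex_norm_square[symmetric] power2_eq_square mult.commute)
  qed
  define \<phi> where "\<phi> x = (\<Sum>j\<in>S. c j * \<Phi> j x)" for x
  have \<phi>: "\<phi> \<in> space_Bdot"
    unfolding \<phi>_def by (intro Bdot_sum S Bdot_cmult \<Phi>)
  have sm: "smooth (\<Phi> j)" for j using dominated_smooth[OF dom] by simp
  have "norm (u \<phi>) \<le> C * K"
  proof (rule L(4)[OF \<phi>])
    fix x
    have "norm (iter_pd vs \<phi> x) \<le> (\<Sum>j\<in>S. norm (iter_pd vs (\<Phi> j) x))" if "vs \<in> L" for vs
    proof -
      have vs: "vs \<in> lists Basis" using that L(2) by blast
      have "norm (iter_pd vs \<phi> x) = norm (\<Sum>j\<in>S. c j * iter_pd vs (\<Phi> j) x)"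
        unfolding \<phi>_def using S(2) sm vs by (simp add: iter_pd_sum smooth_cmult iter_pd_cmult)
      also have "\<dots> \<le> (\<Sum>j\<in>S. norm (iter_pd vs (\<Phi> j) x))"
        by (rule sum_norm_le) (simp add: norm_mult cn)
      finally show ?thesis .
    qed
    then have "(\<Sum>vs\<in>L. norm (iter_pd vs \<phi> x)) \<le> (\<Sum>vs\<in>L. \<Sum>j\<in>S. norm (iter_pd vs (\<Phi> j) x))"
      by (rule sum_mono)
    also have "\<dots> = (\<Sum>j\<in>S. n j x)" unfolding n_def by (rule sum.swap)
    finally show "(\<Sum>vs\<in>L. norm (iter_pd vs \<phi> x)) \<le> K" using S(4)[rule_format, of x] by linarith
  qed
  moreover have "u \<phi> = (\<Sum>j\<in>S. c j * u (\<Phi> j))"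
    unfolding \<phi>_def using S(2)
  proof (induction S)
    case empty
    show ?case using cmult[OF Bdot_zero, of 0] by simp
  next
    case (insert j S)
    have "u (\<lambda>x. c j * \<Phi> j x + (\<Sum>j\<in>S. c j * \<Phi> j x)) = u (\<lambda>x. c j * \<Phi> j x) + u (\<lambda>x. \<Sum>j\<in>S. c j * \<Phi> j x)"
      by (intro add Bdot_cmult Bdot_sum insert(1) \<Phi>)
    then show ?case using insert cmult[OF \<Phi>] by simp
  qed
  ultimately have "norm (\<Sum>j\<in>S. complex_of_real (norm (u (\<Phi> j)))) \<le> C * K" using cu by simp
  moreover have "norm (\<Sum>j\<in>S. complex_of_real (norm (u (\<Phi> j)))) = (\<Sum>j\<in>S. norm (u (\<Phi> j)))"
    unfolding of_real_sum[symmetric] norm_of_real by (simp add: sum_nonneg)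
  moreover have "card S * e \<le> (\<Sum>j\<in>S. norm (u (\<Phi> j)))"
    using S(1) by (intro sum_bounded_below) (auto simp: J_def)
  ultimately show False using m S(3) by simp
qed

text \<open>
  The value of \<open>F\<close> at \<open>\<phi>\<close> is the limit of the values of \<open>u\<close>
  at the cutoffs of \<open>\<phi>\<close>. The limit exists because differences of cutoffs are null
  sequences; the continuity of \<open>F\<close> reduces to that of \<open>u\<close> by choosing for each
  member of a null sequence a cutoff at which the limit is nearly attained.
\<close>

lemma dual_Bdot_extension:
  fixes u :: "(real^'n \<Rightarrow> complex) \<Rightarrow> complex"
  assumes u: "u \<in> dual space_Bdot B_seminorms"
  shows "\<exists>F. Bc_form F \<and> (\<forall>\<phi>\<in>schwartz. F \<phi> = u \<phi>)"
proof -
  have add: "u (\<lambda>x. \<phi> x + \<psi> x) = u \<phi> + u \<psi>" if "\<phi> \<in> space_Bdot" "\<psi> \<in> space_Bdot" for \<phi> \<psi>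
    using u that unfolding dual_def by blast
  have cmult: "u (\<lambda>x. c * \<phi> x) = c * u \<phi>" if "\<phi> \<in> space_Bdot" for c \<phi>
    using u that unfolding dual_def by blast
  have diff: "u (\<lambda>x. \<phi> x - \<psi> x) = u \<phi> - u \<psi>" if "\<phi> \<in> space_Bdot" "\<psi> \<in> space_Bdot" for \<phi> \<psi>
    using add[OF that(1) Bdot_cmult[OF that(2), of "-1"]] cmult[OF that(2), of "-1"] by simp
  have S: "(\<lambda>x. cutoff k x * \<phi> x) \<in> space_Bdot" if "\<phi> \<in> space_B" for k \<phi>
    using cutoff_mult_schwartz[OF that] schwartz_subset_Bdot by blast
  define F where "F \<phi> = lim (\<lambda>k. u (\<lambda>x. cutoff k x * \<phi> x))" for \<phi>
  have F: "(\<lambda>k. u (\<lambda>x. cutoff k x * \<phi> x)) \<longlonglongrightarrow> F \<phi>" if \<phi>: "\<phi> \<in> space_B" for \<phi>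
  proof -
    have "Cauchy (\<lambda>k. u (\<lambda>x. cutoff k x * \<phi> x))"
    proof (rule ccontr)
      assume "\<not> Cauchy (\<lambda>k. u (\<lambda>x. cutoff k x * \<phi> x))"
      then obtain e where "e > 0" and e: "\<forall>M. \<exists>m\<ge>M. \<exists>n\<ge>M. e \<le> dist (u (\<lambda>x. cutoff m x * \<phi> x)) (u (\<lambda>x. cutoff n x * \<phi> x))"
        by (auto simp: Cauchy_def not_less)
      then obtain m n where mn: "\<And>j. j \<le> m j" "\<And>j. j \<le> n j"
        "\<And>j. e \<le> dist (u (\<lambda>x. cutoff (m j) x * \<phi> x)) (u (\<lambda>x. cutoff (n j) x * \<phi> x))" by metis
      have d: "dominated UNIV (\<lambda>_ _. 1) (\<lambda>_. \<phi>)" "dominated UNIV (\<lambda>_ _. 1) (\<lambda>_ x. - 1 * \<phi> x)"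
        using \<phi> space_B_cmult[OF \<phi>, of "-1"] unfolding space_B_iff by (auto intro: dominated_const)
      have "B_null (\<lambda>j x. cutoff (m j) x * \<phi> x - \<phi> x)" "B_null (\<lambda>j x. cutoff (n j) x * (- 1 * \<phi> x) - (- 1 * \<phi> x))"
        by (rule cutoff_mult_null; use d mn in simp)+
      from B_null_add[OF this] have "B_null (\<lambda>j x. cutoff (m j) x * \<phi> x - cutoff (n j) x * \<phi> x)" by simp
      from dual_Bdot_null[OF u this] have "(\<lambda>j. u (\<lambda>x. cutoff (m j) x * \<phi> x) - u (\<lambda>x. cutoff (n j) x * \<phi> x)) \<longlonglongrightarrow> 0"
        using Bdot_add[OF S[OF \<phi>] S[OF space_B_cmult[OF \<phi>, of "-1"]]] by (simp add: diff S \<phi>)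
      then have "\<forall>\<^sub>F j in sequentially. dist (u (\<lambda>x. cutoff (m j) x * \<phi> x) - u (\<lambda>x. cutoff (n j) x * \<phi> x)) 0 < e"
        using \<open>e > 0\<close> by (rule tendstoD)
      then show False using mn(3) by (auto simp: eventually_sequentially dist_norm not_less[symmetric])
    qed
    then show ?thesis unfolding F_def by (simp add: Cauchy_convergent convergent_LIMSEQ_iff[symmetric])
  qed
  have "Bc_form F"
    unfolding Bc_form_def
  proof (intro conjI ballI allI impI)
    fix \<phi> \<psi> :: "real^'n \<Rightarrow> complex" assume *: "\<phi> \<in> space_B" "\<psi> \<in> space_B"
    have "(\<lambda>k. u (\<lambda>x. cutoff k x * (\<phi> x + \<psi> x))) \<longlonglongrightarrow> F \<phi> + F \<psi>"
      using tendsto_add[OF F[OF *(1)] F[OF *(2)]] by (simp add: distrib_left add S *)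
    then show "F (\<lambda>x. \<phi> x + \<psi> x) = F \<phi> + F \<psi>"
      using F[OF space_B_add[OF *]] LIMSEQ_unique by blast
  next
    fix \<phi> :: "real^'n \<Rightarrow> complex" and c assume *: "\<phi> \<in> space_B"
    have "(\<lambda>k. u (\<lambda>x. c * (cutoff k x * \<phi> x))) \<longlonglongrightarrow> c * F \<phi>"
      using tendsto_mult_left[OF F[OF *], of c] by (simp add: cmult S *)
    then have "(\<lambda>k. u (\<lambda>x. cutoff k x * (c * \<phi> x))) \<longlonglongrightarrow> c * F \<phi>" by (simp add: mult_ac)
    then show "F (\<lambda>x. c * \<phi> x) = c * F \<phi>"
      using F[OF space_B_cmult[OF *]] LIMSEQ_unique by blast
  next
    fix \<Phi> :: "nat \<Rightarrow> real^'n \<Rightarrow> complex" assume null: "B_null \<Phi>"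
    then have dom: "dominated UNIV (\<lambda>_ _. 1) \<Phi>" by (simp add: B_null_def)
    then have B: "\<Phi> j \<in> space_B" for j by (rule dominated_in_B[of UNIV "\<lambda>_. 1"]) simp
    have "\<exists>k\<ge>j. dist (u (\<lambda>x. cutoff k x * \<Phi> j x)) (F (\<Phi> j)) < inverse (real (Suc j))" for j
    proof -
      have "\<forall>\<^sub>F k in sequentially. dist (u (\<lambda>x. cutoff k x * \<Phi> j x)) (F (\<Phi> j)) < inverse (real (Suc j))"
        by (rule tendstoD[OF F[OF B]]) simp
      moreover have "\<forall>\<^sub>F k in sequentially. j \<le> k" by (rule eventually_ge_at_top)
      ultimately have "\<forall>\<^sub>F k in sequentially. j \<le> k \<and> dist (u (\<lambda>x. cutoff k x * \<Phi> j x)) (F (\<Phi> j)) < inverse (real (Suc j))"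
        by eventually_elim simp
      then show ?thesis by (auto simp: eventually_sequentially)
    qed
    then obtain \<kappa> where \<kappa>: "\<And>j. j \<le> \<kappa> j"
      "\<And>j. dist (u (\<lambda>x. cutoff (\<kappa> j) x * \<Phi> j x)) (F (\<Phi> j)) < inverse (real (Suc j))" by metis
    have "B_null (\<lambda>j x. cutoff (\<kappa> j) x * \<Phi> j x)"
      using B_null_add[OF cutoff_mult_null[OF dom \<kappa>(1)] null] by simp
    from dual_Bdot_null[OF u this S[OF B]]
    have 1: "(\<lambda>j. u (\<lambda>x. cutoff (\<kappa> j) x * \<Phi> j x)) \<longlonglongrightarrow> 0" .
    have "(\<lambda>j. F (\<Phi> j) - u (\<lambda>x. cutoff (\<kappa> j) x * \<Phi> j x)) \<longlonglongrightarrow> 0"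
      by (rule Lim_null_comparison[OF _ LIMSEQ_inverse_real_of_nat])
        (use \<kappa>(2) in \<open>auto intro!: always_eventually less_imp_le simp: dist_norm norm_minus_commute simp del: of_nat_Suc\<close>)
    from tendsto_add[OF this 1] show "(\<lambda>j. F (\<Phi> j)) \<longlonglongrightarrow> 0" by simp
  qed
  moreover have "F \<phi> = u \<phi>" if \<phi>: "\<phi> \<in> schwartz" for \<phi>
  proof -
    have B: "\<phi> \<in> space_B" "\<phi> \<in> space_Bdot" using \<phi> schwartz_subset_B schwartz_subset_Bdot by auto
    have "B_null (\<lambda>k x. cutoff k x * \<phi> x - \<phi> x)"
      by (rule cutoff_mult_null) (use B in \<open>auto simp: space_B_iff intro: dominated_const\<close>)
    from dual_Bdot_null[OF u this] have "(\<lambda>k. u (\<lambda>x. cutoff k x * \<phi> x) - u \<phi>) \<longlonglongrightarrow> 0"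
      using Bdot_add[OF S[OF B(1)] Bdot_cmult[OF B(2), of "-1"]] by (simp add: diff S B)
    then have "(\<lambda>k. u (\<lambda>x. cutoff k x * \<phi> x)) \<longlonglongrightarrow> u \<phi>" by (simp add: LIM_zero_iff)
    then show ?thesis using F[OF B(1)] LIMSEQ_unique by blast
  qed
  ultimately show ?thesis by blast
qed

section \<open>A continuous function is determined by its integrals against Schwartz functions\<close>

text \<open>
  Suppose that \<open>g a \<noteq> 0\<close>, and test with the Gaussians \<open>exp (- t |x -
  a|\<^sup>2)\<close>. On a ball of radius \<open>d\<close> around \<open>a\<close> the function
  \<open>Re (cnj (g a) g)\<close> is bounded below by a positive constant, so the ball of radius \<open>d
  / 2\<close> contributes at least a multiple of \<open>exp (- t d\<^sup>2 / 4)\<close>; the complement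
  of the ball contributes at most a multiple of \<open>exp (- t d\<^sup>2)\<close>. For large
  \<open>t\<close> the integral is not 0.
\<close>

lemma continuous_eq_zero_if_integrals_zero:
  fixes g :: "real^'n \<Rightarrow> complex"
  assumes cont: "continuous_on UNIV g"
    and int: "\<And>\<phi>. \<phi> \<in> schwartz \<Longrightarrow> integrable lborel (\<lambda>x. g x * \<phi> x)"
    and zero: "\<And>\<phi>. \<phi> \<in> schwartz \<Longrightarrow> (LINT x|lborel. g x * \<phi> x) = 0"
  shows "g a = 0"
proof (rule ccontr)
  assume ga: "g a \<noteq> 0"
  \<comment> \<open>the phase of \<open>g a\<close> is removed to obtain a real function that is positive at \<open>a\<close>\<close>
  define h where "h x = Re (cnj (g a) * g x)" for x
  define m where "m = (norm (g a))\<^sup>2 / 2"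
  have m: "m > 0" using ga by (simp add: m_def)
  have ha: "h a > m"
    using ga by (simp add: h_def m_def complex_norm_square[symmetric] mult.commute[of "cnj (g a)"] flip: of_real_power)
  have hc: "continuous_on UNIV h" unfolding h_def by (intro continuous_intros cont)
  have "open {x. h x > m}" using open_Collect_less[OF continuous_on_const hc] .
  then obtain d where d: "d > 0" "ball a d \<subseteq> {x. h x > m}"
    using ha open_contains_ball by (metis mem_Collect_eq)
  define E where "E t x = exp (- t * (norm (x - a))\<^sup>2)" for t and x :: "real^'n"
  have E: "(\<lambda>x. complex_of_real (E t x)) \<in> schwartz" if "t > 0" for t
    using schwartz_affine[OF gauss_schwartz, of "sqrt t" "- (sqrt t *\<^sub>R a)"] that
    by (simp add: gauss_def E_def[abs_def] power_mult_distrib flip: scaleR_diff_right)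
  have hint: "integrable lborel (\<lambda>x. h x * E t x)" and hzero: "(LINT x|lborel. h x * E t x) = 0" if t: "t > 0" for t
  proof -
    have eq: "h x * E t x = Re (cnj (g a) * (g x * complex_of_real (E t x)))" for x
      by (simp add: h_def algebra_simps)
    have i: "integrable lborel (\<lambda>x. cnj (g a) * (g x * complex_of_real (E t x)))"
      using int[OF E[OF t]] by simp
    show "integrable lborel (\<lambda>x. h x * E t x)" unfolding eq using i by (rule integrable_Re)
    show "(LINT x|lborel. h x * E t x) = 0"
      unfolding eq integral_Re[OF i] using zero[OF E[OF t]] by simp
  qed
  define A where "A = ball a (d / 2)"
  define M where "M = (LINT x|lborel. \<bar>h x * E 1 x\<bar>)"
  have vol: "measure lborel A > 0"
    unfolding A_def using d(1) by (simp add: content_ball_pos)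
  have key: "m * measure lborel A * exp (- (d\<^sup>2 / 4)) \<le> exp (- (real k * (3 * d\<^sup>2 / 4))) * M" for k :: nat
  proof -
    let ?c = "exp (- (real k + 1) * (d\<^sup>2 / 4))"
    have le: "m * ?c * indicator A x - exp (- (real k) * d\<^sup>2) * \<bar>h x * E 1 x\<bar> \<le> h x * E (real k + 1) x" for x
    proof (cases "x \<in> ball a d")
      case True
      then have hx: "h x > m" using d by auto
      have "m * ?c * indicator A x \<le> h x * E (real k + 1) x"
      proof (cases "x \<in> A")
        case True
        then have "norm (x - a) \<le> d / 2" by (simp add: A_def dist_norm norm_minus_commute)
        then have "(norm (x - a))\<^sup>2 \<le> (d / 2)\<^sup>2" by (intro power_mono) auto
        then have "?c \<le> E (real k + 1) x"
          unfolding E_def by (simp add: power_divide mult_left_mono)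
        then show ?thesis using hx m True by (auto intro!: mult_mono)
      qed (use hx m in \<open>auto simp: E_def\<close>)
      moreover have "0 \<le> exp (- (real k) * d\<^sup>2) * \<bar>h x * E 1 x\<bar>" by simp
      ultimately show ?thesis by linarith
    next
      case False
      then have x: "d \<le> norm (x - a)" by (simp add: dist_norm norm_minus_commute)
      then have "x \<notin> A" using d(1) by (auto simp: A_def dist_norm norm_minus_commute)
      have "d\<^sup>2 \<le> (norm (x - a))\<^sup>2" using x d(1) by (intro power_mono) auto
      then have "E (real k) x \<le> exp (- (real k) * d\<^sup>2)" by (simp add: E_def mult_left_mono)
      then have "\<bar>h x * E 1 x\<bar> * E (real k) x \<le> \<bar>h x * E 1 x\<bar> * exp (- (real k) * d\<^sup>2)"
        by (intro mult_left_mono) auto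
      moreover have "E (real k + 1) x = E 1 x * E (real k) x"
        by (simp add: E_def algebra_simps flip: exp_add)
      moreover have "- (\<bar>h x * E 1 x\<bar> * E (real k) x) \<le> h x * E 1 x * E (real k) x"
        by (smt (verit) E_def exp_gt_zero abs_mult abs_of_pos minus_mult_left mult_right_mono abs_le_iff abs_ge_self)
      ultimately show ?thesis using \<open>x \<notin> A\<close> by (simp add: mult_ac)
    qed
    have iA: "integrable lborel (\<lambda>x. m * ?c * indicator A x)"
      unfolding A_def by (intro integrable_mult_right integrable_real_indicator) (auto intro: emeasure_bounded_finite[OF bounded_ball, unfolded infinity_ennreal_def])
    have iM: "integrable lborel (\<lambda>x. exp (- (real k) * d\<^sup>2) * \<bar>h x * E 1 x\<bar>)"
      using hint[of 1] by (intro integrable_mult_right integrable_abs) auto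
    have "(LINT x|lborel. m * ?c * indicator A x - exp (- (real k) * d\<^sup>2) * \<bar>h x * E 1 x\<bar>) \<le> (LINT x|lborel. h x * E (real k + 1) x)"
      by (intro integral_mono Bochner_Integration.integrable_diff iA iM hint le) auto
    then have "m * ?c * measure lborel A - exp (- (real k) * d\<^sup>2) * M \<le> 0"
      using iA iM hzero[of "real k + 1"] by (simp add: Bochner_Integration.integral_diff M_def A_def)
    then have "m * ?c * measure lborel A * exp (real k * (d\<^sup>2 / 4)) \<le> exp (- (real k) * d\<^sup>2) * M * exp (real k * (d\<^sup>2 / 4))"
      by (intro mult_right_mono) auto
    moreover have "?c * exp (real k * (d\<^sup>2 / 4)) = exp (- (d\<^sup>2 / 4))"
      "exp (- (real k) * d\<^sup>2) * exp (real k * (d\<^sup>2 / 4)) = exp (- (real k * (3 * d\<^sup>2 / 4)))"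
      unfolding exp_add[symmetric] by (rule arg_cong[where f = exp], simp add: field_simps)+
    moreover have "m * ?c * measure lborel A * exp (real k * (d\<^sup>2 / 4)) =
        m * measure lborel A * (?c * exp (real k * (d\<^sup>2 / 4)))"
      "exp (- (real k) * d\<^sup>2) * M * exp (real k * (d\<^sup>2 / 4)) =
        (exp (- (real k) * d\<^sup>2) * exp (real k * (d\<^sup>2 / 4))) * M"
      by (simp_all only: mult_ac)
    ultimately show ?thesis by (simp only:)
  qed
  have "(\<lambda>k. exp (- (3 * d\<^sup>2 / 4)) ^ k * M) \<longlonglongrightarrow> 0 * M"
    using d(1) by (intro tendsto_intros LIMSEQ_realpow_zero) auto
  moreover have "exp (- (3 * d\<^sup>2 / 4)) ^ k = exp (- (real k * (3 * d\<^sup>2 / 4)))" for k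
    by (simp flip: exp_of_nat_mult)
  ultimately have "(\<lambda>k. exp (- (real k * (3 * d\<^sup>2 / 4))) * M) \<longlonglongrightarrow> 0" by simp
  from LIMSEQ_le_const[OF this] key have "m * measure lborel A * exp (- (d\<^sup>2 / 4)) \<le> 0" by blast
  then show False using m vol by (simp add: mult_le_0_iff)
qed

section \<open>Symmetry of second derivatives\<close>

lemma has_partials_diff:
  assumes "has_partials f F x" "has_partials g G x"
  shows "has_partials (\<lambda>x. f x - g x) (\<lambda>b x. F b x - G b x) x"
  using has_partials_add[OF assms(1) has_partials_cmult[OF assms(2), of "-1"]] by simp

lemma has_partials_imp_pd:
  assumes "has_partials f F x"
  shows "has_partials f (\<lambda>b. pd b f) x"
  using assms has_partials_differentiable differentiable_imp_has_partials by blast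

lemma pd_cong_open:
  assumes "open S" "x \<in> S" "\<And>y. y \<in> S \<Longrightarrow> f y = g y" "has_partials g G x" "b \<in> Basis"
  shows "pd b f x = pd b g x"
  using pd_has_partials[OF has_partials_cong_open[OF assms(4,1,2,3)] assms(5)] pd_has_partials[OF assms(4,5)]
  by simp

lemma directional_mvt:
  fixes f :: "'a::euclidean_space \<Rightarrow> complex" and M s :: real
  assumes "\<And>t. t \<in> {0..1} \<Longrightarrow> has_partials f G (p + (t * s) *\<^sub>R b)" and b: "b \<in> Basis"
    and "\<And>t. t \<in> {0..1} \<Longrightarrow> norm (G b (p + (t * s) *\<^sub>R b) - A) \<le> M"
  shows "norm (f (p + s *\<^sub>R b) - f p - s *\<^sub>R A) \<le> M * \<bar>s\<bar>"
proof -
  define g where "g t = f (p + (t * s) *\<^sub>R b) - (t * s) *\<^sub>R A" for t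
  have "norm (g (0 + 1) - g 0) \<le> DIM(real) * (M * \<bar>s\<bar>) * norm (1::real)"
  proof (rule has_partials_mvt[where G = "\<lambda>_ t. s *\<^sub>R (G b (p + (t * s) *\<^sub>R b) - A)"])
    fix t :: real assume t: "t \<in> {0..1}"
    have "(f has_derivative (\<lambda>h. \<Sum>c\<in>Basis. (h \<bullet> c) *\<^sub>R G c (p + (t * s) *\<^sub>R b))) (at (p + (t * s) *\<^sub>R b))"
      using assms(1)[OF t] by (simp add: has_partials_def)
    then have "((\<lambda>t. f (p + (t * s) *\<^sub>R b)) has_derivative (\<lambda>h. \<Sum>c\<in>Basis. (((h * s) *\<^sub>R b) \<bullet> c) *\<^sub>R G c (p + (t * s) *\<^sub>R b))) (at t)"
      by (intro has_derivative_compose[where f = "\<lambda>t. p + (t * s) *\<^sub>R b" and g = f])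
        (auto intro!: derivative_eq_intros)
    moreover have "(\<Sum>c\<in>Basis. (((h * s) *\<^sub>R b) \<bullet> c) *\<^sub>R G c (p + (t * s) *\<^sub>R b)) = (h * s) *\<^sub>R G b (p + (t * s) *\<^sub>R b)" for h
    proof -
      have "(\<Sum>c\<in>Basis. (((h * s) *\<^sub>R b) \<bullet> c) *\<^sub>R G c (p + (t * s) *\<^sub>R b)) =
          (\<Sum>c\<in>Basis. if c = b then (h * s) *\<^sub>R G b (p + (t * s) *\<^sub>R b) else 0)"
        using b by (intro sum.cong) (auto simp: inner_Basis)
      then show ?thesis using b by simp
    qed
    ultimately have "((\<lambda>t. f (p + (t * s) *\<^sub>R b)) has_derivative (\<lambda>h. (h * s) *\<^sub>R G b (p + (t * s) *\<^sub>R b))) (at t)"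
      by simp
    then have "(g has_derivative (\<lambda>h. (h * s) *\<^sub>R (G b (p + (t * s) *\<^sub>R b) - A))) (at t)"
      unfolding g_def by (auto intro!: derivative_eq_intros simp: scaleR_diff_right)
    then have "has_partials g (\<lambda>_ t. s *\<^sub>R (G b (p + (t * s) *\<^sub>R b) - A)) t"
      by (simp add: has_partials_def)
    then show "has_partials g (\<lambda>_ t. s *\<^sub>R (G b (p + (t * s) *\<^sub>R b) - A)) (0 + t *\<^sub>R 1)" by simp
    show "norm (s *\<^sub>R (G b (p + ((0 + t *\<^sub>R 1) * s) *\<^sub>R b) - A)) \<le> M * \<bar>s\<bar>"
      using mult_right_mono[OF assms(3)[OF t], of "\<bar>s\<bar>"] by (simp add: mult.commute)
  qed
  then show ?thesis by (simp add: g_def algebra_simps)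
qed

text \<open>
  Both mixed derivatives are limits of the second difference \<open>Q\<close> divided by
  \<open>s\<^sup>2\<close>, and \<open>Q\<close> is symmetric in the two directions.
\<close>

lemma pd_commute:
  fixes f :: "'a::euclidean_space \<Rightarrow> complex"
  assumes S: "open S" "x \<in> S" and bc: "b \<in> Basis" "c \<in> Basis"
    and f: "\<And>y. y \<in> S \<Longrightarrow> has_partials f (\<lambda>b. pd b f) y"
    and f2: "\<And>y b. y \<in> S \<Longrightarrow> b \<in> Basis \<Longrightarrow> has_partials (pd b f) (\<lambda>c. pd c (pd b f)) y"
    and cont: "\<And>b c. b \<in> Basis \<Longrightarrow> c \<in> Basis \<Longrightarrow> continuous_on S (pd c (pd b f))"
  shows "pd c (pd b f) x = pd b (pd c f) x"
proof -
  define Q where "Q s b c = f (x + s *\<^sub>R b + s *\<^sub>R c) - f (x + s *\<^sub>R b) - f (x + s *\<^sub>R c) + f x" for s :: real and b c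
  have Q: "\<exists>d>0. \<forall>s. 0 < s \<and> s < d \<longrightarrow> norm (Q s b c - s *\<^sub>R s *\<^sub>R pd c (pd b f) x) \<le> e * s * s"
    if e: "e > 0" and bc: "b \<in> Basis" "c \<in> Basis" for e b c
  proof -
    define A where "A = pd c (pd b f) x"
    obtain d0 where d0: "d0 > 0" "ball x d0 \<subseteq> S" using S open_contains_ball by blast
    have "continuous (at x) (pd c (pd b f))"
      using cont[OF bc] S by (simp add: continuous_on_eq_continuous_at)
    then obtain d1 where d1: "d1 > 0" "\<And>y. dist y x < d1 \<Longrightarrow> dist (pd c (pd b f) y) A < e"
      using e unfolding continuous_at_eps_delta A_def by blast
    define d where "d = min d0 d1 / 2"
    have near: "x + (t * s) *\<^sub>R b + (t' * s) *\<^sub>R c \<in> S \<and> norm (pd c (pd b f) (x + (t * s) *\<^sub>R b + (t' * s) *\<^sub>R c) - A) \<le> e"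
      if "0 < s" "s < d" "t \<in> {0..1}" "t' \<in> {0..1}" for s t t'
    proof -
      have "norm ((t * s) *\<^sub>R b + (t' * s) *\<^sub>R c) \<le> t * s + t' * s"
        using norm_triangle_ineq[of "(t * s) *\<^sub>R b" "(t' * s) *\<^sub>R c"] that bc by (simp add: norm_Basis)
      also have "\<dots> \<le> 1 * s + 1 * s" using that by (intro add_mono mult_right_mono) auto
      also have "\<dots> < min d0 d1" using that by (simp add: d_def)
      finally have "dist (x + (t * s) *\<^sub>R b + (t' * s) *\<^sub>R c) x < min d0 d1" by (simp add: dist_norm add.assoc)
      then show ?thesis
        using subsetD[OF d0(2), of "x + (t * s) *\<^sub>R b + (t' * s) *\<^sub>R c"]
          d1(2)[of "x + (t * s) *\<^sub>R b + (t' * s) *\<^sub>R c"]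
        by (simp add: dist_commute) (simp add: dist_norm norm_minus_commute)
    qed
    have "norm (Q s b c - s *\<^sub>R s *\<^sub>R A) \<le> e * s * s" if s: "0 < s" "s < d" for s
    proof -
      \<comment> \<open>the second difference is a first difference of \<open>g\<close>, to which the mean value inequality applies twice\<close>
      define g where "g p = f (p + s *\<^sub>R c) - f p" for p
      have "norm (g (x + s *\<^sub>R b) - g x - s *\<^sub>R (s *\<^sub>R A)) \<le> (e * s) * \<bar>s\<bar>"
      proof (rule directional_mvt[where G = "\<lambda>b p. pd b f (p + s *\<^sub>R c) - pd b f p", OF _ bc(1)])
        fix t :: real assume t: "t \<in> {0..1}"
        have in_S: "x + (t * s) *\<^sub>R b \<in> S" "x + (t * s) *\<^sub>R b + s *\<^sub>R c \<in> S"
          using near[OF s t, of 0] near[OF s t, of 1] by auto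
        show "has_partials g (\<lambda>b p. pd b f (p + s *\<^sub>R c) - pd b f p) (x + (t * s) *\<^sub>R b)"
          unfolding g_def
          using has_partials_affine[of f "\<lambda>b. pd b f" 1 "x + (t * s) *\<^sub>R b" "s *\<^sub>R c"] f in_S
          by (intro has_partials_diff) auto
        have "norm (pd b f (x + (t * s) *\<^sub>R b + s *\<^sub>R c) - pd b f (x + (t * s) *\<^sub>R b) - s *\<^sub>R A) \<le> e * \<bar>s\<bar>"
          by (rule directional_mvt[where G = "\<lambda>c. pd c (pd b f)", OF _ bc(2)])
            (use near[OF s t] f2 bc(1) in auto)
        then show "norm (pd b f (x + (t * s) *\<^sub>R b + s *\<^sub>R c) - pd b f (x + (t * s) *\<^sub>R b) - s *\<^sub>R A) \<le> e * s"
          using s by simp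
      qed
      then show ?thesis using s by (simp add: g_def Q_def algebra_simps)
    qed
    then show ?thesis using d0 d1 by (intro exI[of _ d]) (auto simp: d_def A_def)
  qed
  have "norm (pd c (pd b f) x - pd b (pd c f) x) \<le> 0 + e" if e: "e > 0" for e
  proof -
    obtain d where d: "d > 0" "\<And>s. 0 < s \<and> s < d \<Longrightarrow> norm (Q s b c - s *\<^sub>R s *\<^sub>R pd c (pd b f) x) \<le> e / 2 * s * s"
      using Q[OF _ bc, of "e / 2"] e by auto
    obtain d' where d': "d' > 0" "\<And>s. 0 < s \<and> s < d' \<Longrightarrow> norm (Q s c b - s *\<^sub>R s *\<^sub>R pd b (pd c f) x) \<le> e / 2 * s * s"
      using Q[OF _ bc(2,1), of "e / 2"] e by auto
    define s where "s = min d d' / 2"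
    have s: "0 < s" "s < d" "s < d'" using d d' by (auto simp: s_def)
    have "Q s c b = Q s b c" by (simp add: Q_def algebra_simps)
    then have "norm (s *\<^sub>R s *\<^sub>R pd c (pd b f) x - s *\<^sub>R s *\<^sub>R pd b (pd c f) x) \<le> e / 2 * s * s + e / 2 * s * s"
      using d(2)[of s] d'(2)[of s] s norm_triangle_ineq4[of "Q s b c - s *\<^sub>R s *\<^sub>R pd b (pd c f) x" "Q s b c - s *\<^sub>R s *\<^sub>R pd c (pd b f) x"]
      by simp
    moreover have "norm (s *\<^sub>R s *\<^sub>R pd c (pd b f) x - s *\<^sub>R s *\<^sub>R pd b (pd c f) x) = (s * s) * norm (pd c (pd b f) x - pd b (pd c f) x)"
      using s by (simp flip: scaleR_diff_right add: mult.assoc)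
    ultimately have "(s * s) * norm (pd c (pd b f) x - pd b (pd c f) x) \<le> (s * s) * e" by (simp add: algebra_simps)
    then show ?thesis using s by simp
  qed
  then have "norm (pd c (pd b f) x - pd b (pd c f) x) \<le> 0" by (rule field_le_epsilon)
  then show ?thesis by simp
qed

text \<open>
  The form in which differentiability is proved below: a quadratic bound on the remainder survives the
  application of a linear form or of an integral.
\<close>

lemma has_partials_quadratic:
  fixes f :: "'a::euclidean_space \<Rightarrow> complex"
  assumes "d > 0" "\<And>h. norm h \<le> d \<Longrightarrow> norm (f (x + h) - f x - (\<Sum>b\<in>Basis. (h \<bullet> b) *\<^sub>R G b x)) \<le> C * (norm h)\<^sup>2"
  shows "has_partials f G x"
  unfolding has_partials_def has_derivative_at
proof
  show "bounded_linear (\<lambda>h. \<Sum>b\<in>Basis. (h \<bullet> b) *\<^sub>R G b x)"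
    by (intro bounded_linear_sum bounded_linear_scaleR_const bounded_linear_inner_left)
  show "(\<lambda>h. norm (f (x + h) - f x - (\<Sum>b\<in>Basis. (h \<bullet> b) *\<^sub>R G b x)) / norm h) \<midarrow>0\<rightarrow> 0"
  proof (rule Lim_null_comparison)
    show "\<forall>\<^sub>F h in at 0. norm (norm (f (x + h) - f x - (\<Sum>b\<in>Basis. (h \<bullet> b) *\<^sub>R G b x)) / norm h) \<le> C * norm h"
      unfolding eventually_at
    proof (intro exI[of _ d] conjI ballI impI)
      fix h :: 'a assume "h \<noteq> 0 \<and> dist h 0 < d"
      then show "norm (norm (f (x + h) - f x - (\<Sum>b\<in>Basis. (h \<bullet> b) *\<^sub>R G b x)) / norm h) \<le> C * norm h"
        using assms(2)[of h] by (simp add: divide_le_eq power2_eq_square mult.assoc)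
    qed (use assms(1) in auto)
    have "((\<lambda>h::'a. C * norm h) \<longlongrightarrow> C * norm (0::'a)) (at 0)" by (intro tendsto_intros)
    then show "((\<lambda>h::'a. C * norm h) \<longlongrightarrow> 0) (at 0)" by simp
  qed
qed

section \<open>Kernels on the half space\<close>

text \<open>
  The coefficients that arise when \<open>y\<^sup>r (|x|\<^sup>2 + y\<^sup>2)\<^sup>t\<close> is
  differentiated repeatedly. Their generators are bounded on strips \<open>0 < y\<^sub>0 \<le> y \<le>
  y\<^sub>1\<close> (the components of \<open>p\<close> occur only after division by \<open>p \<bullet>
  p\<close>), so on such strips the derivatives of a kernel decay as fast as the kernel.
\<close>

inductive_set kernel_algebra :: "((real^'n) \<times> real \<Rightarrow> real) set" where
  const: "(\<lambda>p. c) \<in> kernel_algebra"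
| height: "snd \<in> kernel_algebra"
| inverse_height: "(\<lambda>p. 1 / snd p) \<in> kernel_algebra"
| inverse_square: "(\<lambda>p. 1 / (p \<bullet> p)) \<in> kernel_algebra"
| component: "(\<lambda>p. (p \<bullet> v) / (p \<bullet> p)) \<in> kernel_algebra"
| add: "f \<in> kernel_algebra \<Longrightarrow> g \<in> kernel_algebra \<Longrightarrow> (\<lambda>p. f p + g p) \<in> kernel_algebra"
| mult: "f \<in> kernel_algebra \<Longrightarrow> g \<in> kernel_algebra \<Longrightarrow> (\<lambda>p. f p * g p) \<in> kernel_algebra"

lemma inner_sum_Basis: "(\<lambda>h::'a::euclidean_space. \<Sum>b\<in>Basis. (h \<bullet> b) * (b \<bullet> v)) = (\<lambda>h. h \<bullet> v)"
  by (rule ext, subst (3) euclidean_inner) (simp add: inner_commute)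

lemmas inner_sum = inner_sum_Basis[THEN fun_cong]

lemma sum_inner_mult: "(\<Sum>b\<in>Basis. (h \<bullet> b) * ((b \<bullet> v) * k)) = (h \<bullet> v) * k"
  for h v :: "'a::euclidean_space"
  unfolding mult.assoc[symmetric] sum_distrib_right[symmetric] inner_sum ..

lemma upper_half_inner_pos: "0 < snd p \<Longrightarrow> 0 < p \<bullet> (p :: (real^'n) \<times> real)"
  by (simp add: inner_prod_def add_nonneg_pos)

lemma kernel_algebra_derivative:
  assumes "a \<in> kernel_algebra"
  shows "\<exists>D. (\<forall>b. D b \<in> kernel_algebra) \<and>
    (\<forall>p. 0 < snd p \<longrightarrow> (a has_derivative (\<lambda>h. \<Sum>b\<in>Basis. (h \<bullet> b) * D b p)) (at p))"
  using assms
proof induction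
  case (const c)
  show ?case by (intro exI[of _ "\<lambda>b p. 0"]) (auto intro: kernel_algebra.intros)
next
  case height
  have "(snd has_derivative (\<lambda>h. \<Sum>b\<in>Basis. (h \<bullet> b) * (b \<bullet> (0, 1)))) (at p)" for p :: "(real^'a) \<times> real"
    unfolding inner_sum_Basis by (auto intro!: derivative_eq_intros simp: inner_prod_def)
  then show ?case by (intro exI[of _ "\<lambda>b p. b \<bullet> (0, 1)"]) (auto intro: kernel_algebra.intros)
next
  case inverse_height
  have "((\<lambda>p. 1 / snd p) has_derivative (\<lambda>h. \<Sum>b\<in>Basis. (h \<bullet> b) * (- (b \<bullet> (0, 1)) * ((1 / snd p) * (1 / snd p))))) (at p)"
    if "0 < snd p" for p :: "(real^'a) \<times> real"
  proof -
    have "(\<lambda>h :: (real^'a) \<times> real. \<Sum>b\<in>Basis. (h \<bullet> b) * (- (b \<bullet> (0, 1)) * ((1 / snd p) * (1 / snd p)))) =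
        (\<lambda>h. (h \<bullet> (0, 1)) * (- ((1 / snd p) * (1 / snd p))))"
    proof (rule ext)
      fix h :: "(real^'a) \<times> real"
      have "(\<Sum>b\<in>Basis. (h \<bullet> b) * (- (b \<bullet> (0, 1)) * ((1 / snd p) * (1 / snd p)))) =
          (\<Sum>b\<in>Basis. (h \<bullet> b) * (b \<bullet> (0, 1))) * (- ((1 / snd p) * (1 / snd p)))"
        unfolding sum_distrib_right by (intro sum.cong refl) simp
      then show "(\<Sum>b\<in>Basis. (h \<bullet> b) * (- (b \<bullet> (0, 1)) * ((1 / snd p) * (1 / snd p)))) =
          (h \<bullet> (0, 1)) * (- ((1 / snd p) * (1 / snd p)))"
        by (simp only: inner_sum)
    qed
    moreover have "((\<lambda>p. 1 / snd p) has_derivative (\<lambda>h. (h \<bullet> (0, 1)) * (- ((1 / snd p) * (1 / snd p))))) (at p)"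
      using that by (auto intro!: derivative_eq_intros simp: inner_prod_def field_simps)
    ultimately show ?thesis by simp
  qed
  moreover have "(\<lambda>p :: (real^'a) \<times> real. - (b \<bullet> (0, 1)) * ((1 / snd p) * (1 / snd p))) \<in> kernel_algebra" for b :: "(real^'a) \<times> real"
    by (intro kernel_algebra.intros)
  ultimately show ?case
    by (intro exI[of _ "\<lambda>b p. - (b \<bullet> (0, 1)) * ((1 / snd p) * (1 / snd p))"]) blast
next
  case inverse_square
  have "((\<lambda>p. 1 / (p \<bullet> p)) has_derivative (\<lambda>h. \<Sum>b\<in>Basis. (h \<bullet> b) * (- 2 * (((p \<bullet> b) / (p \<bullet> p)) * (1 / (p \<bullet> p)))))) (at p)"
    if "0 < snd p" for p :: "(real^'a) \<times> real"
  proof -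
    have "(\<Sum>b\<in>Basis. (h \<bullet> b) * (- 2 * (((p \<bullet> b) / (p \<bullet> p)) * (1 / (p \<bullet> p))))) =
        (h \<bullet> p) * (- 2 * ((1 / (p \<bullet> p)) * (1 / (p \<bullet> p))))" for h
      by (subst sum_inner_mult[symmetric]) (simp add: inner_commute mult_ac)
    moreover have "((\<lambda>p. 1 / (p \<bullet> p)) has_derivative (\<lambda>h. (h \<bullet> p) * (- 2 * ((1 / (p \<bullet> p)) * (1 / (p \<bullet> p)))))) (at p)"
      using upper_half_inner_pos[OF that]
      by (auto intro!: derivative_eq_intros simp: field_simps inner_commute)
    ultimately show ?thesis by simp
  qed
  moreover have "(\<lambda>p :: (real^'a) \<times> real. - 2 * (((p \<bullet> b) / (p \<bullet> p)) * (1 / (p \<bullet> p)))) \<in> kernel_algebra" for b :: "(real^'a) \<times> real"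
    by (intro kernel_algebra.intros)
  ultimately show ?case
    by (intro exI[of _ "\<lambda>b p. - 2 * (((p \<bullet> b) / (p \<bullet> p)) * (1 / (p \<bullet> p)))"]) blast
next
  case (component v)
  have "((\<lambda>p. (p \<bullet> v) / (p \<bullet> p)) has_derivative (\<lambda>h. \<Sum>b\<in>Basis. (h \<bullet> b) *
      ((b \<bullet> v) * (1 / (p \<bullet> p)) + (- 2) * (((p \<bullet> v) / (p \<bullet> p)) * ((p \<bullet> b) / (p \<bullet> p)))))) (at p)"
    if "0 < snd p" for p :: "(real^'a) \<times> real"
  proof -
    have "(\<Sum>b\<in>Basis. (h \<bullet> b) *
        ((b \<bullet> v) * (1 / (p \<bullet> p)) + (- 2) * (((p \<bullet> v) / (p \<bullet> p)) * ((p \<bullet> b) / (p \<bullet> p))))) =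
        (h \<bullet> v) * (1 / (p \<bullet> p)) + (h \<bullet> p) * (- 2 * (((p \<bullet> v) / (p \<bullet> p)) * (1 / (p \<bullet> p))))" for h
    proof -
      have "(\<Sum>b\<in>Basis. (h \<bullet> b) *
          ((b \<bullet> v) * (1 / (p \<bullet> p)) + (- 2) * (((p \<bullet> v) / (p \<bullet> p)) * ((p \<bullet> b) / (p \<bullet> p))))) =
          (\<Sum>b\<in>Basis. (h \<bullet> b) * ((b \<bullet> v) * (1 / (p \<bullet> p)))) +
          (\<Sum>b\<in>Basis. (h \<bullet> b) * ((b \<bullet> p) * (- 2 * (((p \<bullet> v) / (p \<bullet> p)) * (1 / (p \<bullet> p))))))"
        unfolding sum.distrib[symmetric]
        by (intro sum.cong refl) (simp add: algebra_simps inner_commute)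
      then show ?thesis by (simp only: sum_inner_mult)
    qed
    moreover have "((\<lambda>p. (p \<bullet> v) / (p \<bullet> p)) has_derivative
        (\<lambda>h. (h \<bullet> v) * (1 / (p \<bullet> p)) + (h \<bullet> p) * (- 2 * (((p \<bullet> v) / (p \<bullet> p)) * (1 / (p \<bullet> p)))))) (at p)"
      using upper_half_inner_pos[OF that]
      by (auto intro!: derivative_eq_intros simp: field_simps inner_commute)
    ultimately show ?thesis by simp
  qed
  moreover have "(\<lambda>p :: (real^'a) \<times> real. (b \<bullet> v) * (1 / (p \<bullet> p)) + (- 2) * (((p \<bullet> v) / (p \<bullet> p)) * ((p \<bullet> b) / (p \<bullet> p)))) \<in> kernel_algebra" for b :: "(real^'a) \<times> real"
    by (intro kernel_algebra.intros)
  ultimately show ?case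
    by (intro exI[of _ "\<lambda>b p. (b \<bullet> v) * (1 / (p \<bullet> p)) + (- 2) * (((p \<bullet> v) / (p \<bullet> p)) * ((p \<bullet> b) / (p \<bullet> p)))"]) blast
next
  case (add f g)
  then obtain D E where "\<forall>b. D b \<in> kernel_algebra" "\<forall>p. 0 < snd p \<longrightarrow> (f has_derivative (\<lambda>h. \<Sum>b\<in>Basis. (h \<bullet> b) * D b p)) (at p)"
    "\<forall>b. E b \<in> kernel_algebra" "\<forall>p. 0 < snd p \<longrightarrow> (g has_derivative (\<lambda>h. \<Sum>b\<in>Basis. (h \<bullet> b) * E b p)) (at p)" by auto
  then show ?case
    by (intro exI[of _ "\<lambda>b p. D b p + E b p"])
      (auto intro!: kernel_algebra.intros derivative_eq_intros simp: distrib_left sum.distrib)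
next
  case (mult f g)
  then obtain D E where "\<forall>b. D b \<in> kernel_algebra" "\<forall>p. 0 < snd p \<longrightarrow> (f has_derivative (\<lambda>h. \<Sum>b\<in>Basis. (h \<bullet> b) * D b p)) (at p)"
    "\<forall>b. E b \<in> kernel_algebra" "\<forall>p. 0 < snd p \<longrightarrow> (g has_derivative (\<lambda>h. \<Sum>b\<in>Basis. (h \<bullet> b) * E b p)) (at p)" by auto
  with mult show ?case
    by (intro exI[of _ "\<lambda>b p. f p * E b p + D b p * g p"])
      (auto intro!: kernel_algebra.intros derivative_eq_intros
        simp: distrib_left sum.distrib sum_distrib_left sum_distrib_right mult_ac)
qed

lemma kernel_algebra_bounded:
  assumes "a \<in> kernel_algebra" "0 < y0"
  shows "\<exists>C\<ge>0. \<forall>p. y0 \<le> snd p \<and> snd p \<le> y1 \<longrightarrow> \<bar>a p\<bar> \<le> C"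
  using assms(1)
proof induction
  case (const c)
  show ?case by (intro exI[of _ "\<bar>c\<bar>"]) auto
next
  case height
  show ?case using assms(2) by (intro exI[of _ "\<bar>y1\<bar>"]) auto
next
  case inverse_height
  show ?case using assms(2) by (intro exI[of _ "1 / y0"]) (auto simp: field_simps)
next
  case inverse_square
  have "\<bar>1 / (p \<bullet> p)\<bar> \<le> 1 / y0\<^sup>2" if "y0 \<le> snd p" for p :: "(real^'a) \<times> real"
  proof -
    have "y0\<^sup>2 \<le> (snd p)\<^sup>2" using that assms(2) by (intro power_mono) auto
    also have "\<dots> \<le> p \<bullet> p" by (simp add: inner_prod_def power2_eq_square)
    finally have "y0\<^sup>2 \<le> p \<bullet> p" .
    then show ?thesis using assms(2) by (auto intro!: divide_left_mono mult_pos_pos elim: less_le_trans[rotated])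
  qed
  then show ?case by (intro exI[of _ "1 / y0\<^sup>2"]) auto
next
  case (component v)
  have "\<bar>(p \<bullet> v) / (p \<bullet> p)\<bar> \<le> norm v / y0" if "y0 \<le> snd p" for p :: "(real^'a) \<times> real"
  proof -
    have "y0 \<le> norm p" using that norm_snd_le[of "snd p" "fst p"] by simp
    have pp: "p \<bullet> p = norm p * norm p" by (simp flip: power2_norm_eq_inner add: power2_eq_square)
    have "\<bar>p \<bullet> v\<bar> / (norm p * norm p) \<le> (norm p * norm v) / (norm p * norm p)"
      by (intro divide_right_mono Cauchy_Schwarz_ineq2) auto
    also have "\<dots> = norm v / norm p" using \<open>y0 \<le> norm p\<close> assms(2) by auto
    also have "\<dots> \<le> norm v / y0" using \<open>y0 \<le> norm p\<close> assms(2) by (intro divide_left_mono mult_pos_pos) auto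
    finally show ?thesis by (simp add: pp abs_mult)
  qed
  then show ?case using assms(2) by (intro exI[of _ "norm v / y0"]) auto
next
  case (add f g)
  then obtain C D where "C \<ge> 0" "\<forall>p. y0 \<le> snd p \<and> snd p \<le> y1 \<longrightarrow> \<bar>f p\<bar> \<le> C"
    "D \<ge> 0" "\<forall>p. y0 \<le> snd p \<and> snd p \<le> y1 \<longrightarrow> \<bar>g p\<bar> \<le> D" by auto
  then show ?case
    by (intro exI[of _ "C + D"]) (auto intro!: order_trans[OF abs_triangle_ineq] add_mono)
next
  case (mult f g)
  then obtain C D where "C \<ge> 0" "\<forall>p. y0 \<le> snd p \<and> snd p \<le> y1 \<longrightarrow> \<bar>f p\<bar> \<le> C"
    "D \<ge> 0" "\<forall>p. y0 \<le> snd p \<and> snd p \<le> y1 \<longrightarrow> \<bar>g p\<bar> \<le> D" by auto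
  then show ?case
    by (intro exI[of _ "C * D"]) (auto simp: abs_mult intro!: mult_mono)
qed

definition kernel_base :: "real \<Rightarrow> real \<Rightarrow> (real^'n) \<times> real \<Rightarrow> real" where
  "kernel_base r t p = snd p powr r * (p \<bullet> p) powr t"

text \<open>
  A class of functions closed under partial derivatives, with the exponents \<open>r\<close> and
  \<open>t\<close> fixed: loss of powers is recorded in the coefficient.
\<close>

definition kernels :: "real \<Rightarrow> real \<Rightarrow> ((real^'n) \<times> real \<Rightarrow> complex) set" where
  "kernels r t = {g. \<exists>a\<in>kernel_algebra. \<forall>p. 0 < snd p \<longrightarrow> g p = complex_of_real (a p * kernel_base r t p)}"

lemma kernel_base_derivative:
  fixes p :: "(real^'n) \<times> real"
  assumes "0 < snd p"
  shows "(kernel_base r t has_derivative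
    (\<lambda>h. (r * snd h / snd p + 2 * t * (p \<bullet> h) / (p \<bullet> p)) * kernel_base r t p)) (at p)"
proof -
  have eq: "kernel_base r t q = exp (r * ln (snd q) + t * ln (q \<bullet> q))" if "0 < snd q" for q :: "(real^'n) \<times> real"
    using that upper_half_inner_pos[OF that] by (simp add: kernel_base_def powr_def exp_add)
  have "((\<lambda>q. exp (r * ln (snd q) + t * ln (q \<bullet> q))) has_derivative
    (\<lambda>h. (r * snd h / snd p + 2 * t * (p \<bullet> h) / (p \<bullet> p)) * exp (r * ln (snd p) + t * ln (p \<bullet> p)))) (at p)"
    using assms upper_half_inner_pos[OF assms]
    by (auto intro!: derivative_eq_intros simp: field_simps inner_commute)
  moreover have "open {q :: (real^'n) \<times> real. 0 < snd q}"
    by (intro open_Collect_less continuous_intros)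
  ultimately show ?thesis
    unfolding eq[OF assms]
    by (rule has_derivative_transform_within_open) (use assms eq in auto)
qed

lemma kernel_has_partials:
  assumes "0 < snd p" "(a has_derivative (\<lambda>h. \<Sum>b\<in>Basis. (h \<bullet> b) * D b p)) (at p)"
  shows "has_partials (\<lambda>p. complex_of_real (a p * kernel_base r t p))
    (\<lambda>b p. complex_of_real ((D b p + a p * (r * snd b * (1 / snd p) + 2 * t * ((p \<bullet> b) / (p \<bullet> p)))) * kernel_base r t p)) p"
proof -
  let ?K = "kernel_base r t p"
  have k: "(kernel_base r t has_derivative
      (\<lambda>h. \<Sum>b\<in>Basis. (h \<bullet> b) * ((r * snd b * (1 / snd p) + 2 * t * ((p \<bullet> b) / (p \<bullet> p))) * ?K))) (at p)"
  proof -
    have "(\<lambda>h. (r * snd h / snd p + 2 * t * (p \<bullet> h) / (p \<bullet> p)) * ?K) =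
        (\<lambda>h. (h \<bullet> (0, 1)) * (r / snd p * ?K) + (h \<bullet> p) * (2 * t / (p \<bullet> p) * ?K))"
      by (auto simp: inner_prod_def algebra_simps inner_commute)
    also have "\<dots> = (\<lambda>h. \<Sum>b\<in>Basis. (h \<bullet> b) * ((r * snd b * (1 / snd p) + 2 * t * ((p \<bullet> b) / (p \<bullet> p))) * ?K))"
    proof (rule ext)
      fix h :: "(real^'a) \<times> real"
      have "(h \<bullet> (0, 1)) * (r / snd p * ?K) + (h \<bullet> p) * (2 * t / (p \<bullet> p) * ?K) =
          (\<Sum>b\<in>Basis. (h \<bullet> b) * (b \<bullet> (0, 1))) * (r / snd p * ?K) + (\<Sum>b\<in>Basis. (h \<bullet> b) * (b \<bullet> p)) * (2 * t / (p \<bullet> p) * ?K)"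
        by (simp only: inner_sum)
      also have "\<dots> = (\<Sum>b\<in>Basis. (h \<bullet> b) * ((r * snd b * (1 / snd p) + 2 * t * ((p \<bullet> b) / (p \<bullet> p))) * ?K))"
        unfolding sum_distrib_right sum.distrib[symmetric]
      proof (intro sum.cong refl)
        fix b :: "(real^'a) \<times> real"
        have "b \<bullet> (0, 1) = snd b" by (simp add: inner_prod_def)
        then show "(h \<bullet> b) * (b \<bullet> (0, 1)) * (r / snd p * ?K) + (h \<bullet> b) * (b \<bullet> p) * (2 * t / (p \<bullet> p) * ?K) =
            (h \<bullet> b) * ((r * snd b * (1 / snd p) + 2 * t * ((p \<bullet> b) / (p \<bullet> p))) * ?K)"
          by (simp add: algebra_simps inner_commute[of b p])
      qed
      finally show "(h \<bullet> (0, 1)) * (r / snd p * ?K) + (h \<bullet> p) * (2 * t / (p \<bullet> p) * ?K) =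
          (\<Sum>b\<in>Basis. (h \<bullet> b) * ((r * snd b * (1 / snd p) + 2 * t * ((p \<bullet> b) / (p \<bullet> p))) * ?K))" .
    qed
    finally show ?thesis using kernel_base_derivative[OF assms(1), of r t] by simp
  qed
  have "((\<lambda>p. a p * kernel_base r t p) has_derivative (\<lambda>h. \<Sum>b\<in>Basis. (h \<bullet> b) *
      ((D b p + a p * (r * snd b * (1 / snd p) + 2 * t * ((p \<bullet> b) / (p \<bullet> p)))) * ?K))) (at p)"
    by (rule has_derivative_eq_rhs[OF has_derivative_mult[OF assms(2) k]])
      (simp add: sum_distrib_left sum_distrib_right sum.distrib[symmetric] algebra_simps)
  then have "((\<lambda>p. complex_of_real (a p * kernel_base r t p)) has_derivative
      (\<lambda>h. complex_of_real (\<Sum>b\<in>Basis. (h \<bullet> b) *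
        ((D b p + a p * (r * snd b * (1 / snd p) + 2 * t * ((p \<bullet> b) / (p \<bullet> p)))) * ?K)))) (at p)"
    by (rule has_derivative_of_real)
  then show ?thesis
    by (simp add: has_partials_def scaleR_conv_of_real)
qed

lemma open_upper_half: "open {p :: (real^'n) \<times> real. 0 < snd p}"
  by (intro open_Collect_less continuous_intros)

lemma kernels_has_partials:
  assumes g: "g \<in> kernels r t"
  shows "0 < snd p \<Longrightarrow> has_partials g (\<lambda>b. pd b g) p"
    and "b \<in> Basis \<Longrightarrow> pd b g \<in> kernels r t"
proof -
  obtain a where a: "a \<in> kernel_algebra" "\<And>p. 0 < snd p \<Longrightarrow> g p = complex_of_real (a p * kernel_base r t p)"
    using g by (auto simp: kernels_def)
  obtain D where D: "\<And>b. D b \<in> kernel_algebra"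
    "\<And>p. 0 < snd p \<Longrightarrow> (a has_derivative (\<lambda>h. \<Sum>b\<in>Basis. (h \<bullet> b) * D b p)) (at p)"
    using kernel_algebra_derivative[OF a(1)] by blast
  define E where "E b p = D b p + a p * (r * snd b * (1 / snd p) + 2 * t * ((p \<bullet> b) / (p \<bullet> p)))" for b p
  have hp: "has_partials g (\<lambda>b p. complex_of_real (E b p * kernel_base r t p)) p" if "0 < snd p" for p
    unfolding E_def
    by (rule has_partials_cong_open[OF kernel_has_partials[where a = a and D = D, OF that D(2)[OF that]] open_upper_half])
      (use that a(2) in auto)
  show "0 < snd p \<Longrightarrow> has_partials g (\<lambda>b. pd b g) p"
    using has_partials_imp_pd[OF hp] .
  have "E b \<in> kernel_algebra" for b
    unfolding E_def by (intro kernel_algebra.intros a D)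
  then show "pd b g \<in> kernels r t" if "b \<in> Basis"
    unfolding kernels_def using pd_has_partials[OF hp that] by blast
qed

lemma kernels_iter_pd:
  assumes "g \<in> kernels r t" "vs \<in> lists Basis"
  shows "iter_pd vs g \<in> kernels r t"
  using assms(2) by (induction vs) (auto simp: assms(1) kernels_has_partials(2))

lemma kernels_continuous: "g \<in> kernels r t \<Longrightarrow> continuous_on {p. 0 < snd p} g"
  by (intro continuous_at_imp_continuous_on ballI)
    (auto dest!: kernels_has_partials(1) simp: has_partials_def dest: has_derivative_continuous)

lemma kernels_pd_commute:
  assumes g: "g \<in> kernels r t" and p: "0 < snd p" and bc: "b \<in> Basis" "c \<in> Basis"
  shows "pd c (pd b g) p = pd b (pd c g) p"
  by (rule pd_commute[OF open_upper_half, where f = g])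
    (use p bc g in \<open>auto intro: kernels_has_partials kernels_continuous\<close>)

text \<open>
  Needed to recognise the derivative of a Taylor remainder as the Taylor remainder of a derivative.
\<close>

lemma kernels_iter_pd_commute:
  assumes g: "g \<in> kernels r t" and b: "b \<in> Basis" and vs: "vs \<in> lists Basis" and p: "0 < snd p"
  shows "pd b (iter_pd vs g) p = iter_pd vs (pd b g) p"
  using vs p
proof (induction vs arbitrary: p)
  case (Cons v vs)
  then have v: "v \<in> Basis" and vs: "vs \<in> lists Basis" by auto
  have "pd b (pd v (iter_pd vs g)) p = pd v (pd b (iter_pd vs g)) p"
    by (rule kernels_pd_commute[OF kernels_iter_pd[OF g vs] Cons.prems v b])
  also have "\<dots> = pd v (iter_pd vs (pd b g)) p"
    by (rule pd_cong_open[OF open_upper_half])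
      (use Cons v vs g b in \<open>auto intro: kernels_has_partials kernels_iter_pd\<close>)
  finally show ?case by simp
qed simp

lemma kernel_base_bound:
  assumes "0 < y0"
  shows "\<exists>C\<ge>0. \<forall>p :: (real^'n) \<times> real. y0 \<le> snd p \<and> snd p \<le> y1 \<longrightarrow> \<bar>kernel_base r t p\<bar> \<le> C * wt t (fst p)"
proof -
  have 1: "\<exists>C. \<forall>u\<in>{a..b}. \<bar>u powr q\<bar> \<le> C" if "0 < a" for a b q :: real
  proof -
    have "continuous_on {a..b} (\<lambda>u. u powr q)" using that by (intro continuous_intros) auto
    then have "bounded ((\<lambda>u. u powr q) ` {a..b})" by (intro compact_imp_bounded compact_continuous_image) auto
    then show ?thesis by (auto simp: bounded_iff)
  qed
  define m where "m = min 1 (y0\<^sup>2)"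
  define M where "M = max 1 (y1\<^sup>2)"
  have m: "m > 0" using assms by (simp add: m_def)
  obtain C where C: "\<And>u. u \<in> {y0..y1} \<Longrightarrow> \<bar>u powr r\<bar> \<le> C" using 1[OF assms] by blast
  obtain D where D: "\<And>u. u \<in> {m..M} \<Longrightarrow> \<bar>u powr t\<bar> \<le> D" using 1[OF m] by blast
  have "\<bar>kernel_base r t p\<bar> \<le> (\<bar>C\<bar> * \<bar>D\<bar>) * wt t (fst p)" if p: "y0 \<le> snd p" "snd p \<le> y1" for p :: "(real^'n) \<times> real"
  proof -
    \<comment> \<open>on the strip this quotient stays in a compact interval of positive numbers\<close>
    define q where "q = (p \<bullet> p) / (1 + (norm (fst p))\<^sup>2)"
    have pp: "p \<bullet> p = (norm (fst p))\<^sup>2 + (snd p)\<^sup>2"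
      by (simp add: inner_prod_def power2_norm_eq_inner power2_eq_square[of "snd p"])
    have "y0\<^sup>2 \<le> (snd p)\<^sup>2" "(snd p)\<^sup>2 \<le> y1\<^sup>2" using p assms by (auto intro!: power_mono)
    then have y: "m \<le> (snd p)\<^sup>2" "(snd p)\<^sup>2 \<le> M" by (auto simp: m_def M_def)
    have "m * (norm (fst p))\<^sup>2 \<le> 1 * (norm (fst p))\<^sup>2" "1 * (norm (fst p))\<^sup>2 \<le> M * (norm (fst p))\<^sup>2"
      by (intro mult_right_mono; simp add: m_def M_def)+
    with y have "m * (1 + (norm (fst p))\<^sup>2) \<le> p \<bullet> p" "p \<bullet> p \<le> M * (1 + (norm (fst p))\<^sup>2)"
      by (auto simp: pp algebra_simps)
    then have q: "q \<in> {m..M}"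
      using one_plus_norm2_pos[of "fst p"] by (simp add: q_def field_simps)
    have "p \<bullet> p = q * (1 + (norm (fst p))\<^sup>2)" using one_plus_norm2_pos[of "fst p"] by (simp add: q_def)
    then have "kernel_base r t p = snd p powr r * (q powr t * wt t (fst p))"
      using q m by (simp add: kernel_base_def wt_def powr_mult)
    moreover have "\<bar>snd p powr r\<bar> * (\<bar>q powr t\<bar> * wt t (fst p)) \<le> \<bar>C\<bar> * (\<bar>D\<bar> * wt t (fst p))"
      using C[of "snd p"] D[OF q] p by (intro mult_mono mult_right_mono) (auto simp: wt_nonneg)
    ultimately show ?thesis by (simp add: abs_mult wt_nonneg mult.assoc)
  qed
  then show ?thesis by (intro exI[of _ "\<bar>C\<bar> * \<bar>D\<bar>"]) auto
qed

lemma kernels_bound: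
  assumes "g \<in> kernels r t" "0 < y0"
  shows "\<exists>C\<ge>0. \<forall>p. y0 \<le> snd p \<and> snd p \<le> y1 \<longrightarrow> norm (g p) \<le> C * wt t (fst p)"
proof -
  obtain a where a: "a \<in> kernel_algebra" "\<And>p. 0 < snd p \<Longrightarrow> g p = complex_of_real (a p * kernel_base r t p)"
    using assms by (auto simp: kernels_def)
  obtain C where C: "C \<ge> 0" "\<And>p. y0 \<le> snd p \<and> snd p \<le> y1 \<Longrightarrow> \<bar>a p\<bar> \<le> C"
    using kernel_algebra_bounded[OF a(1) assms(2), of y1] by blast
  obtain D where D: "D \<ge> 0" "\<And>p::(real^'a) \<times> real. y0 \<le> snd p \<and> snd p \<le> y1 \<Longrightarrow> \<bar>kernel_base r t p\<bar> \<le> D * wt t (fst p)"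
    using kernel_base_bound[OF assms(2), of y1 r t] by blast
  have "norm (g p) \<le> (C * D) * wt t (fst p)" if p: "y0 \<le> snd p \<and> snd p \<le> y1" for p
  proof -
    have "0 < snd p" using p assms(2) by linarith
    then have "norm (g p) = \<bar>a p\<bar> * \<bar>kernel_base r t p\<bar>" using a(2)[of p] by (simp add: norm_mult)
    also have "\<dots> \<le> C * (D * wt t (fst p))" using C(2)[OF p] D(2)[OF p] C(1) by (intro mult_mono) auto
    finally show ?thesis by (simp add: mult.assoc)
  qed
  then show ?thesis using C(1) D(1) by (intro exI[of _ "C * D"]) auto
qed

lemma wt_shift: "wt t (x + h) \<le> 2 powr \<bar>t\<bar> * wt t x * wt \<bar>t\<bar> h"
proof (cases "0 \<le> t")
  case True
  then show ?thesis using wt_peetre[of t x h] by simp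
next
  case False
  then show ?thesis using wt_peetre_minus[of "- t" "x + h" "- h"] by (simp add: wt_uminus)
qed

text \<open>
  The remainder inherits the decay of the kernel at \<open>p\<close>: by Peetre's inequality the weight
  changes by a bounded factor along a segment of length at most 1.
\<close>

lemma kernels_taylor:
  fixes g :: "(real^'n) \<times> real \<Rightarrow> complex"
  assumes g: "g \<in> kernels r t" and y: "0 < y0"
  shows "\<exists>C\<ge>0. \<forall>p h. norm h \<le> 1 \<and> y0 \<le> snd p \<and> snd p \<le> y1 \<and> y0 \<le> snd (p + h) \<and> snd (p + h) \<le> y1 \<longrightarrow>
      norm (g (p + h) - g p - (\<Sum>b\<in>Basis. (h \<bullet> b) *\<^sub>R pd b g p)) \<le> C * ((norm h)\<^sup>2 * wt t (fst p))"
proof -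
  let ?d = "real DIM((real^'n) \<times> real)"
  have "\<exists>C\<ge>0. \<forall>p. y0 \<le> snd p \<and> snd p \<le> y1 \<longrightarrow> norm (pd c (pd b g) p) \<le> C * wt t (fst p)"
    if "b \<in> Basis" "c \<in> Basis" for b c
    by (rule kernels_bound[OF kernels_has_partials(2)[OF kernels_has_partials(2)[OF g that(1)] that(2)] y])
  then obtain C0 where C0: "\<And>b c p. b \<in> Basis \<Longrightarrow> c \<in> Basis \<Longrightarrow> y0 \<le> snd p \<and> snd p \<le> y1 \<Longrightarrow>
      norm (pd c (pd b g) p) \<le> C0 b c * wt t (fst p)" by metis
  define C where "C = (\<Sum>b\<in>Basis. \<Sum>c\<in>Basis. \<bar>C0 b c\<bar>)"
  have C: "C \<ge> 0" unfolding C_def by (intro sum_nonneg) auto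
  have "\<bar>C0 b c\<bar> \<le> C" if "b \<in> Basis" "c \<in> Basis" for b c
  proof -
    have "\<bar>C0 b c\<bar> \<le> (\<Sum>c\<in>Basis. \<bar>C0 b c\<bar>)" using that by (intro member_le_sum) auto
    also have "\<dots> \<le> C" unfolding C_def using that
      by (intro member_le_sum[of b Basis "\<lambda>b. \<Sum>c\<in>Basis. \<bar>C0 b c\<bar>"]) (auto intro: sum_nonneg)
    finally show ?thesis .
  qed
  then have C2: "norm (pd c (pd b g) p) \<le> C * wt t (fst p)"
    if "b \<in> Basis" "c \<in> Basis" "y0 \<le> snd p \<and> snd p \<le> y1" for b c p
    using C0[OF that] mult_right_mono[of "C0 b c" C "wt t (fst p)"] that wt_nonneg[of t "fst p"]
    by (meson abs_ge_self order_trans)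
  define L where "L = C * (2 powr \<bar>t\<bar> * 2 powr \<bar>t\<bar>)"
  have L: "L \<ge> 0" using C by (simp add: L_def)
  have seg: "y0 \<le> snd (p + s *\<^sub>R h) \<and> snd (p + s *\<^sub>R h) \<le> y1"
    if "y0 \<le> snd p" "snd p \<le> y1" "y0 \<le> snd (p + h)" "snd (p + h) \<le> y1" "s \<in> {0..1}" for p h :: "(real^'n) \<times> real" and s
  proof -
    have "snd (p + s *\<^sub>R h) = (1 - s) * snd p + s * snd (p + h)" by (simp add: algebra_simps)
    moreover have "(1 - s) * y0 + s * y0 \<le> (1 - s) * snd p + s * snd (p + h)"
      using that by (intro add_mono mult_left_mono) auto
    moreover have "(1 - s) * snd p + s * snd (p + h) \<le> (1 - s) * y1 + s * y1"
      using that by (intro add_mono mult_left_mono) auto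
    ultimately show ?thesis by (simp add: algebra_simps)
  qed
  have "norm (g (p + h) - g p - (\<Sum>b\<in>Basis. (h \<bullet> b) *\<^sub>R pd b g p)) \<le> (?d * (?d * L)) * ((norm h)\<^sup>2 * wt t (fst p))"
    if h: "norm h \<le> 1" and p: "y0 \<le> snd p" "snd p \<le> y1" "y0 \<le> snd (p + h)" "snd (p + h) \<le> y1" for p h
  proof -
    have pos: "0 < snd (p + s *\<^sub>R h)" if "s \<in> {0..1}" for s using seg[OF p that] y by linarith
    have "norm (g (p + h) - g p - (\<Sum>b\<in>Basis. (h \<bullet> b) *\<^sub>R pd b g p)) \<le>
        ?d * (?d * (L * wt t (fst p)) * norm h) * norm h"
    proof (rule has_partials_taylor[OF kernels_has_partials(1)[OF g pos]])
      fix s :: real and b :: "(real^'n) \<times> real" assume s: "s \<in> {0..1}" and b: "b \<in> Basis"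
      have sh: "norm (u *\<^sub>R s *\<^sub>R h) \<le> 1" if "u \<in> {0..1}" for u
        using that s h by (simp add: mult_le_one)
      have us: "u * s \<in> {0..1}" if "u \<in> {0..1}" for u using that s by (auto simp: mult_le_one)
      have "norm (pd b g (p + s *\<^sub>R h) - pd b g p) \<le> ?d * (L * wt t (fst p)) * norm (s *\<^sub>R h)"
      proof (rule has_partials_mvt[where G = "\<lambda>c. pd c (pd b g)"])
        fix u :: real assume u: "u \<in> {0..1}"
        show "has_partials (pd b g) (\<lambda>c. pd c (pd b g)) (p + u *\<^sub>R s *\<^sub>R h)"
          using kernels_has_partials(1)[OF kernels_has_partials(2)[OF g b] pos[OF us[OF u]]] by simp
        fix c :: "(real^'n) \<times> real" assume c: "c \<in> Basis"
        have "norm (fst (u *\<^sub>R s *\<^sub>R h)) \<le> norm (u *\<^sub>R s *\<^sub>R h)" by (metis norm_fst_le prod.collapse)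
        then have "norm (fst (u *\<^sub>R s *\<^sub>R h)) \<le> 1" using sh[OF u] by (rule order_trans)
        then have "(norm (fst (u *\<^sub>R s *\<^sub>R h)))\<^sup>2 \<le> 1" by (simp add: abs_square_le_1)
        then have 1: "wt \<bar>t\<bar> (fst (u *\<^sub>R s *\<^sub>R h)) \<le> 2 powr \<bar>t\<bar>" unfolding wt_def by (intro powr_mono2) auto
        have "wt t (fst (p + u *\<^sub>R s *\<^sub>R h)) \<le> 2 powr \<bar>t\<bar> * wt t (fst p) * wt \<bar>t\<bar> (fst (u *\<^sub>R s *\<^sub>R h))"
          unfolding fst_add by (rule wt_shift)
        also have "\<dots> \<le> 2 powr \<bar>t\<bar> * wt t (fst p) * 2 powr \<bar>t\<bar>"
          by (intro mult_left_mono 1) (auto simp: wt_nonneg)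
        finally have "C * wt t (fst (p + u *\<^sub>R s *\<^sub>R h)) \<le> C * (2 powr \<bar>t\<bar> * wt t (fst p) * 2 powr \<bar>t\<bar>)"
          using C by (intro mult_left_mono)
        moreover have "norm (pd c (pd b g) (p + u *\<^sub>R s *\<^sub>R h)) \<le> C * wt t (fst (p + u *\<^sub>R s *\<^sub>R h))"
          using C2[OF b c seg[OF p us[OF u]]] by simp
        ultimately show "norm (pd c (pd b g) (p + u *\<^sub>R s *\<^sub>R h)) \<le> L * wt t (fst p)"
          by (simp add: L_def mult_ac)
      qed
      also have "\<dots> \<le> ?d * (L * wt t (fst p)) * norm h"
        using s L by (intro mult_left_mono) (auto simp: wt_nonneg intro!: mult_left_le_one_le)
      finally show "norm (pd b g (p + s *\<^sub>R h) - pd b g p) \<le> ?d * (L * wt t (fst p)) * norm h" .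
    qed
    then show ?thesis by (simp add: power2_eq_square mult_ac)
  qed
  then show ?thesis using L by (intro exI[of _ "?d * (?d * L)"]) auto
qed

section \<open>Horizontal slices of kernels\<close>

lemma sum_Basis_prod:
  "(\<Sum>b\<in>(Basis :: ('a::euclidean_space \<times> 'b::euclidean_space) set). f b) =
    (\<Sum>b\<in>Basis. f (b, 0)) + (\<Sum>b\<in>Basis. f (0, b))"
proof -
  have "inj_on (\<lambda>u. (u::'a, 0::'b)) Basis" "inj_on (\<lambda>u. (0::'a, u::'b)) Basis"
    by (auto intro!: inj_onI)
  then show ?thesis
    unfolding Basis_prod_def by (subst sum.union_disjoint) (auto simp: sum.reindex)
qed

lemma slice_has_partials:
  fixes g :: "(real^'n) \<times> real \<Rightarrow> complex"
  assumes g: "g \<in> kernels r t" and p: "0 < snd p"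
  shows "has_partials (\<lambda>z. g (p - (z, 0))) (\<lambda>b z. - pd (b, 0) g (p - (z, 0))) z"
proof -
  have "(g has_derivative (\<lambda>h. \<Sum>b\<in>Basis. (h \<bullet> b) *\<^sub>R pd b g (p - (z, 0)))) (at (p - (z, 0)))"
    using kernels_has_partials(1)[OF g, of "p - (z, 0)"] p by (simp add: has_partials_def)
  then have "((\<lambda>z. g (p - (z, 0))) has_derivative (\<lambda>h. \<Sum>b\<in>Basis. ((- h, 0) \<bullet> b) *\<^sub>R pd b g (p - (z, 0)))) (at z)"
    by (intro has_derivative_compose[where f = "\<lambda>z. p - (z, 0)" and g = g])
      (auto intro!: derivative_eq_intros)
  then show ?thesis
    by (simp add: has_partials_def sum_Basis_prod)
qed

lemma slice_iter_pd_has_partials: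
  fixes g :: "(real^'n) \<times> real \<Rightarrow> complex"
  assumes g: "g \<in> kernels r t" and p: "0 < snd p" and vs: "vs \<in> lists Basis"
  defines "G \<equiv> iter_pd (map (\<lambda>v. (v, 0)) vs) g"
  shows "iter_pd vs (\<lambda>z. g (p - (z, 0))) = (\<lambda>z. (- 1) ^ length vs * G (p - (z, 0)))"
    and "has_partials (\<lambda>z. (- 1) ^ length vs * G (p - (z, 0)))
      (\<lambda>b z. (- 1) ^ length (b # vs) * pd (b, 0) G (p - (z, 0))) z"
proof -
  have partials: "has_partials (\<lambda>z. (- 1) ^ length vs * iter_pd (map (\<lambda>v. (v, 0)) vs) g (p - (z, 0)))
      (\<lambda>b z. (- 1) ^ length (b # vs) * pd (b, 0) (iter_pd (map (\<lambda>v. (v, 0)) vs) g) (p - (z, 0))) z"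
    if "vs \<in> lists Basis" for vs z
  proof -
    have "map (\<lambda>v. (v, 0)) vs \<in> lists (Basis :: ((real^'n) \<times> real) set)"
      using that by (auto simp: Basis_prod_def)
    from has_partials_cmult[OF slice_has_partials[OF kernels_iter_pd[OF g this] p], of "(- 1) ^ length vs"]
    show ?thesis by simp
  qed
  show "has_partials (\<lambda>z. (- 1) ^ length vs * G (p - (z, 0)))
      (\<lambda>b z. (- 1) ^ length (b # vs) * pd (b, 0) G (p - (z, 0))) z"
    unfolding G_def by (rule partials[OF vs])
  show "iter_pd vs (\<lambda>z. g (p - (z, 0))) = (\<lambda>z. (- 1) ^ length vs * G (p - (z, 0)))"
    unfolding G_def using vs
  proof (induction vs)
    case (Cons v vs)
    then have v: "v \<in> Basis" and vs: "vs \<in> lists Basis" by auto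
    have "iter_pd (v # vs) (\<lambda>z. g (p - (z, 0))) = pd v (\<lambda>z. (- 1) ^ length vs * iter_pd (map (\<lambda>v. (v, 0)) vs) g (p - (z, 0)))"
      using Cons by simp
    also have "\<dots> = (\<lambda>z. (- 1) ^ length (v # vs) * iter_pd (map (\<lambda>v. (v, 0)) (v # vs)) g (p - (z, 0)))"
      using pd_has_partials[OF partials[OF vs] v] by (intro ext) simp
    finally show ?case .
  qed simp
qed

lemma map_Pair0_Basis:
  fixes vs :: "(real^'n) list"
  shows "vs \<in> lists Basis \<Longrightarrow> map (\<lambda>v. (v, 0 :: real)) vs \<in> lists Basis"
  by (auto simp: Basis_prod_def)

lemma slice_smooth:
  fixes g :: "(real^'n) \<times> real \<Rightarrow> complex"
  assumes "g \<in> kernels r t" "0 < snd p"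
  shows "smooth (\<lambda>z. g (p - (z, 0)))"
  unfolding smooth_iff
proof (intro ballI allI)
  fix vs :: "(real^'n) list" and x assume vs: "vs \<in> lists Basis"
  show "iter_pd vs (\<lambda>z. g (p - (z, 0))) differentiable (at x)"
    using has_partials_differentiable[OF slice_iter_pd_has_partials(2)[OF assms vs]]
      slice_iter_pd_has_partials(1)[OF assms vs] by simp
qed

lemma slices_dominated:
  fixes g :: "(real^'n) \<times> real \<Rightarrow> complex"
  assumes g: "g \<in> kernels r t" and y: "0 < y0"
  shows "dominated {p. y0 \<le> snd p \<and> snd p \<le> y1} (\<lambda>p z. wt t (fst p - z)) (\<lambda>p z. g (p - (z, 0)))"
proof (rule dominatedI)
  fix vs :: "(real^'n) list" assume vs: "vs \<in> lists Basis"
  obtain C where C: "\<And>p. y0 \<le> snd p \<and> snd p \<le> y1 \<Longrightarrow> norm (iter_pd (map (\<lambda>v. (v, 0)) vs) g p) \<le> C * wt t (fst p)"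
    using kernels_bound[OF kernels_iter_pd[OF g map_Pair0_Basis[OF vs]] y, of y1] by blast
  have "norm (iter_pd vs (\<lambda>z. g (p - (z, 0))) z) \<le> C * wt t (fst p - z)"
    if p: "p \<in> {p. y0 \<le> snd p \<and> snd p \<le> y1}" for p z
  proof -
    have "0 < snd p" using p y by auto
    then show ?thesis
      using slice_iter_pd_has_partials(1)[OF g _ vs, of p] C[of "p - (z, 0)"] p
      by (simp add: norm_mult norm_power)
  qed
  then show "\<exists>C. \<forall>p\<in>{p. y0 \<le> snd p \<and> snd p \<le> y1}. \<forall>z. norm (iter_pd vs (\<lambda>z. g (p - (z, 0))) z) \<le> C * wt t (fst p - z)"
    by blast
qed (use slice_smooth[OF g] y in \<open>auto simp: wt_nonneg\<close>)

text \<open>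
  As a function of \<open>z\<close>, the Taylor remainder in the parameter \<open>p\<close> is of second
  order together with its derivatives, since these are up to sign the Taylor remainders of derivatives of
  \<open>g\<close>.
\<close>

lemma slice_remainder_dominated:
  fixes g :: "(real^'n) \<times> real \<Rightarrow> complex"
  assumes g: "g \<in> kernels r t" and p: "0 < snd p"
  shows "dominated {h. norm h \<le> min 1 (snd p / 2)} (\<lambda>h z. (norm h)\<^sup>2 * wt t (fst p - z))
    (\<lambda>h z. g (p + h - (z, 0)) - g (p - (z, 0)) - (\<Sum>b\<in>Basis. complex_of_real (h \<bullet> b) * pd b g (p - (z, 0))))"
    (is "dominated ?I ?W ?\<Phi>")
proof -
  have snd_h: "\<bar>snd h\<bar> \<le> snd p / 2 \<and> norm h \<le> 1 \<and> \<bar>snd h\<bar> \<le> 1" if "h \<in> ?I" for h :: "(real^'n) \<times> real"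
  proof -
    have "\<bar>snd h\<bar> \<le> norm h" using norm_snd_le[of "snd h" "fst h"] by simp
    then show ?thesis using that by auto
  qed
  have pos: "0 < snd (p + h)" if "h \<in> ?I" for h using snd_h[OF that] p by auto
  have sm: "smooth (\<lambda>z. g (p + h - (z, 0)))" "smooth (\<lambda>z. g (p - (z, 0)))"
    "smooth (\<lambda>z. \<Sum>b\<in>Basis. complex_of_real (h \<bullet> b) * pd b g (p - (z, 0)))" if "h \<in> ?I" for h
    using pos[OF that] p g
    by (auto intro!: slice_smooth smooth_sum smooth_cmult kernels_has_partials(2))
  show ?thesis
  proof (rule dominatedI)
    show "smooth (?\<Phi> h)" if "h \<in> ?I" for h by (intro smooth_diff sm[OF that])
    fix vs :: "(real^'n) list" assume vs: "vs \<in> lists Basis"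
    define ws where "ws = map (\<lambda>v. (v, 0::real)) vs"
    define G where "G = iter_pd ws g"
    have ws: "ws \<in> lists Basis" unfolding ws_def by (rule map_Pair0_Basis[OF vs])
    have G: "G \<in> kernels r t" unfolding G_def by (rule kernels_iter_pd[OF g ws])
    obtain C where C: "C \<ge> 0" "\<And>q h. norm h \<le> 1 \<and> snd p / 2 \<le> snd q \<and> snd q \<le> snd p + 1 \<and> snd p / 2 \<le> snd (q + h) \<and> snd (q + h) \<le> snd p + 1 \<Longrightarrow>
      norm (G (q + h) - G q - (\<Sum>b\<in>Basis. (h \<bullet> b) *\<^sub>R pd b G q)) \<le> C * ((norm h)\<^sup>2 * wt t (fst q))"
      using kernels_taylor[OF G, of "snd p / 2" "snd p + 1"] p by auto
    have "norm (iter_pd vs (?\<Phi> h) z) \<le> C * ?W h z" if h: "h \<in> ?I" for h z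
    proof -
      let ?q = "p - (z, 0)"
      have "iter_pd vs (?\<Phi> h) z = iter_pd vs (\<lambda>z. g (p + h - (z, 0))) z - iter_pd vs (\<lambda>z. g (p - (z, 0))) z -
          iter_pd vs (\<lambda>z. \<Sum>b\<in>Basis. complex_of_real (h \<bullet> b) * pd b g (p - (z, 0))) z"
        by (simp add: iter_pd_diff smooth_diff sm[OF h] vs)
      also have "iter_pd vs (\<lambda>z. \<Sum>b\<in>Basis. complex_of_real (h \<bullet> b) * pd b g (p - (z, 0))) z =
          (\<Sum>b\<in>Basis. complex_of_real (h \<bullet> b) * iter_pd vs (\<lambda>z. pd b g (p - (z, 0))) z)"
        using g p by (simp add: iter_pd_sum iter_pd_cmult vs smooth_cmult slice_smooth[OF kernels_has_partials(2)])
      also have "\<dots> = (\<Sum>b\<in>Basis. complex_of_real (h \<bullet> b) * ((- 1) ^ length vs * pd b G ?q))"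
      proof (intro sum.cong refl arg_cong2[where f = "(*)"])
        fix b :: "(real^'n) \<times> real" assume b: "b \<in> Basis"
        have "iter_pd vs (\<lambda>z. pd b g (p - (z, 0))) z = (- 1) ^ length vs * iter_pd ws (pd b g) ?q"
          using slice_iter_pd_has_partials(1)[OF kernels_has_partials(2)[OF g b] p vs] by (simp add: ws_def)
        also have "iter_pd ws (pd b g) ?q = pd b G ?q"
          unfolding G_def by (rule kernels_iter_pd_commute[OF g b ws, symmetric]) (use p in auto)
        finally show "iter_pd vs (\<lambda>z. pd b g (p - (z, 0))) z = (- 1) ^ length vs * pd b G ?q" .
      qed
      also have "iter_pd vs (\<lambda>z. g (p + h - (z, 0))) z = (- 1) ^ length vs * G (?q + h)"
        using slice_iter_pd_has_partials(1)[OF g pos[OF h] vs] by (simp add: ws_def G_def algebra_simps)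
      also have "iter_pd vs (\<lambda>z. g (p - (z, 0))) z = (- 1) ^ length vs * G ?q"
        using slice_iter_pd_has_partials(1)[OF g p vs] by (simp add: ws_def G_def)
      finally have "iter_pd vs (?\<Phi> h) z = (- 1) ^ length vs *
          (G (?q + h) - G ?q - (\<Sum>b\<in>Basis. (h \<bullet> b) *\<^sub>R pd b G ?q))"
        by (simp add: algebra_simps sum_distrib_left scaleR_conv_of_real)
      then have "norm (iter_pd vs (?\<Phi> h) z) = norm (G (?q + h) - G ?q - (\<Sum>b\<in>Basis. (h \<bullet> b) *\<^sub>R pd b G ?q))"
        by (simp add: norm_mult norm_power)
      also have "\<dots> \<le> C * ((norm h)\<^sup>2 * wt t (fst ?q))"
        by (rule C(2)) (use snd_h[OF h] p in auto)
      finally show ?thesis by simp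
    qed
    then show "\<exists>C. \<forall>h\<in>?I. \<forall>z. norm (iter_pd vs (?\<Phi> h) z) \<le> C * ?W h z" by blast
  qed (auto simp: wt_nonneg)
qed

text \<open>
  The weight is the slice of the kernel \<open>(|x|\<^sup>2 + y\<^sup>2)\<^sup>t\<close> at height 1.
\<close>

lemma wt_dominated: "dominated1 (wt t) (\<lambda>z :: real^'n. complex_of_real (wt t z))"
proof -
  define g where "g p = complex_of_real (1 * kernel_base 0 t p)" for p :: "(real^'n) \<times> real"
  have "g \<in> kernels 0 t"
    unfolding kernels_def g_def by (intro CollectI bexI[OF _ kernel_algebra.const[of 1]]) simp
  from dominated_reindex[OF slices_dominated[OF this, of 1 1], of "{()}" "\<lambda>_. (0, 1)"]
  have "dominated1 (\<lambda>z. wt t (- z)) (\<lambda>z. g ((0, 1) - (z, 0)))" by simp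
  moreover have "g ((0, 1) - (z, 0)) = complex_of_real (wt t z)" for z
    by (simp add: g_def kernel_base_def wt_def inner_prod_def power2_norm_eq_inner add.commute)
  ultimately show ?thesis by (simp add: wt_uminus[abs_def])
qed

section \<open>Applying a linear form to the slices of a kernel\<close>

text \<open>
  For the Poisson kernel \<open>g\<close> this is the Poisson integral of the distribution \<open>wt
  t\<close> times \<open>F\<close>.
\<close>

definition slice_transform ::
    "real \<Rightarrow> ((real^'n \<Rightarrow> complex) \<Rightarrow> complex) \<Rightarrow> ((real^'n) \<times> real \<Rightarrow> complex) \<Rightarrow> (real^'n) \<times> real \<Rightarrow> complex" where
  "slice_transform t F g p = F (\<lambda>z. complex_of_real (wt t z) * g (p - (z, 0)))"

lemma wt_mult_shift_le:
  assumes "0 \<le> t"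
  shows "wt t z * wt (- t) (x - z) \<le> 2 powr t * wt t x"
proof -
  have "wt t z * wt (- t) (x - z) \<le> (2 powr t * wt t x * wt t (z - x)) * wt (- t) (x - z)"
    using wt_peetre[OF assms, of x "z - x"] by (intro mult_right_mono) (auto simp: wt_nonneg)
  also have "\<dots> = 2 powr t * wt t x * (wt t (x - z) * wt (- t) (x - z))"
    using wt_uminus[of t "x - z"] by simp
  finally show ?thesis by (simp add: wt_mult wt_0)
qed

text \<open>
  The growth of the weight in \<open>z\<close> is compensated by the decay of the kernel in \<open>x -
  z\<close>; only growth in \<open>x\<close> remains.
\<close>

lemma weighted_slices_dominated:
  fixes g :: "(real^'n) \<times> real \<Rightarrow> complex"
  assumes "g \<in> kernels r (- t)" "0 < y0" "0 \<le> t"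
  shows "dominated {p. y0 \<le> snd p \<and> snd p \<le> y1} (\<lambda>p z. wt t (fst p)) (\<lambda>p z. complex_of_real (wt t z) * g (p - (z, 0)))"
  by (rule dominated_mono[OF dominated_mult[OF dominated_const[OF wt_dominated] slices_dominated[OF assms(1,2)]], where K = "2 powr t"])
    (auto intro: wt_mult_shift_le assms simp: wt_nonneg)

lemma weighted_slice_in_B:
  fixes g :: "(real^'n) \<times> real \<Rightarrow> complex"
  assumes "g \<in> kernels r (- t)" "0 < snd p" "0 \<le> t"
  shows "(\<lambda>z. complex_of_real (wt t z) * g (p - (z, 0))) \<in> space_B"
  using dominated_in_B[OF weighted_slices_dominated[OF assms, of "snd p"], of p] by simp

text \<open>
  The form \<open>F\<close> maps the weighted Taylor remainders, which are of second order with all their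
  derivatives, to numbers of second order.
\<close>

lemma slice_transform_has_partials:
  fixes g :: "(real^'n) \<times> real \<Rightarrow> complex"
  assumes F: "Bc_form F" and g: "g \<in> kernels r (- t)" and p: "0 < snd p" and t: "0 \<le> t"
  shows "has_partials (slice_transform t F g) (\<lambda>b. slice_transform t F (pd b g)) p"
proof -
  let ?I = "{h :: (real^'n) \<times> real. norm h \<le> min 1 (snd p / 2)}"
  let ?\<Phi> = "\<lambda>h z. complex_of_real (wt t z) * (g (p + h - (z, 0)) - g (p - (z, 0)) - (\<Sum>b\<in>Basis. complex_of_real (h \<bullet> b) * pd b g (p - (z, 0))))"
  have "dominated ?I (\<lambda>h z. (norm h)\<^sup>2) ?\<Phi>"
  proof (rule dominated_mono[OF dominated_mult[OF dominated_const[OF wt_dominated] slice_remainder_dominated[OF g p]]])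
    fix h z
    show "wt t z * ((norm h)\<^sup>2 * wt (- t) (fst p - z)) \<le> (2 powr t * wt t (fst p)) * (norm h)\<^sup>2"
      using mult_right_mono[OF wt_mult_shift_le[OF t, of z "fst p"], of "(norm h)\<^sup>2"] by (simp add: mult_ac)
  qed auto
  from Bc_form_bound[OF F this] obtain C where C': "\<forall>h\<in>?I. norm (F (?\<Phi> h)) \<le> C * (norm h)\<^sup>2" by blast
  have C: "norm (F (?\<Phi> h)) \<le> C * (norm h)\<^sup>2" if "h \<in> ?I" for h using bspec[OF C' that] .
  show ?thesis
  proof (rule has_partials_quadratic)
    show "0 < min 1 (snd p / 2)" using p by simp
    fix h :: "(real^'n) \<times> real" assume h: "norm h \<le> min 1 (snd p / 2)"
    have "\<bar>snd h\<bar> \<le> norm h" using norm_snd_le[of "snd h" "fst h"] by simp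
    then have ph: "0 < snd (p + h)" using h p by auto
    have B: "(\<lambda>z. complex_of_real (wt t z) * g (p + h - (z, 0))) \<in> space_B"
      "(\<lambda>z. complex_of_real (wt t z) * g (p - (z, 0))) \<in> space_B"
      by (intro weighted_slice_in_B[OF g _ t] p ph)+
    have Bb: "(\<lambda>z. complex_of_real (wt t z) * pd b g (p - (z, 0))) \<in> space_B" if "b \<in> Basis" for b
      by (rule weighted_slice_in_B[OF kernels_has_partials(2)[OF g that] p t])
    have Bs: "(\<lambda>z. \<Sum>b\<in>Basis. complex_of_real (h \<bullet> b) * (complex_of_real (wt t z) * pd b g (p - (z, 0)))) \<in> space_B"
      by (intro space_B_sum space_B_cmult Bb) auto
    have "?\<Phi> h = (\<lambda>z. complex_of_real (wt t z) * g (p + h - (z, 0)) - complex_of_real (wt t z) * g (p - (z, 0)) -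
        (\<Sum>b\<in>Basis. complex_of_real (h \<bullet> b) * (complex_of_real (wt t z) * pd b g (p - (z, 0)))))"
      by (rule ext) (simp add: right_diff_distrib sum_distrib_left mult_ac)
    then have "F (?\<Phi> h) = slice_transform t F g (p + h) - slice_transform t F g p -
        (\<Sum>b\<in>Basis. (h \<bullet> b) *\<^sub>R slice_transform t F (pd b g) p)"
      using Bc_form_sum[OF F finite_Basis Bb, where c = "\<lambda>b. complex_of_real (h \<bullet> b)"]
      by (simp add: Bc_form_diff[OF F] space_B_diff B Bs slice_transform_def scaleR_conv_of_real)
    then show "norm (slice_transform t F g (p + h) - slice_transform t F g p -
        (\<Sum>b\<in>Basis. (h \<bullet> b) *\<^sub>R slice_transform t F (pd b g) p)) \<le> C * (norm h)\<^sup>2"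
      using C[of h] h by simp
  qed
qed

lemma upper_half_space_eq: "upper_half_space = {p. 0 < snd p}"
  by (auto simp: upper_half_space_def)

lemma slice_transform_Ck_on:
  fixes g :: "(real^'n) \<times> real \<Rightarrow> complex"
  assumes F: "Bc_form F" and g: "g \<in> kernels r (- t)" and t: "0 \<le> t"
    and u: "\<And>p. 0 < snd p \<Longrightarrow> u p = slice_transform t F g p"
  shows "Ck_on k upper_half_space u"
  unfolding upper_half_space_eq
proof (rule partials_closed_class_Ck_on[OF open_upper_half, of "{slice_transform t F g | g. g \<in> kernels r (- t)}"])
  fix v assume "v \<in> {slice_transform t F g | g. g \<in> kernels r (- t)}"
  then obtain h where h: "v = slice_transform t F h" "h \<in> kernels r (- t)" by blast
  show "\<exists>G. (\<forall>x\<in>{p. 0 < snd p}. has_partials v G x) \<and>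
      (\<forall>b\<in>Basis. G b \<in> {slice_transform t F g | g. g \<in> kernels r (- t)})"
    unfolding h(1)
    using slice_transform_has_partials[OF F h(2) _ t] kernels_has_partials(2)[OF h(2)]
    by (intro exI[of _ "\<lambda>b. slice_transform t F (pd b h)"]) auto
qed (use g u in auto)

lemma slice_transform_pd:
  fixes g :: "(real^'n) \<times> real \<Rightarrow> complex"
  assumes F: "Bc_form F" and g: "g \<in> kernels r (- t)" and t: "0 \<le> t"
    and u: "\<And>p. 0 < snd p \<Longrightarrow> u p = slice_transform t F g p" and b: "b \<in> Basis" and p: "0 < snd p"
  shows "pd b u p = slice_transform t F (pd b g) p"
  using pd_cong_open[OF open_upper_half _ _ slice_transform_has_partials[OF F g p t] b, of u]
    pd_has_partials[OF slice_transform_has_partials[OF F g p t] b] p u by simp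

section \<open>The Poisson kernel solves the equation\<close>

lemma poisson_kernel_eq_base:
  assumes "0 < snd p"
  shows "poisson_kernel \<alpha> (snd p) (fst p :: real^'n) =
    Gamma ((\<alpha> + real CARD('n) + 1) / 2) / (Gamma ((\<alpha> + 1) / 2) * pi powr (real CARD('n) / 2)) *
    kernel_base (\<alpha> + 1) (- ((\<alpha> + real CARD('n) + 1) / 2)) p"
proof -
  have "(norm (fst p))\<^sup>2 + (snd p)\<^sup>2 = p \<bullet> p"
    by (simp add: inner_prod_def power2_norm_eq_inner power2_eq_square[of "snd p"])
  then show ?thesis by (simp only: poisson_kernel_def kernel_base_def powr_minus divide_inverse)
qed

definition poisson :: "real \<Rightarrow> (real^'n) \<times> real \<Rightarrow> complex" where
  "poisson \<alpha> p = complex_of_real (poisson_kernel \<alpha> (snd p) (fst p))"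

lemma poisson_in_kernels: "(poisson \<alpha> :: (real^'n) \<times> real \<Rightarrow> complex) \<in> kernels (\<alpha> + 1) (- ((\<alpha> + real CARD('n) + 1) / 2))"
  unfolding kernels_def poisson_def
  by (intro CollectI bexI[OF _ kernel_algebra.const] allI impI) (simp only: poisson_kernel_eq_base)

lemma kernel_base_pd:
  fixes p :: "(real^'n) \<times> real"
  assumes p: "0 < snd p" and b: "b \<in> Basis"
  shows "pd b (\<lambda>p. complex_of_real (c * kernel_base r t p)) p =
      complex_of_real (c * ((r * snd b / snd p + 2 * t * (p \<bullet> b) / (p \<bullet> p)) * kernel_base r t p))"
    and "pd b (pd b (\<lambda>p. complex_of_real (c * kernel_base r t p))) p =
      complex_of_real (c * (((r * snd b / snd p + 2 * t * (p \<bullet> b) / (p \<bullet> p))\<^sup>2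
        - r * (snd b)\<^sup>2 / (snd p)\<^sup>2 + 2 * t * ((p \<bullet> p) - 2 * (p \<bullet> b)\<^sup>2) / (p \<bullet> p)\<^sup>2) * kernel_base r t p))"
proof -
  define A where "A q = r * snd b / snd q + 2 * t * (q \<bullet> b) / (q \<bullet> q)" for q :: "(real^'n) \<times> real"
  have first: "((\<lambda>p. complex_of_real (c * kernel_base r t p)) has_derivative
      (\<lambda>h. complex_of_real (c * ((r * snd h / snd q + 2 * t * (q \<bullet> h) / (q \<bullet> q)) * kernel_base r t q)))) (at q)"
    if "0 < snd q" for q :: "(real^'n) \<times> real"
    by (intro has_derivative_of_real has_derivative_mult_right kernel_base_derivative that)
  then have pd1: "pd b (\<lambda>p. complex_of_real (c * kernel_base r t p)) q = complex_of_real (c * (A q * kernel_base r t q))"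
    if "0 < snd q" for q :: "(real^'n) \<times> real"
    using pd_has_derivative[OF first[OF that], of b] by (simp add: A_def)
  from pd1[OF p] show "pd b (\<lambda>p. complex_of_real (c * kernel_base r t p)) p =
      complex_of_real (c * ((r * snd b / snd p + 2 * t * (p \<bullet> b) / (p \<bullet> p)) * kernel_base r t p))"
    by (simp add: A_def)
  note pp = upper_half_inner_pos[OF p]
  have "(A has_derivative (\<lambda>h. - (r * snd b * snd h / (snd p)\<^sup>2) + 2 * t * ((h \<bullet> b) * (p \<bullet> p) - (p \<bullet> b) * (2 * (p \<bullet> h))) / (p \<bullet> p)\<^sup>2)) (at p)"
    unfolding A_def using p pp
    by (auto intro!: derivative_eq_intros simp: field_simps power2_eq_square inner_commute)
  from has_derivative_of_real[OF has_derivative_mult_right[OF has_derivative_mult[OF this kernel_base_derivative[OF p, of r t]], of c]]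
  have "((\<lambda>q. complex_of_real (c * (A q * kernel_base r t q))) has_derivative
      (\<lambda>h. complex_of_real (c * (A p * ((r * snd h / snd p + 2 * t * (p \<bullet> h) / (p \<bullet> p)) * kernel_base r t p) +
        (- (r * snd b * snd h / (snd p)\<^sup>2) + 2 * t * ((h \<bullet> b) * (p \<bullet> p) - (p \<bullet> b) * (2 * (p \<bullet> h))) / (p \<bullet> p)\<^sup>2) * kernel_base r t p)))) (at p)"
    .
  then have "((pd b (\<lambda>p. complex_of_real (c * kernel_base r t p))) has_derivative
      (\<lambda>h. complex_of_real (c * (A p * ((r * snd h / snd p + 2 * t * (p \<bullet> h) / (p \<bullet> p)) * kernel_base r t p) +
        (- (r * snd b * snd h / (snd p)\<^sup>2) + 2 * t * ((h \<bullet> b) * (p \<bullet> p) - (p \<bullet> b) * (2 * (p \<bullet> h))) / (p \<bullet> p)\<^sup>2) * kernel_base r t p)))) (at p)"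
    by (rule has_derivative_transform_within_open[OF _ open_upper_half]) (use p pd1 in auto)
  from pd_has_derivative[OF this, of b] show "pd b (pd b (\<lambda>p. complex_of_real (c * kernel_base r t p))) p =
      complex_of_real (c * (((r * snd b / snd p + 2 * t * (p \<bullet> b) / (p \<bullet> p))\<^sup>2
        - r * (snd b)\<^sup>2 / (snd p)\<^sup>2 + 2 * t * ((p \<bullet> p) - 2 * (p \<bullet> b)\<^sup>2) / (p \<bullet> p)\<^sup>2) * kernel_base r t p))"
    unfolding A_def using b by (simp only: inner_same_Basis) (simp add: algebra_simps power2_eq_square)
qed

lemma pd_pd_cong_upper_half:
  assumes "\<And>p. 0 < snd p \<Longrightarrow> f p = g p" "g \<in> kernels r t" "0 < snd p" "b \<in> Basis"
  shows "pd b f p = pd b g p" "pd b (pd b f) p = pd b (pd b g) p"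
proof -
  have 1: "pd b f q = pd b g q" if "0 < snd q" for q
    by (rule pd_cong_open[OF open_upper_half _ _ kernels_has_partials(1)[OF assms(2)]]) (use that assms in auto)
  show "pd b f p = pd b g p" by (rule 1[OF assms(3)])
  show "pd b (pd b f) p = pd b (pd b g) p"
    by (rule pd_cong_open[OF open_upper_half _ _ kernels_has_partials(1)[OF kernels_has_partials(2)[OF assms(2)]]])
      (use 1 assms in auto)
qed

text \<open>
  An explicit computation with the exponents \<open>r = \<alpha> + 1\<close> of \<open>y\<close> and
  \<open>t\<close> of \<open>|x|\<^sup>2 + y\<^sup>2\<close>, in which all terms cancel because \<open>n
  = - 2 t - \<alpha> - 1\<close>.
\<close>

lemma poisson_equation:
  fixes p :: "(real^'n) \<times> real"
  assumes p: "0 < snd p"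
  shows "(\<Sum>i\<in>UNIV. pd (axis i 1, 0) (pd (axis i 1, 0) (poisson \<alpha>)) p)
    + pd (0, 1) (pd (0, 1) (poisson \<alpha>)) p - (\<alpha> / snd p) *\<^sub>R pd (0, 1) (poisson \<alpha>) p = 0"
proof -
  define n where "n = real CARD('n)"
  define c where "c = Gamma ((\<alpha> + real CARD('n) + 1) / 2) / (Gamma ((\<alpha> + 1) / 2) * pi powr (real CARD('n) / 2))"
  define r where "r = \<alpha> + 1"
  define t where "t = - ((\<alpha> + n + 1) / 2)"
  define K where "K = kernel_base r t p"
  define \<rho> where "\<rho> = p \<bullet> p"
  define y where "y = snd p"
  define P where "P = (\<lambda>p :: (real^'n) \<times> real. complex_of_real (c * kernel_base r t p))"
  have eq: "P q = poisson \<alpha> q" if "0 < snd q" for q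
    using that by (simp add: P_def poisson_def poisson_kernel_eq_base c_def r_def t_def n_def)
  have y: "y > 0" and \<rho>: "\<rho> > 0" using p upper_half_inner_pos[OF p] by (auto simp: y_def \<rho>_def)
  have bi: "(axis i 1, 0) \<in> (Basis :: ((real^'n) \<times> real) set)" for i by (simp add: Basis_prod_def)
  have by1: "(0, 1) \<in> (Basis :: ((real^'n) \<times> real) set)" by (simp add: Basis_prod_def)
  have i: "pd (axis i 1, 0) (pd (axis i 1, 0) (poisson \<alpha>)) p =
      complex_of_real (c * (((2 * t * fst p $ i / \<rho>)\<^sup>2 + 2 * t * (\<rho> - 2 * (fst p $ i)\<^sup>2) / \<rho>\<^sup>2) * K))" for i
    using kernel_base_pd(2)[OF p bi[of i], of c r t]
      pd_pd_cong_upper_half(2)[OF eq poisson_in_kernels p bi[of i]]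
    by (simp add: P_def K_def \<rho>_def inner_prod_def inner_axis)
  have "(\<Sum>i\<in>UNIV. pd (axis i 1, 0) (pd (axis i 1, 0) (poisson \<alpha>)) p) =
      complex_of_real (c * K * (\<Sum>i\<in>UNIV. (2 * t * fst p $ i / \<rho>)\<^sup>2 + 2 * t * (\<rho> - 2 * (fst p $ i)\<^sup>2) / \<rho>\<^sup>2))"
    unfolding i of_real_sum[symmetric] sum_distrib_left by (simp add: mult_ac)
  also have "(\<Sum>i\<in>UNIV. (2 * t * fst p $ i / \<rho>)\<^sup>2 + 2 * t * (\<rho> - 2 * (fst p $ i)\<^sup>2) / \<rho>\<^sup>2) =
      (\<Sum>i\<in>UNIV. (4 * t\<^sup>2 - 4 * t) / \<rho>\<^sup>2 * (fst p $ i)\<^sup>2 + 2 * t / \<rho>)"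
    using \<rho> by (intro sum.cong refl) (simp add: field_simps power2_eq_square)
  also have "\<dots> = (4 * t\<^sup>2 - 4 * t) / \<rho>\<^sup>2 * (\<rho> - y\<^sup>2) + n * (2 * t / \<rho>)"
  proof -
    have "(\<Sum>i\<in>UNIV. (fst p $ i)\<^sup>2) = \<rho> - y\<^sup>2"
      by (simp add: \<rho>_def y_def inner_prod_def inner_vec_def power2_eq_square)
    then show ?thesis by (simp add: sum.distrib n_def sum_distrib_left[symmetric] del: times_divide_eq_left)
  qed
  finally have 1: "(\<Sum>i\<in>UNIV. pd (axis i 1, 0) (pd (axis i 1, 0) (poisson \<alpha>)) p) =
      complex_of_real (c * K * ((4 * t\<^sup>2 - 4 * t) / \<rho>\<^sup>2 * (\<rho> - y\<^sup>2) + n * (2 * t / \<rho>)))" .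
  have 2: "pd (0, 1) (pd (0, 1) (poisson \<alpha>)) p =
      complex_of_real (c * (((r / y + 2 * t * y / \<rho>)\<^sup>2 - r / y\<^sup>2 + 2 * t * (\<rho> - 2 * y\<^sup>2) / \<rho>\<^sup>2) * K))"
    using kernel_base_pd(2)[OF p by1, of c r t] pd_pd_cong_upper_half(2)[OF eq poisson_in_kernels p by1]
    by (simp add: P_def K_def \<rho>_def y_def inner_prod_def)
  have 3: "pd (0, 1) (poisson \<alpha>) p = complex_of_real (c * ((r / y + 2 * t * y / \<rho>) * K))"
    using kernel_base_pd(1)[OF p by1, of c r t] pd_pd_cong_upper_half(1)[OF eq poisson_in_kernels p by1]
    by (simp add: P_def K_def \<rho>_def y_def inner_prod_def)
  have n: "n = - 2 * t - \<alpha> - 1" by (simp add: t_def field_simps)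
  have "((4 * t\<^sup>2 - 4 * t) / \<rho>\<^sup>2 * (\<rho> - y\<^sup>2) + n * (2 * t / \<rho>)) +
      ((r / y + 2 * t * y / \<rho>)\<^sup>2 - r / y\<^sup>2 + 2 * t * (\<rho> - 2 * y\<^sup>2) / \<rho>\<^sup>2) - \<alpha> / y * (r / y + 2 * t * y / \<rho>) = 0"
    unfolding n r_def using y \<rho> by (simp add: field_simps power2_eq_square)
  then have "c * K * (((4 * t\<^sup>2 - 4 * t) / \<rho>\<^sup>2 * (\<rho> - y\<^sup>2) + n * (2 * t / \<rho>)) +
      ((r / y + 2 * t * y / \<rho>)\<^sup>2 - r / y\<^sup>2 + 2 * t * (\<rho> - 2 * y\<^sup>2) / \<rho>\<^sup>2) - \<alpha> / y * (r / y + 2 * t * y / \<rho>)) = 0"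
    by simp
  then have "c * K * ((4 * t\<^sup>2 - 4 * t) / \<rho>\<^sup>2 * (\<rho> - y\<^sup>2) + n * (2 * t / \<rho>)) +
      c * (((r / y + 2 * t * y / \<rho>)\<^sup>2 - r / y\<^sup>2 + 2 * t * (\<rho> - 2 * y\<^sup>2) / \<rho>\<^sup>2) * K) -
      (\<alpha> / y) * (c * ((r / y + 2 * t * y / \<rho>) * K)) = 0"
    by (simp add: algebra_simps)
  then have "complex_of_real (c * K * ((4 * t\<^sup>2 - 4 * t) / \<rho>\<^sup>2 * (\<rho> - y\<^sup>2) + n * (2 * t / \<rho>)) +
      c * (((r / y + 2 * t * y / \<rho>)\<^sup>2 - r / y\<^sup>2 + 2 * t * (\<rho> - 2 * y\<^sup>2) / \<rho>\<^sup>2) * K) -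
      (\<alpha> / y) * (c * ((r / y + 2 * t * y / \<rho>) * K))) = 0"
    by (simp only: of_real_0)
  then show ?thesis
    unfolding 1 2 3 scaleR_conv_of_real y_def[symmetric] of_real_mult[symmetric] of_real_add[symmetric] of_real_diff[symmetric]
    by assumption
qed

lemma slice_transform_poisson_equation:
  fixes u :: "(real^'n) \<times> real \<Rightarrow> complex"
  assumes F: "Bc_form F" and \<alpha>: "\<alpha> > -1"
    and u: "\<And>p. 0 < snd p \<Longrightarrow> u p = slice_transform ((\<alpha> + real CARD('n) + 1) / 2) F (poisson \<alpha>) p"
    and p: "0 < snd p"
  shows "D_op \<alpha> u p = 0"
proof -
  define t where "t = (\<alpha> + real CARD('n) + 1) / 2"
  have t: "0 \<le> t" using \<alpha> by (simp add: t_def)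
  let ?P = "poisson \<alpha> :: (real^'n) \<times> real \<Rightarrow> complex"
  have P: "?P \<in> kernels (\<alpha> + 1) (- t)" using poisson_in_kernels by (simp add: t_def)
  let ?U = "slice_transform t F"
  have bi: "(axis i 1, 0) \<in> (Basis :: ((real^'n) \<times> real) set)" for i by (simp add: Basis_prod_def)
  have by1: "(0, 1) \<in> (Basis :: ((real^'n) \<times> real) set)" by (simp add: Basis_prod_def)
  note u = u[folded t_def]
  have 1: "pd b u q = ?U (pd b ?P) q" if "b \<in> Basis" "0 < snd q" for b q
    by (rule slice_transform_pd[OF F P t u that])
  have 2: "pd b (pd b u) p = ?U (pd b (pd b ?P)) p" if "b \<in> Basis" for b
    by (rule slice_transform_pd[OF F kernels_has_partials(2)[OF P that] t 1[OF that] that p])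
  let ?w = "\<lambda>z. complex_of_real (wt t z)"
  have Bi: "(\<lambda>z. ?w z * pd b (pd b ?P) (p - (z, 0))) \<in> space_B" if "b \<in> Basis" for b
    by (rule weighted_slice_in_B[OF kernels_has_partials(2)[OF kernels_has_partials(2)[OF P that] that] p t])
  have By: "(\<lambda>z. ?w z * pd (0, 1) ?P (p - (z, 0))) \<in> space_B"
    by (rule weighted_slice_in_B[OF kernels_has_partials(2)[OF P by1] p t])
  let ?f = "\<lambda>i z. ?w z * pd (axis i 1, 0) (pd (axis i 1, 0) ?P) (p - (z, 0))"
  let ?g = "\<lambda>z. ?w z * pd (0, 1) (pd (0, 1) ?P) (p - (z, 0))"
  let ?h = "\<lambda>z. complex_of_real (\<alpha> / snd p) * (?w z * pd (0, 1) ?P (p - (z, 0)))"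
  have zero: "(\<Sum>i\<in>UNIV. 1 * ?f i z) + ?g z - ?h z = 0" for z
  proof -
    have "?w z * ((\<Sum>i\<in>UNIV. pd (axis i 1, 0) (pd (axis i 1, 0) ?P) (p - (z, 0)))
        + pd (0, 1) (pd (0, 1) ?P) (p - (z, 0)) - (\<alpha> / snd (p - (z, 0))) *\<^sub>R pd (0, 1) ?P (p - (z, 0))) = 0"
      using poisson_equation[of "p - (z, 0)" \<alpha>] p by simp
    then show ?thesis by (simp add: algebra_simps sum_distrib_left scaleR_conv_of_real)
  qed
  have Bsum: "(\<lambda>z. \<Sum>i\<in>UNIV. 1 * ?f i z) \<in> space_B"
    by (intro space_B_sum space_B_cmult Bi bi) simp
  have "(\<Sum>i\<in>UNIV. ?U (pd (axis i 1, 0) (pd (axis i 1, 0) ?P)) p) + ?U (pd (0, 1) (pd (0, 1) ?P)) p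
      - complex_of_real (\<alpha> / snd p) * ?U (pd (0, 1) ?P) p = F (\<lambda>z. (\<Sum>i\<in>UNIV. 1 * ?f i z) + ?g z - ?h z)"
  proof -
    have "F (\<lambda>z. (\<Sum>i\<in>UNIV. 1 * ?f i z) + ?g z - ?h z) = F (\<lambda>z. (\<Sum>i\<in>UNIV. 1 * ?f i z) + ?g z) - F ?h"
      by (rule Bc_form_diff[OF F space_B_add[OF Bsum Bi[OF by1]] space_B_cmult[OF By]])
    also have "F (\<lambda>z. (\<Sum>i\<in>UNIV. 1 * ?f i z) + ?g z) = F (\<lambda>z. \<Sum>i\<in>UNIV. 1 * ?f i z) + F ?g"
      by (rule Bc_form_add[OF F Bsum Bi[OF by1]])
    also have "F (\<lambda>z. \<Sum>i\<in>UNIV. 1 * ?f i z) = (\<Sum>i\<in>UNIV. 1 * F (?f i))"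
      by (rule Bc_form_sum[OF F]) (auto intro: Bi bi)
    also have "F ?h = complex_of_real (\<alpha> / snd p) * F (\<lambda>z. ?w z * pd (0, 1) ?P (p - (z, 0)))"
      by (rule Bc_form_cmult[OF F By])
    finally show ?thesis by (simp add: slice_transform_def)
  qed
  also have "\<dots> = 0" using Bc_form_zero[OF F] by (simp only: zero)
  finally show ?thesis
    by (simp add: D_op_def split_beta 1 2 bi by1 p scaleR_conv_of_real)
qed

section \<open>Total mass of the Poisson kernel\<close>

lemma nn_integral_gaussian_real:
  assumes "t > 0"
  shows "(\<integral>\<^sup>+x. ennreal (exp (- t * x\<^sup>2)) \<partial>lborel) = ennreal (sqrt (pi / t))"
proof -
  define \<sigma> where "\<sigma> = sqrt (1 / (2 * t))"
  have \<sigma>: "\<sigma>\<^sup>2 = 1 / (2 * t)" "\<sigma> > 0" using assms by (auto simp: \<sigma>_def)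
  have eq: "exp (- t * x\<^sup>2) = sqrt (pi / t) * normal_density 0 \<sigma> x" for x
    using assms by (simp add: normal_density_def \<sigma> real_sqrt_divide field_simps)
  have "integrable lborel (\<lambda>x. exp (- t * x\<^sup>2))"
    unfolding eq using \<sigma>(2) by (intro integrable_mult_right integrable_normal_density)
  then have "(\<integral>\<^sup>+x. ennreal (exp (- t * x\<^sup>2)) \<partial>lborel) = ennreal (\<integral>x. exp (- t * x\<^sup>2) \<partial>lborel)"
    by (rule nn_integral_eq_integral) simp
  also have "(\<integral>x. exp (- t * x\<^sup>2) \<partial>lborel) = sqrt (pi / t)"
    unfolding eq using \<sigma>(2) by simp
  finally show ?thesis .
qed

lemma nn_integral_gaussian:
  assumes "t > 0"
  shows "(\<integral>\<^sup>+(x::real^'n). ennreal (exp (- t * (norm x)\<^sup>2)) \<partial>lborel) = ennreal ((pi / t) powr (real CARD('n) / 2))"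
proof -
  have "(norm x)\<^sup>2 = (\<Sum>b\<in>Basis. (x \<bullet> b)\<^sup>2)" for x :: "real^'n"
    unfolding power2_norm_eq_inner by (subst euclidean_inner) (simp add: power2_eq_square)
  then have "ennreal (exp (- t * (norm x)\<^sup>2)) = (\<Prod>b\<in>Basis. ennreal (exp (- t * (x \<bullet> b)\<^sup>2)))" for x :: "real^'n"
    by (simp add: prod_ennreal exp_sum[symmetric] sum_distrib_left sum_negf)
  then have "(\<integral>\<^sup>+(x::real^'n). ennreal (exp (- t * (norm x)\<^sup>2)) \<partial>lborel) =
      (\<Prod>b\<in>(Basis::(real^'n) set). \<integral>\<^sup>+x. ennreal (exp (- t * x\<^sup>2)) \<partial>lborel)"
    by (simp only:) (rule nn_integral_lborel_prod; simp)
  also have "\<dots> = (\<Prod>b\<in>(Basis::(real^'n) set). ennreal (sqrt (pi / t)))"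
    by (simp only: nn_integral_gaussian_real[OF assms])
  also have "\<dots> = ennreal (sqrt (pi / t) ^ CARD('n))"
    using assms by (simp add: ennreal_power)
  also have "sqrt (pi / t) ^ CARD('n) = (pi / t) powr (real CARD('n) / 2)"
    using assms by (simp add: powr_half_sqrt[symmetric] powr_powr powr_realpow[symmetric])
  finally show ?thesis .
qed

lemma nn_integral_gamma_scaled:
  assumes "a > 0" "s > 0"
  shows "(\<integral>\<^sup>+t. ennreal (indicator {0<..} t * t powr (s - 1) * exp (- a * t)) \<partial>lborel) = ennreal (Gamma s * a powr (- s))"
proof -
  let ?I = "\<integral>\<^sup>+t. ennreal (indicator {0<..} t * t powr (s - 1) * exp (- a * t)) \<partial>lborel"
  have "ennreal (Gamma s) = (\<integral>\<^sup>+t. ennreal (indicator {0..} t * t powr (s - 1) / exp t) \<partial>lborel)"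
    using Gamma_conv_nn_integral_real[OF assms(2)] .
  also have "\<dots> = ennreal \<bar>a\<bar> * (\<integral>\<^sup>+t. ennreal (indicator {0..} (0 + a * t) * (0 + a * t) powr (s - 1) / exp (0 + a * t)) \<partial>lborel)"
    using assms by (intro nn_integral_real_affine) auto
  also have "(\<integral>\<^sup>+t. ennreal (indicator {0..} (0 + a * t) * (0 + a * t) powr (s - 1) / exp (0 + a * t)) \<partial>lborel) =
      (\<integral>\<^sup>+t. ennreal (a powr (s - 1)) * ennreal (indicator {0<..} t * t powr (s - 1) * exp (- a * t)) \<partial>lborel)"
  proof (intro nn_integral_cong_AE)
    have "AE t in lborel. t \<noteq> (0::real)" by (rule AE_lborel_singleton)
    then show "AE t in lborel. ennreal (indicator {0..} (0 + a * t) * (0 + a * t) powr (s - 1) / exp (0 + a * t)) =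
        ennreal (a powr (s - 1)) * ennreal (indicator {0<..} t * t powr (s - 1) * exp (- a * t))"
    proof eventually_elim
      case (elim t)
      show ?case
        using assms elim by (cases "t > 0")
          (auto simp: indicator_def zero_le_mult_iff powr_mult exp_minus field_simps ennreal_mult[symmetric])
    qed
  qed
  also have "\<dots> = ennreal (a powr (s - 1)) * ?I"
    by (rule nn_integral_cmult) auto
  finally have "ennreal (Gamma s) = ennreal (a powr s) * ?I"
    using assms by (simp add: mult.assoc[symmetric] ennreal_mult[symmetric] powr_diff)
  then have "ennreal (a powr (- s)) * ennreal (Gamma s) = (ennreal (a powr (- s)) * ennreal (a powr s)) * ?I"
    by (simp add: mult.assoc)
  also have "ennreal (a powr (- s)) * ennreal (a powr s) = 1"
    using assms by (simp add: ennreal_mult[symmetric] powr_add[symmetric])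
  finally show ?thesis using assms by (simp add: ennreal_mult' Gamma_real_pos less_imp_le mult.commute)
qed

text \<open>
  Write \<open>Gamma s\<close> times the integrand as the integral of \<open>t\<^sup>s\<^sup>-\<^sup>1
  exp (- (|x|\<^sup>2 + y\<^sup>2) t)\<close> over \<open>t > 0\<close>; the Gaussian integral in
  \<open>x\<close> is then carried out first.
\<close>

lemma nn_integral_kernel:
  fixes s y :: real
  assumes y: "y > 0" and s: "s > real CARD('n) / 2"
  shows "(\<integral>\<^sup>+(x::real^'n). ennreal (((norm x)\<^sup>2 + y\<^sup>2) powr (- s)) \<partial>lborel) =
    ennreal (pi powr (real CARD('n) / 2) * Gamma (s - real CARD('n) / 2) / Gamma s * y powr (real CARD('n) - 2 * s))"
proof -
  define n where "n = real CARD('n)"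
  have s0: "s > 0" using s by (smt (verit) divide_nonneg_nonneg of_nat_0_le_iff)
  have G: "Gamma s > 0" by (rule Gamma_real_pos[OF s0])
  have pos: "(norm x)\<^sup>2 + y\<^sup>2 > 0" for x :: "real^'n" using y by (simp add: add_nonneg_pos)
  let ?g = "\<lambda>t (x::real^'n). ennreal (indicator {0<..} t * t powr (s - 1) * exp (- ((norm x)\<^sup>2 + y\<^sup>2) * t))"
  have "ennreal (Gamma s) * (\<integral>\<^sup>+(x::real^'n). ennreal (((norm x)\<^sup>2 + y\<^sup>2) powr (- s)) \<partial>lborel) =
      (\<integral>\<^sup>+(x::real^'n). ennreal (Gamma s * ((norm x)\<^sup>2 + y\<^sup>2) powr (- s)) \<partial>lborel)"
    using G by (subst nn_integral_cmult[symmetric]) (auto simp: ennreal_mult')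
  also have "\<dots> = (\<integral>\<^sup>+(x::real^'n). \<integral>\<^sup>+t. ?g t x \<partial>lborel \<partial>lborel)"
    by (simp only: nn_integral_gamma_scaled[OF pos s0])
  also have "\<dots> = (\<integral>\<^sup>+t. \<integral>\<^sup>+x. ?g t x \<partial>lborel \<partial>lborel)"
    by (rule lborel_pair.Fubini') (auto simp: split_beta)
  also have "\<dots> = (\<integral>\<^sup>+t. ennreal (pi powr (n / 2)) * ennreal (indicator {0<..} t * t powr ((s - n / 2) - 1) * exp (- (y\<^sup>2) * t)) \<partial>lborel)"
  proof (rule nn_integral_cong)
    fix t :: real
    show "(\<integral>\<^sup>+x. ?g t x \<partial>lborel) = ennreal (pi powr (n / 2)) * ennreal (indicator {0<..} t * t powr ((s - n / 2) - 1) * exp (- (y\<^sup>2) * t))"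
    proof (cases "t > 0")
      case True
      have "(\<integral>\<^sup>+x. ?g t x \<partial>lborel) = (\<integral>\<^sup>+(x::real^'n). ennreal (t powr (s - 1) * exp (- (y\<^sup>2) * t)) * ennreal (exp (- t * (norm x)\<^sup>2)) \<partial>lborel)"
        using True by (intro nn_integral_cong) (simp add: ennreal_mult[symmetric] exp_add[symmetric] algebra_simps)
      also have "\<dots> = ennreal (t powr (s - 1) * exp (- (y\<^sup>2) * t)) * ennreal ((pi / t) powr (n / 2))"
        unfolding n_def nn_integral_gaussian[OF True, symmetric] by (rule nn_integral_cmult) simp
      also have "(pi / t) powr (n / 2) = pi powr (n / 2) * t powr (- (n / 2))"
        using True by (simp add: powr_divide powr_minus_divide)
      also have "ennreal (t powr (s - 1) * exp (- (y\<^sup>2) * t)) * ennreal (pi powr (n / 2) * t powr (- (n / 2))) =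
          ennreal (pi powr (n / 2) * ((t powr (s - 1) * t powr (- (n / 2))) * exp (- (y\<^sup>2) * t)))"
        by (simp add: ennreal_mult[symmetric] mult_ac)
      also have "t powr (s - 1) * t powr (- (n / 2)) = t powr ((s - n / 2) - 1)"
        by (simp add: powr_add[symmetric] algebra_simps)
      finally show ?thesis using True by (simp add: ennreal_mult[symmetric])
    qed simp
  qed
  also have "\<dots> = ennreal (pi powr (n / 2)) * ennreal (Gamma (s - n / 2) * (y\<^sup>2) powr (- (s - n / 2)))"
    using y s nn_integral_gamma_scaled[of "y\<^sup>2" "s - n / 2"]
    by (subst nn_integral_cmult) (auto simp: n_def)
  also have "(y\<^sup>2) powr (- (s - n / 2)) = y powr (n - 2 * s)"
  proof -
    have "(y\<^sup>2) powr (- (s - n / 2)) = (y powr 2) powr (- (s - n / 2))" using y by (simp add: powr_numeral)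
    then show ?thesis by (simp add: powr_powr algebra_simps)
  qed
  finally have "ennreal (1 / Gamma s) * (ennreal (Gamma s) * (\<integral>\<^sup>+(x::real^'n). ennreal (((norm x)\<^sup>2 + y\<^sup>2) powr (- s)) \<partial>lborel)) =
      ennreal (1 / Gamma s) * (ennreal (pi powr (n / 2)) * ennreal (Gamma (s - n / 2) * y powr (n - 2 * s)))" by simp
  moreover have "ennreal (1 / Gamma s) * ennreal (Gamma s) = 1" using G by (simp add: ennreal_mult[symmetric])
  moreover have "Gamma (s - n / 2) \<ge> 0" using s by (intro less_imp_le Gamma_real_pos) (simp add: n_def)
  ultimately show ?thesis
    using G by (simp add: mult.assoc[symmetric] n_def) (simp add: ennreal_mult[symmetric] mult_ac)
qed

lemma integrable_wt:
  assumes "t < - (real CARD('n) / 2)"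
  shows "integrable lborel (wt t :: real^'n \<Rightarrow> real)"
proof (rule integrableI_nonneg)
  have "(\<integral>\<^sup>+(x::real^'n). ennreal (wt t x) \<partial>lborel) = (\<integral>\<^sup>+(x::real^'n). ennreal (((norm x)\<^sup>2 + 1\<^sup>2) powr (- (- t))) \<partial>lborel)"
    by (simp add: wt_def add.commute)
  also have "\<dots> < \<infinity>" using assms by (subst nn_integral_kernel) auto
  finally show "(\<integral>\<^sup>+(x::real^'n). ennreal (wt t x) \<partial>lborel) < \<infinity>" .
qed (auto simp: wt_nonneg)

lemma poisson_kernel_nonneg: "\<alpha> > -1 \<Longrightarrow> 0 \<le> poisson_kernel \<alpha> y (x :: real^'n)"
  unfolding poisson_kernel_def
  by (intro mult_nonneg_nonneg divide_nonneg_nonneg less_imp_le[OF Gamma_real_pos]) (auto simp: add_pos_nonneg intro: add_pos_nonneg)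

lemma poisson_kernel_has_integral_1:
  assumes \<alpha>: "\<alpha> > -1" and y: "y > 0"
  shows "integrable lborel (poisson_kernel \<alpha> y :: real^'n \<Rightarrow> real)"
    and "(LINT x|lborel. poisson_kernel \<alpha> y (x :: real^'n)) = 1"
proof -
  define n where "n = real CARD('n)"
  define s where "s = (\<alpha> + n + 1) / 2"
  have s: "s > n / 2" "s > 0" using \<alpha> by (auto simp: s_def n_def add_pos_nonneg)
  define c where "c = Gamma s / (Gamma ((\<alpha> + 1) / 2) * pi powr (n / 2)) * y powr (\<alpha> + 1)"
  have G: "Gamma s > 0" "Gamma ((\<alpha> + 1) / 2) > 0" using s \<alpha> by (auto intro!: Gamma_real_pos)
  have c: "c > 0" using G y by (simp add: c_def)
  have eq: "poisson_kernel \<alpha> y x = c * ((norm x)\<^sup>2 + y\<^sup>2) powr (- s)" for x :: "real^'n"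
    unfolding poisson_kernel_def c_def s_def n_def powr_minus by (simp only: divide_inverse mult.assoc)
  have "(\<integral>\<^sup>+x. ennreal (poisson_kernel \<alpha> y (x :: real^'n)) \<partial>lborel) =
      ennreal c * (\<integral>\<^sup>+(x::real^'n). ennreal (((norm x)\<^sup>2 + y\<^sup>2) powr (- s)) \<partial>lborel)"
    unfolding eq using c by (subst nn_integral_cmult[symmetric]) (auto simp: ennreal_mult')
  also have "\<dots> = ennreal c * ennreal (pi powr (n / 2) * Gamma (s - n / 2) / Gamma s * y powr (n - 2 * s))"
    using nn_integral_kernel[where 'n = 'n, OF y, of s] s by (simp add: n_def)
  also have "\<dots> = ennreal (c * (pi powr (n / 2) * Gamma (s - n / 2) / Gamma s * y powr (n - 2 * s)))"
    by (simp only: ennreal_mult'[OF less_imp_le[OF c]])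
  also have "c * (pi powr (n / 2) * Gamma (s - n / 2) / Gamma s * y powr (n - 2 * s)) = y powr (\<alpha> + 1) * y powr (n - 2 * s)"
  proof -
    have e: "s - n / 2 = (\<alpha> + 1) / 2" by (simp add: s_def field_simps)
    define g h q where "g = Gamma s" and "h = Gamma ((\<alpha> + 1) / 2)" and "q = pi powr (n / 2)"
    have "g > 0" "h > 0" "q > 0" using G by (auto simp: g_def h_def q_def)
    then have "g / (h * q) * y powr (\<alpha> + 1) * (q * h / g * y powr (n - 2 * s)) = y powr (\<alpha> + 1) * y powr (n - 2 * s)"
      by (simp add: field_simps)
    then show ?thesis by (simp only: c_def e g_def h_def q_def)
  qed
  also have "\<dots> = y powr (\<alpha> + 1 + (n - 2 * s))" by (simp only: powr_add)
  also have "\<alpha> + 1 + (n - 2 * s) = 0" by (simp add: s_def field_simps)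
  also have "y powr 0 = 1" using y by simp
  finally have I: "(\<integral>\<^sup>+x. ennreal (poisson_kernel \<alpha> y (x :: real^'n)) \<partial>lborel) = 1" by simp
  have meas: "(poisson_kernel \<alpha> y :: real^'n \<Rightarrow> real) \<in> borel_measurable lborel"
    unfolding poisson_kernel_def[abs_def] by measurable
  note nn = poisson_kernel_nonneg[OF \<alpha>, of y]
  show "integrable lborel (poisson_kernel \<alpha> y :: real^'n \<Rightarrow> real)"
    by (rule integrableI_nonneg) (use meas I nn in auto)
  show "(LINT x|lborel. poisson_kernel \<alpha> y (x :: real^'n)) = 1"
    by (subst integral_eq_nn_integral[OF meas]) (use nn I in auto)
qed

section \<open>Differentiation under the integral sign\<close>

lemma norm_integral_le:
  fixes f :: "'a \<Rightarrow> complex"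
  assumes "integrable M f" "integrable M g" "\<And>x. norm (f x) \<le> g x"
  shows "norm (integral\<^sup>L M f) \<le> integral\<^sup>L M g"
  by (rule order_trans[OF integral_norm_bound integral_mono]) (use assms in auto)

lemma smooth_taylor:
  fixes f :: "'a::euclidean_space \<Rightarrow> complex" and M :: real
  assumes f: "smooth f" and M: "\<And>b c x. b \<in> Basis \<Longrightarrow> c \<in> Basis \<Longrightarrow> norm (pd c (pd b f) x) \<le> M"
  shows "norm (f (z + h) - f z - (\<Sum>b\<in>Basis. (h \<bullet> b) *\<^sub>R pd b f z)) \<le> DIM('a) * (DIM('a) * M) * (norm h)\<^sup>2"
proof -
  have "0 \<le> M"
    using M nonempty_Basis order_trans[OF norm_ge_zero] by blast
  have "norm (f (z + h) - f z - (\<Sum>b\<in>Basis. (h \<bullet> b) *\<^sub>R pd b f z)) \<le> DIM('a) * (DIM('a) * M * norm h) * norm h"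
  proof (rule has_partials_taylor[OF smooth_has_partials0[OF f]])
    fix t :: real and b :: 'a assume t: "t \<in> {0..1}" and b: "b \<in> Basis"
    have "norm (pd b f (z + t *\<^sub>R h) - pd b f z) \<le> DIM('a) * M * norm (t *\<^sub>R h)"
      by (rule has_partials_mvt[OF smooth_has_partials0[OF smooth_pd[OF f b]]]) (rule M[OF b])
    also have "\<dots> \<le> DIM('a) * M * norm h"
      using t \<open>0 \<le> M\<close> by (intro mult_left_mono) (auto intro!: mult_left_le_one_le)
    finally show "norm (pd b f (z + t *\<^sub>R h) - pd b f z) \<le> DIM('a) * M * norm h" .
  qed
  then show ?thesis by (simp add: power2_eq_square mult_ac)
qed

text \<open>
  Integrals \<open>\<integral> k(x) \<Theta>(x, z) dx\<close> that may be differentiated in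
  \<open>z\<close>: the derivatives of the integrand have majorants that are integrable in
  \<open>x\<close> and independent of \<open>z\<close>.
\<close>

locale integrable_family =
  fixes \<Theta> :: "'b::euclidean_space \<Rightarrow> 'a::euclidean_space \<Rightarrow> complex" and W :: "'b \<Rightarrow> real" and k :: "'b \<Rightarrow> complex"
  assumes dom: "dominated UNIV (\<lambda>x z. W x) \<Theta>"
    and meas: "vs \<in> lists Basis \<Longrightarrow> (\<lambda>x. iter_pd vs (\<Theta> x) z) \<in> borel_measurable borel"
    and k: "k \<in> borel_measurable borel"
    and int: "integrable lborel (\<lambda>x. norm (k x) * W x)"
begin

lemma integrable_iter_pd:
  assumes "vs \<in> lists Basis"
  shows "integrable lborel (\<lambda>x. k x * iter_pd vs (\<Theta> x) z)"
proof -
  obtain C where C: "C \<ge> 0" "\<forall>x\<in>UNIV. \<forall>z. norm (iter_pd vs (\<Theta> x) z) \<le> C * W x"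
    using dominatedD[OF dom assms] by blast
  show ?thesis
  proof (rule Bochner_Integration.integrable_bound)
    show "integrable lborel (\<lambda>x. C * (norm (k x) * W x))" using int by simp
    show "(\<lambda>x. k x * iter_pd vs (\<Theta> x) z) \<in> borel_measurable lborel"
      using meas[OF assms, of z] k by simp
    show "AE x in lborel. norm (k x * iter_pd vs (\<Theta> x) z) \<le> norm (C * (norm (k x) * W x))"
    proof (rule AE_I2)
      fix x
      have W: "0 \<le> W x" using dominated_nonneg[OF dom, of x] by simp
      have "norm (k x) * norm (iter_pd vs (\<Theta> x) z) \<le> norm (k x) * (C * W x)" using C by (intro mult_left_mono) auto
      then show "norm (k x * iter_pd vs (\<Theta> x) z) \<le> norm (C * (norm (k x) * W x))"
        using C(1) W by (simp add: norm_mult abs_mult mult_ac)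
    qed
  qed
qed

text \<open>
  Integrating the Taylor formula gives the derivative together with a quadratic remainder, whose constant
  is the integral of the majorant.
\<close>

lemma integral_has_partials:
  assumes vs: "vs \<in> lists Basis"
  shows "has_partials (\<lambda>z. LINT x|lborel. k x * iter_pd vs (\<Theta> x) z)
    (\<lambda>b z. LINT x|lborel. k x * iter_pd (b # vs) (\<Theta> x) z) z"
proof -
  have "\<exists>C. \<forall>x z. norm (iter_pd (c # b # vs) (\<Theta> x) z) \<le> C * W x" if "b \<in> Basis" "c \<in> Basis" for b c
    using dominatedD[OF dom, of "c # b # vs"] that vs by auto
  then obtain C0 where C0: "\<And>b c x z. b \<in> Basis \<Longrightarrow> c \<in> Basis \<Longrightarrow> norm (iter_pd (c # b # vs) (\<Theta> x) z) \<le> C0 b c * W x"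
    by metis
  define C where "C = (\<Sum>b\<in>Basis. \<Sum>c\<in>Basis. \<bar>C0 b c\<bar>)"
  have W: "0 \<le> W x" for x using dominated_nonneg[OF dom, of x] by simp
  have C: "norm (pd c (pd b (iter_pd vs (\<Theta> x))) z) \<le> C * W x" if "b \<in> Basis" "c \<in> Basis" for b c x z
  proof -
    have "\<bar>C0 b c\<bar> \<le> (\<Sum>c\<in>Basis. \<bar>C0 b c\<bar>)" using that by (intro member_le_sum) auto
    also have "\<dots> \<le> C" unfolding C_def using that
      by (intro member_le_sum[of b Basis "\<lambda>b. \<Sum>c\<in>Basis. \<bar>C0 b c\<bar>"]) (auto intro: sum_nonneg)
    finally have "C0 b c * W x \<le> C * W x" using W by (intro mult_right_mono) auto
    then show ?thesis using C0[OF that, of x z] by simp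
  qed
  have sm: "smooth (iter_pd vs (\<Theta> x))" for x
  proof -
    have "iter_pd ws (iter_pd vs (\<Theta> x)) = iter_pd (ws @ vs) (\<Theta> x)" for ws by (induction ws) auto
    then show ?thesis
      using dominated_smooth[OF dom, of x] vs unfolding smooth_iff by auto
  qed
  let ?d = "real DIM('a)"
  have taylor: "norm (iter_pd vs (\<Theta> x) (z + h) - iter_pd vs (\<Theta> x) z - (\<Sum>b\<in>Basis. (h \<bullet> b) *\<^sub>R iter_pd (b # vs) (\<Theta> x) z))
      \<le> ?d * (?d * (C * W x)) * (norm h)\<^sup>2" for x h
    using smooth_taylor[OF sm C, of x z h] by simp
  show ?thesis
  proof (rule has_partials_quadratic[of 1])
    fix h :: 'a
    note i = integrable_iter_pd
    have ib: "integrable lborel (\<lambda>x. k x * iter_pd (b # vs) (\<Theta> x) z)" if "b \<in> Basis" for b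
      using i[of "b # vs" z] that vs by simp
    have "(LINT x|lborel. k x * iter_pd vs (\<Theta> x) (z + h)) - (LINT x|lborel. k x * iter_pd vs (\<Theta> x) z) -
        (\<Sum>b\<in>Basis. (h \<bullet> b) *\<^sub>R (LINT x|lborel. k x * iter_pd (b # vs) (\<Theta> x) z)) =
        (LINT x|lborel. k x * iter_pd vs (\<Theta> x) (z + h) - k x * iter_pd vs (\<Theta> x) z -
          (\<Sum>b\<in>Basis. (h \<bullet> b) *\<^sub>R (k x * iter_pd (b # vs) (\<Theta> x) z)))"
      using i[OF vs] ib by (simp del: iter_pd.simps add: Bochner_Integration.integral_diff Bochner_Integration.integral_sum)
    also have "\<dots> = (LINT x|lborel. k x * (iter_pd vs (\<Theta> x) (z + h) - iter_pd vs (\<Theta> x) z -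
          (\<Sum>b\<in>Basis. (h \<bullet> b) *\<^sub>R iter_pd (b # vs) (\<Theta> x) z)))"
      by (simp add: right_diff_distrib sum_distrib_left)
    also have "norm \<dots> \<le> (LINT x|lborel. norm (k x) * W x * (?d * (?d * C) * (norm h)\<^sup>2))"
    proof (rule norm_integral_le)
      have "integrable lborel (\<lambda>x. k x * iter_pd vs (\<Theta> x) (z + h) - k x * iter_pd vs (\<Theta> x) z -
          (\<Sum>b\<in>Basis. (h \<bullet> b) *\<^sub>R (k x * iter_pd (b # vs) (\<Theta> x) z)))"
        using i[OF vs] ib by (intro Bochner_Integration.integrable_diff Bochner_Integration.integrable_sum) auto
      then show "integrable lborel (\<lambda>x. k x * (iter_pd vs (\<Theta> x) (z + h) - iter_pd vs (\<Theta> x) z -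
          (\<Sum>b\<in>Basis. (h \<bullet> b) *\<^sub>R iter_pd (b # vs) (\<Theta> x) z)))"
        by (simp add: right_diff_distrib sum_distrib_left)
      show "integrable lborel (\<lambda>x. norm (k x) * W x * (?d * (?d * C) * (norm h)\<^sup>2))"
        using int by simp
      fix x
      show "norm (k x * (iter_pd vs (\<Theta> x) (z + h) - iter_pd vs (\<Theta> x) z -
          (\<Sum>b\<in>Basis. (h \<bullet> b) *\<^sub>R iter_pd (b # vs) (\<Theta> x) z))) \<le> norm (k x) * W x * (?d * (?d * C) * (norm h)\<^sup>2)"
        using mult_left_mono[OF taylor[of x h] norm_ge_zero[of "k x"]] by (simp add: norm_mult mult_ac)
    qed
    also have "\<dots> = ((LINT x|lborel. norm (k x) * W x) * (?d * (?d * C))) * (norm h)\<^sup>2" by simp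
    finally show "norm ((LINT x|lborel. k x * iter_pd vs (\<Theta> x) (z + h)) - (LINT x|lborel. k x * iter_pd vs (\<Theta> x) z) -
        (\<Sum>b\<in>Basis. (h \<bullet> b) *\<^sub>R (LINT x|lborel. k x * iter_pd (b # vs) (\<Theta> x) z))) \<le>
        ((LINT x|lborel. norm (k x) * W x) * (?d * (?d * C))) * (norm h)\<^sup>2" .
  qed simp
qed

lemma integral_iter_pd:
  assumes "vs \<in> lists Basis"
  shows "iter_pd vs (\<lambda>z. LINT x|lborel. k x * \<Theta> x z) = (\<lambda>z. LINT x|lborel. k x * iter_pd vs (\<Theta> x) z)"
  using assms
proof (induction vs)
  case (Cons v vs)
  then have "vs \<in> lists Basis" "v \<in> Basis" by auto
  with Cons.IH show ?case
    using pd_has_partials[OF integral_has_partials, of vs v] by (intro ext) simp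
qed simp

lemma integral_smooth: "smooth (\<lambda>z. LINT x|lborel. k x * \<Theta> x z)"
  unfolding smooth_iff
  using integral_iter_pd has_partials_differentiable[OF integral_has_partials] by auto

end

section \<open>Interchanging a linear form with an integral\<close>

lemma integral_simple_function:
  fixes k g :: "'a::euclidean_space \<Rightarrow> complex"
  assumes \<xi>: "simple_function lborel \<xi>" and k: "integrable lborel k"
  shows "(LINT x|lborel. k x * g (\<xi> x)) = (\<Sum>c\<in>range \<xi>. (LINT x|lborel. k x * indicator (\<xi> -` {c}) x) * g c)"
    and "integrable lborel (\<lambda>x. k x * g (\<xi> x))"
proof -
  have fin: "finite (range \<xi>)" using simple_functionD(1)[OF \<xi>] by simp
  have sets: "\<xi> -` {c} \<in> sets lborel" for c using simple_functionD(2)[OF \<xi>, of "{c}"] by simp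
  have eq: "k x * g (\<xi> x) = (\<Sum>c\<in>range \<xi>. k x * indicator (\<xi> -` {c}) x * g c)" for x
  proof -
    have "(\<Sum>c\<in>range \<xi>. k x * indicator (\<xi> -` {c}) x * g c) = (\<Sum>c\<in>range \<xi>. if c = \<xi> x then k x * g (\<xi> x) else 0)"
      by (intro sum.cong) (auto simp: indicator_def)
    then show ?thesis using fin by simp
  qed
  have i: "integrable lborel (\<lambda>x. k x * indicator (\<xi> -` {c}) x)" for c
    using integrable_mult_indicator[OF sets k, of c]
    by (rule Bochner_Integration.integrable_cong[THEN iffD1, rotated 2]) (auto simp: indicator_def)
  show "integrable lborel (\<lambda>x. k x * g (\<xi> x))" unfolding eq using i by auto
  show "(LINT x|lborel. k x * g (\<xi> x)) = (\<Sum>c\<in>range \<xi>. (LINT x|lborel. k x * indicator (\<xi> -` {c}) x) * g c)"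
    unfolding eq using i by (subst Bochner_Integration.integral_sum) auto
qed

lemma simple_functions_tending_to_id:
  obtains \<xi> :: "nat \<Rightarrow> 'a::euclidean_space \<Rightarrow> 'a"
  where "\<And>i. simple_function lborel (\<xi> i)" "\<And>x. (\<lambda>i. \<xi> i x) \<longlonglongrightarrow> x" "\<And>i x. norm (\<xi> i x) \<le> 2 * norm x"
proof -
  have "(\<lambda>x::'a. x) \<in> borel_measurable lborel" by simp
  from borel_measurable_implies_sequence_metric[OF this, of 0]
  have "\<exists>\<xi>. (\<forall>i. simple_function lborel (\<xi> i)) \<and> (\<forall>x::'a. (\<lambda>i. \<xi> i x) \<longlonglongrightarrow> x) \<and> (\<forall>i x. norm (\<xi> i x) \<le> 2 * norm x)"
    by simp
  then show ?thesis using that by metis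
qed

text \<open>
  When \<open>\<Theta> x\<close> is replaced by \<open>\<Theta> (\<xi> x)\<close> with a simple function
  \<open>\<xi>\<close>, the integral becomes a finite sum and \<open>F\<close> may be applied term by
  term. As the simple functions tend to the identity, the error tends to 0 in \<open>\<B>\<close>. The
  factor \<open>min 1 |x - x'|\<close> in the modulus of continuity makes the error small pointwise, and
  its bound by 1 keeps the majorant integrable.
\<close>

lemma Bc_form_integral:
  fixes \<Theta> :: "real^'n \<Rightarrow> real^'n \<Rightarrow> complex"
  assumes F: "Bc_form F" and s: "0 \<le> s"
    and dom: "dominated UNIV (\<lambda>x z. wt s x) \<Theta>"
    and lip: "dominated UNIV (\<lambda>p z. min 1 (norm (fst p - snd p)) * (wt s (fst p) + wt s (snd p)))
      (\<lambda>p z. \<Theta> (fst p) z - \<Theta> (snd p) z)"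
    and k: "k \<in> borel_measurable borel" and int: "integrable lborel (\<lambda>x. norm (k x) * wt s x)"
  shows "F (\<lambda>z. LINT x|lborel. k x * \<Theta> x z) = (LINT x|lborel. k x * F (\<Theta> x))"
    and "integrable lborel (\<lambda>x. k x * F (\<Theta> x))" and "continuous_on UNIV (\<lambda>x. F (\<Theta> x))"
proof -
  have cont: "continuous_on UNIV g"
    if L: "\<And>x x'. norm (g x - g x') \<le> C * (min 1 (norm (x - x')) * (wt s x + wt s x'))" for g :: "real^'n \<Rightarrow> complex" and C
  proof (rule continuous_at_imp_continuous_on, rule ballI)
    fix x0 :: "real^'n"
    have "((\<lambda>x. C * (min 1 (norm (x - x0)) * (wt s x + wt s x0))) \<longlongrightarrow> C * (min 1 (norm (x0 - x0)) * (wt s x0 + wt s x0))) (at x0)"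
      using continuous_on_wt[of UNIV s] by (intro tendsto_intros) (auto simp: continuous_on_def)
    then have "((\<lambda>x. C * (min 1 (norm (x - x0)) * (wt s x + wt s x0))) \<longlongrightarrow> 0) (at x0)" by simp
    then have "((\<lambda>x. g x - g x0) \<longlongrightarrow> 0) (at x0)"
      by (rule Lim_null_comparison[rotated]) (use L in auto)
    then show "continuous (at x0) g" by (simp add: continuous_at LIM_zero_iff)
  qed
  have smooth: "smooth (\<Theta> x)" for x using dominated_smooth[OF dom] by simp
  have lip': "\<exists>C\<ge>0. \<forall>x x' z. norm (iter_pd vs (\<Theta> x) z - iter_pd vs (\<Theta> x') z) \<le> C * (min 1 (norm (x - x')) * (wt s x + wt s x'))"
    if "vs \<in> lists Basis" for vs
    using dominatedD[OF lip that] by (auto simp: iter_pd_diff smooth that)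
  interpret integrable_family \<Theta> "wt s" k
  proof
    show "(\<lambda>x. iter_pd vs (\<Theta> x) z) \<in> borel_measurable borel" if "vs \<in> lists Basis" for vs z
    proof -
      obtain C where C: "\<forall>x x' z. norm (iter_pd vs (\<Theta> x) z - iter_pd vs (\<Theta> x') z) \<le> C * (min 1 (norm (x - x')) * (wt s x + wt s x'))"
        using lip'[OF \<open>vs \<in> lists Basis\<close>] by blast
      show ?thesis by (intro borel_measurable_continuous_onI cont[of _ C]) (simp add: C)
    qed
  qed (use dom k int in auto)
  define \<Psi> where "\<Psi> = (\<lambda>z. LINT x|lborel. k x * \<Theta> x z)"
  have \<Theta>B: "\<Theta> x \<in> space_B" for x using dominated_in_B[OF dom] by simp
  have \<Psi>B: "\<Psi> \<in> space_B"
    unfolding space_B_iff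
  proof (rule dominatedI)
    fix vs :: "(real^'n) list" assume vs: "vs \<in> lists Basis"
    obtain C where C: "C \<ge> 0" "\<forall>x\<in>UNIV. \<forall>z. norm (iter_pd vs (\<Theta> x) z) \<le> C * wt s x"
      using dominatedD[OF dom vs] by blast
    have "norm (iter_pd vs \<Psi> z) \<le> (LINT x|lborel. C * (norm (k x) * wt s x))" for z
      unfolding \<Psi>_def integral_iter_pd[OF vs]
    proof (rule norm_integral_le[OF integrable_iter_pd[OF vs]])
      fix x
      have "norm (k x) * norm (iter_pd vs (\<Theta> x) z) \<le> norm (k x) * (C * wt s x)" using C(2) by (intro mult_left_mono) auto
      then show "norm (k x * iter_pd vs (\<Theta> x) z) \<le> C * (norm (k x) * wt s x)" by (simp add: norm_mult mult_ac)
    qed (use int in simp)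
    then show "\<exists>D. \<forall>i\<in>{()}. \<forall>z. norm (iter_pd vs \<Psi> z) \<le> D * 1" by auto
  qed (auto simp: \<Psi>_def integral_smooth)
  define h where "h x = F (\<Theta> x)" for x
  from Bc_form_bound[OF F lip] obtain C1 where "C1 \<ge> 0" and C1': "\<forall>p\<in>UNIV. norm (F (\<lambda>z. \<Theta> (fst p) z - \<Theta> (snd p) z)) \<le>
      C1 * (min 1 (norm (fst p - snd p)) * (wt s (fst p) + wt s (snd p)))" by blast
  have C1: "norm (h x - h x') \<le> C1 * (min 1 (norm (x - x')) * (wt s x + wt s x'))" for x x'
    using C1'[rule_format, of "(x, x')"] Bc_form_diff[OF F \<Theta>B \<Theta>B, of x x'] by (simp add: h_def)
  show hc: "continuous_on UNIV (\<lambda>x. F (\<Theta> x))" using cont[of h, OF C1] by (simp add: h_def[abs_def])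
  obtain C2 where C2: "C2 \<ge> 0" "\<forall>x\<in>UNIV. norm (F (\<Theta> x)) \<le> C2 * wt s x"
    using Bc_form_bound[OF F dom] by blast
  have hm: "h \<in> borel_measurable borel" using hc by (auto simp: h_def[abs_def] intro: borel_measurable_continuous_onI)
  have hi: "integrable lborel (\<lambda>x. k x * h x)"
  proof (rule Bochner_Integration.integrable_bound)
    show "integrable lborel (\<lambda>x. C2 * (norm (k x) * wt s x))" using int by simp
    show "AE x in lborel. norm (k x * h x) \<le> norm (C2 * (norm (k x) * wt s x))"
    proof (rule AE_I2)
      fix x
      have "norm (k x) * norm (h x) \<le> norm (k x) * (C2 * wt s x)"
        using C2(2) by (intro mult_left_mono) (auto simp: h_def)
      then show "norm (k x * h x) \<le> norm (C2 * (norm (k x) * wt s x))"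
        using C2(1) by (simp add: norm_mult abs_mult wt_nonneg mult_ac)
    qed
  qed (use k hm in simp)
  then show "integrable lborel (\<lambda>x. k x * F (\<Theta> x))" by (simp add: h_def)
  have wt1: "1 \<le> wt s x" for x :: "real^'n" using wt_mono[of 0 s x] s by (simp add: wt_0)
  have ki: "integrable lborel k"
  proof (rule Bochner_Integration.integrable_bound[OF int])
    show "AE x in lborel. norm (k x) \<le> norm (norm (k x) * wt s x)"
    proof (rule AE_I2)
      fix x
      have "norm (k x) * 1 \<le> norm (k x) * wt s x" by (intro mult_left_mono wt1) simp
      then show "norm (k x) \<le> norm (norm (k x) * wt s x)" by (simp add: abs_mult wt_nonneg)
    qed
  qed (use k in simp)
  obtain \<xi> :: "nat \<Rightarrow> real^'n \<Rightarrow> real^'n" where \<xi>: "\<And>i. simple_function lborel (\<xi> i)" "\<And>x. (\<lambda>i. \<xi> i x) \<longlonglongrightarrow> x"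
    "\<And>i x. norm (\<xi> i x) \<le> 2 * norm x" using simple_functions_tending_to_id by blast
  have \<xi>m: "\<xi> i \<in> borel_measurable borel" for i using borel_measurable_simple_function[OF \<xi>(1)[of i]] by simp
  define c where "c = 1 + 4 powr s"
  have wt\<xi>: "wt s x + wt s (\<xi> i x) \<le> c * wt s x" for i x
  proof -
    have "wt s (\<xi> i x) \<le> (4 * (1 + (norm x)\<^sup>2)) powr s"
    proof -
      have "(norm (\<xi> i x))\<^sup>2 \<le> (2 * norm x)\<^sup>2" by (intro power_mono \<xi>(3)) auto
      then show ?thesis unfolding wt_def using s by (intro powr_mono2) auto
    qed
    also have "\<dots> = 4 powr s * wt s x" unfolding wt_def by (rule powr_mult)
    finally show ?thesis by (simp add: c_def distrib_right)
  qed
  have c: "c \<ge> 0" by (simp add: c_def)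
  \<comment> \<open>the integrand of the error, with the weight at \<open>\<xi> i x\<close> replaced by the weight at \<open>x\<close>\<close>
  define d where "d i x = norm (k x) * (min 1 (norm (x - \<xi> i x)) * (c * wt s x))" for i x
  have dle: "norm (d i x) \<le> c * (norm (k x) * wt s x)" for i x
  proof -
    have "min 1 (norm (x - \<xi> i x)) * (norm (k x) * (c * wt s x)) \<le> 1 * (norm (k x) * (c * wt s x))"
      using c by (intro mult_right_mono) (auto simp: wt_nonneg)
    then show ?thesis using c by (simp add: d_def abs_mult wt_nonneg mult_ac)
  qed
  have dm: "d i \<in> borel_measurable lborel" for i
    unfolding d_def[abs_def] using k \<xi>m by simp
  have di: "integrable lborel (d i)" for i
    by (rule Bochner_Integration.integrable_bound[of _ "\<lambda>x. c * (norm (k x) * wt s x)"])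
      (use int dm dle c in \<open>auto intro!: AE_I2 simp: abs_mult wt_nonneg\<close>)
  define \<epsilon> where "\<epsilon> i = (LINT x|lborel. d i x)" for i
  have \<epsilon>: "\<epsilon> \<longlonglongrightarrow> 0"
  proof -
    have "(\<lambda>i. LINT x|lborel. d i x) \<longlonglongrightarrow> (LINT (x::real^'n)|lborel. 0)"
    proof (rule integral_dominated_convergence[where w = "\<lambda>x. c * (norm (k x) * wt s x)"])
      show "AE x in lborel. (\<lambda>i. d i x) \<longlonglongrightarrow> 0"
      proof (rule AE_I2)
        fix x :: "real^'n"
        have "(\<lambda>i. d i x) \<longlonglongrightarrow> norm (k x) * (min 1 (norm (x - x)) * (c * wt s x))"
          unfolding d_def by (intro tendsto_intros \<xi>(2))
        then show "(\<lambda>i. d i x) \<longlonglongrightarrow> 0" by simp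
      qed
    qed (use int dm dle in auto)
    then show ?thesis by (simp add: \<epsilon>_def[abs_def])
  qed
  have d_bound: "norm (k x) * (C * (min 1 (norm (x - \<xi> i x)) * (wt s x + wt s (\<xi> i x)))) \<le> C * d i x" if "C \<ge> 0" for C i x
  proof -
    have "norm (k x) * (C * (min 1 (norm (x - \<xi> i x)) * (wt s x + wt s (\<xi> i x)))) \<le>
        norm (k x) * (C * (min 1 (norm (x - \<xi> i x)) * (c * wt s x)))"
      using that by (intro mult_left_mono wt\<xi>) auto
    then show ?thesis by (simp add: d_def mult_ac)
  qed
  have int_diff: "norm ((LINT x|lborel. k x * g x) - (LINT x|lborel. k x * g (\<xi> i x))) \<le> C * \<epsilon> i"
    if g: "integrable lborel (\<lambda>x. k x * g x)" and "C \<ge> 0"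
      and L: "\<And>x x'. norm (g x - g x') \<le> C * (min 1 (norm (x - x')) * (wt s x + wt s x'))" for g :: "real^'n \<Rightarrow> complex" and C i
  proof -
    note gi = integral_simple_function(2)[OF \<xi>(1) ki, of g i]
    have "(LINT x|lborel. k x * g x) - (LINT x|lborel. k x * g (\<xi> i x)) = (LINT x|lborel. k x * g x - k x * g (\<xi> i x))"
      using g gi by simp
    also have "norm \<dots> \<le> (LINT x|lborel. C * d i x)"
    proof (rule norm_integral_le)
      fix x
      have "norm (k x * g x - k x * g (\<xi> i x)) = norm (k x) * norm (g x - g (\<xi> i x))"
        by (simp flip: right_diff_distrib add: norm_mult)
      also have "\<dots> \<le> norm (k x) * (C * (min 1 (norm (x - \<xi> i x)) * (wt s x + wt s (\<xi> i x))))"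
        by (intro mult_left_mono L) auto
      also have "\<dots> \<le> C * d i x" by (rule d_bound[OF that(2)])
      finally show "norm (k x * g x - k x * g (\<xi> i x)) \<le> C * d i x" .
    qed (use g gi di in auto)
    also have "\<dots> = C * \<epsilon> i" using di by (simp add: \<epsilon>_def)
    finally show ?thesis .
  qed
  \<comment> \<open>the finite sum \<open>\<Psi>' i\<close> is the integral of \<open>k x\<close> times \<open>\<Theta> (\<xi> i x)\<close>, grouped by the values of \<open>\<xi> i\<close>\<close>
  define \<kappa> where "\<kappa> i c = (LINT x|lborel. k x * indicator (\<xi> i -` {c}) x)" for i c
  define \<Psi>' where "\<Psi>' i z = (\<Sum>c\<in>range (\<xi> i). \<kappa> i c * \<Theta> c z)" for i z
  have fin: "finite (range (\<xi> i))" for i using simple_functionD(1)[OF \<xi>(1)[of i]] by simp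
  have \<Psi>'B: "\<Psi>' i \<in> space_B" for i
    unfolding \<Psi>'_def by (intro space_B_sum space_B_cmult fin \<Theta>B)
  have F\<Psi>': "F (\<Psi>' i) = (LINT x|lborel. k x * h (\<xi> i x))" for i
    unfolding \<Psi>'_def h_def integral_simple_function(1)[OF \<xi>(1) ki, of "\<lambda>x. F (\<Theta> x)"]
    by (subst Bc_form_sum[OF F fin \<Theta>B]) (simp add: \<kappa>_def)
  have \<epsilon>0: "0 \<le> \<epsilon> i" for i
    unfolding \<epsilon>_def d_def using c by (intro Bochner_Integration.integral_nonneg) (auto simp: wt_nonneg)
  have "dominated UNIV (\<lambda>i z. \<epsilon> i) (\<lambda>i z. \<Psi> z - \<Psi>' i z)"
  proof (rule dominatedI)
    show "smooth (\<lambda>z. \<Psi> z - \<Psi>' i z)" for i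
      using \<Psi>B \<Psi>'B by (intro smooth_diff space_B_smooth)
    fix vs :: "(real^'n) list" assume vs: "vs \<in> lists Basis"
    obtain C where C: "C \<ge> 0" "\<And>x x' z. norm (iter_pd vs (\<Theta> x) z - iter_pd vs (\<Theta> x') z) \<le> C * (min 1 (norm (x - x')) * (wt s x + wt s x'))"
      using lip'[OF vs] by blast
    have "norm (iter_pd vs (\<lambda>z. \<Psi> z - \<Psi>' i z) z) \<le> C * \<epsilon> i" for i z
    proof -
      have "iter_pd vs (\<lambda>z. \<Psi> z - \<Psi>' i z) z = iter_pd vs \<Psi> z - iter_pd vs (\<Psi>' i) z"
        using \<Psi>B \<Psi>'B by (simp add: iter_pd_diff space_B_smooth vs)
      also have "iter_pd vs \<Psi> z = (LINT x|lborel. k x * iter_pd vs (\<Theta> x) z)"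
        unfolding \<Psi>_def integral_iter_pd[OF vs] ..
      also have "iter_pd vs (\<Psi>' i) z = (\<Sum>c\<in>range (\<xi> i). \<kappa> i c * iter_pd vs (\<Theta> c) z)"
        unfolding \<Psi>'_def using fin[of i] by (simp add: iter_pd_sum iter_pd_cmult smooth_cmult smooth vs)
      also have "\<dots> = (LINT x|lborel. k x * iter_pd vs (\<Theta> (\<xi> i x)) z)"
        using integral_simple_function(1)[OF \<xi>(1) ki, of "\<lambda>x. iter_pd vs (\<Theta> x) z" i] by (simp add: \<kappa>_def)
      finally show ?thesis
        using int_diff[OF integrable_iter_pd[OF vs] C, of z i] by simp
    qed
    then show "\<exists>C. \<forall>i\<in>UNIV. \<forall>z. norm (iter_pd vs (\<lambda>z. \<Psi> z - \<Psi>' i z) z) \<le> C * \<epsilon> i" by blast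
  qed (use \<epsilon>0 in auto)
  from Bc_form_bound[OF F this] obtain C3 where C3: "C3 \<ge> 0" "\<forall>i\<in>UNIV. norm (F (\<lambda>z. \<Psi> z - \<Psi>' i z)) \<le> C3 * \<epsilon> i" by blast
  have "norm (F \<Psi> - (LINT x|lborel. k x * h x)) \<le> (C3 + C1) * \<epsilon> i" for i
  proof -
    have "norm (F \<Psi> - F (\<Psi>' i)) \<le> C3 * \<epsilon> i"
      using bspec[OF C3(2) UNIV_I, of i] unfolding Bc_form_diff[OF F \<Psi>B \<Psi>'B] .
    moreover have "norm ((LINT x|lborel. k x * h x) - F (\<Psi>' i)) \<le> C1 * \<epsilon> i"
      unfolding F\<Psi>' by (rule int_diff[OF hi \<open>C1 \<ge> 0\<close> C1])
    ultimately show ?thesis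
      using norm_triangle_ineq4[of "F \<Psi> - F (\<Psi>' i)" "(LINT x|lborel. k x * h x) - F (\<Psi>' i)"] by (simp add: distrib_right)
  qed
  moreover have "(\<lambda>i. (C3 + C1) * \<epsilon> i) \<longlonglongrightarrow> (C3 + C1) * 0" by (intro tendsto_intros \<epsilon>)
  ultimately have "norm (F \<Psi> - (LINT x|lborel. k x * h x)) \<le> (C3 + C1) * 0"
    by (intro LIMSEQ_le_const) auto
  then show "F (\<lambda>z. LINT x|lborel. k x * \<Theta> x z) = (LINT x|lborel. k x * F (\<Theta> x))"
    by (simp add: \<Psi>_def h_def)
qed

section \<open>Convolution with a test function\<close>

text \<open>
  The convolution of \<open>\<phi>\<close> with the reflection of \<open>k\<close>.
\<close>

definition corr :: "(real^'n \<Rightarrow> complex) \<Rightarrow> (real^'n \<Rightarrow> complex) \<Rightarrow> real^'n \<Rightarrow> complex" where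
  "corr k \<phi> z = (LINT \<eta>|lborel. k \<eta> * \<phi> (z + \<eta>))"

lemma lborel_shift:
  fixes f :: "'a::euclidean_space \<Rightarrow> 'b::{banach, second_countable_topology}"
  assumes "f \<in> borel_measurable borel"
  shows "integrable lborel (\<lambda>x. f (c + x)) \<longleftrightarrow> integrable lborel f" "(LINT x|lborel. f (c + x)) = (LINT x|lborel. f x)"
  using integrable_distr_eq[of "(+) c" lborel borel f] integral_distr[of "(+) c" lborel borel f] assms
  by (simp_all add: lborel_distr_plus)

lemma lborel_distr_reflect: "distr lborel borel uminus = (lborel :: 'a::euclidean_space measure)"
  using lborel_affine[of "-1" "0 :: 'a"] by (simp add: density_1)

lemma lborel_reflect:
  fixes f :: "'a::euclidean_space \<Rightarrow> 'b::{banach, second_countable_topology}"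
  assumes "f \<in> borel_measurable borel"
  shows "integrable lborel (\<lambda>x. f (- x)) \<longleftrightarrow> integrable lborel f" "(LINT x|lborel. f (- x)) = (LINT x|lborel. f x)"
  using integrable_distr_eq[of uminus lborel borel f] integral_distr[of uminus lborel borel f] assms
  by (simp_all add: lborel_distr_reflect)

lemma shift_dominated:
  assumes "dominated1 W \<phi>"
  shows "dominated UNIV (\<lambda>\<eta> z. W (z + \<eta>)) (\<lambda>\<eta> z. \<phi> (z + \<eta>))"
  using dominated_affine[OF dominated_const[OF assms, of UNIV], of "\<lambda>_. 1" 1 "\<lambda>\<eta>. \<eta>"] by simp

lemma iter_pd_shift:
  assumes "smooth \<phi>" "vs \<in> lists Basis"
  shows "iter_pd vs (\<lambda>z. \<phi> (z + \<eta>)) = (\<lambda>z. iter_pd vs \<phi> (z + \<eta>))"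
  using iter_pd_affine[OF assms, of 1 \<eta>] by simp

lemma wt_mult_wt_shift_le:
  assumes "0 \<le> s"
  shows "wt s z * wt (- s) (z + \<eta>) \<le> 2 powr s * wt s \<eta>"
proof -
  have "- \<eta> - z = - (z + \<eta>)" by simp
  then have "wt (- s) (- \<eta> - z) = wt (- s) (z + \<eta>)" by (simp only: wt_uminus)
  with wt_mult_shift_le[OF assms, of z "- \<eta>"] show ?thesis by (simp only: wt_uminus)
qed

lemma weighted_shift_dominated:
  fixes \<phi> :: "real^'n \<Rightarrow> complex"
  assumes "dominated1 (wt (- s)) \<phi>" "0 \<le> s"
  shows "dominated UNIV (\<lambda>\<eta> z. wt s \<eta>) (\<lambda>\<eta> z. complex_of_real (wt s z) * \<phi> (z + \<eta>))"
  by (rule dominated_mono[OF dominated_mult[OF dominated_const[OF wt_dominated] shift_dominated[OF assms(1)]], where K = "2 powr s"])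
    (auto intro: wt_mult_wt_shift_le assms simp: wt_nonneg)

text \<open>
  Nearby translates are compared by the mean value theorem, distant ones by the triangle inequality.
\<close>

lemma weighted_shift_lipschitz:
  fixes \<phi> :: "real^'n \<Rightarrow> complex"
  assumes \<phi>: "dominated1 (wt (- s)) \<phi>" and s: "0 \<le> s"
  shows "dominated UNIV (\<lambda>p z. min 1 (norm (fst p - snd p)) * (wt s (fst p) + wt s (snd p)))
    (\<lambda>p z. complex_of_real (wt s z) * \<phi> (z + fst p) - complex_of_real (wt s z) * \<phi> (z + snd p))"
proof -
  have sm: "smooth \<phi>" using dominated_smooth[OF \<phi>] by simp
  have sms: "smooth (\<lambda>z. \<phi> (z + \<eta>))" for \<eta> using smooth_affine[OF sm, of 1 \<eta>] by simp
  let ?d = "real DIM(real^'n)"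
  have diff: "dominated UNIV (\<lambda>p z. min 1 (norm (fst p - snd p)) * (wt (- s) (z + fst p) + wt (- s) (z + snd p)))
    (\<lambda>p z. \<phi> (z + fst p) - \<phi> (z + snd p))"
  proof (rule dominatedI)
    show "smooth (\<lambda>z. \<phi> (z + fst p) - \<phi> (z + snd p))" for p :: "(real^'n) \<times> (real^'n)"
      by (intro smooth_diff sms)
    fix vs :: "(real^'n) list" assume vs: "vs \<in> lists Basis"
    define \<psi> where "\<psi> = iter_pd vs \<phi>"
    obtain C0 where C0: "C0 \<ge> 0" "\<forall>i\<in>{()}. \<forall>x. norm (\<psi> x) \<le> C0 * wt (- s) x"
      using dominatedD[OF \<phi> vs] unfolding \<psi>_def by blast
    have "\<exists>C. \<forall>x. norm (pd b \<psi> x) \<le> C * wt (- s) x" if "b \<in> Basis" for b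
      using dominatedD[OF \<phi>, of "b # vs"] that vs by (auto simp: \<psi>_def)
    then obtain D where D: "\<And>b x. b \<in> Basis \<Longrightarrow> norm (pd b \<psi> x) \<le> D b * wt (- s) x" by metis
    define C1 where "C1 = (\<Sum>b\<in>Basis. \<bar>D b\<bar>)"
    have C1: "norm (pd b \<psi> x) \<le> C1 * wt (- s) x" if "b \<in> Basis" for b x
    proof -
      have "\<bar>D b\<bar> \<le> C1" unfolding C1_def using that by (intro member_le_sum) auto
      then have "D b * wt (- s) x \<le> C1 * wt (- s) x" by (intro mult_right_mono) (auto simp: wt_nonneg)
      then show ?thesis using D[OF that, of x] by linarith
    qed
    have C10: "C1 \<ge> 0" by (auto simp: C1_def intro: sum_nonneg)
    define K where "K = C0 + ?d * (C1 * (2 powr s * 2 powr s))"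
    have "norm (iter_pd vs (\<lambda>z. \<phi> (z + fst p) - \<phi> (z + snd p)) z) \<le>
        K * (min 1 (norm (fst p - snd p)) * (wt (- s) (z + fst p) + wt (- s) (z + snd p)))" for p z
    proof -
      define a h where "a = z + snd p" and "h = fst p - snd p"
      have eq: "iter_pd vs (\<lambda>z. \<phi> (z + fst p) - \<phi> (z + snd p)) z = \<psi> (a + h) - \<psi> a"
        using vs by (simp add: iter_pd_diff sms iter_pd_shift sm \<psi>_def a_def h_def)
      define S where "S = wt (- s) (a + h) + wt (- s) a"
      have S: "S \<ge> 0" "wt (- s) a \<le> S" by (auto simp: S_def wt_nonneg)
      have "norm (\<psi> (a + h) - \<psi> a) \<le> K * (min 1 (norm h) * S)"
      proof (cases "norm h \<le> 1")
        case True
        have "norm (\<psi> (a + h) - \<psi> a) \<le> ?d * (C1 * (2 powr s * 2 powr s) * S) * norm h"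
        proof (rule has_partials_mvt[where G = "\<lambda>b. pd b \<psi>"])
          fix t :: real assume t: "t \<in> {0..1}"
          show "has_partials \<psi> (\<lambda>b. pd b \<psi>) (a + t *\<^sub>R h)"
            using smooth_has_partials[OF sm vs] by (simp add: \<psi>_def)
          fix b :: "real^'n" assume b: "b \<in> Basis"
          have "norm (t *\<^sub>R h) \<le> 1" using t True by (simp add: mult_le_one)
          then have "(norm (t *\<^sub>R h))\<^sup>2 \<le> 1" by (simp only: abs_square_le_1 abs_norm_cancel)
          then have 1: "wt s (t *\<^sub>R h) \<le> 2 powr s"
            unfolding wt_def using s by (intro powr_mono2) auto
          have "wt (- s) (a + t *\<^sub>R h) \<le> 2 powr s * wt (- s) a * wt s (t *\<^sub>R h)"
            using wt_shift[of "- s" a "t *\<^sub>R h"] s by simp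
          also have "\<dots> \<le> 2 powr s * S * 2 powr s"
            using 1 S by (intro mult_mono) (auto simp: wt_nonneg)
          finally have "C1 * wt (- s) (a + t *\<^sub>R h) \<le> C1 * (2 powr s * S * 2 powr s)"
            using C10 by (intro mult_left_mono)
          then show "norm (pd b \<psi> (a + t *\<^sub>R h)) \<le> C1 * (2 powr s * 2 powr s) * S"
            using C1[OF b, of "a + t *\<^sub>R h"] by (simp add: mult_ac)
        qed
        also have "\<dots> = (?d * (C1 * (2 powr s * 2 powr s))) * (min 1 (norm h) * S)" using True by simp
        also have "\<dots> \<le> K * (min 1 (norm h) * S)"
          unfolding K_def using C0(1) S(1) by (intro mult_right_mono) auto
        finally show ?thesis .
      next
        case False
        have "norm (\<psi> (a + h) - \<psi> a) \<le> C0 * wt (- s) (a + h) + C0 * wt (- s) a"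
          using C0(2) by (intro order_trans[OF norm_triangle_ineq4] add_mono) auto
        also have "\<dots> = C0 * (min 1 (norm h) * S)" using False by (simp add: S_def distrib_left)
        also have "\<dots> \<le> K * (min 1 (norm h) * S)"
          unfolding K_def using C10 S(1) by (intro mult_right_mono) auto
        finally show ?thesis .
      qed
      then show ?thesis unfolding eq by (simp add: S_def a_def h_def)
    qed
    then show "\<exists>C. \<forall>p\<in>UNIV. \<forall>z. norm (iter_pd vs (\<lambda>z. \<phi> (z + fst p) - \<phi> (z + snd p)) z) \<le>
        C * (min 1 (norm (fst p - snd p)) * (wt (- s) (z + fst p) + wt (- s) (z + snd p)))" by blast
  qed (auto simp: wt_nonneg)
  have "dominated UNIV (\<lambda>p z. min 1 (norm (fst p - snd p)) * (wt s (fst p) + wt s (snd p)))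
    (\<lambda>p z. complex_of_real (wt s z) * (\<phi> (z + fst p) - \<phi> (z + snd p)))"
  proof (rule dominated_mono[OF dominated_mult[OF dominated_const[OF wt_dominated] diff], where K = "2 powr s"])
    fix p :: "(real^'n) \<times> (real^'n)" and z
    have "wt s z * (wt (- s) (z + fst p) + wt (- s) (z + snd p)) \<le> 2 powr s * (wt s (fst p) + wt s (snd p))"
      using wt_mult_wt_shift_le[OF s, of z "fst p"] wt_mult_wt_shift_le[OF s, of z "snd p"] by (simp add: distrib_left)
    then have "min 1 (norm (fst p - snd p)) * (wt s z * (wt (- s) (z + fst p) + wt (- s) (z + snd p))) \<le>
        min 1 (norm (fst p - snd p)) * (2 powr s * (wt s (fst p) + wt s (snd p)))"
      by (intro mult_left_mono) auto
    then show "wt s z * (min 1 (norm (fst p - snd p)) * (wt (- s) (z + fst p) + wt (- s) (z + snd p)))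
        \<le> 2 powr s * (min 1 (norm (fst p - snd p)) * (wt s (fst p) + wt s (snd p)))" by (simp add: mult_ac)
  qed (auto simp: wt_nonneg)
  then show ?thesis by (simp add: right_diff_distrib)
qed

text \<open>
  The integral \<open>corr k \<phi>\<close> is a superposition of translates of \<open>\<phi>\<close>,
  through which \<open>F\<close> passes.
\<close>

lemma Bc_form_weighted_corr:
  fixes \<phi> :: "real^'n \<Rightarrow> complex"
  assumes F: "Bc_form F" and s: "0 \<le> s" and \<phi>: "dominated1 (wt (- s)) \<phi>"
    and k: "k \<in> borel_measurable borel" "integrable lborel (\<lambda>\<eta>. norm (k \<eta>) * wt s \<eta>)"
  shows "F (\<lambda>z. complex_of_real (wt s z) * corr k \<phi> z) = (LINT \<eta>|lborel. k \<eta> * F (\<lambda>z. complex_of_real (wt s z) * \<phi> (z + \<eta>)))"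
    and "integrable lborel (\<lambda>\<eta>. k \<eta> * F (\<lambda>z. complex_of_real (wt s z) * \<phi> (z + \<eta>)))"
proof -
  note * = Bc_form_integral[OF F s weighted_shift_dominated[OF \<phi> s] weighted_shift_lipschitz[OF \<phi> s] k]
  show "integrable lborel (\<lambda>\<eta>. k \<eta> * F (\<lambda>z. complex_of_real (wt s z) * \<phi> (z + \<eta>)))"
    using *(2) .
  have "(\<lambda>z. LINT \<eta>|lborel. k \<eta> * (complex_of_real (wt s z) * \<phi> (z + \<eta>))) = (\<lambda>z. complex_of_real (wt s z) * corr k \<phi> z)"
    unfolding corr_def integral_mult_right_zero[symmetric] by (simp add: mult_ac)
  then show "F (\<lambda>z. complex_of_real (wt s z) * corr k \<phi> z) = (LINT \<eta>|lborel. k \<eta> * F (\<lambda>z. complex_of_real (wt s z) * \<phi> (z + \<eta>)))"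
    using *(1) by simp
qed

lemma Bc_form_weighted_shift:
  fixes \<phi> :: "real^'n \<Rightarrow> complex"
  assumes F: "Bc_form F" and s: "0 \<le> s" and \<phi>: "dominated1 (wt (- s)) \<phi>"
  shows "continuous_on UNIV (\<lambda>\<eta>. F (\<lambda>z. complex_of_real (wt s z) * \<phi> (z + \<eta>)))"
    and "\<exists>C\<ge>0. \<forall>\<eta>. norm (F (\<lambda>z. complex_of_real (wt s z) * \<phi> (z + \<eta>))) \<le> C * wt s \<eta>"
proof -
  show "continuous_on UNIV (\<lambda>\<eta>. F (\<lambda>z. complex_of_real (wt s z) * \<phi> (z + \<eta>)))"
    by (rule Bc_form_integral(3)[OF F s weighted_shift_dominated[OF \<phi> s] weighted_shift_lipschitz[OF \<phi> s], of "\<lambda>_. 0"]) auto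
  show "\<exists>C\<ge>0. \<forall>\<eta>. norm (F (\<lambda>z. complex_of_real (wt s z) * \<phi> (z + \<eta>))) \<le> C * wt s \<eta>"
    using Bc_form_bound[OF F weighted_shift_dominated[OF \<phi> s]] by simp
qed

lemma schwartz_iter_pd: "\<phi> \<in> schwartz \<Longrightarrow> vs \<in> lists Basis \<Longrightarrow> iter_pd vs \<phi> \<in> schwartz"
proof -
  have "pd v \<phi> \<in> schwartz" if "\<phi> \<in> schwartz" "v \<in> Basis" for \<phi> :: "real^'n \<Rightarrow> complex" and v
    using that dominated_pd[of "{()}" _ "\<lambda>_. \<phi>" v] unfolding schwartz_iff by auto
  then show "iter_pd vs \<phi> \<in> schwartz" if "\<phi> \<in> schwartz" "vs \<in> lists Basis" for \<phi> :: "real^'n \<Rightarrow> complex" and vs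
    using that(2,1) by (induction vs) auto
qed

lemma schwartz_smooth: "\<phi> \<in> schwartz \<Longrightarrow> smooth \<phi>"
  by (simp add: schwartz_def)

lemma schwartz_measurable: "\<phi> \<in> schwartz \<Longrightarrow> \<phi> \<in> borel_measurable borel"
  by (intro borel_measurable_continuous_onI smooth_continuous0 schwartz_smooth)

lemma schwartz_bound:
  assumes "\<phi> \<in> schwartz"
  shows "\<exists>C\<ge>0. \<forall>x. norm (\<phi> x) \<le> C * wt t x"
  using dominatedD0[OF schwartz_dominated[OF assms, of t]] by auto

lemma schwartz_integrable:
  fixes \<phi> :: "real^'n \<Rightarrow> complex"
  assumes "\<phi> \<in> schwartz" "g \<in> borel_measurable borel" "\<And>x. norm (g x) \<le> C * wt t x"
  shows "integrable lborel (\<lambda>x. g x * \<phi> x)"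
proof -
  \<comment> \<open>an exponent for which \<open>wt r\<close> is integrable\<close>
  define r where "r = - (real CARD('n) / 2) - 1"
  obtain D where D: "D \<ge> 0" "\<forall>x. norm (\<phi> x) \<le> D * wt (r - t) x" using schwartz_bound[OF assms(1)] by blast
  show ?thesis
  proof (rule Bochner_Integration.integrable_bound)
    show "integrable lborel (\<lambda>x :: real^'n. (C * D) * wt r x)"
      by (intro integrable_mult_right integrable_wt) (simp add: r_def)
    show "(\<lambda>x. g x * \<phi> x) \<in> borel_measurable lborel" using assms(2) schwartz_measurable[OF assms(1)] by simp
    show "AE x in lborel. norm (g x * \<phi> x) \<le> norm ((C * D) * wt r x)"
    proof (rule AE_I2)
      fix x
      have "norm (g x) * norm (\<phi> x) \<le> (C * wt t x) * (D * wt (r - t) x)"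
        using assms(3)[of x] D order_trans[OF norm_ge_zero assms(3)[of x]] by (intro mult_mono) auto
      also have "\<dots> = (C * D) * (wt t x * wt (r - t) x)" by (simp only: mult_ac)
      finally show "norm (g x * \<phi> x) \<le> norm ((C * D) * wt r x)"
        by (simp add: norm_mult wt_mult)
    qed
  qed
qed

lemma schwartz_integrable0: "\<phi> \<in> schwartz \<Longrightarrow> integrable lborel \<phi>"
  using schwartz_integrable[of \<phi> "\<lambda>_. 1" 1 0] by (simp add: wt_0)

lemma schwartz_shift_family:
  fixes \<phi> :: "real^'n \<Rightarrow> complex"
  assumes \<phi>: "\<phi> \<in> schwartz" and k: "integrable lborel k"
  shows "integrable_family (\<lambda>\<eta> z. \<phi> (z + \<eta>)) (\<lambda>_. 1) k"
proof
  have "dominated1 (\<lambda>_. 1) \<phi>" using \<phi> schwartz_subset_B space_B_iff by blast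
  from shift_dominated[OF this] show "dominated UNIV (\<lambda>x z. 1) (\<lambda>\<eta> z. \<phi> (z + \<eta>))" .
  show "(\<lambda>\<eta>. iter_pd vs (\<lambda>z. \<phi> (z + \<eta>)) z) \<in> borel_measurable borel" if "vs \<in> lists Basis" for vs z
    unfolding iter_pd_shift[OF schwartz_smooth[OF \<phi>] that]
    using schwartz_measurable[OF schwartz_iter_pd[OF \<phi> that]] by simp
qed (use k in auto)

lemma corr_integrable:
  assumes "\<phi> \<in> schwartz" "integrable lborel k"
  shows "integrable lborel (\<lambda>\<eta>. k \<eta> * \<phi> (z + \<eta>))"
  using integrable_family.integrable_iter_pd[OF schwartz_shift_family[OF assms], of "[]" z] by simp

lemma corr_iter_pd:
  assumes "\<phi> \<in> schwartz" "integrable lborel k" "vs \<in> lists Basis"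
  shows "iter_pd vs (corr k \<phi>) = corr k (iter_pd vs \<phi>)"
  using integrable_family.integral_iter_pd[OF schwartz_shift_family[OF assms(1,2)] assms(3)]
  by (simp add: corr_def[abs_def] iter_pd_shift schwartz_smooth assms)

lemma corr_smooth:
  assumes "\<phi> \<in> schwartz" "integrable lborel k"
  shows "smooth (corr k \<phi>)"
  using integrable_family.integral_smooth[OF schwartz_shift_family[OF assms(1,2)]]
  by (simp add: corr_def[abs_def])

lemma corr_dominated_L1:
  fixes \<phi> :: "real^'n \<Rightarrow> complex"
  assumes \<phi>: "\<phi> \<in> schwartz"
  shows "dominated {k. integrable lborel k} (\<lambda>k z. LINT \<eta>|lborel. norm (k \<eta>)) (\<lambda>k. corr k \<phi>)"
proof (rule dominatedI)
  fix vs :: "(real^'n) list" assume vs: "vs \<in> lists Basis"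
  obtain C where C: "C \<ge> 0" "\<forall>x. norm (iter_pd vs \<phi> x) \<le> C * wt 0 x"
    using schwartz_bound[OF schwartz_iter_pd[OF \<phi> vs]] by blast
  have "norm (iter_pd vs (corr k \<phi>) z) \<le> C * (LINT \<eta>|lborel. norm (k \<eta>))" if k: "integrable lborel k" for k z
  proof -
    have "norm (corr k (iter_pd vs \<phi>) z) \<le> (LINT \<eta>|lborel. C * norm (k \<eta>))"
      unfolding corr_def
    proof (rule norm_integral_le[OF corr_integrable[OF schwartz_iter_pd[OF \<phi> vs] k]])
      show "norm (k \<eta> * iter_pd vs \<phi> (z + \<eta>)) \<le> C * norm (k \<eta>)" for \<eta>
        using mult_left_mono[OF C(2)[rule_format, of "z + \<eta>"] norm_ge_zero[of "k \<eta>"]]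
        by (simp add: norm_mult wt_0 mult.commute)
    qed (use k in simp)
    then show ?thesis by (simp add: corr_iter_pd[OF \<phi> k vs])
  qed
  then show "\<exists>C. \<forall>k\<in>{k. integrable lborel k}. \<forall>z. norm (iter_pd vs (corr k \<phi>) z) \<le> C * (LINT \<eta>|lborel. norm (k \<eta>))" by blast
qed (auto intro: corr_smooth[OF \<phi>])

text \<open>
  The pointwise condition demands decay like \<open>wt (- s)\<close> only where the kernel is not large.
  In this form it holds uniformly for the Poisson kernels as \<open>y\<close> tends to 0, although they
  are not uniformly bounded near the origin.
\<close>

definition tame_kernels :: "real \<Rightarrow> real \<Rightarrow> (real^'n \<Rightarrow> complex) set" where
  "tame_kernels s B = {k. integrable lborel k \<and> (LINT \<eta>|lborel. norm (k \<eta>)) \<le> B \<and>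
     (\<forall>\<eta>. wt s \<eta> * norm (k \<eta>) \<le> B * (1 + norm (k \<eta>)))}"

text \<open>
  The weight at \<open>z\<close> is split into weights at \<open>z + \<eta>\<close> and
  \<open>\<eta>\<close>. The first is absorbed by the Schwartz function; the second, multiplied by the
  kernel, is bounded by a constant plus a multiple of the kernel.
\<close>

lemma weighted_corr_dominated:
  fixes \<phi> :: "real^'n \<Rightarrow> complex"
  assumes \<phi>: "\<phi> \<in> schwartz" and s: "0 \<le> s" and B: "0 \<le> B"
  shows "dominated (tame_kernels s B) (\<lambda>k z. 1) (\<lambda>k z. complex_of_real (wt s z) * corr k \<phi> z)"
proof -
  have "dominated (tame_kernels s B) (\<lambda>k z. wt (- s) z) (\<lambda>k. corr k \<phi>)"
  proof (rule dominatedI)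
    fix vs :: "(real^'n) list" assume vs: "vs \<in> lists Basis"
    define \<psi> where "\<psi> = iter_pd vs \<phi>"
    have \<psi>: "\<psi> \<in> schwartz" unfolding \<psi>_def by (rule schwartz_iter_pd[OF \<phi> vs])
    obtain C1 where C1: "C1 \<ge> 0" "\<forall>x. norm (\<psi> x) \<le> C1 * wt (- s) x" using schwartz_bound[OF \<psi>] by blast
    obtain C2 where C2: "C2 \<ge> 0" "\<forall>x. norm (\<psi> x) \<le> C2 * wt 0 x" using schwartz_bound[OF \<psi>] by blast
    define N where "N = (LINT x|lborel. norm (\<psi> x))"
    have \<psi>i: "integrable lborel (\<lambda>x. norm (\<psi> x))" using schwartz_integrable0[OF \<psi>] by simp
    have \<psi>m: "(\<lambda>x. norm (\<psi> x)) \<in> borel_measurable borel" using schwartz_measurable[OF \<psi>] by simp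
    define K where "K = 4 powr s * (C1 * B + B * N + B * C2 * B)"
    have "norm (iter_pd vs (corr k \<phi>) z) \<le> K * wt (- s) z" if "k \<in> tame_kernels s B" for k z
    proof -
      have k: "integrable lborel k" "(LINT \<eta>|lborel. norm (k \<eta>)) \<le> B" "\<And>\<eta>. wt s \<eta> * norm (k \<eta>) \<le> B * (1 + norm (k \<eta>))"
        using that by (auto simp: tame_kernels_def)
      have le: "norm (complex_of_real (wt s z) * (k \<eta> * \<psi> (z + \<eta>))) \<le>
          4 powr s * ((C1 + B * C2) * norm (k \<eta>) + B * norm (\<psi> (z + \<eta>)))" for \<eta>
      proof -
        have "wt s z \<le> 4 powr s * (wt s (z + \<eta>) + wt s \<eta>)"
          using wt_add_le[OF s, of "z + \<eta>" "- \<eta>"] by (simp add: wt_uminus)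
        then have "wt s z * (norm (k \<eta>) * norm (\<psi> (z + \<eta>))) \<le>
            4 powr s * (wt s (z + \<eta>) + wt s \<eta>) * (norm (k \<eta>) * norm (\<psi> (z + \<eta>)))"
          by (intro mult_right_mono) auto
        also have "\<dots> = 4 powr s * (norm (k \<eta>) * (wt s (z + \<eta>) * norm (\<psi> (z + \<eta>))) + (wt s \<eta> * norm (k \<eta>)) * norm (\<psi> (z + \<eta>)))"
          by (simp add: algebra_simps)
        also have "\<dots> \<le> 4 powr s * (norm (k \<eta>) * C1 + (B * (1 + norm (k \<eta>))) * norm (\<psi> (z + \<eta>)))"
        proof (intro mult_left_mono add_mono mult_right_mono k(3))
          have "wt s (z + \<eta>) * norm (\<psi> (z + \<eta>)) \<le> wt s (z + \<eta>) * (C1 * wt (- s) (z + \<eta>))"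
            using C1(2) by (intro mult_left_mono) (auto simp: wt_nonneg)
          also have "\<dots> = C1 * (wt s (z + \<eta>) * wt (- s) (z + \<eta>))" by simp
          finally show "wt s (z + \<eta>) * norm (\<psi> (z + \<eta>)) \<le> C1" by (simp add: wt_mult wt_0)
        qed auto
        also have "\<dots> \<le> 4 powr s * ((C1 + B * C2) * norm (k \<eta>) + B * norm (\<psi> (z + \<eta>)))"
        proof (rule mult_left_mono)
          have "(B * norm (k \<eta>)) * norm (\<psi> (z + \<eta>)) \<le> (B * norm (k \<eta>)) * C2"
            using C2(2)[rule_format, of "z + \<eta>"] B by (intro mult_left_mono) (auto simp: wt_0)
          then show "norm (k \<eta>) * C1 + (B * (1 + norm (k \<eta>))) * norm (\<psi> (z + \<eta>)) \<le>
              (C1 + B * C2) * norm (k \<eta>) + B * norm (\<psi> (z + \<eta>))" by (simp add: algebra_simps)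
        qed simp
        finally show ?thesis by (simp add: norm_mult wt_nonneg)
      qed
      have \<psi>shift: "integrable lborel (\<lambda>\<eta>. norm (\<psi> (z + \<eta>)))" "(LINT \<eta>|lborel. norm (\<psi> (z + \<eta>))) = N"
        using lborel_shift[OF \<psi>m, of z] \<psi>i by (simp_all add: N_def)
      have "norm (complex_of_real (wt s z) * corr k \<psi> z) \<le>
          (LINT \<eta>|lborel. 4 powr s * ((C1 + B * C2) * norm (k \<eta>) + B * norm (\<psi> (z + \<eta>))))"
      proof -
        have "complex_of_real (wt s z) * corr k \<psi> z = (LINT \<eta>|lborel. complex_of_real (wt s z) * (k \<eta> * \<psi> (z + \<eta>)))"
          by (simp add: corr_def)
        also have "norm \<dots> \<le> (LINT \<eta>|lborel. 4 powr s * ((C1 + B * C2) * norm (k \<eta>) + B * norm (\<psi> (z + \<eta>))))"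
          using corr_integrable[OF \<psi> k(1), of z] k(1) \<psi>shift(1) by (intro norm_integral_le le) auto
        finally show ?thesis .
      qed
      also have "\<dots> = 4 powr s * ((C1 + B * C2) * (LINT \<eta>|lborel. norm (k \<eta>)) + B * N)"
        using k(1) \<psi>shift by (simp add: Bochner_Integration.integral_add)
      also have "\<dots> \<le> 4 powr s * ((C1 + B * C2) * B + B * N)"
        using k(2) C1(1) C2(1) B by (intro mult_left_mono add_mono) auto
      finally have "wt (- s) z * (wt s z * norm (corr k \<psi> z)) \<le> wt (- s) z * K"
        unfolding K_def by (intro mult_left_mono) (auto simp: norm_mult wt_nonneg algebra_simps)
      then have "(wt (- s) z * wt s z) * norm (corr k \<psi> z) \<le> K * wt (- s) z" by (simp only: mult_ac)
      then show ?thesis by (simp add: wt_mult wt_0 corr_iter_pd[OF \<phi> k(1) vs] \<psi>_def)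
    qed
    then show "\<exists>C. \<forall>k\<in>tame_kernels s B. \<forall>z. norm (iter_pd vs (corr k \<phi>) z) \<le> C * wt (- s) z" by blast
  qed (auto intro: corr_smooth[OF \<phi>] simp: tame_kernels_def wt_nonneg)
  from dominated_mult[OF dominated_const[OF wt_dominated[of s]] this] show ?thesis
    by (simp add: wt_mult wt_0)
qed

section \<open>The slices of the Poisson kernel\<close>

lemma poisson_slice_dominated:
  assumes "0 < y"
  shows "dominated1 (wt (- ((\<alpha> + real CARD('n) + 1) / 2))) (\<lambda>z :: real^'n. poisson \<alpha> (z, y))"
proof -
  have "dominated1 (\<lambda>z. wt (- ((\<alpha> + real CARD('n) + 1) / 2)) (0 - z)) (\<lambda>z :: real^'n. poisson \<alpha> ((0, y) - (z, 0)))"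
    using dominated_reindex[OF slices_dominated[OF poisson_in_kernels assms, of y], of "{()}" "\<lambda>_. (0, y)"] by simp
  moreover have "poisson \<alpha> ((0, y) - (z, 0)) = poisson \<alpha> (z, y)" for z :: "real^'n"
    by (simp add: poisson_def poisson_kernel_def)
  ultimately show ?thesis by (simp add: wt_uminus)
qed

text \<open>
  Up to a factor the weight is at most \<open>1 + |\<eta>|\<^sup>2\<^sup>s\<close>, and
  \<open>|\<eta>|\<^sup>2\<^sup>s\<close> is cancelled by the denominator of the kernel.
\<close>

lemma poisson_kernel_weighted_bound:
  fixes \<eta> :: "real^'n"
  assumes \<alpha>: "\<alpha> > -1" and y: "0 < y"
  defines "c \<equiv> Gamma ((\<alpha> + real CARD('n) + 1) / 2) / (Gamma ((\<alpha> + 1) / 2) * pi powr (real CARD('n) / 2))"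
  shows "wt ((\<alpha> + real CARD('n) + 1) / 2) \<eta> * poisson_kernel \<alpha> y \<eta> \<le>
    2 powr ((\<alpha> + real CARD('n) + 1) / 2) * (poisson_kernel \<alpha> y \<eta> + c * y powr (\<alpha> + 1))"
proof -
  define s where "s = (\<alpha> + real CARD('n) + 1) / 2"
  have s: "s > 0" using \<alpha> by (simp add: s_def add_pos_nonneg)
  have c: "c \<ge> 0" unfolding c_def using s[unfolded s_def] \<alpha>
    by (intro divide_nonneg_nonneg mult_nonneg_nonneg less_imp_le[OF Gamma_real_pos]) auto
  define P where "P = poisson_kernel \<alpha> y \<eta>"
  define \<rho> where "\<rho> = (norm \<eta>)\<^sup>2 + y\<^sup>2"
  have \<rho>: "\<rho> > 0" using y by (simp add: \<rho>_def add_nonneg_pos)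
  have P: "P = c * y powr (\<alpha> + 1) * \<rho> powr (- s)"
    unfolding P_def poisson_kernel_def c_def s_def \<rho>_def powr_minus by (simp only: divide_inverse mult.assoc)
  have P0: "P \<ge> 0" unfolding P_def by (rule poisson_kernel_nonneg[OF \<alpha>])
  have "1 + (norm \<eta>)\<^sup>2 \<le> 2 * max 1 ((norm \<eta>)\<^sup>2)" by simp
  then have "wt s \<eta> \<le> (2 * max 1 ((norm \<eta>)\<^sup>2)) powr s"
    unfolding wt_def using s by (intro powr_mono2) auto
  also have "\<dots> = 2 powr s * max 1 ((norm \<eta>)\<^sup>2) powr s" by (rule powr_mult)
  also have "max 1 ((norm \<eta>)\<^sup>2) powr s \<le> 1 + ((norm \<eta>)\<^sup>2) powr s" by (auto simp: max_def)
  finally have "wt s \<eta> * P \<le> 2 powr s * (1 + ((norm \<eta>)\<^sup>2) powr s) * P"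
    using P0 by (intro mult_right_mono) auto
  also have "\<dots> = 2 powr s * (P + ((norm \<eta>)\<^sup>2) powr s * P)" by (simp add: algebra_simps)
  also have "((norm \<eta>)\<^sup>2) powr s * P \<le> c * y powr (\<alpha> + 1)"
  proof -
    have "((norm \<eta>)\<^sup>2) powr s \<le> \<rho> powr s" using s by (intro powr_mono2) (auto simp: \<rho>_def)
    then have "((norm \<eta>)\<^sup>2) powr s * \<rho> powr (- s) \<le> \<rho> powr s * \<rho> powr (- s)" by (intro mult_right_mono) auto
    also have "\<dots> = 1" using \<rho> by (simp add: powr_add[symmetric])
    finally have "(c * y powr (\<alpha> + 1)) * (((norm \<eta>)\<^sup>2) powr s * \<rho> powr (- s)) \<le> (c * y powr (\<alpha> + 1)) * 1"
      using c by (intro mult_left_mono) auto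
    then show ?thesis by (simp add: P mult_ac)
  qed
  finally show ?thesis by (simp add: P_def s_def)
qed

lemma poisson_measurable: "(\<lambda>z :: real^'n. poisson \<alpha> (z, y)) \<in> borel_measurable borel"
  unfolding poisson_def poisson_kernel_def[abs_def] by measurable

lemma poisson_norm: "\<alpha> > -1 \<Longrightarrow> norm (poisson \<alpha> (z, y)) = poisson_kernel \<alpha> y (z :: real^'n)"
  using poisson_kernel_nonneg[of \<alpha> y z] by (simp add: poisson_def)

lemma poisson_integrable:
  assumes "\<alpha> > -1" "0 < y"
  shows "integrable lborel (\<lambda>z :: real^'n. poisson \<alpha> (z, y))"
    and "(LINT z|lborel. poisson \<alpha> (z :: real^'n, y)) = 1"
  using poisson_kernel_has_integral_1[OF assms, where 'n = 'n] by (simp_all add: poisson_def)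

lemma poisson_mult_tame:
  assumes \<alpha>: "\<alpha> > -1" and Y: "0 < Y" and D: "0 \<le> D"
  shows "\<exists>B\<ge>0. \<forall>y \<psi>. 0 < y \<and> y \<le> Y \<and> \<psi> \<in> borel_measurable borel \<and> (\<forall>\<eta>. norm (\<psi> \<eta>) \<le> D) \<longrightarrow>
    (\<lambda>\<eta> :: real^'n. poisson \<alpha> (\<eta>, y) * \<psi> \<eta>) \<in> tame_kernels ((\<alpha> + real CARD('n) + 1) / 2) B"
proof -
  define s where "s = (\<alpha> + real CARD('n) + 1) / 2"
  define c where "c = Gamma ((\<alpha> + real CARD('n) + 1) / 2) / (Gamma ((\<alpha> + 1) / 2) * pi powr (real CARD('n) / 2))"
  have "s > 0" using \<alpha> by (simp add: s_def add_pos_nonneg)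
  then have c: "c \<ge> 0" unfolding c_def using \<alpha>
    by (intro divide_nonneg_nonneg mult_nonneg_nonneg less_imp_le[OF Gamma_real_pos]) (auto simp: s_def)
  \<comment> \<open>bounds the second term of \<open>poisson_kernel_weighted_bound\<close> times \<open>|\<psi>|\<close> uniformly for \<open>y \<le> Y\<close>\<close>
  define E where "E = c * Y powr (\<alpha> + 1) * D"
  have E: "E \<ge> 0" using c D by (simp add: E_def)
  define B where "B = D + 2 powr s * (1 + E)"
  have B: "B \<ge> 0" using D E by (simp add: B_def)
  have "(\<lambda>\<eta>. poisson \<alpha> (\<eta>, y) * \<psi> \<eta>) \<in> tame_kernels s B"
    if y: "0 < y" "y \<le> Y" and m: "\<psi> \<in> borel_measurable borel" and \<psi>: "\<And>\<eta>. norm (\<psi> \<eta>) \<le> D" for y and \<psi> :: "real^'n \<Rightarrow> complex"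
    unfolding tame_kernels_def
  proof (intro CollectI conjI allI)
    note Pi = poisson_integrable[where 'n = 'n, OF \<alpha> y(1)]
    note P1 = poisson_kernel_has_integral_1[where 'n = 'n, OF \<alpha> y(1)]
    have le: "norm (poisson \<alpha> (\<eta>, y) * \<psi> \<eta>) \<le> D * poisson_kernel \<alpha> y \<eta>" for \<eta>
      using mult_left_mono[OF \<psi>[of \<eta>] poisson_kernel_nonneg[OF \<alpha>, of y \<eta>]]
      by (simp add: norm_mult poisson_norm \<alpha> mult.commute)
    show i: "integrable lborel (\<lambda>\<eta>. poisson \<alpha> (\<eta>, y) * \<psi> \<eta>)"
    proof (rule Bochner_Integration.integrable_bound)
      show "integrable lborel (\<lambda>\<eta> :: real^'n. D * poisson_kernel \<alpha> y \<eta>)" using P1(1) by simp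
      show "AE \<eta> in lborel. norm (poisson \<alpha> (\<eta>, y) * \<psi> \<eta>) \<le> norm (D * poisson_kernel \<alpha> y \<eta>)"
        using le by (intro AE_I2) (metis abs_ge_self order_trans real_norm_def)
      show "(\<lambda>\<eta>. poisson \<alpha> (\<eta>, y) * \<psi> \<eta>) \<in> borel_measurable lborel"
        using m poisson_measurable[of \<alpha> y] by (intro borel_measurable_times) simp_all
    qed
    have "(LINT \<eta>|lborel. norm (poisson \<alpha> (\<eta>, y) * \<psi> \<eta>)) \<le> (LINT \<eta>|lborel. D * poisson_kernel \<alpha> y (\<eta> :: real^'n))"
      using i P1(1) by (intro integral_mono le) auto
    also have "\<dots> = D" using P1(2) by simp
    finally have "(LINT \<eta>|lborel. norm (poisson \<alpha> (\<eta>, y) * \<psi> \<eta>)) \<le> D" .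
    moreover have "D \<le> B" using E by (simp add: B_def)
    ultimately show "(LINT \<eta>|lborel. norm (poisson \<alpha> (\<eta>, y) * \<psi> \<eta>)) \<le> B" by linarith
    fix \<eta> :: "real^'n"
    define P where "P = poisson_kernel \<alpha> y \<eta>"
    define q where "q = norm (\<psi> \<eta>)"
    have q: "0 \<le> q" "q \<le> D" using \<psi> by (auto simp: q_def)
    have P0: "0 \<le> P" unfolding P_def by (rule poisson_kernel_nonneg[OF \<alpha>])
    have "(wt s \<eta> * P) * q \<le> (2 powr s * (P + c * y powr (\<alpha> + 1))) * q"
      using poisson_kernel_weighted_bound[OF \<alpha> y(1), of \<eta>] q(1)
      by (intro mult_right_mono) (simp_all add: P_def s_def c_def)
    also have "\<dots> = 2 powr s * (P * q + (c * y powr (\<alpha> + 1)) * q)" by (simp add: algebra_simps)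
    also have "\<dots> \<le> 2 powr s * (P * q + E)"
      unfolding E_def using c y \<alpha> q by (intro mult_left_mono add_left_mono mult_mono powr_mono2) auto
    also have "\<dots> \<le> 2 powr s * ((1 + E) * (1 + P * q))"
    proof (rule mult_left_mono)
      have "0 \<le> E * (P * q)" using E P0 q by simp
      then show "P * q + E \<le> (1 + E) * (1 + P * q)" by (simp add: algebra_simps)
    qed simp
    also have "\<dots> \<le> B * (1 + P * q)"
      unfolding B_def using D P0 q by (simp add: algebra_simps)
    finally show "wt s \<eta> * norm (poisson \<alpha> (\<eta>, y) * \<psi> \<eta>) \<le> B * (1 + norm (poisson \<alpha> (\<eta>, y) * \<psi> \<eta>))"
      by (simp add: norm_mult poisson_norm \<alpha> P_def q_def mult_ac)
  qed
  then show ?thesis using B unfolding s_def by blast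
qed

section \<open>Functions of polynomial growth as tempered distributions\<close>

lemma dist_of_tempered:
  fixes g :: "real^'n \<Rightarrow> complex"
  assumes g: "g \<in> borel_measurable borel" "\<And>x. norm (g x) \<le> C * wt t x"
  shows "dist_of g \<in> tempered"
proof -
  \<comment> \<open>an exponent for which \<open>wt r\<close> is integrable\<close>
  define r where "r = - (real CARD('n) / 2) - 1"
  obtain k :: nat where k: "2 * \<bar>t - r\<bar> \<le> real k" using real_arch_simple by blast
  have C: "0 \<le> C" using order_trans[OF norm_ge_zero g(2)[of 0]] wt_pos[of t "0 :: real^'n"] by (simp add: zero_le_mult_iff)
  note int = schwartz_integrable[OF _ g]
  show ?thesis
  proof (rule temperedI[where k = k and C = "C * (LINT x|lborel. wt r (x :: real^'n))"])
    show "dist_of g (\<lambda>x. \<phi> x + \<psi> x) = dist_of g \<phi> + dist_of g \<psi>" if "\<phi> \<in> schwartz" "\<psi> \<in> schwartz" for \<phi> \<psi>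
      using int[OF that(1)] int[OF that(2)] by (simp add: dist_of_def distrib_left)
    show "dist_of g (\<lambda>x. c * \<phi> x) = c * dist_of g \<phi>" for c \<phi>
      unfolding dist_of_def integral_mult_right_zero[symmetric] by (simp add: mult_ac)
    fix \<phi> :: "real^'n \<Rightarrow> complex" and K
    assume \<phi>: "\<phi> \<in> schwartz" and K: "\<And>x. (1 + norm x) ^ k * norm (\<phi> x) \<le> K"
    have le: "norm (g x * \<phi> x) \<le> (C * K) * wt r x" for x
    proof -
      have "wt (t - r) x * norm (\<phi> x) \<le> (1 + norm x) ^ k * norm (\<phi> x)"
        by (intro mult_right_mono wt_le_power k) auto
      then have 1: "wt (t - r) x * norm (\<phi> x) \<le> K" using K[of x] by linarith
      have "norm (g x) * norm (\<phi> x) \<le> (C * wt t x) * norm (\<phi> x)" by (intro mult_right_mono g) auto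
      also have "wt t x = wt r x * wt (t - r) x" by (simp add: wt_mult)
      also have "(C * (wt r x * wt (t - r) x)) * norm (\<phi> x) = (C * wt r x) * (wt (t - r) x * norm (\<phi> x))" by simp
      also have "\<dots> \<le> (C * wt r x) * K" using C by (intro mult_left_mono 1) (auto simp: wt_nonneg)
      finally show ?thesis by (simp add: norm_mult mult_ac)
    qed
    have "norm (dist_of g \<phi>) \<le> (LINT x|lborel. (C * K) * wt r (x :: real^'n))"
      unfolding dist_of_def
      by (rule norm_integral_le[OF int[OF \<phi>] _ le]) (intro integrable_mult_right integrable_wt, simp add: r_def)
    then show "norm (dist_of g \<phi>) \<le> C * (LINT x|lborel. wt r (x :: real^'n)) * K" by (simp add: mult_ac)
  qed
qed

section \<open>The Poisson integral as a function\<close>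

text \<open>
  The form \<open>F\<close> is the extension of the integrable distribution obtained by dividing
  \<open>f\<close> by the weight.
\<close>

locale weighted_distribution =
  fixes \<alpha> :: real and f F :: "(real^'n \<Rightarrow> complex) \<Rightarrow> complex"
  assumes \<alpha>: "\<alpha> > -1" and F: "Bc_form F" and tempered_f: "f \<in> tempered"
    and f_eq: "\<And>\<phi>. \<phi> \<in> schwartz \<Longrightarrow> f \<phi> = F (\<lambda>z. complex_of_real (wt ((\<alpha> + real CARD('n) + 1) / 2) z) * \<phi> z)"
begin

definition s :: real where "s = (\<alpha> + real CARD('n) + 1) / 2"

abbreviation w :: "real^'n \<Rightarrow> complex" where "w z \<equiv> complex_of_real (wt s z)"

abbreviation P :: "real \<Rightarrow> real^'n \<Rightarrow> complex" where "P y z \<equiv> poisson \<alpha> (z, y)"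

lemma s_nonneg: "0 \<le> s"
  using \<alpha> by (simp add: s_def)

lemma s_gt: "- s < - (real CARD('n) / 2)"
  using \<alpha> by (simp add: s_def)

lemma P_dominated: "0 < y \<Longrightarrow> dominated1 (wt (- s)) (P y)"
  unfolding s_def by (rule poisson_slice_dominated)

lemma P_bound:
  assumes "0 < y"
  shows "\<exists>C\<ge>0. \<forall>z. norm (P y z) \<le> C * wt (- s) z"
  using dominatedD0[OF P_dominated[OF assms]] by auto

lemma P_even: "P y (- z) = P y z"
  by (simp add: poisson_def poisson_kernel_def)

lemma P_mult_tame:
  fixes h :: "'i \<Rightarrow> real" and \<Psi> :: "'i \<Rightarrow> real^'n \<Rightarrow> complex"
  assumes "0 < Y" "0 \<le> D"
    and h: "\<And>i. i \<in> I \<Longrightarrow> 0 < h i" "\<And>i. i \<in> I \<Longrightarrow> h i \<le> Y"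
    and \<Psi>: "\<And>i. i \<in> I \<Longrightarrow> \<Psi> i \<in> borel_measurable borel" "\<And>i x. i \<in> I \<Longrightarrow> norm (\<Psi> i x) \<le> D"
  shows "\<exists>b\<ge>0. \<forall>i\<in>I. (\<lambda>\<eta>. P (h i) \<eta> * \<Psi> i \<eta>) \<in> tame_kernels s b"
proof -
  obtain b where b: "0 \<le> b" "\<forall>y \<psi>. 0 < y \<and> y \<le> Y \<and> \<psi> \<in> borel_measurable borel \<and> (\<forall>\<eta>. norm (\<psi> \<eta>) \<le> D) \<longrightarrow>
    (\<lambda>\<eta>. P y \<eta> * \<psi> \<eta>) \<in> tame_kernels s b"
    using poisson_mult_tame[OF \<alpha> assms(1,2), where 'n = 'n] unfolding s_def by (elim exE conjE)
  show ?thesis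
    by (intro exI[of _ b] conjI b(1) ballI b(2)[rule_format] allI h \<Psi>) assumption+
qed

lemma f_shift:
  assumes "\<phi> \<in> schwartz"
  shows "refl_conv f \<phi> \<eta> = F (\<lambda>z. w z * \<phi> (z + \<eta>))"
proof -
  have "translate (- \<eta>) \<phi> = (\<lambda>x. \<phi> (1 *\<^sub>R x + \<eta>))" by (simp add: translate_def[abs_def])
  with schwartz_affine[OF assms, of 1 \<eta>] show ?thesis
    by (simp add: refl_conv_def f_eq s_def)
qed

text \<open>
  The extension to \<open>\<B>\<close> of the distribution whose pairing with 1 defines the convolution
  of \<open>P y\<close> with \<open>f\<close> at \<open>\<phi>\<close>.
\<close>

definition conv_form :: "real \<Rightarrow> (real^'n \<Rightarrow> complex) \<Rightarrow> (real^'n \<Rightarrow> complex) \<Rightarrow> complex" where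
  "conv_form y \<phi> \<psi> = F (\<lambda>z. w z * corr (\<lambda>\<eta>. P y \<eta> * \<psi> \<eta>) \<phi> z)"

lemma B_bound: "\<psi> \<in> space_B \<Longrightarrow> \<exists>D\<ge>0. \<forall>x. norm (\<psi> x) \<le> D"
  using dominatedD0[of "{()}" "\<lambda>_ _. 1" "\<lambda>_. \<psi>"] by (simp add: space_B_iff)

lemma B_measurable: "\<psi> \<in> space_B \<Longrightarrow> \<psi> \<in> borel_measurable borel"
  by (intro borel_measurable_continuous_onI smooth_continuous0 space_B_smooth)

lemma P_mult_integrable:
  assumes "0 < y" "\<psi> \<in> space_B"
  shows "integrable lborel (\<lambda>\<eta>. P y \<eta> * \<psi> \<eta>)"
proof -
  obtain D where D: "D \<ge> 0" "\<forall>x. norm (\<psi> x) \<le> D" using B_bound[OF assms(2)] by blast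
  obtain b where "b \<ge> 0" "\<forall>i\<in>{()}. (\<lambda>\<eta>. P y \<eta> * \<psi> \<eta>) \<in> tame_kernels s b"
    using P_mult_tame[OF assms(1) D(1), of "{()}" "\<lambda>_. y" "\<lambda>_. \<psi>"] assms(1) B_measurable[OF assms(2)] D(2) by auto
  then show ?thesis by (simp add: tame_kernels_def)
qed

lemma weighted_corr_in_B:
  assumes "0 < y" "\<psi> \<in> space_B" "\<phi> \<in> schwartz"
  shows "(\<lambda>z. w z * corr (\<lambda>\<eta>. P y \<eta> * \<psi> \<eta>) \<phi> z) \<in> space_B"
proof -
  obtain D where D: "D \<ge> 0" "\<forall>x. norm (\<psi> x) \<le> D" using B_bound[OF assms(2)] by blast
  obtain b where b: "b \<ge> 0" "\<forall>i\<in>{()}. (\<lambda>\<eta>. P y \<eta> * \<psi> \<eta>) \<in> tame_kernels s b"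
    using P_mult_tame[OF assms(1) D(1), of "{()}" "\<lambda>_. y" "\<lambda>_. \<psi>"] assms(1) B_measurable[OF assms(2)] D(2) by auto
  show ?thesis
    by (rule dominated_in_B[OF weighted_corr_dominated[OF assms(3) s_nonneg b(1)] bspec[OF b(2) singletonI]])
qed

lemma conv_form_add:
  assumes "0 < y" "\<phi> \<in> schwartz" "\<psi> \<in> space_B" "\<psi>' \<in> space_B"
  shows "conv_form y \<phi> (\<lambda>x. \<psi> x + \<psi>' x) = conv_form y \<phi> \<psi> + conv_form y \<phi> \<psi>'"
proof -
  note i = corr_integrable[OF assms(2) P_mult_integrable[OF assms(1,3)]]
    corr_integrable[OF assms(2) P_mult_integrable[OF assms(1,4)]]
  have "(\<lambda>z. w z * corr (\<lambda>\<eta>. P y \<eta> * (\<psi> \<eta> + \<psi>' \<eta>)) \<phi> z) =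
      (\<lambda>z. w z * corr (\<lambda>\<eta>. P y \<eta> * \<psi> \<eta>) \<phi> z + w z * corr (\<lambda>\<eta>. P y \<eta> * \<psi>' \<eta>) \<phi> z)"
    using i by (simp add: corr_def distrib_left distrib_right)
  then show ?thesis
    unfolding conv_form_def
    using Bc_form_add[OF F weighted_corr_in_B[OF assms(1,3,2)] weighted_corr_in_B[OF assms(1,4,2)]] by simp
qed

lemma conv_form_cmult:
  assumes "0 < y" "\<phi> \<in> schwartz" "\<psi> \<in> space_B"
  shows "conv_form y \<phi> (\<lambda>x. c * \<psi> x) = c * conv_form y \<phi> \<psi>"
proof -
  have "corr (\<lambda>\<eta>. P y \<eta> * (c * \<psi> \<eta>)) \<phi> z = c * corr (\<lambda>\<eta>. P y \<eta> * \<psi> \<eta>) \<phi> z" for z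
    unfolding corr_def integral_mult_right_zero[symmetric] by (simp add: mult_ac)
  then have "(\<lambda>z. w z * corr (\<lambda>\<eta>. P y \<eta> * (c * \<psi> \<eta>)) \<phi> z) = (\<lambda>z. c * (w z * corr (\<lambda>\<eta>. P y \<eta> * \<psi> \<eta>) \<phi> z))"
    by (simp add: mult_ac)
  then show ?thesis
    unfolding conv_form_def using Bc_form_cmult[OF F weighted_corr_in_B[OF assms(1,3,2)]] by simp
qed

lemma wt_s_locally_bounded: "\<exists>K. \<forall>x\<in>cball 0 R. \<bar>wt s (x :: real^'n)\<bar> \<le> K"
proof -
  have "bounded (wt s ` cball (0 :: real^'n) R)"
    by (intro compact_imp_bounded compact_continuous_image continuous_on_wt compact_cball)
  then show ?thesis by (auto simp: bounded_iff)
qed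

text \<open>
  For a null sequence of functions \<open>\<Phi> j\<close> the weighted correlations stay bounded in
  \<open>\<B>\<close>, since the kernels \<open>P y \<Phi> j\<close> are uniformly tame; without the
  weight they tend to 0 uniformly with all derivatives, since \<open>P y \<Phi> j\<close> tends to 0 in
  the mean.
\<close>

lemma conv_form_Bc_form:
  assumes y: "0 < y" and \<phi>: "\<phi> \<in> schwartz"
  shows "Bc_form (conv_form y \<phi>)"
  unfolding Bc_form_def
proof (intro conjI ballI allI impI conv_form_add[OF y \<phi>] conv_form_cmult[OF y \<phi>])
  fix \<Phi> :: "nat \<Rightarrow> real^'n \<Rightarrow> complex" assume null: "B_null \<Phi>"
  then have dom: "dominated UNIV (\<lambda>_ _. 1) \<Phi>" by (simp add: B_null_def)
  have B: "\<Phi> j \<in> space_B" for j using dominated_in_B[OF dom] by simp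
  obtain D where D: "D \<ge> 0" "\<And>j x. norm (\<Phi> j x) \<le> D" using dominatedD0[OF dom] by auto
  obtain b where b: "b \<ge> 0" "\<forall>j\<in>UNIV. (\<lambda>\<eta>. P y \<eta> * \<Phi> j \<eta>) \<in> tame_kernels s b"
    using P_mult_tame[OF y D(1), of UNIV "\<lambda>_. y" \<Phi>, OF y order_refl B_measurable[OF B] D(2)] by (elim exE conjE)
  define \<epsilon> where "\<epsilon> j = (LINT \<eta>|lborel. norm (P y \<eta> * \<Phi> j \<eta>))" for j
  have ptw: "(\<lambda>j. \<Phi> j x) \<longlonglongrightarrow> 0" for x
  proof (rule tendstoI)
    fix e :: real assume "e > 0"
    then have "\<forall>\<^sub>F j in sequentially. \<forall>x\<in>cball 0 (norm x). norm (iter_pd [] (\<Phi> j) x) < e"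
      using null unfolding B_null_def by blast
    then show "\<forall>\<^sub>F j in sequentially. dist (\<Phi> j x) 0 < e"
      by (rule eventually_mono) simp
  qed
  have \<epsilon>: "\<epsilon> \<longlonglongrightarrow> 0"
  proof -
    have "(\<lambda>j. LINT \<eta>|lborel. norm (P y \<eta> * \<Phi> j \<eta>)) \<longlonglongrightarrow> (LINT (\<eta> :: real^'n)|lborel. 0)"
    proof (rule integral_dominated_convergence[where w = "\<lambda>\<eta>. D * norm (P y \<eta>)"])
      show "integrable lborel (\<lambda>\<eta>. D * norm (P y \<eta>))"
        using poisson_integrable(1)[OF \<alpha> y, where 'n = 'n] by simp
      show "(\<lambda>\<eta>. norm (P y \<eta> * \<Phi> j \<eta>)) \<in> borel_measurable lborel" for j
        using P_mult_integrable[OF y B[of j]] by simp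
      show "AE \<eta> in lborel. norm (norm (P y \<eta> * \<Phi> j \<eta>)) \<le> D * norm (P y \<eta>)" for j
        by (intro AE_I2) (use mult_right_mono[OF D(2)[of j] norm_ge_zero] in \<open>simp add: norm_mult mult.commute[of "norm (P y _)"]\<close>)
      show "AE \<eta> in lborel. (\<lambda>j. norm (P y \<eta> * \<Phi> j \<eta>)) \<longlonglongrightarrow> 0"
        by (intro AE_I2 tendsto_norm_zero tendsto_mult_right_zero ptw)
    qed simp
    then show ?thesis by (simp add: \<epsilon>_def[abs_def])
  qed
  have "B_null (\<lambda>j z. w z * corr (\<lambda>\<eta>. P y \<eta> * \<Phi> j \<eta>) \<phi> z)"
  proof (rule B_nullI[OF _ _ \<epsilon> wt_s_locally_bounded])
    show "dominated UNIV (\<lambda>_ _. 1) (\<lambda>j z. w z * corr (\<lambda>\<eta>. P y \<eta> * \<Phi> j \<eta>) \<phi> z)"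
      by (rule dominated_reindex[OF weighted_corr_dominated[OF \<phi> s_nonneg b(1)], where h = "\<lambda>j \<eta>. P y \<eta> * \<Phi> j \<eta>"]) (rule bspec[OF b(2)])
    have "dominated UNIV (\<lambda>j z. \<epsilon> j) (\<lambda>j. corr (\<lambda>\<eta>. P y \<eta> * \<Phi> j \<eta>) \<phi>)"
      unfolding \<epsilon>_def
      by (rule dominated_reindex[OF corr_dominated_L1[OF \<phi>], where h = "\<lambda>j \<eta>. P y \<eta> * \<Phi> j \<eta>"])
        (use P_mult_integrable[OF y B] in simp)
    from dominated_mult[OF dominated_const[OF wt_dominated[of s]] this]
    show "dominated UNIV (\<lambda>j z. \<epsilon> j * wt s z) (\<lambda>j z. w z * corr (\<lambda>\<eta>. P y \<eta> * \<Phi> j \<eta>) \<phi> z)"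
      by (simp add: mult.commute)
  qed
  from Bc_form_null[OF F this] show "(\<lambda>j. conv_form y \<phi> (\<Phi> j)) \<longlonglongrightarrow> 0"
    by (simp add: conv_form_def)
qed

lemma refl_conv_properties:
  assumes \<phi>: "\<phi> \<in> schwartz"
  shows "refl_conv f \<phi> \<in> borel_measurable borel" "\<exists>C\<ge>0. \<forall>\<eta>. norm (refl_conv f \<phi> \<eta>) \<le> C * wt s \<eta>"
  using Bc_form_weighted_shift[OF F s_nonneg schwartz_dominated[OF \<phi>]]
  by (auto simp: f_shift[OF \<phi>] intro!: borel_measurable_continuous_onI)

lemma conv_form_schwartz:
  assumes y: "0 < y" and \<phi>: "\<phi> \<in> schwartz" and \<psi>: "\<psi> \<in> schwartz"
  shows "conv_form y \<phi> \<psi> = dist_mult (refl_conv f \<phi>) (dist_of (P y)) \<psi>"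
proof -
  have Pm: "P y \<in> borel_measurable borel" by (rule poisson_measurable)
  obtain C where C: "C \<ge> 0" "\<forall>z. norm (P y z) \<le> C * wt (- s) z" using P_bound[OF y] by blast
  have "integrable lborel (\<lambda>\<eta>. (w \<eta> * P y \<eta>) * \<psi> \<eta>)"
  proof (rule schwartz_integrable[OF \<psi>, where C = C and t = 0])
    show "(\<lambda>\<eta>. w \<eta> * P y \<eta>) \<in> borel_measurable borel" using Pm by simp
    fix x
    have "wt s x * norm (P y x) \<le> wt s x * (C * wt (- s) x)" using C by (intro mult_left_mono) (auto simp: wt_nonneg)
    also have "\<dots> = C * (wt s x * wt (- s) x)" by simp
    finally show "norm (w x * P y x) \<le> C * wt 0 x" by (simp add: norm_mult wt_mult wt_nonneg)
  qed
  then have "integrable lborel (\<lambda>\<eta>. norm ((w \<eta> * P y \<eta>) * \<psi> \<eta>))" by simp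
  then have int: "integrable lborel (\<lambda>\<eta>. norm (P y \<eta> * \<psi> \<eta>) * wt s \<eta>)"
    by (simp add: norm_mult wt_nonneg mult_ac)
  have "conv_form y \<phi> \<psi> = (LINT \<eta>|lborel. P y \<eta> * \<psi> \<eta> * F (\<lambda>z. w z * \<phi> (z + \<eta>)))"
    unfolding conv_form_def
    by (rule Bc_form_weighted_corr(1)[OF F s_nonneg schwartz_dominated[OF \<phi>] _ int])
      (use Pm schwartz_measurable[OF \<psi>] in simp)
  then show ?thesis
    by (simp add: dist_mult_def dist_of_def f_shift[OF \<phi>] mult_ac)
qed

text \<open>
  The form \<open>conv_form y \<phi>\<close> is bounded with respect to the supremum norm alone, because
  \<open>F\<close> is bounded on the weighted correlations of \<open>P y \<psi>\<close> with
  \<open>\<phi>\<close> for \<open>|\<psi>| \<le> 1\<close>.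
\<close>

lemma convolvable_P:
  assumes y: "0 < y"
  shows "convolvable (dist_of (P y)) f"
  unfolding convolvable_def
proof (intro conjI ballI tempered_f)
  have Pm: "P y \<in> borel_measurable borel" by (rule poisson_measurable)
  obtain C where C: "C \<ge> 0" "\<forall>z. norm (P y z) \<le> C * wt (- s) z" using P_bound[OF y] by blast
  show "dist_of (P y) \<in> tempered" by (rule dist_of_tempered[OF Pm]) (use C in auto)
  fix \<phi> :: "real^'n \<Rightarrow> complex" assume \<phi>: "\<phi> \<in> schwartz"
  obtain D where D: "D \<ge> 0" "\<forall>\<eta>. norm (refl_conv f \<phi> \<eta>) \<le> D * wt s \<eta>" using refl_conv_properties(2)[OF \<phi>] by blast
  have "dist_of (\<lambda>x. P y x * refl_conv f \<phi> x) \<in> tempered"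
  proof (rule dist_of_tempered[where C = "C * D" and t = 0])
    show "(\<lambda>x. P y x * refl_conv f \<phi> x) \<in> borel_measurable borel" using Pm refl_conv_properties(1)[OF \<phi>] by simp
    fix x
    have "norm (P y x) * norm (refl_conv f \<phi> x) \<le> (C * wt (- s) x) * (D * wt s x)"
      using C D by (intro mult_mono) (auto simp: wt_nonneg)
    also have "\<dots> = (C * D) * (wt (- s) x * wt s x)" by simp
    finally show "norm (P y x * refl_conv f \<phi> x) \<le> C * D * wt 0 x" by (simp add: norm_mult wt_mult)
  qed
  moreover have "dist_of (\<lambda>x. P y x * refl_conv f \<phi> x) = dist_mult (refl_conv f \<phi>) (dist_of (P y))"
    by (rule ext) (simp add: dist_of_def dist_mult_def mult.assoc)
  ultimately have temp: "dist_mult (refl_conv f \<phi>) (dist_of (P y)) \<in> tempered" by simp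
  note V = conv_form_Bc_form[OF y \<phi>]
  let ?I = "{\<psi> \<in> space_B. \<forall>x. norm (\<psi> x) \<le> 1}"
  have I: "\<psi> \<in> borel_measurable borel" "norm (\<psi> x) \<le> 1" if "\<psi> \<in> ?I" for \<psi> x
    using that by (simp_all add: B_measurable)
  have "\<exists>b\<ge>0. \<forall>\<psi>\<in>?I. (\<lambda>\<eta>. P y \<eta> * \<psi> \<eta>) \<in> tame_kernels s b"
    by (rule P_mult_tame[OF y zero_le_one, of ?I "\<lambda>_. y" "\<lambda>\<psi>. \<psi>"]) (rule y order_refl I, assumption?)+
  then obtain b where b: "b \<ge> 0" "\<forall>\<psi>\<in>?I. (\<lambda>\<eta>. P y \<eta> * \<psi> \<eta>) \<in> tame_kernels s b"
    by (elim exE conjE)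
  have "dominated ?I (\<lambda>\<psi> z. 1) (\<lambda>\<psi> z. w z * corr (\<lambda>\<eta>. P y \<eta> * \<psi> \<eta>) \<phi> z)"
    by (rule dominated_reindex[OF weighted_corr_dominated[OF \<phi> s_nonneg b(1)], where h = "\<lambda>\<psi> \<eta>. P y \<eta> * \<psi> \<eta>"]) (rule bspec[OF b(2)])
  from Bc_form_bound[OF F this] obtain K where K: "K \<ge> 0" "\<forall>\<psi>\<in>?I. norm (conv_form y \<phi> \<psi>) \<le> K * 1"
    unfolding conv_form_def by blast
  have sub: "space_Bdot \<subseteq> (space_B :: (real^'n \<Rightarrow> complex) set)" by (auto simp: space_Bdot_def)
  have "conv_form y \<phi> \<in> dual space_Bdot B_seminorms"
  proof (rule dual_BdotI[where C = K])
    show "conv_form y \<phi> (\<lambda>x. \<psi> x + \<psi>' x) = conv_form y \<phi> \<psi> + conv_form y \<phi> \<psi>'" if "\<psi> \<in> space_Bdot" "\<psi>' \<in> space_Bdot" for \<psi> \<psi>'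
      using that sub by (intro Bc_form_add[OF V]) auto
    show "conv_form y \<phi> (\<lambda>x. c * \<psi> x) = c * conv_form y \<phi> \<psi>" if "\<psi> \<in> space_Bdot" for \<psi> c
      using that sub by (intro Bc_form_cmult[OF V]) auto
    fix \<psi> :: "real^'n \<Rightarrow> complex" and M assume \<psi>: "\<psi> \<in> space_Bdot" and M: "\<And>x. norm (\<psi> x) \<le> M"
    have \<psi>B: "\<psi> \<in> space_B" using \<psi> sub by blast
    have "0 \<le> M" using order_trans[OF norm_ge_zero M] .
    show "norm (conv_form y \<phi> \<psi>) \<le> K * M"
    proof (cases "M = 0")
      case True
      then have "\<psi> = (\<lambda>x. 0)" using M by auto
      then show ?thesis using Bc_form_zero[OF V] True by simp
    next
      case False
      with \<open>0 \<le> M\<close> have M0: "M > 0" by simp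
      define \<psi>' where "\<psi>' x = complex_of_real (1 / M) * \<psi> x" for x
      have "\<psi>' \<in> ?I"
        using space_B_cmult[OF \<psi>B, of "complex_of_real (1 / M)"] M M0
        by (auto simp: \<psi>'_def[abs_def] norm_mult norm_divide field_simps)
      then have "norm (conv_form y \<phi> \<psi>') \<le> K" using K(2) by simp
      moreover have "conv_form y \<phi> \<psi>' = complex_of_real (1 / M) * conv_form y \<phi> \<psi>"
        unfolding \<psi>'_def[abs_def] by (rule Bc_form_cmult[OF V \<psi>B])
      ultimately show ?thesis using M0 by (simp add: norm_mult norm_divide field_simps)
    qed
  qed
  then show "dist_mult (refl_conv f \<phi>) (dist_of (P y)) \<in> DL1"
    unfolding DL1_def using temp conv_form_schwartz[OF y \<phi>] by blast
qed

definition poisson_int :: "(real^'n) \<times> real \<Rightarrow> complex" where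
  "poisson_int = slice_transform s F (poisson \<alpha>)"

lemma poisson_int_eq: "poisson_int (x, y) = F (\<lambda>z. w z * P y (z + - x))"
proof -
  have "poisson \<alpha> ((x, y) - (z, 0)) = P y (z + - x)" for z
    using P_even[where y = y and z = "z - x"] by simp
  then show ?thesis by (simp add: poisson_int_def slice_transform_def)
qed

lemma poisson_int_slice:
  assumes y: "0 < y"
  shows "continuous_on UNIV (\<lambda>x. poisson_int (x, y))"
    and "\<exists>C\<ge>0. \<forall>x. norm (poisson_int (x, y)) \<le> C * wt s x"
proof -
  note * = Bc_form_weighted_shift[OF F s_nonneg P_dominated[OF y]]
  show "continuous_on UNIV (\<lambda>x. poisson_int (x, y))"
    unfolding poisson_int_eq
    by (rule continuous_on_compose2[OF *(1), where f = uminus]) (auto intro: continuous_intros)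
  obtain C where C: "C \<ge> 0" "\<forall>\<eta>. norm (F (\<lambda>z. w z * P y (z + \<eta>))) \<le> C * wt s \<eta>" using *(2) by blast
  have "norm (poisson_int (x, y)) \<le> C * wt s x" for x
    using C(2)[rule_format, of "- x"] unfolding poisson_int_eq wt_uminus .
  with C(1) show "\<exists>C\<ge>0. \<forall>x. norm (poisson_int (x, y)) \<le> C * wt s x" by blast
qed

lemma poisson_int_measurable: "0 < y \<Longrightarrow> (\<lambda>x. poisson_int (x, y)) \<in> borel_measurable borel"
  by (intro borel_measurable_continuous_onI poisson_int_slice)

lemma poisson_int_integrable:
  assumes "0 < y" "\<phi> \<in> schwartz"
  shows "integrable lborel (\<lambda>x. poisson_int (x, y) * \<phi> x)"
proof -
  obtain C where "C \<ge> 0" "\<forall>x. norm (poisson_int (x, y)) \<le> C * wt s x" using poisson_int_slice(2)[OF assms(1)] by blast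
  then show ?thesis by (intro schwartz_integrable[OF assms(2) poisson_int_measurable[OF assms(1)], of C s]) auto
qed

text \<open>
  The correlation of \<open>P y\<close> with \<open>\<phi>\<close> is also a superposition of translates
  of \<open>P y\<close> with the coefficients \<open>\<phi>(- \<eta>)\<close>, and \<open>F\<close> maps
  the weighted translates to values of the Poisson integral.
\<close>

lemma conv_form_one:
  assumes y: "0 < y" and \<phi>: "\<phi> \<in> schwartz"
  shows "conv_form y \<phi> (\<lambda>x. 1) = dist_of (\<lambda>x. poisson_int (x, y)) \<phi>"
proof -
  have Pm: "P y \<in> borel_measurable borel" by (rule poisson_measurable)
  have \<phi>m: "\<phi> \<in> borel_measurable borel" by (rule schwartz_measurable[OF \<phi>])
  define k where "k \<eta> = \<phi> (- \<eta>)" for \<eta>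
  have k: "k \<in> schwartz" using schwartz_affine[OF \<phi>, of "-1" 0] by (simp add: k_def[abs_def])
  have corr_eq: "corr (\<lambda>\<eta>. P y \<eta> * 1) \<phi> z = corr k (P y) z" for z
  proof -
    have "corr (\<lambda>\<eta>. P y \<eta> * 1) \<phi> z = (LINT x|lborel. P y (- z + x) * \<phi> (z + (- z + x)))"
      unfolding corr_def mult_1_right
      by (rule lborel_shift(2)[symmetric, where f = "\<lambda>\<eta>. P y \<eta> * \<phi> (z + \<eta>)"]) (use Pm \<phi>m in simp)
    also have "\<dots> = (LINT x|lborel. k (- x) * P y (z + - x))"
    proof (rule Bochner_Integration.integral_cong[OF refl])
      fix x
      have "P y (- z + x) = P y (z + - x)" using P_even[where y = y and z = "z + - x"] by simp
      then show "P y (- z + x) * \<phi> (z + (- z + x)) = k (- x) * P y (z + - x)" by (simp add: k_def)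
    qed
    also have "\<dots> = corr k (P y) z"
      unfolding corr_def
      by (rule lborel_reflect(2)[where f = "\<lambda>\<eta>. k \<eta> * P y (z + \<eta>)"]) (use Pm schwartz_measurable[OF k] in simp)
    finally show ?thesis .
  qed
  have "integrable lborel (\<lambda>\<eta>. w \<eta> * k \<eta>)"
    by (rule schwartz_integrable[OF k, where C = 1 and t = s]) (auto simp: wt_nonneg)
  then have "integrable lborel (\<lambda>\<eta>. norm (w \<eta> * k \<eta>))" by simp
  then have int: "integrable lborel (\<lambda>\<eta>. norm (k \<eta>) * wt s \<eta>)"
    by (simp add: norm_mult wt_nonneg mult.commute)
  note * = Bc_form_weighted_corr[OF F s_nonneg P_dominated[OF y] schwartz_measurable[OF k] int]
  have "conv_form y \<phi> (\<lambda>x. 1) = (LINT \<eta>|lborel. k \<eta> * F (\<lambda>z. w z * P y (z + \<eta>)))"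
    unfolding conv_form_def corr_eq by (rule *(1))
  also have "\<dots> = (LINT x|lborel. k (- x) * F (\<lambda>z. w z * P y (z + - x)))"
    by (rule lborel_reflect(2)[symmetric, where f = "\<lambda>\<eta>. k \<eta> * F (\<lambda>z. w z * P y (z + \<eta>))"])
      (use borel_measurable_integrable[OF *(2)] in simp)
  also have "\<dots> = dist_of (\<lambda>x. poisson_int (x, y)) \<phi>"
    unfolding dist_of_def poisson_int_eq by (simp add: k_def mult.commute)
  finally show ?thesis .
qed

lemma dist_conv_P:
  assumes y: "0 < y" and \<phi>: "\<phi> \<in> schwartz"
  shows "dist_conv (dist_of (P y)) f \<phi> = dist_of (\<lambda>x. poisson_int (x, y)) \<phi>"
  unfolding dist_conv_def conv_form_one[OF y \<phi>, symmetric]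
  by (rule Bc_pairing_eq[OF conv_form_Bc_form[OF y \<phi>] conv_form_schwartz[OF y \<phi>] space_B_const])

lemma poisson_integral_eq:
  assumes y: "0 < y"
  shows "poisson_integral \<alpha> f (x, y) = poisson_int (x, y)"
proof -
  have K: "(\<lambda>z. complex_of_real (poisson_kernel \<alpha> y z)) = P y" by (simp add: poisson_def)
  have "(THE g. convolvable (dist_of (P y)) f \<and> continuous_on UNIV g \<and>
      (\<forall>\<phi>\<in>schwartz. integrable lborel (\<lambda>z. g z * \<phi> z) \<and> dist_conv (dist_of (P y)) f \<phi> = dist_of g \<phi>)) =
      (\<lambda>x. poisson_int (x, y))"
  proof (rule the_equality)
    show "convolvable (dist_of (P y)) f \<and> continuous_on UNIV (\<lambda>x. poisson_int (x, y)) \<and>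
      (\<forall>\<phi>\<in>schwartz. integrable lborel (\<lambda>z. poisson_int (z, y) * \<phi> z) \<and>
        dist_conv (dist_of (P y)) f \<phi> = dist_of (\<lambda>x. poisson_int (x, y)) \<phi>)"
      using convolvable_P[OF y] poisson_int_slice(1)[OF y] poisson_int_integrable[OF y] dist_conv_P[OF y] by blast
  next
    fix g assume g: "convolvable (dist_of (P y)) f \<and> continuous_on UNIV g \<and>
      (\<forall>\<phi>\<in>schwartz. integrable lborel (\<lambda>z. g z * \<phi> z) \<and> dist_conv (dist_of (P y)) f \<phi> = dist_of g \<phi>)"
    have gi: "integrable lborel (\<lambda>z. g z * \<phi> z)" and ge: "dist_of g \<phi> = dist_of (\<lambda>x. poisson_int (x, y)) \<phi>"
      if "\<phi> \<in> schwartz" for \<phi>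
      using g that dist_conv_P[OF y that] by auto
    have "g x - poisson_int (x, y) = 0" for x
    proof (rule continuous_eq_zero_if_integrals_zero[where g = "\<lambda>x. g x - poisson_int (x, y)"])
      show "continuous_on UNIV (\<lambda>x. g x - poisson_int (x, y))"
        using g poisson_int_slice(1)[OF y] by (intro continuous_intros) auto
      fix \<phi> :: "real^'n \<Rightarrow> complex" assume \<phi>: "\<phi> \<in> schwartz"
      note i = gi[OF \<phi>] poisson_int_integrable[OF y \<phi>]
      show "integrable lborel (\<lambda>x. (g x - poisson_int (x, y)) * \<phi> x)"
        using i by (simp add: left_diff_distrib)
      show "(LINT x|lborel. (g x - poisson_int (x, y)) * \<phi> x) = 0"
        using i ge[OF \<phi>] by (simp add: left_diff_distrib dist_of_def)
    qed
    then show "g = (\<lambda>x. poisson_int (x, y))" by auto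
  qed
  then show ?thesis by (simp add: poisson_integral_def K Let_def)
qed

section \<open>The boundary values\<close>

text \<open>
  Bounds the distance between \<open>\<phi>\<close> and its average over \<open>P y\<close>, as
  \<open>\<phi>(z + \<eta>) - \<phi>(z)\<close> is at most a multiple of \<open>min 1 |\<eta>|\<close>.
\<close>

definition spread :: "real \<Rightarrow> real" where
  "spread y = (LINT \<eta>|lborel. poisson_kernel \<alpha> y (\<eta> :: real^'n) * min 1 (norm \<eta>))"

lemma spread_integrable:
  assumes y: "0 < y"
  shows "integrable lborel (\<lambda>\<eta> :: real^'n. poisson_kernel \<alpha> y \<eta> * min 1 (norm \<eta>))"
proof (rule Bochner_Integration.integrable_bound[OF poisson_kernel_has_integral_1(1)[OF \<alpha> y]])
  show "(\<lambda>\<eta> :: real^'n. poisson_kernel \<alpha> y \<eta> * min 1 (norm \<eta>)) \<in> borel_measurable lborel"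
    using borel_measurable_integrable[OF poisson_kernel_has_integral_1(1)[OF \<alpha> y, where 'n = 'n]] by simp
  show "AE \<eta> in lborel. norm (poisson_kernel \<alpha> y \<eta> * min 1 (norm \<eta>)) \<le> norm (poisson_kernel \<alpha> y (\<eta> :: real^'n))"
    using poisson_kernel_nonneg[OF \<alpha>, of y] by (intro AE_I2) (auto simp: abs_mult intro!: mult_left_le)
qed

text \<open>
  The mass within distance \<open>\<delta>\<close> of the origin contributes at most
  \<open>\<delta>\<close>. Farther out the kernel is at most a constant depending on
  \<open>\<delta>\<close> times \<open>y\<^sup>\<alpha>\<^sup>+\<^sup>1 wt (- s)\<close>, which is
  integrable and tends to 0 with \<open>y\<close>.
\<close>

lemma spread_tendsto_0:
  assumes X: "\<And>i. 0 < X i" "X \<longlonglongrightarrow> 0"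
  shows "(\<lambda>i. spread (X i)) \<longlonglongrightarrow> 0"
proof -
  define c where "c = Gamma ((\<alpha> + real CARD('n) + 1) / 2) / (Gamma ((\<alpha> + 1) / 2) * pi powr (real CARD('n) / 2))"
  have c: "c \<ge> 0" unfolding c_def using \<alpha>
    by (intro divide_nonneg_nonneg mult_nonneg_nonneg less_imp_le[OF Gamma_real_pos]) (auto simp: add_pos_nonneg)
  have s0: "0 \<le> s" by (rule s_nonneg)
  define N where "N = (LINT \<eta>|lborel. wt (- s) (\<eta> :: real^'n))"
  have Ni: "integrable lborel (wt (- s) :: real^'n \<Rightarrow> real)" by (rule integrable_wt[OF s_gt])
  have bound: "spread y \<le> \<delta> + (c * (\<delta>\<^sup>2 / (1 + \<delta>\<^sup>2)) powr (- s) * N) * y powr (\<alpha> + 1)"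
    if \<delta>: "0 < \<delta>" and y: "0 < y" for \<delta> y
  proof -
    \<comment> \<open>the largest constant with \<open>m (1 + |\<eta>|\<^sup>2) \<le> |\<eta>|\<^sup>2\<close> for all \<open>|\<eta>| \<ge> \<delta>\<close>\<close>
    define m where "m = \<delta>\<^sup>2 / (1 + \<delta>\<^sup>2)"
    have m: "0 < m" using \<delta> by (simp add: m_def add_pos_nonneg)
    define A where "A = c * m powr (- s) * y powr (\<alpha> + 1)"
    have A: "0 \<le> A" using c by (simp add: A_def)
    have "poisson_kernel \<alpha> y \<eta> * min 1 (norm \<eta>) \<le> \<delta> * poisson_kernel \<alpha> y \<eta> + A * wt (- s) \<eta>" for \<eta> :: "real^'n"
    proof (cases "norm \<eta> \<le> \<delta>")
      case True
      have "poisson_kernel \<alpha> y \<eta> * min 1 (norm \<eta>) \<le> poisson_kernel \<alpha> y \<eta> * \<delta>"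
        using True poisson_kernel_nonneg[OF \<alpha>, of y \<eta>] by (intro mult_left_mono) auto
      moreover have "0 \<le> A * wt (- s) \<eta>" using A by (simp add: wt_nonneg)
      ultimately show ?thesis by (simp add: mult.commute)
    next
      case False
      then have "\<delta>\<^sup>2 \<le> (norm \<eta>)\<^sup>2" using \<delta> by (intro power_mono) auto
      then have "m * (1 + (norm \<eta>)\<^sup>2) \<le> (norm \<eta>)\<^sup>2"
        by (simp add: m_def field_simps add_pos_nonneg)
      also have "\<dots> \<le> (norm \<eta>)\<^sup>2 + y\<^sup>2" by simp
      finally have "((norm \<eta>)\<^sup>2 + y\<^sup>2) powr (- s) \<le> (m * (1 + (norm \<eta>)\<^sup>2)) powr (- s)"
        using m s0 one_plus_norm2_pos[of \<eta>] by (intro powr_mono2') auto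
      also have "\<dots> = m powr (- s) * wt (- s) \<eta>" unfolding wt_def by (rule powr_mult)
      finally have "(c * y powr (\<alpha> + 1)) * ((norm \<eta>)\<^sup>2 + y\<^sup>2) powr (- s) \<le> (c * y powr (\<alpha> + 1)) * (m powr (- s) * wt (- s) \<eta>)"
        using c by (intro mult_left_mono) auto
      moreover have "poisson_kernel \<alpha> y \<eta> = (c * y powr (\<alpha> + 1)) * ((norm \<eta>)\<^sup>2 + y\<^sup>2) powr (- s)"
        unfolding poisson_kernel_def c_def s_def powr_minus by (simp only: divide_inverse mult.assoc)
      ultimately have "poisson_kernel \<alpha> y \<eta> \<le> A * wt (- s) \<eta>" by (simp add: A_def mult_ac)
      moreover have "poisson_kernel \<alpha> y \<eta> * min 1 (norm \<eta>) \<le> poisson_kernel \<alpha> y \<eta> * 1"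
        using poisson_kernel_nonneg[OF \<alpha>, of y \<eta>] by (intro mult_left_mono) auto
      moreover have "0 \<le> \<delta> * poisson_kernel \<alpha> y \<eta>" using \<delta> poisson_kernel_nonneg[OF \<alpha>, of y \<eta>] by simp
      ultimately show ?thesis by linarith
    qed
    then have "spread y \<le> (LINT \<eta>|lborel. \<delta> * poisson_kernel \<alpha> y (\<eta> :: real^'n) + A * wt (- s) \<eta>)"
      unfolding spread_def
      using spread_integrable[OF y] poisson_kernel_has_integral_1(1)[OF \<alpha> y, where 'n = 'n] Ni
      by (intro integral_mono) auto
    also have "\<dots> = \<delta> + A * N"
      using poisson_kernel_has_integral_1[OF \<alpha> y, where 'n = 'n] Ni by (simp add: N_def)
    finally show ?thesis by (simp add: A_def m_def mult_ac)
  qed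
  have nonneg: "0 \<le> spread y" for y
    unfolding spread_def by (intro Bochner_Integration.integral_nonneg mult_nonneg_nonneg poisson_kernel_nonneg[OF \<alpha>]) simp
  show ?thesis
  proof (rule tendstoI)
    fix e :: real assume e: "e > 0"
    define Q where "Q = c * ((e / 2)\<^sup>2 / (1 + (e / 2)\<^sup>2)) powr (- s) * N"
    have "(\<lambda>i. X i powr (\<alpha> + 1)) \<longlonglongrightarrow> 0 powr (\<alpha> + 1)"
      by (rule tendsto_powr'[OF X(2) tendsto_const]) (use X(1) \<alpha> in \<open>auto simp: less_imp_le\<close>)
    then have "(\<lambda>i. Q * X i powr (\<alpha> + 1)) \<longlonglongrightarrow> Q * 0" using \<alpha> by (intro tendsto_intros) simp
    then have "\<forall>\<^sub>F i in sequentially. Q * X i powr (\<alpha> + 1) < e / 2"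
      using e by (intro order_tendstoD) auto
    then show "\<forall>\<^sub>F i in sequentially. dist (spread (X i)) 0 < e"
    proof (rule eventually_mono)
      fix i assume "Q * X i powr (\<alpha> + 1) < e / 2"
      then show "dist (spread (X i)) 0 < e"
        using bound[of "e / 2" "X i"] e X(1)[of i] nonneg[of "X i"] unfolding Q_def[symmetric]
        by (simp add: dist_real_def)
    qed
  qed
qed

lemma corr_minus_dominated:
  assumes \<phi>: "\<phi> \<in> schwartz"
  shows "dominated {0<..} (\<lambda>y z. spread y) (\<lambda>y z. corr (P y) \<phi> z - \<phi> z)"
proof (rule dominatedI)
  have Pi: "integrable lborel (P y)" if "0 < y" for y by (rule poisson_integrable(1)[OF \<alpha> that])
  show "smooth (\<lambda>z. corr (P y) \<phi> z - \<phi> z)" if "y \<in> {0<..}" for y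
    using that by (intro smooth_diff corr_smooth \<phi> Pi schwartz_smooth) auto
  show "0 \<le> spread y" for y
    unfolding spread_def by (intro Bochner_Integration.integral_nonneg mult_nonneg_nonneg poisson_kernel_nonneg[OF \<alpha>]) simp
  fix vs :: "(real^'n) list" assume vs: "vs \<in> lists Basis"
  define \<psi> where "\<psi> = iter_pd vs \<phi>"
  have \<psi>: "\<psi> \<in> schwartz" unfolding \<psi>_def by (rule schwartz_iter_pd[OF \<phi> vs])
  obtain C0 where C0: "C0 \<ge> 0" "\<forall>x. norm (\<psi> x) \<le> C0 * wt 0 x" using schwartz_bound[OF \<psi>] by blast
  have "\<exists>C. \<forall>x. norm (pd b \<psi> x) \<le> C" if "b \<in> Basis" for b
    using schwartz_bound[OF schwartz_iter_pd[OF \<psi>, of "[b]"], of 0] that by (auto simp: wt_0)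
  then obtain D where D: "\<And>b x. b \<in> Basis \<Longrightarrow> norm (pd b \<psi> x) \<le> D b" by metis
  define C1 where "C1 = (\<Sum>b\<in>Basis. \<bar>D b\<bar>)"
  have C1: "norm (pd b \<psi> x) \<le> C1" if "b \<in> Basis" for b x
  proof -
    have "\<bar>D b\<bar> \<le> C1" unfolding C1_def using that by (intro member_le_sum) auto
    then show ?thesis using D[OF that, of x] by linarith
  qed
  have C10: "C1 \<ge> 0" by (auto simp: C1_def intro: sum_nonneg)
  define C where "C = 2 * C0 + DIM(real^'n) * C1"
  have lip: "norm (\<psi> (z + \<eta>) - \<psi> z) \<le> C * min 1 (norm \<eta>)" for z \<eta>
  proof (cases "norm \<eta> \<le> 1")
    case True
    have "norm (\<psi> (z + \<eta>) - \<psi> z) \<le> DIM(real^'n) * C1 * norm \<eta>"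
      by (rule has_partials_mvt[OF smooth_has_partials0[OF schwartz_smooth[OF \<psi>]] C1])
    also have "\<dots> \<le> C * norm \<eta>" using C0(1) by (intro mult_right_mono) (auto simp: C_def)
    finally show ?thesis using True by simp
  next
    case False
    have "norm (\<psi> (z + \<eta>) - \<psi> z) \<le> C0 + C0"
      using C0(2) by (intro order_trans[OF norm_triangle_ineq4] add_mono) (auto simp: wt_0)
    also have "\<dots> \<le> C" using C10 by (simp add: C_def)
    finally show ?thesis using False by simp
  qed
  have "norm (iter_pd vs (\<lambda>z. corr (P y) \<phi> z - \<phi> z) z) \<le> C * spread y" if "y \<in> {0<..}" for y z
  proof -
    have y: "0 < y" using that by simp
    have "iter_pd vs (\<lambda>z. corr (P y) \<phi> z - \<phi> z) z = corr (P y) \<psi> z - \<psi> z"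
      by (simp add: iter_pd_diff corr_smooth \<phi> Pi[OF y] schwartz_smooth vs corr_iter_pd \<psi>_def)
    also have "\<dots> = (LINT \<eta>|lborel. P y \<eta> * \<psi> (z + \<eta>)) - (LINT \<eta>|lborel. P y \<eta> * \<psi> z)"
      using poisson_integrable(2)[OF \<alpha> y, where 'n = 'n] by (simp add: corr_def)
    also have "\<dots> = (LINT \<eta>|lborel. P y \<eta> * \<psi> (z + \<eta>) - P y \<eta> * \<psi> z)"
      using corr_integrable[OF \<psi> Pi[OF y]] Pi[OF y] by (subst Bochner_Integration.integral_diff) auto
    also have "norm \<dots> \<le> (LINT \<eta>|lborel. C * (poisson_kernel \<alpha> y (\<eta> :: real^'n) * min 1 (norm \<eta>)))"
    proof (rule norm_integral_le)
      show "integrable lborel (\<lambda>\<eta>. P y \<eta> * \<psi> (z + \<eta>) - P y \<eta> * \<psi> z)"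
        using corr_integrable[OF \<psi> Pi[OF y]] Pi[OF y] by auto
      show "integrable lborel (\<lambda>\<eta>. C * (poisson_kernel \<alpha> y (\<eta> :: real^'n) * min 1 (norm \<eta>)))"
        using spread_integrable[OF y] by simp
      show "norm (P y \<eta> * \<psi> (z + \<eta>) - P y \<eta> * \<psi> z) \<le> C * (poisson_kernel \<alpha> y \<eta> * min 1 (norm \<eta>))" for \<eta>
      proof -
        have "norm (P y \<eta> * \<psi> (z + \<eta>) - P y \<eta> * \<psi> z) = poisson_kernel \<alpha> y \<eta> * norm (\<psi> (z + \<eta>) - \<psi> z)"
          by (simp add: norm_mult poisson_norm[OF \<alpha>] flip: right_diff_distrib)
        also have "\<dots> \<le> poisson_kernel \<alpha> y \<eta> * (C * min 1 (norm \<eta>))"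
          by (intro mult_left_mono lip poisson_kernel_nonneg[OF \<alpha>])
        finally show ?thesis by (simp add: mult_ac)
      qed
    qed
    also have "\<dots> = C * spread y" by (simp add: spread_def)
    finally show ?thesis .
  qed
  then show "\<exists>C. \<forall>y\<in>{0<..}. \<forall>z. norm (iter_pd vs (\<lambda>z. corr (P y) \<phi> z - \<phi> z) z) \<le> C * spread y" by blast
qed

text \<open>
  The difference is \<open>F\<close> applied to the weighted difference of \<open>corr (P y)
  \<phi>\<close> and \<open>\<phi>\<close>. It stays bounded in \<open>\<B>\<close> by the uniform
  tameness of the kernels, and it tends to 0 in \<open>C\<^sup>\<infinity>\<close> at the rate
  \<open>spread y\<close>.
\<close>

lemma boundary_values:
  assumes \<phi>: "\<phi> \<in> schwartz"
  shows "((\<lambda>y. dist_of (\<lambda>x. poisson_int (x, y)) \<phi>) \<longlongrightarrow> f \<phi>) (at_right 0)"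
  unfolding tendsto_at_iff_sequentially
proof (intro allI impI)
  fix X :: "nat \<Rightarrow> real" assume X: "\<forall>i. X i \<in> {0<..} - {0}" "X \<longlonglongrightarrow> 0"
  have X0: "0 < X i" for i using X(1) by auto
  obtain Y where Y: "Y > 0" "\<And>i. norm (X i) \<le> Y"
    using convergent_imp_Bseq[OF convergentI[OF X(2)]] by (auto simp: Bseq_def)
  have XY: "X i \<le> Y" for i using Y(2)[of i] by simp
  obtain b where b: "b \<ge> 0" "\<forall>i\<in>UNIV. (\<lambda>\<eta>. P (X i) \<eta> * 1) \<in> tame_kernels s b"
    using P_mult_tame[OF Y(1) zero_le_one, of UNIV X "\<lambda>_ _. 1", OF X0 XY] by auto
  have w\<phi>: "(\<lambda>z. w z * \<phi> z) \<in> schwartz" by (rule schwartz_mult[OF \<phi> wt_dominated])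
  have corr1: "corr (\<lambda>\<eta>. P y \<eta> * 1) \<phi> = corr (P y) \<phi>" for y by simp
  have "B_null (\<lambda>i z. w z * (corr (P (X i)) \<phi> z - \<phi> z))"
  proof (rule B_nullI[OF _ _ spread_tendsto_0[OF X0 X(2)] wt_s_locally_bounded])
    have "dominated UNIV (\<lambda>i z. 1) (\<lambda>i z. w z * corr (\<lambda>\<eta>. P (X i) \<eta> * 1) \<phi> z)"
      by (rule dominated_reindex[OF weighted_corr_dominated[OF \<phi> s_nonneg b(1)], where h = "\<lambda>i \<eta>. P (X i) \<eta> * 1"]) (rule bspec[OF b(2)])
    moreover have "dominated UNIV (\<lambda>(i::nat) z. 1) (\<lambda>i z. w z * \<phi> z)"
      by (rule dominated_const) (rule subsetD[OF schwartz_subset_B w\<phi>, unfolded space_B_iff])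
    ultimately show "dominated UNIV (\<lambda>_ _. 1) (\<lambda>i z. w z * (corr (P (X i)) \<phi> z - \<phi> z))"
      unfolding corr1 right_diff_distrib by (rule dominated_diff)
    have "dominated UNIV (\<lambda>i z. spread (X i)) (\<lambda>i z. corr (P (X i)) \<phi> z - \<phi> z)"
      by (rule dominated_reindex[OF corr_minus_dominated[OF \<phi>], where h = X]) (use X0 in auto)
    from dominated_mult[OF dominated_const[OF wt_dominated[of s]] this]
    show "dominated UNIV (\<lambda>i z. spread (X i) * wt s z) (\<lambda>i z. w z * (corr (P (X i)) \<phi> z - \<phi> z))"
      by (simp add: mult.commute)
  qed
  from Bc_form_null[OF F this]
  have "(\<lambda>i. F (\<lambda>z. w z * (corr (P (X i)) \<phi> z - \<phi> z))) \<longlonglongrightarrow> 0" .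
  moreover have "F (\<lambda>z. w z * (corr (P (X i)) \<phi> z - \<phi> z)) = dist_of (\<lambda>x. poisson_int (x, X i)) \<phi> - f \<phi>" for i
  proof -
    have "F (\<lambda>z. w z * corr (P (X i)) \<phi> z - w z * \<phi> z) = F (\<lambda>z. w z * corr (P (X i)) \<phi> z) - F (\<lambda>z. w z * \<phi> z)"
      using weighted_corr_in_B[OF X0 space_B_const \<phi>, of i 1] w\<phi> schwartz_subset_B
      by (intro Bc_form_diff[OF F]) (auto simp: corr1)
    also have "F (\<lambda>z. w z * corr (P (X i)) \<phi> z) = dist_of (\<lambda>x. poisson_int (x, X i)) \<phi>"
      unfolding conv_form_one[OF X0 \<phi>, symmetric] conv_form_def corr1 ..
    also have "F (\<lambda>z. w z * \<phi> z) = f \<phi>" by (simp add: f_eq[OF \<phi>] s_def)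
    finally show ?thesis by (simp add: right_diff_distrib)
  qed
  ultimately show "((\<lambda>y. dist_of (\<lambda>x. poisson_int (x, y)) \<phi>) \<circ> X) \<longlonglongrightarrow> f \<phi>"
    by (simp add: LIM_zero_iff o_def)
qed

lemma poisson_int_tempered:
  assumes y: "0 < y"
  shows "dist_of (\<lambda>x. poisson_int (x, y)) \<in> tempered"
proof -
  obtain C where "C \<ge> 0" "\<forall>x. norm (poisson_int (x, y)) \<le> C * wt s x" using poisson_int_slice(2)[OF y] by blast
  then show ?thesis by (intro dist_of_tempered[OF poisson_int_measurable[OF y], of C s]) auto
qed

end

lemma weighted_DL1_form:
  fixes f :: "(real^'n \<Rightarrow> complex) \<Rightarrow> complex"
  assumes "f \<in> weighted_DL1 \<alpha>"
  shows "\<exists>F. Bc_form F \<and> (\<forall>\<phi>\<in>schwartz. f \<phi> = F (\<lambda>z. complex_of_real (wt ((\<alpha> + real CARD('n) + 1) / 2) z) * \<phi> z))"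
proof -
  define s where "s = (\<alpha> + real CARD('n) + 1) / 2"
  have weight: "weight \<alpha> x = wt s x" for x :: "real^'n" by (simp add: weight_def wt_def s_def)
  obtain v where v: "v \<in> dual space_Bdot B_seminorms"
    "\<forall>\<phi>\<in>schwartz. v \<phi> = f (\<lambda>x. complex_of_real (inverse (wt s x)) * \<phi> x)"
    using assms by (auto simp: weighted_DL1_def DL1_def dist_mult_def weight)
  obtain F where F: "Bc_form F" "\<forall>\<phi>\<in>schwartz. F \<phi> = v \<phi>"
    using dual_Bdot_extension[OF v(1)] by blast
  have "f \<phi> = F (\<lambda>z. complex_of_real (wt s z) * \<phi> z)" if \<phi>: "\<phi> \<in> schwartz" for \<phi>
  proof -
    have w\<phi>: "(\<lambda>z. complex_of_real (wt s z) * \<phi> z) \<in> schwartz" by (rule schwartz_mult[OF \<phi> wt_dominated])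
    have "F (\<lambda>z. complex_of_real (wt s z) * \<phi> z) =
        f (\<lambda>x. complex_of_real (inverse (wt s x)) * (complex_of_real (wt s x) * \<phi> x))"
      using F(2) v(2) w\<phi> by simp
    also have "(\<lambda>x. complex_of_real (inverse (wt s x)) * (complex_of_real (wt s x) * \<phi> x)) = \<phi>"
    proof (rule ext)
      show "complex_of_real (inverse (wt s x)) * (complex_of_real (wt s x) * \<phi> x) = \<phi> x" for x
        using wt_pos[of s x] by simp
    qed
    finally show ?thesis by simp
  qed
  then show ?thesis using F(1) unfolding s_def by blast
qed

theorem corollary4p4:
  fixes \<alpha> :: real
    and f :: "(real^'n \<Rightarrow> complex) \<Rightarrow> complex"
    and u :: "(real^'n) \<times> real \<Rightarrow> complex"
  assumes "\<alpha> > -1"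
    and "f \<in> weighted_DL1 \<alpha>"
    and "u = poisson_integral \<alpha> f"
  shows "Ck_on 2 upper_half_space u \<and>
         (\<forall>p\<in>upper_half_space. D_op \<alpha> u p = 0) \<and>
         tendsto_tempered (\<lambda>y. dist_of (\<lambda>x. u (x, y))) f (at_right 0)"
proof -
  obtain F where F: "Bc_form F"
    "\<And>\<phi>. \<phi> \<in> schwartz \<Longrightarrow> f \<phi> = F (\<lambda>z. complex_of_real (wt ((\<alpha> + real CARD('n) + 1) / 2) z) * \<phi> z)"
    using weighted_DL1_form[OF assms(2)] by blast
  interpret weighted_distribution \<alpha> f F
    by unfold_locales (use assms F in \<open>auto simp: weighted_DL1_def\<close>)
  have u: "u p = slice_transform s F (poisson \<alpha>) p" if "0 < snd p" for p
    using poisson_integral_eq[OF that, of "fst p"] by (simp add: assms(3) poisson_int_def)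
  have u_slice: "(\<lambda>x. u (x, y)) = (\<lambda>x. poisson_int (x, y))" if "0 < y" for y
    using poisson_integral_eq[OF that] by (simp add: assms(3))
  have P: "(poisson \<alpha> :: (real^'n) \<times> real \<Rightarrow> complex) \<in> kernels (\<alpha> + 1) (- s)"
    unfolding s_def by (rule poisson_in_kernels)
  have pos: "\<forall>\<^sub>F y in at_right (0::real). 0 < y" by (rule eventually_at_right_less)
  have "Ck_on 2 upper_half_space u"
    by (rule slice_transform_Ck_on[OF F(1) P s_nonneg u])
  moreover have "D_op \<alpha> u p = 0" if "p \<in> upper_half_space" for p
    by (rule slice_transform_poisson_equation[OF F(1) assms(1) u[unfolded s_def]])
      (use that in \<open>auto simp: upper_half_space_eq\<close>)
  moreover have "tendsto_tempered (\<lambda>y. dist_of (\<lambda>x. u (x, y))) f (at_right 0)"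
    unfolding tendsto_tempered_def
  proof (intro conjI ballI tempered_f)
    show "\<forall>\<^sub>F y in at_right 0. dist_of (\<lambda>x. u (x, y)) \<in> tempered"
      using pos by (rule eventually_mono) (simp add: u_slice poisson_int_tempered)
    fix \<phi> :: "real^'n \<Rightarrow> complex" assume "\<phi> \<in> schwartz"
    from boundary_values[OF this]
    show "((\<lambda>y. dist_of (\<lambda>x. u (x, y)) \<phi>) \<longlongrightarrow> f \<phi>) (at_right 0)"
      by (rule Lim_transform_eventually) (use pos in \<open>auto elim: eventually_mono simp: u_slice\<close>)
  qed
  ultimately show ?thesis by blast
qed

end
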